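(* Let $G$ be a torsion group and let $K$ be a commutative $G$-favourable integral domain of characteristic $p\geq 0$. Then $S_*(KG)$ is a subgroup of $U(KG)$ if and only if $G$ satisfies at least one of the following conditions: 1. $G$ is abelian; 2. $p\neq 2$ and $G$ is a hamiltonian $2$-group; 3. $p=2$ and $G$ is the direct product of an elementary abelian group and a group $H$ for which at least one of the following holds: (i) $H$ has an abelian subgroup $M$ of index $2$ and an element $b$ of order $4$ such that conjugation by $b$ inverts each element of $M$; (ii) $H$ is the direct product of a quaternion group of order $8$ and a cyclic group of order $4$, or the direct product of two quaternion groups of order $8$; (iii) $H$ is the central product of the group $\langle x,y\mid x^4=y^4=1,\ x^2=[y,x]\rangle$ with a quaternion group of order $8$, the nontrivial element common to the two central factors being $x^2y^2$; (iv) $H$ is isomorphic to one of the groups $H_{32}$ and $H_{245}$, where $$H_{32}=\langle x,y,u \mid x^4=y^4=1,\ x^2=[y,x],\ y^2=u^2=[u,x],\ x^2y^2=[u,y]\rangle,$$ $$H_{245}=\langle x,y,u,v \mid x^4=y^4=[v,u]=1,\ x^2=v^2=[y,x]=[v,y],\ y^2=u^2=[u,x],\ x^2y^2=[u,y]=[v,x]\rangle.$$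
   Context: $KG$ is the group ring of $G$ over $K$ and $U(KG)$ is its group of units. The map $a\mapsto a^*$ is the $K$-linear extension to $KG$ of the anti-automorphism $g\mapsto g^{-1}$ of $G$, and $S_*(KG)=\{x\in U(KG)\mid x^*=x\}$ is the set of symmetric units. A commutative ring $K$ is called $G$-favourable if for every $g\in G$ of finite order $|g|$ there is a non-zero $\alpha\in K$ such that $1-\alpha^{|g|}$ is a unit in $K$. A hamiltonian group is a nonabelian group all of whose subgroups are normal. $[a,b]=a^{-1}b^{-1}ab$ denotes the commutator.
   Formalization: In condition 3, "elementary abelian group" is taken to mean elementary abelian 2-group (possibly trivial or infinite); with odd primes allowed the claim fails, e.g. for the product of a cyclic group of order 3 and the quaternion group of order 8 in characteristic 2. *)

theory Defs
  imports "HOL-Algebra.Algebra"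
begin

section \<open>Group rings and symmetric units\<close>

text \<open>
  The formal sum \<open>\<Sum> f(g) g\<close> is represented by its coefficient function \<open>f\<close>, taken to be zero
  outside the carrier of the group.
\<close>

definition supp :: "('k, 'n) ring_scheme \<Rightarrow> ('g \<Rightarrow> 'k) \<Rightarrow> 'g set"
  where "supp K f = {g. f g \<noteq> \<zero>\<^bsub>K\<^esub>}"

definition group_ring :: "('k, 'n) ring_scheme \<Rightarrow> ('g, 'm) monoid_scheme \<Rightarrow> ('g \<Rightarrow> 'k) ring"
  where "group_ring K G =
    \<lparr>carrier = {f. range f \<subseteq> carrier K \<and> supp K f \<subseteq> carrier G \<and> finite (supp K f)},
     monoid.mult = (\<lambda>f h g. \<Oplus>\<^bsub>K\<^esub>p \<in> {p \<in> supp K f \<times> supp K h. fst p \<otimes>\<^bsub>G\<^esub> snd p = g}.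
               f (fst p) \<otimes>\<^bsub>K\<^esub> h (snd p)),
     one = (\<lambda>g. if g = \<one>\<^bsub>G\<^esub> then \<one>\<^bsub>K\<^esub> else \<zero>\<^bsub>K\<^esub>),
     ring.zero = (\<lambda>g. \<zero>\<^bsub>K\<^esub>),
     ring.add = (\<lambda>f h g. f g \<oplus>\<^bsub>K\<^esub> h g)\<rparr>"

text \<open>
  The \<open>K\<close>-linear extension of \<open>g \<mapsto> g\<^sup>-\<^sup>1\<close>: the coefficient of \<open>g\<close> in \<open>f\<^sup>*\<close> is that of \<open>g\<^sup>-\<^sup>1\<close> in \<open>f\<close>.
\<close>

definition star :: "('k, 'n) ring_scheme \<Rightarrow> ('g, 'm) monoid_scheme \<Rightarrow> ('g \<Rightarrow> 'k) \<Rightarrow> 'g \<Rightarrow> 'k"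
  where "star K G f = (\<lambda>g. if g \<in> carrier G then f (inv\<^bsub>G\<^esub> g) else \<zero>\<^bsub>K\<^esub>)"

definition symmetric_units :: "('k, 'n) ring_scheme \<Rightarrow> ('g, 'm) monoid_scheme \<Rightarrow> ('g \<Rightarrow> 'k) set"
  where "symmetric_units K G = {f \<in> Units (group_ring K G). star K G f = f}"

text \<open>
  Recall that \<open>group.ord\<close> is 0 on elements of infinite order, so that the additive order of \<open>1\<close>
  is the characteristic, including the case of characteristic 0.
\<close>

definition ring_characteristic :: "('k, 'n) ring_scheme \<Rightarrow> nat"
  where "ring_characteristic K = group.ord (add_monoid K) \<one>\<^bsub>K\<^esub>"

definition favourable :: "('g, 'm) monoid_scheme \<Rightarrow> ('k, 'n) ring_scheme \<Rightarrow> bool"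
  where "favourable G K \<longleftrightarrow>
    (\<forall>g \<in> carrier G. group.ord G g \<noteq> 0 \<longrightarrow>
      (\<exists>\<alpha> \<in> carrier K. \<alpha> \<noteq> \<zero>\<^bsub>K\<^esub> \<and> \<one>\<^bsub>K\<^esub> \<ominus>\<^bsub>K\<^esub> \<alpha> [^]\<^bsub>K\<^esub> group.ord G g \<in> Units K))"


section \<open>Classes of groups\<close>

definition torsion_group :: "('g, 'm) monoid_scheme \<Rightarrow> bool"
  where "torsion_group G \<longleftrightarrow> group G \<and> (\<forall>g \<in> carrier G. \<exists>n::nat. n > 0 \<and> g [^]\<^bsub>G\<^esub> n = \<one>\<^bsub>G\<^esub>)"

definition hamiltonian_group :: "('g, 'm) monoid_scheme \<Rightarrow> bool"
  where "hamiltonian_group G \<longleftrightarrow>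
    group G \<and> \<not> comm_group G \<and> (\<forall>N. subgroup N G \<longrightarrow> N \<lhd> G)"

definition two_group :: "('g, 'm) monoid_scheme \<Rightarrow> bool"
  where "two_group G \<longleftrightarrow> group G \<and> (\<forall>g \<in> carrier G. \<exists>k::nat. group.ord G g = 2 ^ k)"

definition elementary_abelian_two_group :: "('g, 'm) monoid_scheme \<Rightarrow> bool"
  where "elementary_abelian_two_group G \<longleftrightarrow>
    comm_group G \<and> (\<forall>g \<in> carrier G. g [^]\<^bsub>G\<^esub> (2::nat) = \<one>\<^bsub>G\<^esub>)"

definition internal_direct_product :: "('g, 'm) monoid_scheme \<Rightarrow> 'g set \<Rightarrow> 'g set \<Rightarrow> bool"
  where "internal_direct_product G A B \<longleftrightarrow>
    subgroup A G \<and> subgroup B G \<and>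
    (\<lambda>(a, b). a \<otimes>\<^bsub>G\<^esub> b) \<in> iso (G\<lparr>carrier := A\<rparr> \<times>\<times> G\<lparr>carrier := B\<rparr>) G"


section \<open>Groups given by generators and relations\<close>

text \<open>
  A word is a list of letters \<open>(x, e)\<close>, where \<open>(x, True)\<close> stands for the generator \<open>x\<close> and
  \<open>(x, False)\<close> for its inverse; a relation \<open>l = r\<close> is the pair \<open>(l, r)\<close>.
\<close>

type_synonym 'x word = "('x \<times> bool) list"

definition words :: "'x set \<Rightarrow> 'x word set"
  where "words S = lists (S \<times> UNIV)"

inductive word_eq :: "'x set \<Rightarrow> ('x word \<times> 'x word) set \<Rightarrow> 'x word \<Rightarrow> 'x word \<Rightarrow> bool"
  for S R
  where
    refl: "w \<in> words S \<Longrightarrow> word_eq S R w w"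
  | sym: "word_eq S R v w \<Longrightarrow> word_eq S R w v"
  | trans: "word_eq S R u v \<Longrightarrow> word_eq S R v w \<Longrightarrow> word_eq S R u w"
  | cancel: "u \<in> words S \<Longrightarrow> v \<in> words S \<Longrightarrow> x \<in> S \<Longrightarrow>
      word_eq S R (u @ [(x, e), (x, \<not> e)] @ v) (u @ v)"
  | rel: "u \<in> words S \<Longrightarrow> v \<in> words S \<Longrightarrow> (l, r) \<in> R \<Longrightarrow> l \<in> words S \<Longrightarrow> r \<in> words S \<Longrightarrow>
      word_eq S R (u @ l @ v) (u @ r @ v)"

definition word_class :: "'x set \<Rightarrow> ('x word \<times> 'x word) set \<Rightarrow> 'x word \<Rightarrow> 'x word set"
  where "word_class S R w = {v. word_eq S R w v}"

definition presented_group :: "'x set \<Rightarrow> ('x word \<times> 'x word) set \<Rightarrow> 'x word set monoid"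
  where "presented_group S R =
    \<lparr>carrier = word_class S R ` words S,
     monoid.mult = (\<lambda>A B. \<Union>v \<in> A. \<Union>w \<in> B. word_class S R (v @ w)),
     one = word_class S R []\<rparr>"

definition gen :: "'x \<Rightarrow> 'x word"
  where "gen x = [(x, True)]"

definition word_pow :: "'x word \<Rightarrow> nat \<Rightarrow> 'x word"
  where "word_pow w n = concat (replicate n w)"

definition word_inv :: "'x word \<Rightarrow> 'x word"
  where "word_inv w = rev (map (\<lambda>(x, e). (x, \<not> e)) w)"

definition word_comm :: "'x word \<Rightarrow> 'x word \<Rightarrow> 'x word"
  where "word_comm a b = word_inv a @ word_inv b @ a @ b"

datatype generator = Gx | Gy | Gu | Gv

definition Q8_rels :: "(generator word \<times> generator word) set"
  where "Q8_rels = (let x = gen Gx; y = gen Gy in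
    {(word_pow x 4, []), (word_pow y 2, word_pow x 2), (word_inv y @ x @ y, word_inv x)})"

definition Q8 :: "generator word set monoid"
  where "Q8 = presented_group {Gx, Gy} Q8_rels"

definition P16_rels :: "(generator word \<times> generator word) set"
  where "P16_rels = (let x = gen Gx; y = gen Gy in
    {(word_pow x 4, []), (word_pow y 4, []), (word_pow x 2, word_comm y x)})"

definition P16 :: "generator word set monoid"
  where "P16 = presented_group {Gx, Gy} P16_rels"

definition P16_x2y2 :: "generator word set"
  where "P16_x2y2 = word_class {Gx, Gy} P16_rels (word_pow (gen Gx) 2 @ word_pow (gen Gy) 2)"

definition H32_rels :: "(generator word \<times> generator word) set"
  where "H32_rels = (let x = gen Gx; y = gen Gy; u = gen Gu in
    {(word_pow x 4, []), (word_pow y 4, []),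
     (word_pow x 2, word_comm y x),
     (word_pow y 2, word_pow u 2), (word_pow u 2, word_comm u x),
     (word_pow x 2 @ word_pow y 2, word_comm u y)})"

definition H32 :: "generator word set monoid"
  where "H32 = presented_group {Gx, Gy, Gu} H32_rels"

definition H245_rels :: "(generator word \<times> generator word) set"
  where "H245_rels = (let x = gen Gx; y = gen Gy; u = gen Gu; v = gen Gv in
    {(word_pow x 4, []), (word_pow y 4, []), (word_comm v u, []),
     (word_pow x 2, word_pow v 2), (word_pow v 2, word_comm y x), (word_comm y x, word_comm v y),
     (word_pow y 2, word_pow u 2), (word_pow u 2, word_comm u x),
     (word_pow x 2 @ word_pow y 2, word_comm u y), (word_comm u y, word_comm v x)})"

definition H245 :: "generator word set monoid"
  where "H245 = presented_group {Gx, Gy, Gu, Gv} H245_rels"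


section \<open>The exceptional factors in characteristic 2\<close>

definition has_inverted_index2_subgroup :: "('g, 'm) monoid_scheme \<Rightarrow> bool"
  where "has_inverted_index2_subgroup H \<longleftrightarrow>
    (\<exists>M. subgroup M H \<and> comm_group (H\<lparr>carrier := M\<rparr>) \<and> card (rcosets\<^bsub>H\<^esub> M) = 2 \<and>
      (\<exists>b \<in> carrier H. group.ord H b = 4 \<and>
        (\<forall>m \<in> M. inv\<^bsub>H\<^esub> b \<otimes>\<^bsub>H\<^esub> m \<otimes>\<^bsub>H\<^esub> b = inv\<^bsub>H\<^esub> m)))"

text \<open>
  Central product of \<open>P16\<close> and \<open>Q8\<close> in which the two factors, embedded as \<open>A\<close> and \<open>B\<close>, share
  exactly one nontrivial element, the image of \<open>x\<^sup>2y\<^sup>2\<close>.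
\<close>

definition central_product_P16_Q8 :: "('g, 'm) monoid_scheme \<Rightarrow> bool"
  where "central_product_P16_Q8 H \<longleftrightarrow>
    (\<exists>A B \<phi>. subgroup A H \<and> subgroup B H \<and>
      \<phi> \<in> iso P16 (H\<lparr>carrier := A\<rparr>) \<and> Q8 \<cong> H\<lparr>carrier := B\<rparr> \<and>
      (\<forall>a \<in> A. \<forall>b \<in> B. a \<otimes>\<^bsub>H\<^esub> b = b \<otimes>\<^bsub>H\<^esub> a) \<and> A <#>\<^bsub>H\<^esub> B = carrier H \<and>
      \<phi> P16_x2y2 \<noteq> \<one>\<^bsub>H\<^esub> \<and> A \<inter> B = {\<one>\<^bsub>H\<^esub>, \<phi> P16_x2y2})"

definition exceptional_group :: "('g, 'm) monoid_scheme \<Rightarrow> bool"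
  where "exceptional_group H \<longleftrightarrow>
    has_inverted_index2_subgroup H \<or>
    (H \<cong> Q8 \<times>\<times> integer_mod_group 4 \<or> H \<cong> Q8 \<times>\<times> Q8) \<or>
    central_product_P16_Q8 H \<or>
    (H \<cong> H32 \<or> H \<cong> H245)"

end

theory Submission
  imports Defs
begin

text \<open>
  The symmetric units form a subgroup if and only if they commute. If \<open>g\<close> has order \<open>n\<close> and
  \<open>1 - \<alpha>\<^sup>n\<close> is a unit, then \<open>(1 - \<alpha> g) (1 - \<alpha> g\<^sup>-\<^sup>1)\<close> is a symmetric unit; hence all \<open>g + g\<^sup>-\<^sup>1\<close>
  commute with each other and with the involutions of \<open>G\<close>. Comparing the coefficients of \<open>gh\<close>
  yields that involutions are central and that, for any noncommuting \<open>g\<close> and \<open>h\<close>, one of them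
  inverts the other or, in characteristic 2 only, \<open>g\<^sup>2 = h\<^sup>2\<close> and \<open>g\<^sup>4 = 1\<close>. Conversely, every
  symmetric element is a linear combination of involutions, of \<open>1\<close> and of elements
  \<open>g + g\<^sup>-\<^sup>1\<close>, so that this condition on the group is also sufficient.

  In characteristic different from 2 the condition says that \<open>G\<close> is abelian or a hamiltonian
  2-group. In characteristic 2, an element \<open>a\<close> with \<open>a\<^sup>4 \<noteq> 1\<close> lies in an abelian subgroup of index 2
  that is inverted by an element of order 4. In exponent 4, squaring is a quadratic map modulo the
  central subgroup of involutions, and the condition relates it to its polar form, the commutator.
  Unless there is an inverted abelian subgroup of index 2, or a central element of order 4
  (which leads to \<open>Q\<^sub>8 \<times> C\<^sub>4\<close>), the squares take at most four values, and the quadratic map becomes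
  an anisotropic pair of quadratic forms over the field with two elements, of rank at most 4. Each of
  the remaining groups in the list is such a pair of forms.
\<close>

section \<open>The condition on the group in characteristic 2\<close>

text \<open>The group may be infinite, so nothing can be counted. The recurring argument is instead
  that an element which fails to commute with another one is not an involution: applied to several
  products at once, it excludes coincidences among squares until few configurations are left. Once
  squares have two coordinates, these exclusions are propositional statements about bits. The
  elementary abelian factor is a complement of the at most four squares inside the possibly infinite
  subgroup of involutions, and it comes from Zorn's lemma. A presentation bounds its group only from
  above. Each presented group is therefore compared with an explicit extension of bit vectors by
  bits, in which normal forms are visibly different. The models serve twice more: they are embedded
  into \<open>G\<close> to produce the exceptional factor, and in the converse direction their
  squares have at most four values by construction, so that only the centrality of involutions
  remains to be checked.\<close>

text \<open>
  \<open>ghg = h\<close> says that conjugation by \<open>h\<close> inverts \<open>g\<close>; written without inverses, the condition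
  involves only multiplication and passes through isomorphisms and products easily.
\<close>

definition char2_condition :: "('g, 'm) monoid_scheme \<Rightarrow> bool"
  where "char2_condition G \<longleftrightarrow>
    (\<forall>t\<in>carrier G. \<forall>h\<in>carrier G. t \<otimes>\<^bsub>G\<^esub> t = \<one>\<^bsub>G\<^esub> \<longrightarrow> t \<otimes>\<^bsub>G\<^esub> h = h \<otimes>\<^bsub>G\<^esub> t) \<and>
    (\<forall>g\<in>carrier G. \<forall>h\<in>carrier G. g \<otimes>\<^bsub>G\<^esub> h = h \<otimes>\<^bsub>G\<^esub> g \<or> g \<otimes>\<^bsub>G\<^esub> h \<otimes>\<^bsub>G\<^esub> g = h \<or> h \<otimes>\<^bsub>G\<^esub> g \<otimes>\<^bsub>G\<^esub> h = g \<or>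
      (g \<otimes>\<^bsub>G\<^esub> g = h \<otimes>\<^bsub>G\<^esub> h \<and> (g \<otimes>\<^bsub>G\<^esub> g) \<otimes>\<^bsub>G\<^esub> (g \<otimes>\<^bsub>G\<^esub> g) = \<one>\<^bsub>G\<^esub>))"

lemma (in group) inv_cancel_left [simp]:
  "x \<in> carrier G \<Longrightarrow> y \<in> carrier G \<Longrightarrow> inv x \<otimes> (x \<otimes> y) = y"
  "x \<in> carrier G \<Longrightarrow> y \<in> carrier G \<Longrightarrow> x \<otimes> (inv x \<otimes> y) = y"
  by (simp_all flip: m_assoc)

lemma (in group) square_mult_commuting:
  assumes "x \<in> carrier G" "y \<in> carrier G" "x \<otimes> y = y \<otimes> x"
  shows "(x \<otimes> y) \<otimes> (x \<otimes> y) = (x \<otimes> x) \<otimes> (y \<otimes> y)" "(x \<otimes> x) \<otimes> (y \<otimes> y) = (y \<otimes> y) \<otimes> (x \<otimes> x)"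
proof -
  have e: "y \<otimes> (x \<otimes> z) = x \<otimes> (y \<otimes> z)" if "z \<in> carrier G" for z
    using assms that by (metis m_assoc)
  show "(x \<otimes> y) \<otimes> (x \<otimes> y) = (x \<otimes> x) \<otimes> (y \<otimes> y)" using assms(1,2) by (simp add: m_assoc e)
  show "(x \<otimes> x) \<otimes> (y \<otimes> y) = (y \<otimes> y) \<otimes> (x \<otimes> x)" using assms(1,2) by (simp add: m_assoc e assms(3)[symmetric])
qed

text \<open>The abelian subgroup of index 2 is the centralizer of \<open>k\<close>.\<close>

lemma (in group) has_inverted_index2I:
  assumes G: "k \<in> carrier G" "b \<in> carrier G" and ne: "b \<otimes> k \<noteq> k \<otimes> b"
    and b4: "(b \<otimes> b) \<otimes> (b \<otimes> b) = \<one>" and b2: "b \<otimes> b \<noteq> \<one>"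
    and inv: "\<And>m. m \<in> carrier G \<Longrightarrow> m \<otimes> k = k \<otimes> m \<Longrightarrow> m \<otimes> b \<otimes> m = b"
    and co: "\<And>g. g \<in> carrier G \<Longrightarrow> g \<otimes> k \<noteq> k \<otimes> g \<Longrightarrow> (g \<otimes> b) \<otimes> k = k \<otimes> (g \<otimes> b)"
  shows "has_inverted_index2_subgroup G"
proof -
  define M where "M = {m \<in> carrier G. m \<otimes> k = k \<otimes> m}"
  have sub: "subgroup M G"
  proof
    show "M \<subseteq> carrier G" by (auto simp: M_def)
    show "\<one> \<in> M" using G by (simp add: M_def)
    fix x assume x: "x \<in> M"
    then have xG: "x \<in> carrier G" "x \<otimes> k = k \<otimes> x" by (auto simp: M_def)
    have "inv x \<otimes> (x \<otimes> k) \<otimes> inv x = inv x \<otimes> (k \<otimes> x) \<otimes> inv x" using xG by simp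
    then have "k \<otimes> inv x = inv x \<otimes> k" using xG(1) G by (simp add: m_assoc)
    then show "inv x \<in> M" using xG by (simp add: M_def)
    fix y assume y: "y \<in> M"
    then have yG: "y \<in> carrier G" "y \<otimes> k = k \<otimes> y" by (auto simp: M_def)
    have "x \<otimes> y \<otimes> k = k \<otimes> (x \<otimes> y)"
      using xG yG G by (metis m_assoc)
    then show "x \<otimes> y \<in> M" using xG yG by (simp add: M_def)
  qed
  interpret M: subgroup M G by (rule sub)
  have MD: "m \<otimes> b = b \<otimes> inv m" if "m \<in> M" for m
  proof -
    have m: "m \<in> carrier G" "m \<otimes> b \<otimes> m = b" using that inv unfolding M_def by blast+
    then have "m \<otimes> b \<otimes> m \<otimes> inv m = b \<otimes> inv m" by simp
    then show ?thesis using m(1) G by (simp add: m_assoc)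
  qed
  \<comment> \<open>Conjugation by \<open>b\<close> is a homomorphism and agrees with inversion on
    \<open>M\<close>; a group on which inversion is a homomorphism is abelian.\<close>
  have comm: "m \<otimes> n = n \<otimes> m" if "m \<in> M" "n \<in> M" for m n
  proof -
    have G': "m \<in> carrier G" "n \<in> carrier G" using that by auto
    have "b \<otimes> inv (m \<otimes> n) = m \<otimes> (n \<otimes> b)" using MD[of "m \<otimes> n"] that G G' by (simp add: m_assoc)
    also have "\<dots> = (m \<otimes> b) \<otimes> inv n" using MD[of n] that G G' by (simp add: m_assoc)
    also have "\<dots> = b \<otimes> (inv m \<otimes> inv n)" using MD[of m] that G G' by (simp add: m_assoc)
    finally have "b \<otimes> inv (m \<otimes> n) = b \<otimes> inv (n \<otimes> m)" using G' by (simp only: inv_mult_group)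
    then have "inv (m \<otimes> n) = inv (n \<otimes> m)" by (rule l_cancel) (simp_all add: G G')
    then show ?thesis by (rule inj_onD[OF inv_inj]) (use G' in auto)
  qed
  have bM: "b \<notin> M" using ne unfolding M_def by blast
  have bb: "b \<otimes> b \<in> M" using co[OF G(2) ne] m_closed[OF G(2) G(2)] unfolding M_def by blast
  \<comment> \<open>By \<open>co\<close>, outside \<open>M\<close> multiplication by
    \<open>b\<close> leads into \<open>M\<close>; as \<open>b^2\<close> lies in \<open>M\<close>, so
    does division by \<open>b\<close>. This is what leaves only two cosets.\<close>
  have cos: "a \<otimes> inv b \<in> M" if a: "a \<in> carrier G" "a \<notin> M" for a
  proof -
    have "a \<otimes> b \<in> M" using co[OF a(1)] m_closed[OF a(1) G(2)] a(1,2) unfolding M_def by blast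
    then have "(a \<otimes> b) \<otimes> inv (b \<otimes> b) \<in> M" using bb by auto
    then show ?thesis using a G by (simp add: m_assoc inv_mult_group)
  qed
  have rc: "rcosets M = {M, M #> b}"
  proof (intro subset_antisym subsetI)
    fix Y assume "Y \<in> rcosets M"
    then obtain a where a: "a \<in> carrier G" "Y = M #> a" by (auto simp: RCOSETS_def)
    show "Y \<in> {M, M #> b}"
    proof (cases "a \<in> M")
      case True then show ?thesis using a sub by (simp add: coset_join2 )
    next
      case False
      have "a \<in> M #> b" unfolding r_coset_def
        using cos[OF a(1) False] a(1) G by (auto intro!: bexI[of _ "a \<otimes> inv b"] simp: m_assoc)
      then have "M #> b = M #> a" using G sub by (intro repr_independence)
      then show ?thesis using a by simp
    qed
  next
    fix Y assume "Y \<in> {M, M #> b}"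
    then show "Y \<in> rcosets M"
      using rcosetsI[OF M.subset G(2)] rcosetsI[OF M.subset one_closed] M.subset by auto
  qed
  have "b \<in> M #> b" using G sub by (simp add: rcos_self)
  then have "M \<noteq> M #> b" using bM by auto
  then have c2: "card (rcosets M) = 2" by (simp add: rc)
  have cg: "comm_group (G\<lparr>carrier := M\<rparr>)"
    by (rule group.group_comm_groupI[OF subgroup_imp_group[OF sub]]) (auto simp: comm)
  have "b [^] (4::nat) = \<one>" using b4 G by (simp add: numeral_eq_Suc m_assoc)
  then have d1: "ord b dvd 4" using pow_eq_id[OF G(2), of 4] by simp
  have "b [^] (2::nat) \<noteq> \<one>" using b2 G by (simp add: numeral_eq_Suc)
  then have "\<not> ord b dvd 2" using pow_eq_id[OF G(2), of 2] by simp
  note d = d1 this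
  have "ord b \<le> 4" using d by (simp add: dvd_imp_le)
  then have "ord b \<in> {0,1,2,3,4}" by auto
  then have "ord b = 4" using d by auto
  moreover have "inv b \<otimes> m \<otimes> b = inv m" if "m \<in> M" for m
    using MD[OF that] that G by (simp add: m_assoc)
  ultimately show ?thesis unfolding has_inverted_index2_subgroup_def
    using sub c2 cg G by blast
qed

locale char2_group = group G for G (structure) + assumes char2_condition: "char2_condition G"
begin

lemma involution_central: "t \<in> carrier G \<Longrightarrow> h \<in> carrier G \<Longrightarrow> t \<otimes> t = \<one> \<Longrightarrow> t \<otimes> h = h \<otimes> t"
  using char2_condition unfolding char2_condition_def by blast

lemma noncommuting_cases:
  assumes "g \<in> carrier G" "h \<in> carrier G" "g \<otimes> h \<noteq> h \<otimes> g"
  obtains "g \<otimes> h \<otimes> g = h" | "h \<otimes> g \<otimes> h = g" | "g \<otimes> g = h \<otimes> h" "(g \<otimes> g) \<otimes> (g \<otimes> g) = \<one>"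
  using char2_condition assms unfolding char2_condition_def by blast

section \<open>Elements with nontrivial fourth power\<close>

text \<open>If \<open>c^4\<close> were nontrivial, the multipliers 1, \<open>c\<close> and
  \<open>c^2\<close> would have three different squares. Being central, they preserve the failure of
  \<open>g\<close> and \<open>h\<close> to commute. But with the other element fixed,
  \<open>ghg = h\<close> holds for at most one of the three multiples of \<open>g\<close>, and each
  of \<open>hgh = g\<close> and \<open>g^2 = h^2\<close> for at most one of the three multiples of
  \<open>h\<close>.\<close>

lemma center_exponent4:
  assumes gh: "g \<in> carrier G" "h \<in> carrier G" "g \<otimes> h \<noteq> h \<otimes> g"
    and c: "c \<in> carrier G" "\<And>x. x \<in> carrier G \<Longrightarrow> c \<otimes> x = x \<otimes> c"
  shows "(c \<otimes> c) \<otimes> (c \<otimes> c) = \<one>"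
proof (rule ccontr)
  assume c4: "(c \<otimes> c) \<otimes> (c \<otimes> c) \<noteq> \<one>"
  define d where "d = c \<otimes> c"
  have d: "d \<in> carrier G" "d \<otimes> d \<noteq> \<one>" "d \<noteq> \<one>" using c(1) c4 by (auto simp: d_def)
  define C where "C = {\<one>, c, d}"
  have CG: "k \<in> carrier G" if "k \<in> C" for k using that c(1) by (auto simp: C_def d_def)
  have Cc: "k \<otimes> x = x \<otimes> k" if "k \<in> C" "x \<in> carrier G" for k x
  proof -
    have "d \<otimes> x = c \<otimes> (c \<otimes> x)" using c(1) that(2) by (simp add: d_def m_assoc)
    also have "\<dots> = c \<otimes> (x \<otimes> c)" using c(2)[OF that(2)] by simp
    also have "\<dots> = (c \<otimes> x) \<otimes> c" using c(1) that(2) by (simp add: m_assoc)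
    also have "\<dots> = (x \<otimes> c) \<otimes> c" using c(2)[OF that(2)] by simp
    finally have "d \<otimes> x = x \<otimes> d" using c(1) that(2) by (simp add: d_def m_assoc)
    then show ?thesis using that c(2)[OF that(2)] by (auto simp: C_def)
  qed
  have sqinj: "k = l" if "k \<in> C" "l \<in> C" "k \<otimes> k = l \<otimes> l" for k l
    using that d c(1) by (auto simp: C_def d_def)
  have first: "k = l" if kl: "k \<in> C" "l \<in> C" and xy: "x \<in> carrier G" "y \<in> carrier G"
     and e: "(x \<otimes> k) \<otimes> y \<otimes> (x \<otimes> k) = (x \<otimes> l) \<otimes> y \<otimes> (x \<otimes> l)" for k l x y
  proof -
    have *: "(x \<otimes> k) \<otimes> y \<otimes> (x \<otimes> k) = (x \<otimes> y \<otimes> x) \<otimes> (k \<otimes> k)" if "k \<in> C" for k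
    proof -
      have "(x \<otimes> k) \<otimes> y \<otimes> (x \<otimes> k) = x \<otimes> (k \<otimes> (y \<otimes> x)) \<otimes> k" using that xy CG[OF that] by (simp add: m_assoc)
      also have "k \<otimes> (y \<otimes> x) = (y \<otimes> x) \<otimes> k" by (rule Cc) (use that xy in auto)
      finally show ?thesis using that xy CG[OF that] by (simp add: m_assoc)
    qed
    have "(x \<otimes> y \<otimes> x) \<otimes> (k \<otimes> k) = (x \<otimes> y \<otimes> x) \<otimes> (l \<otimes> l)" using *[OF kl(1)] *[OF kl(2)] e by simp
    then have "k \<otimes> k = l \<otimes> l" using kl xy CG by simp
    then show ?thesis using sqinj kl by blast
  qed
  have nc: "(g \<otimes> k) \<otimes> (h \<otimes> l) \<noteq> (h \<otimes> l) \<otimes> (g \<otimes> k)" if "k \<in> C" "l \<in> C" for k l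
  proof
    note G' = CG[OF that(1)] CG[OF that(2)] gh
    assume "(g \<otimes> k) \<otimes> (h \<otimes> l) = (h \<otimes> l) \<otimes> (g \<otimes> k)"
    moreover have "(g \<otimes> k) \<otimes> (h \<otimes> l) = (g \<otimes> h) \<otimes> (k \<otimes> l)"
      using G' Cc[of k h] that by (metis m_assoc m_closed)
    moreover have "(h \<otimes> l) \<otimes> (g \<otimes> k) = (h \<otimes> g) \<otimes> (k \<otimes> l)"
      using G' Cc[of l g] Cc[of k l] that by (metis m_assoc m_closed)
    ultimately show False using G' by auto
  qed
  \<comment> \<open>In \<open>(gk)(hl)(gk) = hl\<close> the central factor \<open>l\<close> cancels.
    If every \<open>k\<close> had such an \<open>l\<close>, the relation would hold for both
    \<open>g\<close> and \<open>gc\<close>, which \<open>first\<close> forbids.\<close>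
  have "\<exists>k\<in>C. \<forall>l\<in>C. (g \<otimes> k) \<otimes> (h \<otimes> l) \<otimes> (g \<otimes> k) \<noteq> h \<otimes> l"
  proof (rule ccontr)
    assume "\<not> ?thesis"
    then have A: "\<forall>k\<in>C. \<exists>l\<in>C. (g \<otimes> k) \<otimes> (h \<otimes> l) \<otimes> (g \<otimes> k) = h \<otimes> l" by blast
    have B: "(g \<otimes> k) \<otimes> h \<otimes> (g \<otimes> k) = h" if k: "k \<in> C" for k
    proof -
      obtain l where l: "l \<in> C" "(g \<otimes> k) \<otimes> (h \<otimes> l) \<otimes> (g \<otimes> k) = h \<otimes> l" using A k by blast
      note G' = CG[OF k] CG[OF l(1)] gh
      have "(g \<otimes> k) \<otimes> (h \<otimes> l) \<otimes> (g \<otimes> k) = (g \<otimes> k) \<otimes> h \<otimes> (l \<otimes> (g \<otimes> k))" using G' by (simp add: m_assoc)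
      also have "l \<otimes> (g \<otimes> k) = (g \<otimes> k) \<otimes> l" by (rule Cc[OF l(1)]) (use G' in auto)
      finally have "((g \<otimes> k) \<otimes> h \<otimes> (g \<otimes> k)) \<otimes> l = h \<otimes> l" using l G' by (simp add: m_assoc)
      then show ?thesis using G' by (metis r_cancel m_closed)
    qed
    have "\<one> = c" using first[of \<one> c g h] B[of \<one>] B[of c] gh by (simp add: C_def)
    then have "c \<otimes> c = \<one>" using c(1) by (metis l_one)
    then show False using d by (simp add: d_def)
  qed
  then obtain k where k: "k \<in> C" "\<And>l. l \<in> C \<Longrightarrow> (g \<otimes> k) \<otimes> (h \<otimes> l) \<otimes> (g \<otimes> k) \<noteq> h \<otimes> l" by blast
  define x where "x = g \<otimes> k"
  have x: "x \<in> carrier G" using gh CG k by (simp add: x_def)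
  have two: "(h \<otimes> l) \<otimes> x \<otimes> (h \<otimes> l) = x \<or> x \<otimes> x = (h \<otimes> h) \<otimes> (l \<otimes> l)" if l: "l \<in> C" for l
  proof -
    have "(h \<otimes> l) \<otimes> (h \<otimes> l) = (h \<otimes> h) \<otimes> (l \<otimes> l)"
      using gh CG[OF l] Cc[OF l, of h] by (metis m_assoc m_closed)
    then show ?thesis
      using noncommuting_cases[of x "h \<otimes> l"] nc[OF k(1) l] k(2)[OF l] x gh CG[OF l] unfolding x_def by (metis m_closed)
  qed
  have three: "k = l" if "k \<in> C" "l \<in> C" "x \<otimes> x = (h \<otimes> h) \<otimes> (k \<otimes> k)" "x \<otimes> x = (h \<otimes> h) \<otimes> (l \<otimes> l)" for k l
  proof -
    have "(h \<otimes> h) \<otimes> (k \<otimes> k) = (h \<otimes> h) \<otimes> (l \<otimes> l)" using that by simp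
    then have "k \<otimes> k = l \<otimes> l" using that gh CG by simp
    then show ?thesis using sqinj that by blast
  qed
  have in_C: "\<one> \<in> C" "c \<in> C" "d \<in> C" by (auto simp: C_def)
  \<comment> \<open>Pigeonhole: each of the three multiples \<open>hl\<close> satisfies one of two
    alternatives with \<open>x\<close>, and each alternative holds for at most one multiple.\<close>
  have "\<one> \<noteq> c" "\<one> \<noteq> d" "c \<noteq> d" using d c(1) by (auto simp: d_def)
  moreover define P where "P l \<longleftrightarrow> (h \<otimes> l) \<otimes> x \<otimes> (h \<otimes> l) = x" for l
  moreover have "k = l" if "k \<in> C" "l \<in> C" "P k" "P l" for k l
    using first[of k l h x] that gh x by (simp add: P_def)
  moreover have "k = l" if "k \<in> C" "l \<in> C" "\<not> P k" "\<not> P l" for k l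
    using three[of k l] two[of k] two[of l] that by (simp add: P_def)
  ultimately show False using in_C by metis
qed

text \<open>The alternative \<open>hah = a\<close> is handled by applying the condition to
  \<open>a\<close> and \<open>ah\<close> as well. This either gives the claim or forces
  \<open>h^2 = a^-2\<close>; then \<open>h^2 a h^2 = a\<close> becomes \<open>a^-4 = 1\<close>,
  against the hypothesis.\<close>

lemma inverts_long_element:
  assumes a: "a \<in> carrier G" "(a \<otimes> a) \<otimes> (a \<otimes> a) \<noteq> \<one>"
    and h: "h \<in> carrier G" "a \<otimes> h \<noteq> h \<otimes> a"
  shows "a \<otimes> h \<otimes> a = h"
  using a(1) h
proof (cases rule: noncommuting_cases)
  case 2
  have ne: "a \<otimes> (a \<otimes> h) \<noteq> (a \<otimes> h) \<otimes> a" using a h by (simp add: m_assoc)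
  have *: "h \<otimes> (a \<otimes> h) = a" using 2 a h by (simp add: m_assoc)
  show ?thesis
    using a(1) m_closed[OF a(1) h(1)] ne
  proof (cases rule: noncommuting_cases)
    case 1
    then have "a \<otimes> (a \<otimes> h \<otimes> a) = a \<otimes> h" using a h by (simp add: m_assoc)
    then show ?thesis using a h by simp
  next
    case 22: 2
    have "a \<otimes> h \<otimes> (a \<otimes> a \<otimes> h) = a" using 22 a h by (simp add: m_assoc)
    then have "a \<otimes> (h \<otimes> a \<otimes> a \<otimes> h) = a \<otimes> \<one>" using a h by (simp add: m_assoc)
    then have 3: "h \<otimes> a \<otimes> a \<otimes> h = \<one>" using a h by (metis l_cancel m_closed one_closed)
    have 4: "a \<otimes> h = inv h \<otimes> a" using * a(1) h(1) by (metis inv_solve_left m_closed)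
    have 5: "h \<otimes> a = a \<otimes> inv h" using 2 a(1) h(1) by (metis inv_solve_right m_closed)
    have "h \<otimes> a \<otimes> a \<otimes> h = a \<otimes> (inv h \<otimes> a) \<otimes> h" unfolding 5 using a(1) h(1) by (simp add: m_assoc)
    also have "\<dots> = a \<otimes> a \<otimes> (h \<otimes> h)" unfolding 4[symmetric] using a(1) h(1) by (simp add: m_assoc)
    finally have "a \<otimes> a \<otimes> (h \<otimes> h) = \<one>" using 3 by simp
    then have hh: "h \<otimes> h = inv (a \<otimes> a)" using a h by (metis inv_equality inv_inv m_closed inv_comm)
    have "(h \<otimes> h) \<otimes> a \<otimes> (h \<otimes> h) = a" using * a h by (simp add: m_assoc) (metis a(1) h(1) * m_assoc m_closed)
    then have "inv (a \<otimes> a) \<otimes> a \<otimes> inv (a \<otimes> a) = a" using hh by simp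
    then have "inv (a \<otimes> a) \<otimes> a = a \<otimes> (a \<otimes> a)" using a by (metis inv_solve_right m_closed inv_closed inv_inv)
    then have "a = (a \<otimes> a) \<otimes> (a \<otimes> (a \<otimes> a))" using a by (metis inv_solve_left m_closed)
    then have "a \<otimes> \<one> = a \<otimes> ((a \<otimes> a) \<otimes> (a \<otimes> a))" using a by (simp add: m_assoc)
    then show ?thesis using a by (metis l_cancel m_closed one_closed)
  next
    case 3 then show ?thesis using a by simp
  qed
next
  case 3 then show ?thesis using a by simp
qed

text \<open>Of the alternatives for \<open>b\<close> and \<open>ab\<close>, the third contains the
  claim. The other two yield \<open>b^2 a^2 = 1\<close>, so that \<open>a^2\<close> would both
  commute with \<open>b\<close> and be inverted by it, against
  \<open>a^4 \<noteq> 1\<close>.\<close>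

lemma inverting_exponent4:
  assumes a: "a \<in> carrier G" "(a \<otimes> a) \<otimes> (a \<otimes> a) \<noteq> \<one>"
    and b: "b \<in> carrier G" "a \<otimes> b \<otimes> a = b"
  shows "a \<otimes> b \<noteq> b \<otimes> a" "(b \<otimes> b) \<otimes> (b \<otimes> b) = \<one>"
proof -
  have ab: "a \<otimes> (b \<otimes> a) = b" using a b by (simp add: m_assoc)
  show nc: "a \<otimes> b \<noteq> b \<otimes> a"
  proof
    assume "a \<otimes> b = b \<otimes> a"
    then have "(b \<otimes> a) \<otimes> a = b" using b(2) by simp
    then have "b \<otimes> (a \<otimes> a) = b \<otimes> \<one>" using a b(1) by (simp add: m_assoc)
    then have "a \<otimes> a = \<one>" using a b by (metis l_cancel m_closed one_closed)
    then show False using a by simp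
  qed
  have a2b: "(a \<otimes> a) \<otimes> b \<otimes> (a \<otimes> a) = b" using ab a b by (simp add: m_assoc) (metis a(1) b(1) ab m_assoc m_closed)
  have no: False if "(b \<otimes> b) \<otimes> (a \<otimes> a) = \<one>"
  proof -
    have "inv (b \<otimes> b) = a \<otimes> a" using that a b by (metis inv_equality inv_comm m_closed)
    moreover have "inv (b \<otimes> b) \<otimes> b = b \<otimes> inv (b \<otimes> b)" using b by (simp add: inv_mult_group m_assoc)
    ultimately have "(a \<otimes> a) \<otimes> b = b \<otimes> (a \<otimes> a)" by simp
    then have "b \<otimes> ((a \<otimes> a) \<otimes> (a \<otimes> a)) = b \<otimes> \<one>" using a2b a b by (simp add: m_assoc)
    then show False using a b by (metis l_cancel m_closed one_closed)
  qed
  have ne: "b \<otimes> (a \<otimes> b) \<noteq> (a \<otimes> b) \<otimes> b" using nc a b by (metis m_assoc r_cancel m_closed)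
  show "(b \<otimes> b) \<otimes> (b \<otimes> b) = \<one>"
    using b(1) m_closed[OF a(1) b(1)] ne
  proof (cases rule: noncommuting_cases)
    case 1
    then have "(b \<otimes> a \<otimes> b) \<otimes> b = a \<otimes> b" using a b by (simp add: m_assoc)
    then have "b \<otimes> a \<otimes> b = a" using a b by (metis r_cancel m_closed)
    then have "b \<otimes> a \<otimes> (a \<otimes> b \<otimes> a) = a" using b(2) by simp
    then have "(b \<otimes> a \<otimes> a \<otimes> b) \<otimes> a = \<one> \<otimes> a" using a b by (simp add: m_assoc)
    then have e: "b \<otimes> (a \<otimes> a \<otimes> b) = \<one>" using a b by (metis r_cancel m_closed one_closed m_assoc)
    then have "(a \<otimes> a \<otimes> b) \<otimes> b = \<one>" using a b by (metis inv_comm m_closed)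
    then have "(a \<otimes> a) \<otimes> (b \<otimes> b) = \<one>" using a b by (simp add: m_assoc)
    then show ?thesis using no a b by (metis inv_comm m_closed)
  next
    case 2
    then have "a \<otimes> (b \<otimes> b \<otimes> a) \<otimes> b = \<one> \<otimes> b" using a b by (simp add: m_assoc)
    then have "a \<otimes> (b \<otimes> b \<otimes> a) = \<one>" using a b by (metis r_cancel m_closed one_closed)
    then have "(b \<otimes> b \<otimes> a) \<otimes> a = \<one>" using a b by (metis inv_comm m_closed)
    then show ?thesis using no a b by (simp add: m_assoc)
  next
    case 3 then show ?thesis by simp
  qed
qed

text \<open>The subgroup is the centralizer of \<open>a\<close>, inverted by any \<open>b\<close>
  that does not commute with \<open>a\<close>; such a \<open>b\<close> exists by
  \<open>center_exponent4\<close>. An element commuting with \<open>a\<close> whose fourth power is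
  trivial escapes \<open>inverts_long_element\<close>, but its product with \<open>a\<close> does
  not, and if \<open>b\<close> inverts \<open>a\<close> and the product, it inverts the
  element.\<close>

lemma long_element_has_inverted_index2:
  assumes a: "a \<in> carrier G" "(a \<otimes> a) \<otimes> (a \<otimes> a) \<noteq> \<one>" and nab: "\<not> comm_group G"
  shows "has_inverted_index2_subgroup G"
proof -
  obtain g h where gh: "g \<in> carrier G" "h \<in> carrier G" "g \<otimes> h \<noteq> h \<otimes> g"
    using nab group_comm_groupI by blast
  obtain b where b: "b \<in> carrier G" "a \<otimes> b \<noteq> b \<otimes> a"
    using center_exponent4[OF gh a(1)] a by blast
  have inv: "a \<otimes> b \<otimes> a = b" using inverts_long_element a b by blast
  \<comment> \<open>Both \<open>b\<close> and \<open>bc\<close> invert \<open>a\<close>, so both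
    have trivial fourth power, and \<open>c\<close> is their quotient.\<close>
  have comm4: "(c \<otimes> c) \<otimes> (c \<otimes> c) = \<one>" if c: "c \<in> carrier G" "a \<otimes> c = c \<otimes> a" "b \<otimes> c = c \<otimes> b" for c
  proof -
    have "a \<otimes> (b \<otimes> c) \<otimes> a = a \<otimes> b \<otimes> (c \<otimes> a)" using a(1) b(1) c(1) by (simp add: m_assoc)
    also have "\<dots> = (a \<otimes> b \<otimes> a) \<otimes> c" using a(1) b(1) c(1) by (simp add: m_assoc flip: c(2))
    finally have "a \<otimes> (b \<otimes> c) \<otimes> a = b \<otimes> c" using inv by simp
    then have 1: "((b \<otimes> c) \<otimes> (b \<otimes> c)) \<otimes> ((b \<otimes> c) \<otimes> (b \<otimes> c)) = \<one>"
      using inverting_exponent4[OF a, of "b \<otimes> c"] b c by simp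
    have 2: "(b \<otimes> b) \<otimes> (b \<otimes> b) = \<one>" using inverting_exponent4[OF a b(1) inv] by simp
    note 3 = square_mult_commuting[OF b(1) c(1) c(3)]
    then have "((b \<otimes> c) \<otimes> (b \<otimes> c)) \<otimes> ((b \<otimes> c) \<otimes> (b \<otimes> c)) = ((b \<otimes> b) \<otimes> (b \<otimes> b)) \<otimes> ((c \<otimes> c) \<otimes> (c \<otimes> c))"
      unfolding 3(1) by (intro square_mult_commuting(1) 3(2)) (use b(1) c(1) in auto)
    then show ?thesis using 1 2 b c by simp
  qed
  have a': "a \<otimes> (b \<otimes> a) = b" using inv a b by (simp add: m_assoc)
  have bC: "m \<otimes> b \<otimes> m = b" if m: "m \<in> carrier G" "m \<otimes> a = a \<otimes> m" for m
  proof (cases "(m \<otimes> m) \<otimes> (m \<otimes> m) = \<one>")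
    case False
    then show ?thesis using inverts_long_element[OF m(1) _ b(1)] comm4[OF m(1)] m by metis
  next
    case True
    note 1 = square_mult_commuting[OF a(1) m(1) m(2)[symmetric]]
    have "((a \<otimes> m) \<otimes> (a \<otimes> m)) \<otimes> ((a \<otimes> m) \<otimes> (a \<otimes> m)) = ((a \<otimes> a) \<otimes> (a \<otimes> a)) \<otimes> ((m \<otimes> m) \<otimes> (m \<otimes> m))"
      unfolding 1(1) by (intro square_mult_commuting(1) 1(2)) (use a(1) m(1) in auto)
    then have am: "((a \<otimes> m) \<otimes> (a \<otimes> m)) \<otimes> ((a \<otimes> m) \<otimes> (a \<otimes> m)) \<noteq> \<one>" using True a by simp
    have "a \<otimes> (a \<otimes> m) = (a \<otimes> m) \<otimes> a" using a m by (simp add: m_assoc)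
    then have "(a \<otimes> m) \<otimes> b \<noteq> b \<otimes> (a \<otimes> m)" using am comm4[of "a \<otimes> m"] a m by auto
    then have "(a \<otimes> m) \<otimes> b \<otimes> (a \<otimes> m) = b" using inverts_long_element[of "a \<otimes> m" b] am a m b by simp
    moreover have "m \<otimes> (a \<otimes> (b \<otimes> a)) \<otimes> m = (m \<otimes> a) \<otimes> b \<otimes> (a \<otimes> m)" using a(1) m(1) b(1) by (simp add: m_assoc)
    ultimately have "m \<otimes> (a \<otimes> (b \<otimes> a)) \<otimes> m = b" using m(2) by simp
    then show ?thesis using a' by simp
  qed
  have co: "(g \<otimes> b) \<otimes> a = a \<otimes> (g \<otimes> b)" if g: "g \<in> carrier G" "g \<otimes> a \<noteq> a \<otimes> g" for g
  proof -
    have "a \<otimes> g \<otimes> a = g" using inverts_long_element[OF a g(1)] g by metis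
    then have "a \<otimes> (g \<otimes> b) = a \<otimes> g \<otimes> (a \<otimes> b \<otimes> a)" using inv g a b by (simp add: m_assoc)
    also have "\<dots> = (a \<otimes> g \<otimes> a) \<otimes> (b \<otimes> a)" using g a b by (simp add: m_assoc)
    finally show ?thesis using \<open>a \<otimes> g \<otimes> a = g\<close> g a b by (simp add: m_assoc)
  qed
  have "b \<otimes> b \<noteq> \<one>" using involution_central[of b a] a b by auto
  then show ?thesis
    using has_inverted_index2I[OF a(1) b(1) _ _ _ bC co] inverting_exponent4[OF a b(1) inv] b by metis
qed

end

section \<open>Groups of exponent 4\<close>

text \<open>
  Squares are central involutions here. So \<open>cm g h\<close>, the polar form of the squaring map, is
  bimultiplicative and equals the commutator of \<open>g\<close> and \<open>h\<close>.
\<close>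

locale char2_exponent4_group = char2_group +
  assumes exponent4: "g \<in> carrier G \<Longrightarrow> (g \<otimes> g) \<otimes> (g \<otimes> g) = \<one>"
begin

definition sq :: "'a \<Rightarrow> 'a" where "sq g = g \<otimes> g"
definition cm :: "'a \<Rightarrow> 'a \<Rightarrow> 'a" where "cm g h = sq (g \<otimes> h) \<otimes> (sq g \<otimes> sq h)"
definition Om :: "'a set" where "Om = {g \<in> carrier G. g \<otimes> g = \<one>}"

lemma Om_closed: "x \<in> Om \<Longrightarrow> x \<in> carrier G"
  by (simp add: Om_def)

lemma Om_comm: "x \<in> Om \<Longrightarrow> y \<in> carrier G \<Longrightarrow> x \<otimes> y = y \<otimes> x"
  using involution_central[of x y] by (simp add: Om_def)

lemma Om_comm2: "x \<in> Om \<Longrightarrow> y \<in> Om \<Longrightarrow> x \<otimes> y = y \<otimes> x"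
  using Om_comm Om_closed by blast

lemma Om_lcomm: "x \<in> Om \<Longrightarrow> y \<in> Om \<Longrightarrow> z \<in> carrier G \<Longrightarrow> x \<otimes> (y \<otimes> z) = y \<otimes> (x \<otimes> z)"
  using Om_comm2[of x y] Om_closed by (metis m_assoc)

lemma Om_mult [simp]: "x \<in> Om \<Longrightarrow> y \<in> Om \<Longrightarrow> x \<otimes> y \<in> Om"
  using square_mult_commuting(1)[of x y] Om_comm2[of x y] by (simp add: Om_def)

lemma Om_sq: "x \<in> Om \<Longrightarrow> x \<otimes> x = \<one>"
  by (simp add: Om_def)

lemma Om_sq2: "x \<in> Om \<Longrightarrow> y \<in> carrier G \<Longrightarrow> x \<otimes> (x \<otimes> y) = y"
  using Om_closed Om_sq by (metis m_assoc l_one)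

lemma one_Om [simp]: "\<one> \<in> Om" by (simp add: Om_def)

lemma Om_eq: "x \<in> Om \<Longrightarrow> y \<in> carrier G \<Longrightarrow> x \<otimes> y = \<one> \<Longrightarrow> y = x"
  using Om_sq2[of x y] Om_closed[of x] by simp

lemmas Om_simps = Om_closed Om_comm2 Om_lcomm Om_sq Om_sq2 m_assoc

lemma sq_Om [simp]: "g \<in> carrier G \<Longrightarrow> sq g \<in> Om"
  using exponent4 by (simp add: Om_def sq_def)

lemma sq_closed [simp]: "g \<in> carrier G \<Longrightarrow> sq g \<in> carrier G"
  by (simp add: sq_def)

lemma sq_eq_one: "g \<in> carrier G \<Longrightarrow> sq g = \<one> \<longleftrightarrow> g \<in> Om"
  by (simp add: sq_def Om_def)

lemma cm_Om [simp]: "g \<in> carrier G \<Longrightarrow> h \<in> carrier G \<Longrightarrow> cm g h \<in> Om"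
  by (simp add: cm_def)

lemma cm_closed [simp]: "g \<in> carrier G \<Longrightarrow> h \<in> carrier G \<Longrightarrow> cm g h \<in> carrier G"
  by (simp add: cm_def)

lemma sq_mult: "g \<in> carrier G \<Longrightarrow> h \<in> carrier G \<Longrightarrow> sq (g \<otimes> h) = sq g \<otimes> sq h \<otimes> cm g h"
  by (simp add: cm_def Om_simps)

text \<open>Squares are central involutions, so \<open>g\<close> and \<open>h\<close> can be
  cancelled in \<open>g(hg)h = (gh)^2\<close>. This identifies the polar form with the commutator,
  and bimultiplicativity follows.\<close>

lemma swap:
  assumes g: "g \<in> carrier G" and h: "h \<in> carrier G"
  shows "h \<otimes> g = g \<otimes> h \<otimes> cm g h"
proof -
  have "g \<otimes> (h \<otimes> g) \<otimes> h = sq (g \<otimes> h)" using g h by (simp add: sq_def m_assoc)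
  also have "\<dots> = sq g \<otimes> sq h \<otimes> cm g h" using g h by (rule sq_mult)
  also have "\<dots> = g \<otimes> (g \<otimes> h \<otimes> (h \<otimes> cm g h))" using g h by (simp add: sq_def m_assoc)
  also have "h \<otimes> cm g h = cm g h \<otimes> h" using Om_comm[of "cm g h" h] g h by simp
  also have "g \<otimes> (g \<otimes> h \<otimes> (cm g h \<otimes> h)) = g \<otimes> (g \<otimes> h \<otimes> cm g h) \<otimes> h" using g h by (simp add: m_assoc)
  finally have "g \<otimes> (h \<otimes> g) = g \<otimes> (g \<otimes> h \<otimes> cm g h)"
    by (rule r_cancel) (use g h in auto)
  then show ?thesis by (rule l_cancel) (use g h in auto)
qed

lemma commute_iff: "g \<in> carrier G \<Longrightarrow> h \<in> carrier G \<Longrightarrow> g \<otimes> h = h \<otimes> g \<longleftrightarrow> cm g h = \<one>"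
  using swap[of g h] l_cancel_one[of "g \<otimes> h" "cm g h"] by auto

lemma cm_eqI:
  "g \<in> carrier G \<Longrightarrow> h \<in> carrier G \<Longrightarrow> x \<in> carrier G \<Longrightarrow> h \<otimes> g = g \<otimes> h \<otimes> x \<Longrightarrow> cm g h = x"
  using swap[of g h] l_cancel[of "g \<otimes> h" "cm g h" x] by auto

lemma cm_sym: assumes g: "g \<in> carrier G" and h: "h \<in> carrier G" shows "cm g h = cm h g"
proof (rule cm_eqI[OF g h])
  show "h \<otimes> g = g \<otimes> h \<otimes> cm h g"
    using swap[OF h g] g h by (simp add: m_assoc Om_sq)
qed (use g h in auto)

lemma cm_mult_left:
  assumes g: "g \<in> carrier G" and k: "k \<in> carrier G" and h: "h \<in> carrier G"
  shows "cm (g \<otimes> k) h = cm g h \<otimes> cm k h"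
proof (rule cm_eqI)
  have "h \<otimes> (g \<otimes> k) = (g \<otimes> h \<otimes> cm g h) \<otimes> k" using swap[OF g h] g h k by (simp flip: m_assoc)
  also have "\<dots> = g \<otimes> h \<otimes> (k \<otimes> cm g h)" using Om_comm[of "cm g h" k] g h k by (simp add: m_assoc)
  also have "\<dots> = g \<otimes> (h \<otimes> k) \<otimes> cm g h" using g h k by (simp add: m_assoc)
  also have "h \<otimes> k = k \<otimes> h \<otimes> cm k h" by (rule swap[OF k h])
  also have "g \<otimes> (k \<otimes> h \<otimes> cm k h) \<otimes> cm g h = g \<otimes> k \<otimes> h \<otimes> (cm g h \<otimes> cm k h)"
    using g h k Om_comm2[of "cm g h" "cm k h"] by (simp add: m_assoc)
  finally show "h \<otimes> (g \<otimes> k) = g \<otimes> k \<otimes> h \<otimes> (cm g h \<otimes> cm k h)" .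
qed (use assms in auto)

lemma cm_mult_right:
  "g \<in> carrier G \<Longrightarrow> k \<in> carrier G \<Longrightarrow> h \<in> carrier G \<Longrightarrow> cm h (g \<otimes> k) = cm h g \<otimes> cm h k"
  using cm_mult_left[of g k h] cm_sym[of h g] cm_sym[of h k] cm_sym[of h "g \<otimes> k"] by simp

lemma cm_self: "g \<in> carrier G \<Longrightarrow> cm g g = \<one>"
  using commute_iff[of g g] by simp

lemma cm_Om_left: "x \<in> Om \<Longrightarrow> g \<in> carrier G \<Longrightarrow> cm x g = \<one>"
  using commute_iff[of x g] Om_comm[of x g] Om_closed[of x] by simp

lemma inverts_iff:
  assumes g: "g \<in> carrier G" and h: "h \<in> carrier G"
  shows "g \<otimes> h \<otimes> g = h \<longleftrightarrow> cm g h = sq g"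
proof -
  have "g \<otimes> h \<otimes> g = g \<otimes> (g \<otimes> h \<otimes> cm g h)" using g h swap[OF g h] by (simp add: m_assoc)
  also have "\<dots> = sq g \<otimes> (h \<otimes> cm g h)" using g h by (simp add: sq_def m_assoc)
  also have "h \<otimes> cm g h = cm g h \<otimes> h" using Om_comm[of "cm g h" h] g h by simp
  finally have e: "g \<otimes> h \<otimes> g = (sq g \<otimes> cm g h) \<otimes> h" using g h by (simp add: m_assoc)
  then have "g \<otimes> h \<otimes> g = h \<longleftrightarrow> sq g \<otimes> cm g h = \<one>" using g h by simp
  also have "\<dots> \<longleftrightarrow> cm g h = sq g" using Om_eq[of "sq g" "cm g h"] Om_sq g h by auto
  finally show ?thesis .
qed

text \<open>The form in which \<open>char2_condition\<close> is used from here on: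
  \<open>inverts_iff\<close> turns its alternatives into coincidences between a commutator and
  squares.\<close>

lemma cm_cases:
  assumes g: "g \<in> carrier G" and h: "h \<in> carrier G"
  shows "cm g h = \<one> \<or> cm g h = sq g \<or> cm g h = sq h \<or> sq g = sq h"
  using noncommuting_cases[OF g h] commute_iff[OF g h] inverts_iff[OF g h] inverts_iff[OF h g] cm_sym[OF g h]
  by (metis sq_def)

text \<open>By the last hypothesis commutation with \<open>k\<close> takes a single nontrivial
  value. It is a homomorphism whose kernel is the centralizer of \<open>k\<close>, which thus has
  index 2.\<close>

lemma has_inverted_index2I':
  assumes G: "k \<in> carrier G" "b \<in> carrier G" and ne: "cm k b \<noteq> \<one>"
    and inv: "\<And>m. m \<in> carrier G \<Longrightarrow> cm m k = \<one> \<Longrightarrow> cm m b = sq m"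
    and co: "\<And>g. g \<in> carrier G \<Longrightarrow> cm g k \<noteq> \<one> \<Longrightarrow> cm g k = cm b k"
  shows "has_inverted_index2_subgroup G"
proof (rule has_inverted_index2I[OF G])
  show "b \<otimes> k \<noteq> k \<otimes> b" using ne commute_iff[OF G] by auto
  show "b \<otimes> b \<otimes> (b \<otimes> b) = \<one>" using exponent4 G by simp
  show "b \<otimes> b \<noteq> \<one>" using cm_Om_left[of b k] cm_sym[OF G] ne G by (auto simp: Om_def)
  show "m \<otimes> b \<otimes> m = b" if "m \<in> carrier G" "m \<otimes> k = k \<otimes> m" for m
    using that inv[of m] commute_iff inverts_iff G by simp
  show "g \<otimes> b \<otimes> k = k \<otimes> (g \<otimes> b)" if "g \<in> carrier G" "g \<otimes> k \<noteq> k \<otimes> g" for g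
    using that co[of g] commute_iff[of g k] commute_iff[of "g \<otimes> b" k] cm_mult_left[of g b k] G Om_sq[of "cm b k"] by simp
qed

section \<open>Independent squares, equal squares and central squares\<close>

text \<open>The three squares \<open>a\<close>, \<open>b\<close>, \<open>c\<close> are independent
  in the elementary abelian group \<open>Om\<close>, so \<open>cm_cases\<close> leaves three values
  each for \<open>p\<close> and \<open>r\<close>. The same condition for \<open>g1 g2\<close> and
  \<open>g3\<close>, for \<open>g2\<close> and \<open>g1 g3\<close>, and for \<open>g1\<close> and
  \<open>g2 g3\<close> eliminates every pair except \<open>p = 1\<close>,
  \<open>r = c\<close>.\<close>

lemma inverted_triple:
  assumes g: "g1 \<in> carrier G" "g2 \<in> carrier G" "g3 \<in> carrier G"
    and e: "cm g1 g2 = sq g1" "sq g1 \<noteq> \<one>" "sq g1 \<noteq> sq g2"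
    and n: "sq g3 \<noteq> \<one>" "sq g3 \<noteq> sq g1" "sq g3 \<noteq> sq g2" "sq g3 \<noteq> sq g1 \<otimes> sq g2"
  shows "cm g1 g3 = \<one>" "cm g3 g2 = sq g3"
proof -
  define a b c p r where "a = sq g1" "b = sq g2" "c = sq g3" "p = cm g1 g3" "r = cm g2 g3"
  note defs = this
  have O: "a \<in> Om" "b \<in> Om" "c \<in> Om" "p \<in> Om" "r \<in> Om" using g by (auto simp: defs)
  note C = this[THEN Om_closed]
  have b1: "b \<noteq> \<one>"
    using e cm_Om_left[of g2 g1] cm_sym[of g1 g2] sq_eq_one[of g2] g by (auto simp: defs)
  have a1: "a \<noteq> \<one>" "a \<noteq> b" "c \<noteq> \<one>" "c \<noteq> a" "c \<noteq> b" "a \<otimes> b \<noteq> c" using e n by (auto simp: defs)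
  have *: "a \<otimes> b \<noteq> \<one>" "b \<otimes> c \<noteq> \<one>" "a \<otimes> c \<noteq> \<one>"
    using a1 Om_eq O C by metis+
  have **: "a \<otimes> c \<noteq> b" "b \<otimes> c \<noteq> a" using a1(6) Om_sq2 Om_comm2 O C by metis+
  have ***: "a \<otimes> b \<noteq> a \<otimes> c" "a \<otimes> c \<noteq> b \<otimes> c" "a \<otimes> b \<noteq> b \<otimes> c" using a1 Om_sq2 Om_comm2 O C by metis+
  note dist = a1 b1 * ** *** a1[symmetric] b1[symmetric] *[symmetric] **[symmetric] ***[symmetric]
  have p: "p = \<one> \<or> p = a \<or> p = c" using cm_cases[of g1 g3] g a1 by (auto simp: defs)
  have r: "r = \<one> \<or> r = b \<or> r = c" using cm_cases[of g2 g3] g a1 by (auto simp: defs)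
  have ab: "cm g1 g2 = a" "cm g2 g1 = a" using e(1) cm_sym[of g1 g2] g by (auto simp: defs)
  have L1: "p \<otimes> r = \<one> \<or> p \<otimes> r = b \<or> p \<otimes> r = c \<or> b = c"
    using cm_cases[of "g1 \<otimes> g2" g3] g O C ab by (simp add: sq_mult cm_mult_left Om_simps flip: defs)
  have L2: "a \<otimes> r = \<one> \<or> a \<otimes> r = b \<or> a \<otimes> r = a \<otimes> (c \<otimes> p) \<or> b = a \<otimes> (c \<otimes> p)"
    using cm_cases[of g2 "g1 \<otimes> g3"] g O C ab by (simp add: sq_mult cm_mult_right m_assoc flip: defs)
  have L3: "a \<otimes> p = \<one> \<or> a \<otimes> p = a \<or> a \<otimes> p = b \<otimes> (c \<otimes> r) \<or> a = b \<otimes> (c \<otimes> r)"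
    using cm_cases[of g1 "g2 \<otimes> g3"] g O C ab by (simp add: sq_mult cm_mult_right m_assoc flip: defs)
  from p consider "p = \<one>" | "p = a" | "p = c" by blast
  then have "p = \<one> \<and> r = c"
  proof cases
    assume p: "p = \<one>"
    have "r \<noteq> \<one>" using L2 p dist O(1-3) C(1-3) by auto
    moreover have "r \<noteq> b" using L2 p dist O(1-3) C(1-3) by auto
    ultimately show ?thesis using p r by auto
  next
    assume p: "p = a"
    have "r \<noteq> \<one>" "r \<noteq> b" "r \<noteq> c" using L1 p dist O(1-3) C(1-3) by auto
    then show ?thesis using r by auto
  next
    assume p: "p = c"
    have "r \<noteq> \<one>" using L3 p dist O(1-3) C(1-3) by auto
    moreover have "r \<noteq> b" using L1 p dist O(1-3) C(1-3) Om_comm2[of b c] by auto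
    moreover have "a \<otimes> (c \<otimes> c) = a" using O C by (simp add: Om_sq)
    then have "r \<noteq> c" using L2 p dist O(1-3) C(1-3) by auto
    ultimately show ?thesis using r by auto
  qed
  then show "cm g1 g3 = \<one>" "cm g3 g2 = sq g3" using cm_sym[of g2 g3] g by (auto simp: defs)
qed

end

context char2_exponent4_group
begin

text \<open>All elements whose square is not \<open>z\<close> are inverted by \<open>h\<close> and
  commute with each other; the centralizer of \<open>k\<close> then satisfies
  \<open>has_inverted_index2I'\<close>. Starting from the pair \<open>g\<close>, \<open>h\<close>,
  \<open>inverted_triple\<close> reaches only squares independent of \<open>a\<close> and
  \<open>z\<close>. The third square makes \<open>k\<close>, \<open>h\<close> a second pair to start
  from, which reaches the others.\<close>

lemma inverted_if_three_squares:
  assumes g: "g \<in> carrier G" "h \<in> carrier G" "cm g h = sq g" "sq g \<noteq> \<one>" "sq g \<noteq> sq h"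
    and k: "k \<in> carrier G" "sq k \<noteq> \<one>" "sq k \<noteq> sq g" "sq k \<noteq> sq h" "sq k \<noteq> sq g \<otimes> sq h"
  shows "has_inverted_index2_subgroup G"
proof -
  define a z where "a = sq g" and "z = sq h"
  have O: "a \<in> Om" "z \<in> Om" "sq k \<in> Om" using g k by (auto simp: a_def z_def)
  note C = this[THEN Om_closed]
  have kh: "cm k h = sq k" using inverted_triple(2)[OF g(1,2) k(1) g(3-5) k(2-5)] .
  \<comment> \<open>Independence of \<open>a\<close>, \<open>z\<close> and \<open>sq k\<close> is
    symmetric and survives replacing \<open>a\<close> by \<open>az\<close>.\<close>
  have shift: "u \<noteq> \<one> \<and> u \<noteq> sq k \<and> u \<noteq> z \<and> u \<noteq> sq k \<otimes> z" if "u = a \<or> u = a \<otimes> z" for u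
  proof -
    have "a \<noteq> \<one>" "a \<noteq> z" "sq k \<noteq> a" "sq k \<noteq> a \<otimes> z" using g k by (auto simp: a_def z_def)
    moreover have "a \<otimes> z \<noteq> \<one>" using Om_eq[of z a] Om_comm2[of a z] O C calculation by auto
    moreover have "a \<otimes> z \<noteq> z" using calculation O C by simp
    moreover have "a \<noteq> sq k \<otimes> z" using calculation Om_sq[of z] O C by (metis m_assoc r_one)
    moreover have "a \<otimes> z \<noteq> sq k \<otimes> z" using calculation O C by simp
    ultimately show ?thesis using that by auto
  qed
  have inv: "cm x h = sq x" if x: "x \<in> carrier G" "sq x \<noteq> z" for x
  proof -
    consider "sq x = \<one>" | "sq x \<noteq> \<one>" "sq x \<noteq> a" "sq x \<noteq> a \<otimes> z" | "sq x = a \<or> sq x = a \<otimes> z" by blast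
    then show ?thesis
    proof cases
      case 1 then show ?thesis using x g cm_Om_left[of x h] sq_eq_one[of x] by simp
    next
      case 2 then show ?thesis using inverted_triple(2)[OF g(1,2) x(1) g(3-5)] x(2) by (simp add: a_def z_def)
    next
      case 3
      show ?thesis using inverted_triple(2)[OF k(1) g(2) x(1) kh k(2) k(4)] shift[OF 3] by (simp add: z_def)
    qed
  qed
  have comm: "cm x y = \<one>" if x: "x \<in> carrier G" "sq x \<noteq> z" and y: "y \<in> carrier G" "sq y \<noteq> z" for x y
  proof -
    have ox: "sq x \<in> Om" "sq x \<in> carrier G" "sq y \<in> Om" "sq y \<in> carrier G" using x y by auto
    have tri: "cm x' y' = \<one>" if "x' \<in> carrier G" "sq x' \<noteq> z" "sq x' \<noteq> \<one>" "y' \<in> carrier G"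
      "sq y' \<noteq> \<one>" "sq y' \<noteq> sq x'" "sq y' \<noteq> z" "sq y' \<noteq> sq x' \<otimes> z" for x' y'
      using inverted_triple(1)[of x' h y'] that inv[of x'] g by (simp add: z_def)
    consider "sq x = \<one>" | "sq y = \<one>" | "sq x \<noteq> \<one>" "sq y \<noteq> \<one>" "sq y \<noteq> sq x" "sq y \<noteq> sq x \<otimes> z"
      | "sq x \<noteq> \<one>" "sq y \<noteq> \<one>" "sq y = sq x \<or> sq y = sq x \<otimes> z" by blast
    then show ?thesis
    proof cases
      case 1 then show ?thesis using x y cm_Om_left[of x y] sq_eq_one[of x] by simp
    next
      case 2 then show ?thesis using x y cm_Om_left[of y x] sq_eq_one[of y] cm_sym[of x y] by simp
    next
      case 3 then show ?thesis using tri x y by blast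
    next
      case 4
      \<comment> \<open>When the squares of \<open>x\<close> and \<open>y\<close> agree modulo
        \<open>z\<close>, an auxiliary \<open>l\<close> with independent square separates them: it
        commutes with both, and the square of \<open>xl\<close> is independent of
        \<open>sq y\<close> and \<open>z\<close>. Either \<open>k\<close> or \<open>g\<close> can
        serve.\<close>
      have "\<exists>l. l \<in> carrier G \<and> sq l \<noteq> \<one> \<and> sq l \<noteq> sq x \<and> sq l \<noteq> z \<and> sq l \<noteq> sq x \<otimes> z"
      proof (cases "sq k = sq x \<or> sq k = sq x \<otimes> z")
        case True
        have "sq x = sq k \<or> sq x = sq k \<otimes> z" using True Om_sq[of z] O C ox by (metis m_assoc r_one)
        moreover have "a \<noteq> \<one> \<and> a \<noteq> sq k \<and> a \<noteq> z \<and> a \<noteq> sq k \<otimes> z" using shift by blast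
        moreover have "(sq k \<otimes> z) \<otimes> z = sq k" using O C by (simp add: m_assoc Om_sq)
        ultimately show ?thesis using g(1) by (intro exI[of _ g]) (auto simp flip: a_def)
      next
        case False
        then show ?thesis using k by (auto simp: z_def)
      qed
      then obtain l where l: "l \<in> carrier G" "sq l \<noteq> \<one>" "sq l \<noteq> sq x" "sq l \<noteq> z" "sq l \<noteq> sq x \<otimes> z" by blast
      have ol: "sq l \<in> Om" "sq l \<in> carrier G" using l by auto
      have e: "(sq x \<otimes> z) \<otimes> z = sq x" using O C ox by (simp add: m_assoc Om_sq)
      have xl: "cm x l = \<one>" using tri x l 4 by blast
      have "sq l \<noteq> sq y \<and> sq l \<noteq> sq y \<otimes> z" using 4(3) l e by auto
      then have yl: "cm y l = \<one>" using tri y l 4 by blast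
      have sxl: "sq (x \<otimes> l) = sq x \<otimes> sq l" using x l xl ox by (simp add: sq_mult)
      have s1: "sq x \<otimes> sq l \<noteq> \<one>" using Om_eq[OF ox(1) ol(2)] l by metis
      have s2: "sq x \<otimes> sq l \<noteq> sq x" using ol ox l by simp
      have s3: "sq x \<otimes> sq l \<noteq> z" using Om_sq2[OF ox(1) ol(2)] l by metis
      have s4: "sq x \<otimes> sq l \<noteq> sq x \<otimes> z" using l ox ol C by (metis l_cancel)
      have s: "sq (x \<otimes> l) \<noteq> \<one>" "sq (x \<otimes> l) \<noteq> sq y" "sq (x \<otimes> l) \<noteq> z" "sq (x \<otimes> l) \<noteq> sq y \<otimes> z"
        using s1 s2 s3 s4 4(3) e unfolding sxl by auto
      have "cm y (x \<otimes> l) = \<one>" using tri[of y "x \<otimes> l"] y x l 4 s by blast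
      then show ?thesis using cm_mult_right[of x l y] cm_sym[of x y] x y l yl by simp
    qed
  qed
  have sk: "sq k \<noteq> z" using k by (simp add: z_def)
  show ?thesis
  proof (rule has_inverted_index2I'[OF k(1) g(2)])
    show "cm k h \<noteq> \<one>" using kh k by simp
    show "cm m h = sq m" if m: "m \<in> carrier G" "cm m k = \<one>" for m
    proof (cases "sq m = z")
      case True
      \<comment> \<open>An element with square \<open>z\<close> is not covered by
        \<open>inv\<close>, but its product with \<open>k\<close> is.\<close>
      have "sq (m \<otimes> k) = z \<otimes> sq k" using m k True C by (simp add: sq_mult)
      moreover have "\<dots> \<noteq> z" using C k by simp
      ultimately have "cm (m \<otimes> k) h = z \<otimes> sq k" using inv[of "m \<otimes> k"] m k by simp
      then have "cm m h \<otimes> sq k = z \<otimes> sq k" using cm_mult_left[of m k h] m k g kh by simp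
      then have "cm m h = z" by (rule r_cancel) (use m g C in auto)
      then show ?thesis using True by simp
    qed (use inv m in auto)
    show "cm m k = cm h k" if m: "m \<in> carrier G" "cm m k \<noteq> \<one>" for m
    proof -
      have mz: "sq m = z" using comm[OF m(1) _ k(1) sk] m(2) by blast
      have mk: "cm m k = sq k \<or> cm m k = z" using cm_cases[OF m(1) k(1)] mz m(2) sk by auto
      \<comment> \<open>Otherwise \<open>mk\<close> would have the same square as \<open>k\<close>,
        so would commute with \<open>k\<close>, and so would \<open>m\<close>.\<close>
      have "cm m k \<noteq> z"
      proof
        assume e: "cm m k = z"
        have "sq (m \<otimes> k) = sq k" using sq_mult[OF m(1) k(1)] e mz O C by (simp add: Om_simps)
        then have "cm (m \<otimes> k) k = \<one>" using comm[of "m \<otimes> k" k] sk m k by simp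
        then show False using cm_mult_left[of m k k] cm_self[of k] m k by simp
      qed
      then show ?thesis using mk kh cm_sym[of k h] k g by simp
    qed
  qed
qed

text \<open>If \<open>g\<close> and \<open>h\<close> do not commute, neither do \<open>gh\<close>
  and \<open>h\<close>, so all three squares agree and equal the commutator: noncommuting elements
  invert each other. An element commuting with both \<open>x\<close> and \<open>y\<close> is an
  involution, as its product with \<open>x\<close> still has square \<open>z\<close>. So
  \<open>y\<close> inverts the centralizer of \<open>x\<close>.\<close>

lemma inverted_if_equal_squares:
  assumes x: "x \<in> carrier G" "y \<in> carrier G" "cm x y \<noteq> \<one>"
    and eq: "\<And>g h. g \<in> carrier G \<Longrightarrow> h \<in> carrier G \<Longrightarrow> cm g h \<noteq> \<one> \<Longrightarrow> sq g = sq h"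
  shows "has_inverted_index2_subgroup G"
proof -
  have e: "cm g h = sq g" if "g \<in> carrier G" "h \<in> carrier G" "cm g h \<noteq> \<one>" for g h
  proof -
    have "cm (g \<otimes> h) h \<noteq> \<one>" using that cm_mult_left[of g h h] cm_self[of h] by simp
    then have "sq (g \<otimes> h) = sq h" using eq[of "g \<otimes> h" h] that by simp
    then have "sq g \<otimes> sq g \<otimes> cm g h = sq g" using eq[OF that] that by (simp add: sq_mult)
    then show ?thesis using that by (simp add: Om_sq)
  qed
  define z where "z = sq x"
  have z: "cm x y = z" "sq y = z" "cm y x = z" using x e[of x y] eq[of x y] cm_sym[of x y] by (auto simp: z_def)
  have zO: "z \<in> Om" "z \<in> carrier G" "z \<noteq> \<one>" using x z by auto
  show ?thesis
  proof (rule has_inverted_index2I'[OF x])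
    show "cm m y = sq m" if m: "m \<in> carrier G" "cm m x = \<one>" for m
    proof (cases "cm m y = \<one>")
      case True
      have "cm (m \<otimes> x) y \<noteq> \<one>" using cm_mult_left[of m x y] m x True by simp
      then have "sq (m \<otimes> x) = z" using eq[of "m \<otimes> x" y] m x z by simp
      then have "sq m \<otimes> z = z" using m x by (simp add: sq_mult z_def)
      then show ?thesis using True m zO by simp
    qed (use e m x in auto)
    show "cm g x = cm y x" if g: "g \<in> carrier G" "cm g x \<noteq> \<one>" for g
      using e[of g x] eq[of g x] g x z by (simp add: z_def)
  qed
qed

text \<open>Boolean exponents, because modulo the involutions the group is a vector space over the
  field with two elements and these exponents are coordinates.\<close>

definition pw :: "bool \<Rightarrow> 'a \<Rightarrow> 'a" where "pw b x = (if b then x else \<one>)"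

lemma pw_closed [simp]: "x \<in> carrier G \<Longrightarrow> pw b x \<in> carrier G"
  by (simp add: pw_def)

lemma pw_simps [simp]: "pw False x = \<one>" "pw True x = x"
  by (simp_all add: pw_def)

text \<open>Multiplying \<open>g\<close> or \<open>h\<close> by \<open>c\<close> leaves their
  commutator unchanged and multiplies the square by \<open>w\<close>. \<open>cm_cases\<close> must
  hold in all four resulting versions at once.\<close>

lemma central_square_classes:
  assumes c: "c \<in> carrier G" "\<And>x. x \<in> carrier G \<Longrightarrow> cm c x = \<one>" "sq c = w" "w \<noteq> \<one>"
    and gh: "g \<in> carrier G" "h \<in> carrier G" "cm g h \<noteq> \<one>"
  shows "sq g = cm g h \<or> sq g = cm g h \<otimes> w"
proof -
  define B a b where "B = cm g h" "a = sq g" "b = sq h"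
  note defs = this
  have O: "B \<in> Om" "a \<in> Om" "b \<in> Om" "w \<in> Om" using c gh by (auto simp: defs)
  note C = this[THEN Om_closed]
  have m: "cm (g \<otimes> c) h = B" "cm g (h \<otimes> c) = B" "cm (g \<otimes> c) (h \<otimes> c) = B" "sq (g \<otimes> c) = a \<otimes> w" "sq (h \<otimes> c) = b \<otimes> w"
    using c gh cm_sym[of g c] cm_sym[of h c] cm_self[of c] by (auto simp: cm_mult_left cm_mult_right sq_mult defs)
  have 1: "B = a \<or> B = b \<or> a = b" using cm_cases[OF gh(1,2)] gh by (auto simp: defs)
  have 2: "B = a \<otimes> w \<or> B = b \<or> a \<otimes> w = b" using cm_cases[of "g \<otimes> c" h] gh c unfolding m by (auto simp: defs)
  have 3: "B = a \<or> B = b \<otimes> w \<or> a = b \<otimes> w" using cm_cases[of g "h \<otimes> c"] gh c unfolding m by (auto simp: defs)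
  have 4: "B = a \<otimes> w \<or> B = b \<otimes> w \<or> a \<otimes> w = b \<otimes> w" using cm_cases[of "g \<otimes> c" "h \<otimes> c"] gh c unfolding m by (auto simp: defs)
  have f: "a \<otimes> w \<noteq> a" "b \<otimes> w \<noteq> b" using C c by auto
  have f2: "(u \<otimes> w) \<otimes> w = u" if "u \<in> carrier G" for u using that O C by (simp add: m_assoc Om_sq)
  show ?thesis using 1 2 3 4 f f2[OF C(1)] f2[OF C(2)] f2[OF C(3)] unfolding defs[symmetric] by metis
qed

text \<open>A factor \<open>c\<close> corrects squares by \<open>w\<close>, so \<open>x\<close> and
  \<open>y\<close> can be chosen to generate a quaternion group. Commutators with them take only the
  values 1 and \<open>e\<close>; hence any \<open>g\<close> can be multiplied into their
  centralizer, where squares are 1 or \<open>w\<close> and a last factor \<open>c\<close> leads to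
  an involution.\<close>

lemma central_square_structure:
  assumes c: "c \<in> carrier G" "\<And>x. x \<in> carrier G \<Longrightarrow> cm c x = \<one>" "sq c = w" "w \<noteq> \<one>"
    and ab: "a \<in> carrier G" "b \<in> carrier G" "cm a b \<noteq> \<one>"
  obtains x y e where "x \<in> carrier G" "y \<in> carrier G" "sq x = e" "sq y = e" "cm x y = e" "e \<noteq> \<one>" "e \<noteq> w"
    "\<And>g. g \<in> carrier G \<Longrightarrow> \<exists>i j k. sq (g \<otimes> (pw i x \<otimes> (pw j y \<otimes> pw k c))) = \<one>"
proof -
  have cl: "sq g = cm g h \<or> sq g = cm g h \<otimes> w" if "g \<in> carrier G" "h \<in> carrier G" "cm g h \<noteq> \<one>" for g h
    using central_square_classes c that by blast
  define e where "e = cm a b"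
  have wO: "w \<in> Om" "w \<in> carrier G" using c by auto
  have norm: "\<exists>x. x \<in> carrier G \<and> sq x = cm g h \<and> cm x h = cm g h" if gh: "g \<in> carrier G" "h \<in> carrier G" "cm g h \<noteq> \<one>" for g h
    using cl[OF gh]
  proof
    assume "sq g = cm g h \<otimes> w"
    then have "sq (g \<otimes> c) = cm g h" using gh c wO cm_sym[of g c] by (simp add: sq_mult m_assoc Om_sq)
    then show ?thesis using cm_mult_left[of g c h] gh c by (intro exI[of _ "g \<otimes> c"]) simp
  qed (use gh in auto)
  obtain x where x: "x \<in> carrier G" "sq x = e" "cm x b = e" using norm[OF ab] by (auto simp: e_def)
  obtain y where y: "y \<in> carrier G" "sq y = e" "cm x y = e" using norm[of b x] x ab cm_sym[of b x] cm_sym[of _ x]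
    by (metis e_def)
  have eO: "e \<in> Om" "e \<in> carrier G" "e \<noteq> \<one>" using ab by (auto simp: e_def)
  have ew: "e \<noteq> w"
  proof
    assume "e = w"
    then have "sq (x \<otimes> c) = \<one>" using x c cm_sym[of x c] wO by (simp add: sq_mult Om_sq)
    then have "cm (x \<otimes> c) y = \<one>" using cm_Om_left[of "x \<otimes> c" y] sq_eq_one[of "x \<otimes> c"] x c y by simp
    then show False using cm_mult_left[of x c y] x y c eO by simp
  qed
  \<comment> \<open>Another value could only be \<open>ew\<close>. Then \<open>gv\<close> and
    \<open>u\<close> would have commutator \<open>w\<close>, and by \<open>cl\<close> the square
    \<open>e\<close> of \<open>u\<close> would be \<open>w\<close> or 1.\<close>
  have dich: "cm g u = \<one> \<or> cm g u = e" if u: "u \<in> carrier G" "sq u = e" "v \<in> carrier G" "cm v u = e" and g: "g \<in> carrier G" for g u v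
  proof (rule ccontr)
    assume n: "\<not> ?thesis"
    then have "e = cm g u \<or> e = cm g u \<otimes> w" using cl[of u g] u g cm_sym[of u g] by auto
    then have "cm g u = e \<otimes> w" using n u g wO by (metis Om_sq m_assoc r_one cm_closed)
    then have "cm (g \<otimes> v) u = w" using cm_mult_left[of g v u] u g eO wO by (simp add: Om_simps)
    then have "e = w \<or> e = w \<otimes> w" using cl[of u "g \<otimes> v"] u g c(4) cm_sym[of u "g \<otimes> v"] by auto
    then show False using ew eO wO Om_sq[of w] by auto
  qed
  show thesis
  proof (rule that[OF x(1) y(1) x(2) y(2) y(3) eO(3) ew])
    fix g assume g: "g \<in> carrier G"
    have yx: "cm y x = e" using y x cm_sym[of x y] by simp
    \<comment> \<open>Commutation with \<open>y\<close> detects the factor \<open>x\<close>, and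
      conversely.\<close>
    define i j where "i = (cm g y = e)" "j = (cm g x = e)"
    have gx: "cm g x = pw j e" using dich[OF x(1,2) y(1) yx g] by (auto simp: i_j_def pw_def)
    have gy: "cm g y = pw i e" using dich[OF y(1,2) x(1) y(3) g] by (auto simp: i_j_def pw_def)
    define u where "u = g \<otimes> (pw i x \<otimes> pw j y)"
    have u: "u \<in> carrier G" using g x y by (simp add: u_def)
    have "cm u x = \<one>" "cm u y = \<one>"
      unfolding u_def using g x y yx gx gy eO
      by (cases i; cases j; simp add: cm_mult_left cm_self Om_sq)+
    then have "cm (u \<otimes> x) y = e" and s: "sq (u \<otimes> x) = sq u \<otimes> e"
      using u x y eO by (simp_all add: cm_mult_left sq_mult)
    then have "sq u \<otimes> e = e \<or> sq u \<otimes> e = e \<otimes> w" using cl[of "u \<otimes> x" y] u x y eO by simp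
    then have "sq u = \<one> \<or> sq u = w" using u eO wO Om_comm2[of e w] r_cancel[of "sq u" e w] by auto
    then obtain k where k: "sq u = pw k w" by (metis pw_simps)
    have uc: "cm u c = \<one>" using cm_sym[of u c] u c by simp
    have "sq (u \<otimes> pw k c) = \<one>" using k uc u c wO by (cases k) (simp_all add: sq_mult Om_sq)
    then have "sq (g \<otimes> (pw i x \<otimes> (pw j y \<otimes> pw k c))) = \<one>" using g x y c by (simp add: u_def m_assoc)
    then show "\<exists>i j k. sq (g \<otimes> (pw i x \<otimes> (pw j y \<otimes> pw k c))) = \<one>" by blast
  qed
qed

end

section \<open>Pairs of quadratic forms over the field with two elements\<close>

locale quadratic_group = char2_exponent4_group +
  fixes s t
  assumes s: "s \<in> Om" "s \<noteq> \<one>" and t: "t \<in> Om" "t \<noteq> \<one>" and st: "s \<noteq> t"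
    and squares: "g \<in> carrier G \<Longrightarrow> sq g \<in> {\<one>, s, t, s \<otimes> t}"

text \<open>The third alternative is the one excluded by hypothesis. A central element with
  nontrivial square leads to \<open>central\<close>. Otherwise some noncommuting pair has different
  squares, and any square independent of these two would bring back the excluded subgroup.\<close>

theorem (in char2_exponent4_group) trichotomy:
  assumes "\<not> comm_group G" "\<not> has_inverted_index2_subgroup G"
  obtains (central) s t x y c where "quadratic_group G s t" "x \<in> carrier G" "y \<in> carrier G" "c \<in> carrier G"
      "sq x = s" "sq y = s" "sq c = t" "cm x y = s" "\<And>g. g \<in> carrier G \<Longrightarrow> cm c g = \<one>"
      "\<And>g. g \<in> carrier G \<Longrightarrow> \<exists>i j k. sq (g \<otimes> (pw i x \<otimes> (pw j y \<otimes> pw k c))) = \<one>"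
    | (nondegenerate) s t where "quadratic_group G s t"
      "\<And>c. c \<in> carrier G \<Longrightarrow> (\<And>g. g \<in> carrier G \<Longrightarrow> cm c g = \<one>) \<Longrightarrow> sq c = \<one>"
proof -
  obtain a b where ab: "a \<in> carrier G" "b \<in> carrier G" "cm a b \<noteq> \<one>"
    using assms(1) group_comm_groupI commute_iff by metis
  show thesis
  proof (cases "\<exists>c \<in> carrier G. (\<forall>g \<in> carrier G. cm c g = \<one>) \<and> sq c \<noteq> \<one>")
    case True
    then obtain c where c: "c \<in> carrier G" "\<And>g. g \<in> carrier G \<Longrightarrow> cm c g = \<one>" "sq c \<noteq> \<one>" by blast
    obtain x y e where xy: "x \<in> carrier G" "y \<in> carrier G" "sq x = e" "sq y = e" "cm x y = e" "e \<noteq> \<one>" "e \<noteq> sq c"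
      and span: "\<And>g. g \<in> carrier G \<Longrightarrow> \<exists>i j k. sq (g \<otimes> (pw i x \<otimes> (pw j y \<otimes> pw k c))) = \<one>"
      using central_square_structure[OF c(1,2) _ c(3) ab] by blast
    have O: "e \<in> Om" "sq c \<in> Om" using xy c by auto
    note C = O[THEN Om_closed]
    have "quadratic_group G e (sq c)"
    proof
      fix g assume g: "g \<in> carrier G"
      obtain i j k where ijk: "sq (g \<otimes> (pw i x \<otimes> (pw j y \<otimes> pw k c))) = \<one>" using span[OF g] by blast
      define u where "u = pw i x \<otimes> (pw j y \<otimes> pw k c)"
      have u: "u \<in> carrier G" using xy c by (simp add: u_def)
      \<comment> \<open>As \<open>gu\<close> is central, \<open>g\<close> commutes with
        \<open>u\<close>, and so both have the same square.\<close>
      have "g \<otimes> u \<in> Om" using ijk sq_eq_one[of "g \<otimes> u"] g u by (simp add: u_def)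
      then have "cm (g \<otimes> u) u = \<one>" using cm_Om_left u by simp
      then have "cm g u = \<one>" using cm_mult_left[of g u u] cm_self[of u] g u by simp
      then have "sq g \<otimes> sq u = \<one>" using ijk sq_mult[of g u] g u by (simp add: u_def)
      then have "sq g = sq u" using Om_eq[of "sq g" "sq u"] g u by simp
      moreover have "cm x c = \<one>" "cm y c = \<one>" using c xy cm_sym by metis+
      then have "sq u \<in> {\<one>, e, sq c, e \<otimes> sq c}"
        unfolding u_def using xy(1-5) c O C sq_eq_one[of \<one>]
        by (cases i; cases j; cases k) (simp_all add: sq_mult cm_mult_right Om_sq Om_sq2 Om_comm2)
      ultimately show "sq g \<in> {\<one>, e, sq c, e \<otimes> sq c}" by simp
    qed (use xy c O in auto)
    then show thesis using central[of e "sq c" x y c] xy c span by blast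
  next
    case False
    then have nd: "\<And>c. c \<in> carrier G \<Longrightarrow> (\<And>g. g \<in> carrier G \<Longrightarrow> cm c g = \<one>) \<Longrightarrow> sq c = \<one>" by blast
    obtain g h where gh: "g \<in> carrier G" "h \<in> carrier G" "cm g h \<noteq> \<one>" "sq g \<noteq> sq h"
      using inverted_if_equal_squares[OF ab] assms(2) by blast
    have "\<exists>g h. g \<in> carrier G \<and> h \<in> carrier G \<and> cm g h = sq g \<and> sq g \<noteq> \<one> \<and> sq g \<noteq> sq h \<and> sq h \<noteq> \<one>"
    proof -
      have "sq g \<noteq> \<one>" "sq h \<noteq> \<one>" using gh cm_Om_left[of g h] cm_Om_left[of h g] cm_sym[of g h] sq_eq_one[of g] sq_eq_one[of h] by auto
      then show ?thesis using gh cm_cases[of g h] cm_sym[of g h] by metis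
    qed
    then obtain g h where gh: "g \<in> carrier G" "h \<in> carrier G" "cm g h = sq g" "sq g \<noteq> \<one>" "sq g \<noteq> sq h" "sq h \<noteq> \<one>" by blast
    have "quadratic_group G (sq g) (sq h)"
    proof
      fix k assume "k \<in> carrier G"
      then show "sq k \<in> {\<one>, sq g, sq h, sq g \<otimes> sq h}"
        using inverted_if_three_squares[OF gh(1-5), of k] assms(2) by blast
    qed (use gh in auto)
    then show thesis using nondegenerate nd by blast
  qed
qed

context quadratic_group
begin

text \<open>
  \<open>q1\<close> and \<open>q2\<close> are the coordinates of \<open>sq\<close>, and \<open>B1\<close> and \<open>B2\<close> those of \<open>cm\<close>, with respect to the
  basis \<open>s\<close>, \<open>t\<close>. Inequality of booleans is addition in the field with two elements.
\<close>

definition S :: "bool \<Rightarrow> bool \<Rightarrow> 'a" where "S a b = pw a s \<otimes> pw b t"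
definition q1 :: "'a \<Rightarrow> bool" where "q1 g \<longleftrightarrow> sq g = s \<or> sq g = s \<otimes> t"
definition q2 :: "'a \<Rightarrow> bool" where "q2 g \<longleftrightarrow> sq g = t \<or> sq g = s \<otimes> t"
definition B1 :: "'a \<Rightarrow> 'a \<Rightarrow> bool" where "B1 g h \<longleftrightarrow> (q1 (g \<otimes> h) \<noteq> (q1 g \<noteq> q1 h))"
definition B2 :: "'a \<Rightarrow> 'a \<Rightarrow> bool" where "B2 g h \<longleftrightarrow> (q2 (g \<otimes> h) \<noteq> (q2 g \<noteq> q2 h))"

lemma st_closed [simp]: "s \<in> carrier G" "t \<in> carrier G"
  using s t Om_closed by auto

lemma st_distinct: "s \<otimes> t \<noteq> \<one>" "s \<otimes> t \<noteq> s" "s \<otimes> t \<noteq> t"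
  using Om_eq[of s t] s t st by auto

lemma S_closed [simp]: "S a b \<in> carrier G"
  by (simp add: S_def)

lemma S_Om [simp]: "S a b \<in> Om"
  using s t by (cases a; cases b) (simp_all add: S_def)

lemma S_simps: "S False False = \<one>" "S True False = s" "S False True = t" "S True True = s \<otimes> t"
  by (simp_all add: S_def)

lemma S_mult: "S a b \<otimes> S c d = S (a \<noteq> c) (b \<noteq> d)"
  using s t by (cases a; cases b; cases c; cases d) (simp_all add: S_simps Om_simps)

lemma S_inj: "S a b = S c d \<longleftrightarrow> a = c \<and> b = d"
proof -
  note d = s(2) t(2) st st_distinct
  show ?thesis
    by (cases a; cases b; cases c; cases d)
      (simp_all only: S_simps d d[symmetric] simp_thms)
qed

lemma sq_S: "g \<in> carrier G \<Longrightarrow> sq g = S (q1 g) (q2 g)"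
proof -
  note d = s(2) t(2) st st_distinct
  assume "g \<in> carrier G"
  then consider "sq g = \<one>" | "sq g = s" | "sq g = t" | "sq g = s \<otimes> t" using squares[of g] by blast
  then show ?thesis by cases (simp_all only: q1_def q2_def S_simps d d[symmetric] simp_thms)
qed

lemma cm_S: "g \<in> carrier G \<Longrightarrow> h \<in> carrier G \<Longrightarrow> cm g h = S (B1 g h) (B2 g h)"
  by (simp add: cm_def sq_S S_mult S_inj B1_def B2_def)

lemma q_mult: "q1 (g \<otimes> h) \<longleftrightarrow> (q1 g \<noteq> (q1 h \<noteq> B1 g h))" "q2 (g \<otimes> h) \<longleftrightarrow> (q2 g \<noteq> (q2 h \<noteq> B2 g h))"
  by (auto simp: B1_def B2_def)

lemma B_mult:
  assumes "g \<in> carrier G" "h \<in> carrier G" "k \<in> carrier G"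
  shows "B1 (g \<otimes> k) h \<longleftrightarrow> B1 g h \<noteq> B1 k h" "B2 (g \<otimes> k) h \<longleftrightarrow> B2 g h \<noteq> B2 k h"
    "B1 h (g \<otimes> k) \<longleftrightarrow> B1 h g \<noteq> B1 h k" "B2 h (g \<otimes> k) \<longleftrightarrow> B2 h g \<noteq> B2 h k"
  using cm_mult_left[of g k h] cm_mult_right[of g k h] assms by (simp_all add: cm_S S_mult S_inj)

lemma B_sym: "g \<in> carrier G \<Longrightarrow> h \<in> carrier G \<Longrightarrow> B1 g h = B1 h g" "g \<in> carrier G \<Longrightarrow> h \<in> carrier G \<Longrightarrow> B2 g h = B2 h g"
  using cm_sym[of g h] by (simp_all add: cm_S S_inj)

lemma B_self: "g \<in> carrier G \<Longrightarrow> \<not> B1 g g" "g \<in> carrier G \<Longrightarrow> \<not> B2 g g"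
  using cm_self[of g] S_inj[of "B1 g g" "B2 g g" False False] by (simp_all add: cm_S S_simps)

lemma q_one: "\<not> q1 \<one>" "\<not> q2 \<one>"
  using s t st_distinct sq_eq_one[of \<one>] by (auto simp: q1_def q2_def)

lemma sq_one_iff: "g \<in> carrier G \<Longrightarrow> sq g = \<one> \<longleftrightarrow> \<not> q1 g \<and> \<not> q2 g"
  using S_inj[of "q1 g" "q2 g" False False] by (simp add: sq_S S_simps)

lemma cm_one_iff: "g \<in> carrier G \<Longrightarrow> h \<in> carrier G \<Longrightarrow> cm g h = \<one> \<longleftrightarrow> \<not> B1 g h \<and> \<not> B2 g h"
  using S_inj[of "B1 g h" "B2 g h" False False] by (simp add: cm_S S_simps)

text \<open>A common zero of the two forms is an involution, hence central. Read backwards, a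
  nonzero commutator forces a nonzero square; this is the source of almost all exclusions
  below.\<close>

lemma anisotropic:
  assumes "g \<in> carrier G" "h \<in> carrier G" "\<not> q1 g" "\<not> q2 g"
  shows "\<not> B1 g h" "\<not> B2 g h" "\<not> B1 h g" "\<not> B2 h g"
  using cm_Om_left[of g h] sq_eq_one[of g] sq_one_iff[of g] cm_one_iff[of g h] B_sym[of g h] assms by auto

lemma B_one: "g \<in> carrier G \<Longrightarrow> \<not> B1 g \<one>" "g \<in> carrier G \<Longrightarrow> \<not> B2 g \<one>"
  "g \<in> carrier G \<Longrightarrow> \<not> B1 \<one> g" "g \<in> carrier G \<Longrightarrow> \<not> B2 \<one> g"
  using anisotropic[of \<one> g] q_one by auto

lemma q_pw: "q1 (pw b x) \<longleftrightarrow> b \<and> q1 x" "q2 (pw b x) \<longleftrightarrow> b \<and> q2 x"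
  by (cases b; simp add: q_one)+

lemma B_pw:
  "x \<in> carrier G \<Longrightarrow> g \<in> carrier G \<Longrightarrow> B1 g (pw b x) \<longleftrightarrow> b \<and> B1 g x"
  "x \<in> carrier G \<Longrightarrow> g \<in> carrier G \<Longrightarrow> B2 g (pw b x) \<longleftrightarrow> b \<and> B2 g x"
  "x \<in> carrier G \<Longrightarrow> g \<in> carrier G \<Longrightarrow> B1 (pw b x) g \<longleftrightarrow> b \<and> B1 x g"
  "x \<in> carrier G \<Longrightarrow> g \<in> carrier G \<Longrightarrow> B2 (pw b x) g \<longleftrightarrow> b \<and> B2 x g"
  by (cases b; simp add: B_one)+

lemmas bool_simps = q_mult B_mult B_self q_pw B_pw

text \<open>Any two of the three nontrivial square values form a basis. This lets a distinguished
  value be taken as the first basis vector.\<close>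

lemma rebase:
  assumes "s' \<in> {s, t, s \<otimes> t}" "t' \<in> {s, t, s \<otimes> t}" "s' \<noteq> t'"
  shows "quadratic_group G s' t'"
proof
  have c: "t \<otimes> s = s \<otimes> t" "s \<otimes> (s \<otimes> t) = t" "t \<otimes> (s \<otimes> t) = s" "s \<otimes> t \<otimes> s = t" "s \<otimes> t \<otimes> t = s"
    using s t by (simp_all add: Om_simps)
  have "x \<in> Om \<and> x \<noteq> \<one>" if "x \<in> {s, t, s \<otimes> t}" for x
    using that s t st_distinct by (elim insertE emptyE) simp_all
  then show "s' \<in> Om" "t' \<in> Om" "s' \<noteq> \<one>" "t' \<noteq> \<one>" "s' \<noteq> t'"
    using assms by blast+
  have "(s' = s \<and> t' = t) \<or> (s' = s \<and> t' = s \<otimes> t) \<or> (s' = t \<and> t' = s) \<or> (s' = t \<and> t' = s \<otimes> t)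
      \<or> (s' = s \<otimes> t \<and> t' = s) \<or> (s' = s \<otimes> t \<and> t' = t)"
    using assms by blast
  then have "{\<one>, s', t', s' \<otimes> t'} = {\<one>, s, t, s \<otimes> t}" by (elim disjE conjE) (simp_all only: c insert_commute)
  then show "sq g \<in> {\<one>, s', t', s' \<otimes> t'}" if "g \<in> carrier G" for g
    using squares[OF that] by simp
qed

text \<open>Generation modulo the involutions. Multiplying \<open>g\<close> by the product amounts
  to dividing by it there. A factor may be \<open>\<one>\<close>, so the same notion serves for
  spaces of dimension 3.\<close>

definition spans :: "'a \<Rightarrow> 'a \<Rightarrow> 'a \<Rightarrow> 'a \<Rightarrow> bool" where
  "spans a b c d \<longleftrightarrow> (\<forall>g\<in>carrier G. \<exists>i j k l. sq (g \<otimes> (pw i a \<otimes> (pw j b \<otimes> (pw k c \<otimes> pw l d)))) = \<one>)"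

lemma spansI:
  assumes "a \<in> carrier G" "b \<in> carrier G" "c \<in> carrier G" "d \<in> carrier G"
    "\<And>g. g \<in> carrier G \<Longrightarrow> \<exists>i j k l. \<not> q1 (g \<otimes> (pw i a \<otimes> (pw j b \<otimes> (pw k c \<otimes> pw l d)))) \<and>
      \<not> q2 (g \<otimes> (pw i a \<otimes> (pw j b \<otimes> (pw k c \<otimes> pw l d))))"
  shows "spans a b c d"
  unfolding spans_def using assms by (simp add: sq_one_iff)

lemma spansE:
  assumes "spans a b c d" "a \<in> carrier G" "b \<in> carrier G" "c \<in> carrier G" "d \<in> carrier G" "g \<in> carrier G"
  obtains i j k l where "\<not> q1 (g \<otimes> (pw i a \<otimes> (pw j b \<otimes> (pw k c \<otimes> pw l d))))"
    "\<not> q2 (g \<otimes> (pw i a \<otimes> (pw j b \<otimes> (pw k c \<otimes> pw l d))))"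
  using assms unfolding spans_def by (metis sq_one_iff m_closed pw_closed)

text \<open>Together with \<open>spans_rotate\<close> and \<open>spans_shift\<close>, this supplies
  the changes of basis that normalize two orthogonal planes.\<close>

lemma spans_swap:
  assumes "spans a b c d" and G: "a \<in> carrier G" "b \<in> carrier G" "c \<in> carrier G" "d \<in> carrier G"
  shows "spans b a c d"
proof (rule spansI)
  fix g assume g: "g \<in> carrier G"
  obtain i j k l where "\<not> q1 (g \<otimes> (pw i a \<otimes> (pw j b \<otimes> (pw k c \<otimes> pw l d))))"
    "\<not> q2 (g \<otimes> (pw i a \<otimes> (pw j b \<otimes> (pw k c \<otimes> pw l d))))" by (rule spansE[OF assms g])
  then have "\<not> q1 (g \<otimes> (pw j b \<otimes> (pw i a \<otimes> (pw k c \<otimes> pw l d))))" "\<not> q2 (g \<otimes> (pw j b \<otimes> (pw i a \<otimes> (pw k c \<otimes> pw l d))))"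
    using g G B_sym[of a b] by (simp add: bool_simps; argo)+
  then show "\<exists>i j k l. \<not> q1 (g \<otimes> (pw i b \<otimes> (pw j a \<otimes> (pw k c \<otimes> pw l d)))) \<and> \<not> q2 (g \<otimes> (pw i b \<otimes> (pw j a \<otimes> (pw k c \<otimes> pw l d))))"
    by blast
qed (use G in auto)

lemma spans_rotate:
  assumes "spans a b c d" and G: "a \<in> carrier G" "b \<in> carrier G" "c \<in> carrier G" "d \<in> carrier G"
  shows "spans c d a b"
proof (rule spansI)
  fix g assume g: "g \<in> carrier G"
  obtain i j k l where "\<not> q1 (g \<otimes> (pw i a \<otimes> (pw j b \<otimes> (pw k c \<otimes> pw l d))))"
    "\<not> q2 (g \<otimes> (pw i a \<otimes> (pw j b \<otimes> (pw k c \<otimes> pw l d))))" by (rule spansE[OF assms g])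
  then have "\<not> q1 (g \<otimes> (pw k c \<otimes> (pw l d \<otimes> (pw i a \<otimes> pw j b))))" "\<not> q2 (g \<otimes> (pw k c \<otimes> (pw l d \<otimes> (pw i a \<otimes> pw j b))))"
    using g G B_sym[of a c] B_sym[of a d] B_sym[of b c] B_sym[of b d]
    by (cases i; cases j; cases k; cases l; simp add: bool_simps q_one B_one; argo)+
  then show "\<exists>i j k l. \<not> q1 (g \<otimes> (pw i c \<otimes> (pw j d \<otimes> (pw k a \<otimes> pw l b)))) \<and> \<not> q2 (g \<otimes> (pw i c \<otimes> (pw j d \<otimes> (pw k a \<otimes> pw l b))))"
    by blast
qed (use G in auto)

lemma spans_shift:
  assumes "spans a b c d" and G: "a \<in> carrier G" "b \<in> carrier G" "c \<in> carrier G" "d \<in> carrier G"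
  shows "spans (a \<otimes> b) b c d"
proof (rule spansI)
  fix g assume g: "g \<in> carrier G"
  obtain i j k l where "\<not> q1 (g \<otimes> (pw i a \<otimes> (pw j b \<otimes> (pw k c \<otimes> pw l d))))"
    "\<not> q2 (g \<otimes> (pw i a \<otimes> (pw j b \<otimes> (pw k c \<otimes> pw l d))))" by (rule spansE[OF assms g])
  then have "\<not> q1 (g \<otimes> (pw i (a \<otimes> b) \<otimes> (pw (i \<noteq> j) b \<otimes> (pw k c \<otimes> pw l d))))"
      "\<not> q2 (g \<otimes> (pw i (a \<otimes> b) \<otimes> (pw (i \<noteq> j) b \<otimes> (pw k c \<otimes> pw l d))))"
    using g G B_sym[of a b] by (cases i; cases j; simp add: bool_simps; argo)+
  then show "\<exists>i j k l. \<not> q1 (g \<otimes> (pw i (a \<otimes> b) \<otimes> (pw j b \<otimes> (pw k c \<otimes> pw l d)))) \<and> \<not> q2 (g \<otimes> (pw i (a \<otimes> b) \<otimes> (pw j b \<otimes> (pw k c \<otimes> pw l d))))"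
    by blast
qed (use G in auto)

lemma inverted_boolI:
  assumes G: "k \<in> carrier G" "b \<in> carrier G" and ne: "B1 k b \<or> B2 k b"
    and inv: "\<And>m. m \<in> carrier G \<Longrightarrow> \<not> B1 m k \<Longrightarrow> \<not> B2 m k \<Longrightarrow> B1 m b = q1 m \<and> B2 m b = q2 m"
    and co: "\<And>g. g \<in> carrier G \<Longrightarrow> B1 g k \<or> B2 g k \<Longrightarrow> B1 g k = B1 b k \<and> B2 g k = B2 b k"
  shows "has_inverted_index2_subgroup G"
proof (rule has_inverted_index2I'[OF G])
  show "cm k b \<noteq> \<one>" using ne G by (simp add: cm_one_iff)
  show "cm m b = sq m" if "m \<in> carrier G" "cm m k = \<one>" for m
  proof -
    have "B1 m b = q1 m \<and> B2 m b = q2 m" using inv[OF that(1)] that G by (simp add: cm_one_iff)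
    then show ?thesis using that G by (simp add: cm_S sq_S)
  qed
  show "cm g k = cm b k" if "g \<in> carrier G" "cm g k \<noteq> \<one>" for g
  proof -
    have "B1 g k = B1 b k \<and> B2 g k = B2 b k" using co[OF that(1)] that G by (simp add: cm_one_iff)
    then show ?thesis using that G by (simp add: cm_S)
  qed
qed

section \<open>A vector whose commutators take only one nontrivial value\<close>

text \<open>The centralizer of \<open>r\<close> consists of involutions and their multiples by
  \<open>r\<close>. If \<open>r\<close> has square \<open>s\<close>, it is inverted by
  \<open>x\<close>. If some \<open>y\<close> outside it has square \<open>s\<close>, then
  \<open>r\<close> inverts the centralizer of \<open>y\<close>. One of \<open>r\<close>,
  \<open>x\<close>, \<open>rx\<close> has square \<open>s\<close>, since otherwise \<open>rx\<close>
  would be an involution not commuting with \<open>r\<close>.\<close>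

lemma inverted_if_plane:
  assumes G: "r \<in> carrier G" "x \<in> carrier G" and r: "\<And>g. g \<in> carrier G \<Longrightarrow> \<not> B2 r g" and rx: "B1 r x"
    and plane: "\<And>m. m \<in> carrier G \<Longrightarrow> \<not> B1 r m \<Longrightarrow> q1 m \<or> q2 m \<Longrightarrow> q1 m = q1 r \<and> q2 m = q2 r"
  shows "has_inverted_index2_subgroup G"
proof -
  \<comment> \<open>Here \<open>m\<close> and \<open>r\<close> commute and have the same square, so
    \<open>mr\<close> is an involution; being central, it does not affect commutators.\<close>
  have M: "(B1 m g \<longleftrightarrow> B1 r g) \<and> (B2 m g \<longleftrightarrow> B2 r g)"
    if m: "m \<in> carrier G" "\<not> B1 r m" "q1 m \<or> q2 m" and g: "g \<in> carrier G" for m g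
    using plane[OF m] anisotropic[of "m \<otimes> r" g] m g G r[of m] B_sym[of m r] by (auto simp: bool_simps)
  have x: "has_inverted_index2_subgroup G" if y: "y \<in> carrier G" "B1 r y" "q1 y" "\<not> q2 y" for y
  proof (rule inverted_boolI[OF y(1) G(1)])
    have yr: "B1 y r" "\<not> B2 y r" "B1 r y" "\<not> B2 r y" using y r[of y] B_sym[of y r] G by auto
    show "B1 y r \<or> B2 y r" using yr by simp
    fix m assume m: "m \<in> carrier G"
    have my: "m \<otimes> y \<in> carrier G" using m y by simp
    have sym: "B1 m r = B1 r m" "B2 m r = B2 r m" "\<not> B2 r m" using B_sym[of m r] m G r by auto
    {
      assume c: "\<not> B1 m y" "\<not> B2 m y"
      show "B1 m r = q1 m \<and> B2 m r = q2 m"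
      proof (cases "B1 r m")
        case True
        then have "\<not> B1 r (m \<otimes> y)" using m y G by (simp add: bool_simps)
        moreover have "\<not> B1 (m \<otimes> y) y" using m y c by (simp add: bool_simps)
        ultimately have "\<not> q1 (m \<otimes> y)" "\<not> q2 (m \<otimes> y)" using M[OF my _ _ y(1)] yr by auto
        then show ?thesis using True sym c y by (auto simp: bool_simps)
      next
        case False
        then have "\<not> q1 m" "\<not> q2 m" using M[OF m _ _ y(1)] yr c by auto
        then show ?thesis using False sym by auto
      qed
    }
    assume c: "B1 m y \<or> B2 m y"
    show "B1 m y = B1 r y \<and> B2 m y = B2 r y"
    proof (cases "B1 r m")
      case True
      then have 1: "\<not> B1 r (m \<otimes> y)" using m y G by (simp add: bool_simps)
      have 2: "B1 (m \<otimes> y) y = B1 m y" "B2 (m \<otimes> y) y = B2 m y" using m y by (auto simp: bool_simps)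
      then have "q1 (m \<otimes> y) \<or> q2 (m \<otimes> y)" using anisotropic[of "m \<otimes> y" y] my y c by blast
      then show ?thesis using M[OF my 1 _ y(1)] 2 by auto
    next
      case False
      have "q1 m \<or> q2 m" using anisotropic[of m y] m y c by blast
      then show ?thesis using M[OF m False _ y(1)] by auto
    qed
  qed
  have rx': "B1 x r" "\<not> B2 r x" "\<not> B2 x r" using rx r[of x] B_sym[of x r] G by auto
  have nz: "q1 r \<or> q2 r" "q1 x \<or> q2 x" using anisotropic[of r x] anisotropic[of x r] G rx rx' by auto
  consider "q1 r" "\<not> q2 r" | "q1 x" "\<not> q2 x" | "q1 (r \<otimes> x)" "\<not> q2 (r \<otimes> x)"
    | "\<not> q1 (r \<otimes> x)" "\<not> q2 (r \<otimes> x)"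
    using nz rx rx' by (auto simp: bool_simps)
  then show ?thesis
  proof cases
    case 1
    show ?thesis
    proof (rule inverted_boolI[OF G])
      show "B1 r x \<or> B2 r x" using rx by simp
      fix m assume m: "m \<in> carrier G"
      have sym: "B1 m r = B1 r m" "B2 m r = B2 r m" "\<not> B2 r m" using B_sym[of m r] m G r by auto
      show "B1 m x = q1 m \<and> B2 m x = q2 m" if "\<not> B1 m r" "\<not> B2 m r"
      proof (cases "q1 m \<or> q2 m")
        case True
        then show ?thesis using M[OF m _ True G(2)] plane[OF m _ True] that sym rx rx' 1 by auto
      next
        case False
        then show ?thesis using anisotropic[of m x] m G by auto
      qed
      show "B1 m r = B1 x r \<and> B2 m r = B2 x r" if "B1 m r \<or> B2 m r" using that sym rx' by auto
    qed
  next
    case 2 then show ?thesis using x[of x] G rx by blast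
  next
    case 3 then show ?thesis using x[of "r \<otimes> x"] G rx by (simp add: bool_simps)
  next
    case 4
    have "B1 (r \<otimes> x) r" using G rx' by (simp add: bool_simps)
    then show ?thesis using anisotropic[of "r \<otimes> x" r] G 4 by simp
  qed
qed

text \<open>Squares and commutators are considered modulo \<open>sq r\<close>. If \<open>a\<close>
  and \<open>b\<close> commute with \<open>r\<close> but not with each other, then \<open>a\<close>,
  \<open>b\<close> and \<open>ab\<close> have squares outside \<open>{1, sq r}\<close>, because
  neither they nor their products with \<open>r\<close> are involutions. Comparing the three squares
  puts the commutator outside as well. On the centralizer of \<open>r\<close> it is thus detected by
  a single bit, for which \<open>u\<close> and \<open>v\<close> form a hyperbolic pair.\<close>

lemma centralizer_structure:
  assumes G: "r \<in> carrier G" "u \<in> carrier G" "v \<in> carrier G" and r: "q1 r \<or> q2 r"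
    and ru: "\<not> B1 r u" "\<not> B2 r u" "\<not> B1 r v" "\<not> B2 r v" and uv: "B1 u v \<or> B2 u v"
  shows "B1 u v \<noteq> q1 r \<or> B2 u v \<noteq> q2 r" "q1 u \<or> q2 u" "q1 u \<noteq> q1 r \<or> q2 u \<noteq> q2 r"
    "m \<in> carrier G \<Longrightarrow> \<not> B1 r m \<Longrightarrow> \<not> B2 r m \<Longrightarrow>
      \<exists>i j k. \<not> q1 (m \<otimes> (pw i u \<otimes> (pw j v \<otimes> pw k r))) \<and> \<not> q2 (m \<otimes> (pw i u \<otimes> (pw j v \<otimes> pw k r)))"
proof -
  have C0: "(q1 a \<or> q2 a) \<and> (q1 a \<noteq> q1 r \<or> q2 a \<noteq> q2 r)" if a: "a \<in> carrier G" "\<not> B1 r a" "\<not> B2 r a"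
    and b: "b \<in> carrier G" "\<not> B1 r b" "\<not> B2 r b" and ab: "B1 a b \<or> B2 a b" for a b
    using anisotropic[of a b] anisotropic[of "a \<otimes> r" b] a b ab G B_sym[of a r] by (auto simp: bool_simps)
  have C1: "B1 a b \<noteq> q1 r \<or> B2 a b \<noteq> q2 r" if a: "a \<in> carrier G" "\<not> B1 r a" "\<not> B2 r a"
    and b: "b \<in> carrier G" "\<not> B1 r b" "\<not> B2 r b" and ab: "B1 a b \<or> B2 a b" for a b
  proof -
    have "B1 b a \<or> B2 b a" using ab a b B_sym by blast
    moreover have "B1 (a \<otimes> b) b \<or> B2 (a \<otimes> b) b" using ab a b by (simp add: bool_simps)
    moreover have "\<not> B1 r (a \<otimes> b)" "\<not> B2 r (a \<otimes> b)" using a b G by (simp_all add: bool_simps)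
    ultimately show ?thesis using C0[OF a b ab] C0[OF b a] C0[of "a \<otimes> b" b] a b r by (auto simp: bool_simps)
  qed
  show "B1 u v \<noteq> q1 r \<or> B2 u v \<noteq> q2 r" using C1 G ru uv by blast
  show "q1 u \<or> q2 u" "q1 u \<noteq> q1 r \<or> q2 u \<noteq> q2 r" using C0[of u v] G ru uv by blast+
  assume m: "m \<in> carrier G" "\<not> B1 r m" "\<not> B2 r m"
  \<comment> \<open>The nonzero linear functional on pairs of bits that vanishes on the square of
    \<open>r\<close>.\<close>
  define L where "L a b \<longleftrightarrow> (a \<or> b) \<and> (a \<noteq> q1 r \<or> b \<noteq> q2 r)" for a b
  define i j where "i = L (B1 m v) (B2 m v)" and "j = L (B1 m u) (B2 m u)"
  define n where "n = m \<otimes> (pw i u \<otimes> pw j v)"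
  have n: "n \<in> carrier G" "\<not> B1 r n" "\<not> B2 r n" using m G ru by (simp_all add: n_def bool_simps)
  have Luv: "L (B1 u v) (B2 u v)" using C1[of u v] G ru uv by (simp add: L_def)
  have sym: "B1 v u = B1 u v" "B2 v u = B2 u v" using B_sym[of u v] G by auto
  have "B1 n u = (B1 m u \<noteq> (j \<and> B1 u v))" "B2 n u = (B2 m u \<noteq> (j \<and> B2 u v))"
    "B1 n v = (B1 m v \<noteq> (i \<and> B1 u v))" "B2 n v = (B2 m v \<noteq> (i \<and> B2 u v))"
    using m G sym by (auto simp: n_def bool_simps)
  then have "\<not> L (B1 n u) (B2 n u)" "\<not> L (B1 n v) (B2 n v)"
    using Luv r unfolding i_def j_def L_def by argo+
  then have nu: "\<not> B1 n u" "\<not> B2 n u" "\<not> B1 n v" "\<not> B2 n v"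
    using C1[of n u] C1[of n v] n G ru by (auto simp: L_def)
  \<comment> \<open>Since \<open>nu\<close> does not commute with \<open>v\<close>, its square lies
    in the same coset of \<open>{1, sq r}\<close> as that of \<open>u\<close>; so the square of
    \<open>n\<close> is 1 or \<open>sq r\<close>.\<close>
  have "(q1 (n \<otimes> u) \<or> q2 (n \<otimes> u)) \<and> (q1 (n \<otimes> u) \<noteq> q1 r \<or> q2 (n \<otimes> u) \<noteq> q2 r)"
    using n G ru nu uv by (intro C0[of "n \<otimes> u" v]) (simp_all add: bool_simps)
  moreover have "(q1 u \<or> q2 u) \<and> (q1 u \<noteq> q1 r \<or> q2 u \<noteq> q2 r)" using C0[of u v] G ru uv by blast
  ultimately have d: "(\<not> q1 n \<and> \<not> q2 n) \<or> (q1 n = q1 r \<and> q2 n = q2 r)"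
    using nu r unfolding q_mult by argo
  have nr: "\<not> B1 n r" "\<not> B2 n r" using n B_sym[of n r] G by auto
  have "\<exists>k. \<not> q1 (n \<otimes> pw k r) \<and> \<not> q2 (n \<otimes> pw k r)"
    using d
  proof
    assume "\<not> q1 n \<and> \<not> q2 n"
    then show ?thesis using n by (intro exI[of _ False]) simp
  next
    assume "q1 n = q1 r \<and> q2 n = q2 r"
    then show ?thesis using nr by (intro exI[of _ True]) (simp add: q_mult)
  qed
  then show "\<exists>i j k. \<not> q1 (m \<otimes> (pw i u \<otimes> (pw j v \<otimes> pw k r))) \<and> \<not> q2 (m \<otimes> (pw i u \<otimes> (pw j v \<otimes> pw k r)))"
    using m G unfolding n_def by (auto simp: m_assoc)
qed

end

text \<open>Distinct nonzero vectors \<open>(a, b)\<close> and \<open>(c, d)\<close> over the field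
  with two elements form a basis of the plane.\<close>

lemma bool_solve:
  assumes "a \<or> b" "c \<or> d" "a \<noteq> c \<or> b \<noteq> d"
  shows "\<exists>j k. (e \<longleftrightarrow> ((j \<and> a) \<noteq> (k \<and> c))) \<and> (f \<longleftrightarrow> ((j \<and> b) \<noteq> (k \<and> d)))"
  using assms by (cases a; cases b; cases c; cases d; cases e; cases f) (auto simp: ex_bool_eq)

context quadratic_group
begin

text \<open>The group \<open>H32\<close> seen from an abelian subgroup: \<open>x\<close> acts on the
  commuting elements \<open>m\<close> and \<open>n\<close>, and \<open>x\<close>, \<open>xm\<close>,
  \<open>xn\<close> satisfy the defining relations.\<close>

lemma H32_from_triple:
  assumes G: "x \<in> carrier G" "m \<in> carrier G" "n \<in> carrier G"
    and c: "cm m n = \<one>" "cm m x = s'" "cm n x = t'" and q: "sq m = t'" "sq n = s'" "sq x = s'"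
    and sp: "spans x m n \<one>"
  shows "sq (x \<otimes> m) = t'" "sq (x \<otimes> n) = t'" "cm x (x \<otimes> m) = s'" "cm x (x \<otimes> n) = t'" "cm (x \<otimes> m) (x \<otimes> n) = s' \<otimes> t'"
    "spans x (x \<otimes> m) (x \<otimes> n) \<one>"
proof -
  have O: "s' \<in> Om" "t' \<in> Om" using G c by auto
  note C = O[THEN Om_closed]
  have c': "cm x m = s'" "cm x n = t'" using c cm_sym G by auto
  show "sq (x \<otimes> m) = t'" "sq (x \<otimes> n) = t'" "cm x (x \<otimes> m) = s'" "cm x (x \<otimes> n) = t'"
    using G c' q O C by (simp_all add: sq_mult cm_mult_right cm_self Om_simps)
  show "cm (x \<otimes> m) (x \<otimes> n) = s' \<otimes> t'"
    using G c' c O C by (simp add: cm_mult_right cm_mult_left cm_self Om_simps)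
  show "spans x (x \<otimes> m) (x \<otimes> n) \<one>"
  proof (rule spansI)
    fix g assume g: "g \<in> carrier G"
    obtain i j k l where "\<not> q1 (g \<otimes> (pw i x \<otimes> (pw j m \<otimes> (pw k n \<otimes> pw l \<one>))))"
      "\<not> q2 (g \<otimes> (pw i x \<otimes> (pw j m \<otimes> (pw k n \<otimes> pw l \<one>))))" by (rule spansE[OF sp _ _ _ _ g]) (use G in auto)
    then have "\<not> q1 (g \<otimes> (pw (i \<noteq> (j \<noteq> k)) x \<otimes> (pw j (x \<otimes> m) \<otimes> (pw k (x \<otimes> n) \<otimes> pw l \<one>)))) \<and>
      \<not> q2 (g \<otimes> (pw (i \<noteq> (j \<noteq> k)) x \<otimes> (pw j (x \<otimes> m) \<otimes> (pw k (x \<otimes> n) \<otimes> pw l \<one>))))"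
      using g G B_sym[of x m] B_sym[of x n] by (cases i; cases j; cases k; simp add: bool_simps q_one B_one; argo)
    then show "\<exists>i j k l. \<not> q1 (g \<otimes> (pw i x \<otimes> (pw j (x \<otimes> m) \<otimes> (pw k (x \<otimes> n) \<otimes> pw l \<one>)))) \<and>
      \<not> q2 (g \<otimes> (pw i x \<otimes> (pw j (x \<otimes> m) \<otimes> (pw k (x \<otimes> n) \<otimes> pw l \<one>))))" by blast
  qed (use G in auto)
qed

text \<open>The centralizer of \<open>r\<close> is abelian of index 2. On it, both the square and
  the commutator with \<open>x\<close> are linear and injective modulo involutions. No
  \<open>xm\<close> with \<open>m\<close> in it is an involution; hence the linear map taking the
  square of \<open>m\<close> to its commutator with \<open>x\<close> fixes a nonzero vector. If this
  map is the identity, then \<open>x\<close> inverts the centralizer. Otherwise it is one of three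
  transvections, and each gives \<open>H32\<close> in a suitable basis.\<close>

lemma H32_structure:
  assumes nd: "\<And>c. c \<in> carrier G \<Longrightarrow> (\<And>g. g \<in> carrier G \<Longrightarrow> cm c g = \<one>) \<Longrightarrow> sq c = \<one>"
    and G: "r \<in> carrier G" "x \<in> carrier G" and r: "\<And>g. g \<in> carrier G \<Longrightarrow> \<not> B2 r g" and rx: "B1 r x"
    and ab: "\<And>m n. m \<in> carrier G \<Longrightarrow> n \<in> carrier G \<Longrightarrow> \<not> B1 r m \<Longrightarrow> \<not> B1 r n \<Longrightarrow> \<not> B1 m n \<and> \<not> B2 m n"
    and ni: "\<not> has_inverted_index2_subgroup G"
  obtains s' t' x y u where "s' \<in> {s, t, s \<otimes> t}" "t' \<in> {s, t, s \<otimes> t}" "s' \<noteq> t'"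
    "x \<in> carrier G" "y \<in> carrier G" "u \<in> carrier G"
    "sq x = s'" "sq y = t'" "sq u = t'" "cm x y = s'" "cm x u = t'" "cm y u = s' \<otimes> t'" "spans x y u \<one>"
proof -
  note main = that
  \<comment> \<open>\<open>x\<close> and the centralizer of \<open>r\<close> generate the group, so
    \<open>w\<close> is central, and then \<open>nd\<close> applies.\<close>
  have central: "\<not> q1 w \<and> \<not> q2 w" if w: "w \<in> carrier G" "\<not> B1 r w" "\<not> B1 w x" "\<not> B2 w x" for w
  proof -
    have "cm w g = \<one>" if g: "g \<in> carrier G" for g
    proof (cases "B1 r g")
      case True
      then have "\<not> B1 w (g \<otimes> x) \<and> \<not> B2 w (g \<otimes> x)" using w g G rx by (intro ab) (simp_all add: bool_simps)
      then show ?thesis using w g G by (simp add: bool_simps cm_one_iff)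
    next
      case False then show ?thesis using ab[OF w(1) g w(2)] w g by (simp add: cm_one_iff)
    qed
    then show ?thesis using nd[OF w(1)] sq_one_iff[OF w(1)] by simp
  qed
  have qr: "q1 r \<or> q2 r" using anisotropic[of r x] G rx by auto
  have rr: "\<not> B1 r r" "\<not> B2 r r" "\<not> B2 r x" using G B_self[of r] r by auto
  have "\<exists>u \<in> carrier G. \<not> B1 r u \<and> (q1 u \<or> q2 u) \<and> (q1 u \<noteq> q1 r \<or> q2 u \<noteq> q2 r)"
    using inverted_if_plane[OF G r rx] ni by blast
  then obtain w where w: "w \<in> carrier G" "\<not> B1 r w" "q1 w \<or> q2 w" "q1 w \<noteq> q1 r \<or> q2 w \<noteq> q2 r" by blast
  have wr: "\<not> B1 w r" "\<not> B2 w r" using w G r[of w] B_sym[of w r] by auto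
  have 1: "B1 w x \<or> B2 w x" using central[OF w(1,2)] w(3) by blast
  have "q1 (w \<otimes> r) \<or> q2 (w \<otimes> r)" using w(4) wr by (auto simp: bool_simps)
  then have "B1 (w \<otimes> r) x \<or> B2 (w \<otimes> r) x" using central[of "w \<otimes> r"] w G rr by (auto simp: B_mult)
  then have w2: "B2 w x" using 1 w G rx rr by (auto simp: bool_simps)
  \<comment> \<open>As \<open>cm r x = s\<close>, a factor \<open>r\<close> removes the
    \<open>s\<close>-coordinate of \<open>cm w x\<close>. The two commutators with \<open>x\<close>
    are now the basis vectors \<open>s\<close> and \<open>t\<close>.\<close>
  define u where "u = w \<otimes> pw (B1 w x) r"
  have u: "u \<in> carrier G" "\<not> B1 r u" "\<not> B1 u x" "B2 u x"
    using w G rr rx w2 by (auto simp: u_def bool_simps)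
  have qu: "q1 u \<or> q2 u" "q1 u \<noteq> q1 r \<or> q2 u \<noteq> q2 r"
    using w(3,4) wr qr w G by (auto simp: u_def bool_simps)
  have span: "spans y m n \<one>" if y: "y \<in> carrier G" "B1 r y" and m: "m \<in> carrier G" "\<not> B1 r m" "q1 m \<or> q2 m"
    and n: "n \<in> carrier G" "\<not> B1 r n" "q1 n \<or> q2 n" and mn: "q1 m \<noteq> q1 n \<or> q2 m \<noteq> q2 n" for y m n
  proof (rule spansI)
    fix g assume g: "g \<in> carrier G"
    define h where "h = g \<otimes> pw (B1 r g) y"
    have h: "h \<in> carrier G" "\<not> B1 r h" using g y G by (auto simp: h_def bool_simps)
    obtain j k where "q1 h \<longleftrightarrow> ((j \<and> q1 m) \<noteq> (k \<and> q1 n))" "q2 h \<longleftrightarrow> ((j \<and> q2 m) \<noteq> (k \<and> q2 n))"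
      using bool_solve[OF m(3) n(3) mn, of "q1 h" "q2 h"] by blast
    then have "\<not> q1 (h \<otimes> (pw j m \<otimes> (pw k n \<otimes> pw False \<one>))) \<and> \<not> q2 (h \<otimes> (pw j m \<otimes> (pw k n \<otimes> pw False \<one>)))"
      using h m n ab[of h m] ab[of h n] ab[of m n] by (simp add: bool_simps)
    then show "\<exists>i j k l. \<not> q1 (g \<otimes> (pw i y \<otimes> (pw j m \<otimes> (pw k n \<otimes> pw l \<one>)))) \<and> \<not> q2 (g \<otimes> (pw i y \<otimes> (pw j m \<otimes> (pw k n \<otimes> pw l \<one>))))"
      unfolding h_def using g y m n by (metis m_assoc m_closed pw_closed one_closed)
  qed (use that in auto)
  have sym: "B1 x r" "\<not> B2 x r" "\<not> B1 x u" "B2 x u" "\<not> B1 r u" "\<not> B2 r u" "\<not> B1 u r" "\<not> B2 u r" "\<not> B2 r x"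
    using B_sym[of x r] B_sym[of x u] B_sym[of r u] u G r rx by auto
  have an: "q1 y \<or> q2 y" if "y \<in> carrier G" "B1 r y" for y using anisotropic[of y r] that G by auto
  \<comment> \<open>The elements \<open>x\<close>, \<open>xr\<close>, \<open>xu\<close> and
    \<open>xru\<close> do not commute with \<open>r\<close>, so all four have nontrivial
    squares.\<close>
  have a0: "q1 x \<or> q2 x" using an[of x] G rx by simp
  have a1: "q1 x \<noteq> (q1 r \<noteq> True) \<or> q2 x \<noteq> q2 r" using an[of "x \<otimes> r"] G rx u sym rr by (simp add: bool_simps)
  have a2: "q1 x \<noteq> q1 u \<or> q2 x \<noteq> (q2 u \<noteq> True)" using an[of "x \<otimes> u"] G rx u sym rr by (simp add: bool_simps)
  have a3: "q1 x \<noteq> ((q1 r \<noteq> q1 u) \<noteq> True) \<or> q2 x \<noteq> ((q2 r \<noteq> q2 u) \<noteq> True)"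
    using an[of "x \<otimes> (r \<otimes> u)"] G rx u sym rr by (simp add: bool_simps)
  have ur: "u \<otimes> r \<in> carrier G" "\<not> B1 r (u \<otimes> r)" "q1 (u \<otimes> r) = (q1 u \<noteq> q1 r)" "q2 (u \<otimes> r) = (q2 u \<noteq> q2 r)"
    "B1 (u \<otimes> r) x" "B2 (u \<otimes> r) x" "\<not> B1 u (u \<otimes> r)" "\<not> B2 u (u \<otimes> r)" "\<not> B1 r (u \<otimes> r)" "\<not> B2 r (u \<otimes> r)"
    using u G sym rr rx B_self[of u] by (auto simp: bool_simps)
  have fin: thesis if "y \<in> carrier G" "B1 r y" "m \<in> carrier G" "n \<in> carrier G" "\<not> B1 r m" "\<not> B1 r n"
    "q1 m \<or> q2 m" "q1 n \<or> q2 n" "q1 m \<noteq> q1 n \<or> q2 m \<noteq> q2 n"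
    "s' \<in> {s, t, s \<otimes> t}" "t' \<in> {s, t, s \<otimes> t}" "s' \<noteq> t'" "cm m y = s'" "cm n y = t'" "sq m = t'" "sq n = s'" "sq y = s'"
    for y m n s' t'
  proof -
    have "cm m n = \<one>" using ab[of m n] that by (simp add: cm_one_iff)
    note h = H32_from_triple[OF that(1) that(3,4) this that(13-17) span[OF that(1,2) that(3,5,7) that(4,6,8,9)]]
    show thesis using main[OF that(10-12,1) _ _ that(17) h] that by simp
  qed
  have st3: "s \<in> {s, t, s \<otimes> t}" "t \<in> {s, t, s \<otimes> t}" "s \<otimes> t \<in> {s, t, s \<otimes> t}" "s \<noteq> t" "t \<noteq> s \<otimes> t" "s \<noteq> s \<otimes> t"
    using st st_distinct by auto
  \<comment> \<open>The linear maps sending \<open>sq r\<close> to \<open>s\<close> and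
    \<open>sq u\<close> to \<open>t\<close> that have a nonzero fixed vector; the case names record
    which vector is fixed.\<close>
  consider (id) "q1 r" "\<not> q2 r" "\<not> q1 u" "q2 u" | (fs) "q1 r" "\<not> q2 r" "q1 u" "q2 u"
    | (fst) "\<not> q1 r" "q2 r" "q1 u" "\<not> q2 u" | (ft) "q1 r" "q2 r" "\<not> q1 u" "q2 u"
    using qr qu a0 a1 a2 a3 by argo
  then show thesis
  proof cases
    case id
    have "has_inverted_index2_subgroup G"
    proof (rule inverted_boolI[OF G])
      show "B1 r x \<or> B2 r x" using rx by simp
      fix m assume m: "m \<in> carrier G"
      have mr: "B1 m r = B1 r m" "B2 m r = B2 r m" "\<not> B2 r m" using B_sym[of m r] m G r by auto
      show "B1 m r = B1 x r \<and> B2 m r = B2 x r" if "B1 m r \<or> B2 m r" using that mr sym by auto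
      show "B1 m x = q1 m \<and> B2 m x = q2 m" if "\<not> B1 m r" "\<not> B2 m r"
      proof -
        have mu: "\<not> B1 m u" "\<not> B2 m u" using ab[of m u] m u that mr by auto
        define h where "h = m \<otimes> (pw (q1 m) r \<otimes> pw (q2 m) u)"
        have h: "h \<in> carrier G" "\<not> q1 h" "\<not> q2 h"
          using m u G id that mu sym by (auto simp: h_def bool_simps)
        have "\<not> B1 h x" "\<not> B2 h x" using anisotropic[of h x] h G by auto
        then show ?thesis using m u G rx sym by (auto simp: h_def bool_simps)
      qed
    qed
    then show thesis using ni by simp
  next
    case fs
    \<comment> \<open>In each of the three cases the factor gives \<open>y\<close> the square that
      \<open>H32_from_triple\<close> expects; \<open>m\<close> and \<open>n\<close> are then the
      elements of the centralizer with the two square values that the map exchanges.\<close>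
    define y where "y = x \<otimes> pw (q1 x) u"
    have "y \<in> carrier G" "B1 r y" "\<not> q1 y" "q2 y" "\<not> B1 u y" "B2 u y" "B1 (u \<otimes> r) y" "B2 (u \<otimes> r) y"
      using G u ur sym rx fs a0 a1 a2 a3 B_self[of u] by (auto simp: y_def bool_simps)
    then show thesis using fin[of y u "u \<otimes> r" t "s \<otimes> t"] u ur fs st3 by (simp add: cm_S sq_S S_simps)
  next
    case fst
    define y where "y = x \<otimes> pw (q2 x) r"
    have "y \<in> carrier G" "B1 r y" "q1 y" "\<not> q2 y" "\<not> B2 r y" "\<not> B1 u y" "B2 u y"
      using G u ur sym rx rr fst a0 a1 a2 a3 by (auto simp: y_def bool_simps)
    then show thesis using fin[of y r u s t] u rr G fst st3 by (simp add: cm_S sq_S S_simps)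
  next
    case ft
    define y where "y = x \<otimes> pw (q2 x) r"
    have "y \<in> carrier G" "B1 r y" "q1 y" "\<not> q2 y" "\<not> B2 r y" "B1 (u \<otimes> r) y" "B2 (u \<otimes> r) y"
      using G u ur sym rx rr ft a0 a1 a2 a3 by (auto simp: y_def bool_simps)
    then show thesis using fin[of y r "u \<otimes> r" s "s \<otimes> t"] u ur rr G ft st3 by (simp add: cm_S sq_S S_simps)
  qed
qed

end

context quadratic_group
begin

text \<open>By \<open>cm_cases\<close>, one of \<open>a\<close>, \<open>b\<close> and
  \<open>ab\<close> has square \<open>\<delta>\<close>; the last case occurs when \<open>a\<close>
  and \<open>b\<close> have equal squares.\<close>

lemma plane_normal:
  assumes G: "a \<in> carrier G" "b \<in> carrier G" "c \<in> carrier G" "d \<in> carrier G"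
    and ab: "cm a b = \<delta>" and sp: "spans a b c d"
    and cr: "cm a c = \<one>" "cm a d = \<one>" "cm b c = \<one>" "cm b d = \<one>" and ne: "\<delta> \<noteq> \<one>"
  obtains a' b' where "a' \<in> carrier G" "b' \<in> carrier G" "sq a' = \<delta>" "cm a' b' = \<delta>" "spans a' b' c d"
    "cm a' c = \<one>" "cm a' d = \<one>" "cm b' c = \<one>" "cm b' d = \<one>"
proof -
  consider "\<delta> = sq a" | "\<delta> = sq b" | "sq a = sq b" using cm_cases[OF G(1,2)] ab ne by auto
  then show thesis
  proof cases
    case 1 then show thesis using that[of a b] assms by simp
  next
    case 2 then show thesis using that[of b a] assms spans_swap[OF sp G] cm_sym[of a b] by simp
  next
    case 3
    have "\<delta> \<in> carrier G" using G ab by auto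
    then have "sq (a \<otimes> b) = \<delta>" using 3 G ab by (simp add: sq_mult Om_sq)
    then show thesis using that[of "a \<otimes> b" b] assms spans_shift[OF sp G] \<open>\<delta> \<in> carrier G\<close> by (simp add: cm_mult_left cm_self)
  qed
qed

text \<open>The space is made an orthogonal sum of a plane containing \<open>r\<close>, with
  commutator \<open>s\<close>, and a plane in the centralizer of \<open>r\<close>, with commutator
  \<open>\<delta>\<close>. \<open>plane_normal\<close> fixes the square of one basis vector in each.
  For the other two, anisotropy leaves \<open>sq y'\<close> in \<open>{s, s\<delta>}\<close> and
  \<open>sq b'\<close> in \<open>{\<delta>, s\<delta>}\<close>, not both \<open>s\<delta>\<close>.
  If neither is \<open>s\<delta>\<close>, the planes are two quaternion groups; otherwise one of
  them is \<open>P16\<close>.\<close>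

lemma two_plane_structure:
  assumes G: "r \<in> carrier G" "x \<in> carrier G" "u \<in> carrier G" "v \<in> carrier G"
    and r: "\<And>g. g \<in> carrier G \<Longrightarrow> \<not> B2 r g" and rx: "B1 r x"
    and ru: "\<not> B1 r u" "\<not> B1 r v" and uv: "B1 u v \<or> B2 u v"
  obtains (Q8Q8) s' t' x y u v where "s' \<in> {s, t, s \<otimes> t}" "t' \<in> {s, t, s \<otimes> t}" "s' \<noteq> t'"
    "x \<in> carrier G" "y \<in> carrier G" "u \<in> carrier G" "v \<in> carrier G"
    "sq x = s'" "sq y = s'" "cm x y = s'" "sq u = t'" "sq v = t'" "cm u v = t'"
    "cm x u = \<one>" "cm x v = \<one>" "cm y u = \<one>" "cm y v = \<one>" "spans x y u v"
  | (P16Q8) s' t' x y u v where "s' \<in> {s, t, s \<otimes> t}" "t' \<in> {s, t, s \<otimes> t}" "s' \<noteq> t'"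
    "x \<in> carrier G" "y \<in> carrier G" "u \<in> carrier G" "v \<in> carrier G"
    "sq x = s'" "sq y = t'" "cm x y = s'" "sq u = s' \<otimes> t'" "sq v = s' \<otimes> t'" "cm u v = s' \<otimes> t'"
    "cm x u = \<one>" "cm x v = \<one>" "cm y u = \<one>" "cm y v = \<one>" "spans x y u v"
proof -
  have qr: "q1 r \<or> q2 r" using anisotropic[of r x] G rx by auto
  have an: "q1 y \<or> q2 y" if "y \<in> carrier G" "B1 r y" for y using anisotropic[of y r] that G by auto
  note cs = centralizer_structure[OF G(1) _ _ qr]
  \<comment> \<open>If \<open>cm u v\<close> were \<open>s\<close>, there would be a
    \<open>w\<close> of square \<open>s\<close> commuting with \<open>r\<close> and with some
    \<open>y\<close> that does not commute with \<open>r\<close>. The squares of \<open>y\<close>,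
    \<open>yw\<close>, \<open>yr\<close> and \<open>yrw\<close> would then run through all four
    values, including 1.\<close>
  have B2uv: "B2 u v"
  proof (rule ccontr)
    assume n: "\<not> B2 u v"
    then have B1uv: "B1 u v" using uv by simp
    have q2r: "q2 r" using cs(1)[OF G(3,4) ru(1) r[OF G(3)] ru(2) r[OF G(4)] uv] n B1uv qr by auto
    have "\<exists>a b. a \<in> carrier G \<and> b \<in> carrier G \<and> \<not> B1 r a \<and> \<not> B1 r b \<and> B1 a b \<and> \<not> B2 a b \<and> \<not> B2 a x"
    proof (cases "B2 u x \<and> B2 v x")
      case True
      then show ?thesis using G ru B1uv n by - (rule exI[of _ "u \<otimes> v"], rule exI[of _ v], simp add: bool_simps)
    next
      case False
      then show ?thesis using G ru B1uv n B_sym[of u v] by blast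
    qed
    then obtain a b where ab: "a \<in> carrier G" "b \<in> carrier G" "\<not> B1 r a" "\<not> B1 r b" "B1 a b" "\<not> B2 a b" "\<not> B2 a x" by blast
    have rab: "\<not> B2 r a" "\<not> B2 r b" "\<not> B2 r x" using r ab G by auto
    have qa: "q1 a \<or> q2 a" "q1 a \<noteq> q1 r \<or> q2 a \<noteq> q2 r" using cs(2,3)[of a b] ab rab by auto
    define w where "w = a \<otimes> pw (q2 a) r"
    have ar: "\<not> B1 a r" "\<not> B2 a r" using B_sym[of a r] ab rab G by auto
    have w: "w \<in> carrier G" "q1 w" "\<not> q2 w" "\<not> B2 w x" "B1 w b" "\<not> B2 w b" "\<not> B1 r w" "\<not> B2 r w"
      using ab G qa q2r ar rab B_self[of r] by (auto simp: w_def bool_simps)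
    define y where "y = x \<otimes> pw (B1 w x) b"
    have y: "y \<in> carrier G" "B1 r y" "\<not> B2 r y" "\<not> B1 w y" "\<not> B2 w y"
      using w ab G rab rx by (auto simp: y_def bool_simps)
    have sym: "B1 y r" "\<not> B2 y r" "\<not> B1 y w" "\<not> B2 y w" "\<not> B1 w r" "\<not> B2 w r" "\<not> B1 r r" "\<not> B2 r r"
      using B_sym[of y r] B_sym[of y w] B_sym[of w r] y w G B_self[of r] by auto
    have "q1 y \<or> q2 y" using an y by blast
    moreover have "q1 (y \<otimes> w) \<or> q2 (y \<otimes> w)" using an[of "y \<otimes> w"] y w G by (simp add: B_mult)
    moreover have "q1 (y \<otimes> r) \<or> q2 (y \<otimes> r)" using an[of "y \<otimes> r"] y w G sym by (simp add: B_mult)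
    moreover have "q1 (y \<otimes> (r \<otimes> w)) \<or> q2 (y \<otimes> (r \<otimes> w))" using an[of "y \<otimes> (r \<otimes> w)"] y w G sym by (simp add: B_mult)
    ultimately show False using sym y w G q2r by (simp add: bool_simps) argo
  qed
  \<comment> \<open>Orthogonalization in two rounds: \<open>u\<close> and \<open>v\<close> clear the
    \<open>t\<close>-coordinates of the commutators of \<open>x\<close> with them, then
    \<open>r\<close> clears the remaining \<open>s\<close>-coordinates.\<close>
  define y where "y = x \<otimes> (pw (B2 x u) v \<otimes> pw (B2 x v) u)"
  have vu: "B2 v u" using B_sym[of u v] B2uv G by auto
  have y: "y \<in> carrier G" "B1 r y" "\<not> B2 r y" "\<not> B2 y u" "\<not> B2 y v"
    using G r[of x] r[of u] r[of v] rx ru vu B2uv by (auto simp: y_def bool_simps)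
  have yr: "B1 y r" "\<not> B2 y r" using B_sym[of y r] y G by auto
  define a b where "a = u \<otimes> pw (B1 y u) r" and "b = v \<otimes> pw (B1 y v) r"
  have ur: "\<not> B1 u r" "\<not> B2 u r" "\<not> B1 v r" "\<not> B2 v r" "\<not> B2 r u" "\<not> B2 r v" using B_sym[of u r] B_sym[of v r] r[of u] r[of v] ru G by auto
  have ab: "a \<in> carrier G" "b \<in> carrier G" "\<not> B1 r a" "\<not> B2 r a" "\<not> B1 r b" "\<not> B2 r b" "\<not> B1 y a" "\<not> B2 y a" "\<not> B1 y b" "\<not> B2 y b" "B2 a b"
    using G y yr ru ur B2uv B_self[of r] by (auto simp: a_def b_def bool_simps)
  have sp: "spans r y a b"
  proof (rule spansI)
    fix g assume g: "g \<in> carrier G"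
    define e where "e = B1 r g"
    define h where "h = g \<otimes> pw e y"
    have h: "h \<in> carrier G" "\<not> B1 r h" "\<not> B2 r h" using g y G r[of g] by (auto simp: h_def e_def bool_simps)
    obtain i j k where "\<not> q1 (h \<otimes> (pw i a \<otimes> (pw j b \<otimes> pw k r)))" "\<not> q2 (h \<otimes> (pw i a \<otimes> (pw j b \<otimes> pw k r)))"
      using cs(4)[of a b h] ab h by auto
    then have "\<not> q1 (g \<otimes> (pw k r \<otimes> (pw e y \<otimes> (pw i a \<otimes> pw j b)))) \<and> \<not> q2 (g \<otimes> (pw k r \<otimes> (pw e y \<otimes> (pw i a \<otimes> pw j b))))"
      using g G y ab B_sym[of a r] B_sym[of b r] B_sym[of y r] unfolding h_def by (simp add: bool_simps; argo)
    then show "\<exists>i j k l. \<not> q1 (g \<otimes> (pw i r \<otimes> (pw j y \<otimes> (pw k a \<otimes> pw l b)))) \<and> \<not> q2 (g \<otimes> (pw i r \<otimes> (pw j y \<otimes> (pw k a \<otimes> pw l b))))"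
      by blast
  qed (use G y ab in auto)
  define \<delta> where "\<delta> = cm a b"
  have d: "\<delta> = t \<or> \<delta> = s \<otimes> t" using ab by (cases "B1 a b") (simp_all add: \<delta>_def cm_S S_simps)
  have d1: "\<delta> \<noteq> \<one>" "\<delta> \<noteq> s" "\<delta> \<in> Om" "\<delta> \<in> carrier G" using d by (elim disjE; simp add: s t st st[symmetric] st_distinct)+
  have cr: "cm r a = \<one>" "cm r b = \<one>" "cm y a = \<one>" "cm y b = \<one>" using ab y G by (auto simp: cm_one_iff)
  have ry: "cm r y = s" using G y by (simp add: cm_S S_simps)
  obtain r' y' where r': "r' \<in> carrier G" "y' \<in> carrier G" "sq r' = s" "cm r' y' = s" "spans r' y' a b"
    "cm r' a = \<one>" "cm r' b = \<one>" "cm y' a = \<one>" "cm y' b = \<one>"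
    using plane_normal[OF G(1) y(1) ab(1,2) ry sp cr s(2)] by blast
  have cr': "cm a r' = \<one>" "cm a y' = \<one>" "cm b r' = \<one>" "cm b y' = \<one>" using r' ab cm_sym by metis+
  obtain a' b' where a': "a' \<in> carrier G" "b' \<in> carrier G" "sq a' = \<delta>" "cm a' b' = \<delta>" "spans a' b' r' y'"
    "cm a' r' = \<one>" "cm a' y' = \<one>" "cm b' r' = \<one>" "cm b' y' = \<one>"
    using plane_normal[OF ab(1,2) r'(1,2) _ spans_rotate[OF r'(5,1,2) ab(1,2)] cr' d1(1)] \<delta>_def by blast
  have sp: "spans r' y' a' b'" using spans_rotate[OF a'(5,1,2) r'(1,2)] .
  have cr: "cm r' a' = \<one>" "cm r' b' = \<one>" "cm y' a' = \<one>" "cm y' b' = \<one>" using r' a' cm_sym by metis+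
  have nz: "sq g \<noteq> \<one>" if "g \<in> carrier G" "h \<in> carrier G" "cm g h \<noteq> \<one>" for g h
    using cm_Om_left[of g h] sq_eq_one[of g] that by auto
  have ca: "cm b' a' = \<delta>" "cm y' r' = s" using a' r' cm_sym by metis+
  have mul: "sq (g \<otimes> h) = sq g \<otimes> sq h" if "g \<in> carrier G" "h \<in> carrier G" "cm g h = \<one>" for g h
    using that by (simp add: sq_mult)
  \<comment> \<open>Commuting elements with equal squares have an involution as product; it would be
    central, but it does not commute with \<open>k\<close>.\<close>
  have neq: "sq g \<noteq> sq h" if "g \<in> carrier G" "h \<in> carrier G" "cm g h = \<one>" "k \<in> carrier G" "cm g k = \<one>" "cm h k \<noteq> \<one>" for g h k
    using nz[of "g \<otimes> h" k] mul[of g h] that by (auto simp: cm_mult_left Om_sq)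
  have "sq y' \<noteq> \<one>" using nz[of y' r'] r' ca s by simp
  moreover have "sq y' \<noteq> \<delta>" using neq[of y' a' b'] cr a' r' d1 by simp
  moreover have "sq b' \<noteq> \<one>" using nz[of b' a'] a' ca d1 by simp
  moreover have "sq b' \<noteq> s" using neq[of b' r' y'] a' r' s by metis
  moreover have "sq y' \<noteq> sq b'" using neq[of y' b' a'] cr a' r' ca d1 by simp
  moreover have "sq y' \<in> {\<one>, s, t, s \<otimes> t}" "sq b' \<in> {\<one>, s, t, s \<otimes> t}" using squares a' r' by auto
  moreover have sd: "{\<one>, s, t, s \<otimes> t} = {\<one>, s, \<delta>, s \<otimes> \<delta>}" using d by (elim disjE; simp add: s t Om_simps insert_commute)
  ultimately consider "sq y' = s" "sq b' = \<delta>" | "sq y' = s" "sq b' = s \<otimes> \<delta>" | "sq y' = s \<otimes> \<delta>" "sq b' = \<delta>" by auto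
  note cases = this
  have m: "s \<in> {s, t, s \<otimes> t}" "\<delta> \<in> {s, t, s \<otimes> t}" "s \<otimes> \<delta> \<in> {s, t, s \<otimes> t}" "s \<noteq> \<delta>" "s \<noteq> s \<otimes> \<delta>" "\<delta> \<noteq> s \<otimes> \<delta>"
    "\<delta> \<otimes> (s \<otimes> \<delta>) = s" "s \<otimes> (s \<otimes> \<delta>) = \<delta>"
    using d by (elim disjE; simp add: s t st st[symmetric] st_distinct st_distinct[symmetric] Om_simps)+
  have sp': "spans a' b' r' y'" by (rule a')
  show thesis
    using cases
  proof cases
    case 1
    show thesis by (rule Q8Q8[of s \<delta> r' y' a' b']) (use 1 m a' r' cr sp in simp_all)
  next
    case 2
    show thesis by (rule P16Q8[of \<delta> "s \<otimes> \<delta>" a' b' r' y']) (use 2 m a' r' cr sp' in simp_all)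
  next
    case 3
    show thesis by (rule P16Q8[of s "s \<otimes> \<delta>" r' y' a' b']) (use 3 m a' r' cr sp in simp_all)
  qed
qed

end

section \<open>Forms in which commutation with any nonzero vector is surjective\<close>

text \<open>One condition for each of the three nonzero functionals on the square values: none of
  them vanishes on all commutators with a noninvolution \<open>r\<close>.\<close>

locale quadratic_group_no_radical = quadratic_group +
  assumes no_radical: "r \<in> carrier G \<Longrightarrow> q1 r \<or> q2 r \<Longrightarrow> \<exists>g\<in>carrier G. B1 r g"
    "r \<in> carrier G \<Longrightarrow> q1 r \<or> q2 r \<Longrightarrow> \<exists>g\<in>carrier G. B2 r g"
    "r \<in> carrier G \<Longrightarrow> q1 r \<or> q2 r \<Longrightarrow> \<exists>g\<in>carrier G. B1 r g \<noteq> B2 r g"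
begin

lemma surjective:
  assumes r: "r \<in> carrier G" "q1 r \<or> q2 r"
  obtains g where "g \<in> carrier G" "B1 r g \<longleftrightarrow> a" "B2 r g \<longleftrightarrow> b"
proof -
  obtain f where f: "f \<in> carrier G" "B1 r f" using no_radical(1) r by blast
  obtain g where g: "g \<in> carrier G" "B2 r g" using no_radical(2) r by blast
  obtain h where h: "h \<in> carrier G" "B1 r h \<noteq> B2 r h" using no_radical(3) r by blast
  have "\<exists>x \<in> carrier G. \<exists>y \<in> carrier G. (B1 r x \<or> B2 r x) \<and> (B1 r y \<or> B2 r y) \<and> (B1 r x \<noteq> B1 r y \<or> B2 r x \<noteq> B2 r y)"
    using f g h by metis
  then obtain x y where xy: "x \<in> carrier G" "y \<in> carrier G" "B1 r x \<or> B2 r x" "B1 r y \<or> B2 r y" "B1 r x \<noteq> B1 r y \<or> B2 r x \<noteq> B2 r y"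
    by blast
  obtain j k where "a \<longleftrightarrow> ((j \<and> B1 r x) \<noteq> (k \<and> B1 r y))" "b \<longleftrightarrow> ((j \<and> B2 r x) \<noteq> (k \<and> B2 r y))"
    using bool_solve[OF xy(3-5), of a b] by blast
  then show thesis using that[of "pw j x \<otimes> pw k y"] xy r by (simp add: bool_simps)
qed

text \<open>Otherwise \<open>v\<close>, \<open>x\<close> and \<open>y\<close> would span the group
  modulo involutions. The alternating form \<open>B2\<close> on a space of dimension 3 is
  degenerate, and a radical vector contradicts \<open>no_radical\<close>.\<close>

lemma centralizer_large:
  assumes v: "v \<in> carrier G" "q1 v \<or> q2 v"
  shows "\<exists>w \<in> carrier G. \<not> B1 v w \<and> \<not> B2 v w \<and> (q1 w \<or> q2 w) \<and> (q1 w \<noteq> q1 v \<or> q2 w \<noteq> q2 v)"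
proof (rule ccontr)
  assume "\<not> ?thesis"
  then have C: "(\<not> q1 w \<and> \<not> q2 w) \<or> (q1 w = q1 v \<and> q2 w = q2 v)" if "w \<in> carrier G" "\<not> B1 v w" "\<not> B2 v w" for w
    using that by blast
  obtain x where x: "x \<in> carrier G" "B1 v x" "\<not> B2 v x" using surjective[OF v, of True False] by blast
  obtain y where y: "y \<in> carrier G" "\<not> B1 v y" "B2 v y" using surjective[OF v, of False True] by blast
  have vv: "\<not> B1 v v" "\<not> B2 v v" "B1 x v" "\<not> B2 x v" using B_self[of v] B_sym[of x v] v x by auto
  \<comment> \<open>The explicit radical vector: \<open>B2 z\<close> vanishes on \<open>v\<close>,
    on \<open>y\<close> and on \<open>z\<close> itself.\<close>
  define z where "z = x \<otimes> pw (B2 x y) v"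
  have z: "z \<in> carrier G" "B1 v z" "\<not> B2 v z" "B1 z v" "\<not> B2 z v" "\<not> B2 z y" "\<not> B2 z z"
    using x y v vv B_self[of x] B_sym[of v x] unfolding z_def by (simp_all add: bool_simps)
  obtain g where g: "g \<in> carrier G" "B2 z g" using no_radical(2)[of z] anisotropic[of z v] z v by blast
  define h where "h = g \<otimes> (pw (B1 v g) z \<otimes> pw (B2 v g) y)"
  have h: "h \<in> carrier G" "\<not> B1 v h" "\<not> B2 v h" "B2 z h" using g z y v by (auto simp: h_def bool_simps)
  have "q1 h \<or> q2 h" using anisotropic[of h z] h z by blast
  then have "q1 h = q1 v" "q2 h = q2 v" using C h by blast+
  moreover have "\<not> B1 h v" "\<not> B2 h v" using h v B_sym[of h v] by auto
  ultimately have "\<not> q1 (h \<otimes> v)" "\<not> q2 (h \<otimes> v)" by (simp_all add: q_mult)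
  then have "\<not> B2 z (h \<otimes> v)" using anisotropic[of "h \<otimes> v" z] h z v by simp
  then show False using h z v by (simp add: bool_simps)
qed

text \<open>If \<open>m\<close> and \<open>n\<close> did not commute,
  \<open>centralizer_structure\<close> would give the spanning family \<open>m\<close>,
  \<open>n\<close>, \<open>v\<close>, \<open>x\<close>, \<open>y\<close>. An alternating form in the
  odd dimension 5 has a radical vector, here \<open>w\<close>, which \<open>no_radical\<close>
  forbids. The argument is the same for either form, hence the variable \<open>bl\<close>.\<close>

lemma centralizer_abelian:
  assumes v: "v \<in> carrier G" "q1 v \<or> q2 v" and m: "m \<in> carrier G" "\<not> B1 v m" "\<not> B2 v m"
    and n: "n \<in> carrier G" "\<not> B1 v n" "\<not> B2 v n"
  shows "\<not> B1 m n \<and> \<not> B2 m n"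
proof -
  have "\<not> bl m n" if bl: "bl = B1 \<or> bl = B2" for bl
  proof
    assume mn: "bl m n"
    have bmult: "bl (g \<otimes> k) h \<longleftrightarrow> bl g h \<noteq> bl k h" "bl h (g \<otimes> k) \<longleftrightarrow> bl h g \<noteq> bl h k"
      if "g \<in> carrier G" "h \<in> carrier G" "k \<in> carrier G" for g h k
      using bl that by (auto simp: B_mult)
    have bpw: "bl g (pw b x) \<longleftrightarrow> b \<and> bl g x" "bl (pw b x) g \<longleftrightarrow> b \<and> bl x g" if "x \<in> carrier G" "g \<in> carrier G" for x g b
      using bl that by (auto simp: B_pw)
    have bsym: "bl g h = bl h g" if "g \<in> carrier G" "h \<in> carrier G" for g h using bl B_sym that by blast
    have bself: "\<not> bl g g" if "g \<in> carrier G" for g using bl B_self that by blast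
    have ban: "q1 g \<or> q2 g" if "g \<in> carrier G" "h \<in> carrier G" "bl h g" for g h using bl anisotropic[of g h] that by blast
    have brad: "\<exists>g\<in>carrier G. bl r g" if "r \<in> carrier G" "q1 r \<or> q2 r" for r using bl no_radical that by blast
    have vmn: "\<not> bl v m" "\<not> bl v n" using bl m n by auto
    \<comment> \<open>Commutators with \<open>v\<close> take all values, so one of \<open>x\<close>
      and \<open>y\<close> can be chosen in the kernel of \<open>bl v\<close> and the other outside
      it, both with nontrivial commutator.\<close>
    obtain x where x: "x \<in> carrier G" "\<not> bl v x" "B1 v x \<or> B2 v x"
      using surjective[OF v, of True False] surjective[OF v, of False True] bl by metis
    obtain y where y: "y \<in> carrier G" "bl v y" "B1 v y \<or> B2 v y"
      using surjective[OF v, of True False] surjective[OF v, of False True] bl by metis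
    have xy: "B1 v x \<noteq> B1 v y \<or> B2 v x \<noteq> B2 v y" using x y bl by auto
    \<comment> \<open>\<open>m\<close> and \<open>n\<close> are a hyperbolic pair for
      \<open>bl\<close> and clear its values at each other; \<open>v\<close> then does the same for
      \<open>y\<close>. The result \<open>w\<close> is orthogonal to the whole family.\<close>
    define z where "z = x \<otimes> (pw (bl x m) n \<otimes> pw (bl x n) m)"
    have z: "z \<in> carrier G" "\<not> bl z m" "\<not> bl z n" "\<not> bl v z" "B1 v z = B1 v x" "B2 v z = B2 v x"
      using x m n v mn vmn bsym[of m n] bself by (auto simp: z_def bmult bpw bool_simps)
    define w where "w = z \<otimes> pw (bl z y) v"
    have w: "w \<in> carrier G" "\<not> bl w m" "\<not> bl w n" "\<not> bl w y" "\<not> bl w v" "\<not> bl w w" "B1 v w = B1 v x" "B2 v w = B2 v x"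
      using z v m n y vmn bself bsym[of v z] B_self[of v] by (auto simp: w_def bmult bpw bool_simps)
    have "q1 w \<or> q2 w" using anisotropic[of w v] w v x by auto
    then obtain g where g: "g \<in> carrier G" "bl w g" using brad w by blast
    obtain j k where jk: "B1 v g \<longleftrightarrow> ((j \<and> B1 v x) \<noteq> (k \<and> B1 v y))" "B2 v g \<longleftrightarrow> ((j \<and> B2 v x) \<noteq> (k \<and> B2 v y))"
      using bool_solve[OF x(3) y(3) xy, of "B1 v g" "B2 v g"] by blast
    define h where "h = g \<otimes> (pw j w \<otimes> pw k y)"
    have h: "h \<in> carrier G" "bl w h" using g w y by (auto simp: h_def bmult bpw)
    have vh: "\<not> B1 v h" "\<not> B2 v h" using jk g w y v unfolding h_def by (simp add: bool_simps)+
    have "B1 m n \<or> B2 m n" using mn bl by auto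
    then obtain i j k where e: "\<not> q1 (h \<otimes> (pw i m \<otimes> (pw j n \<otimes> pw k v)))" "\<not> q2 (h \<otimes> (pw i m \<otimes> (pw j n \<otimes> pw k v)))"
      using centralizer_structure(4)[OF v(1) m(1) n(1) v(2) m(2,3) n(2,3) _ h(1) vh] by blast
    have "bl w (h \<otimes> (pw i m \<otimes> (pw j n \<otimes> pw k v)))" using h w m n v by (simp add: bmult bpw)
    then show False using ban[of "h \<otimes> (pw i m \<otimes> (pw j n \<otimes> pw k v))" w] e h w m n v by simp
  qed
  from this[of B1] this[of B2] show ?thesis by blast
qed

text \<open>The commuting elements \<open>u\<close> and \<open>v\<close> have squares
  \<open>t\<close> and \<open>s\<close>. For \<open>g\<close> outside the centralizer of
  \<open>v\<close>, none of \<open>g\<close>, \<open>gu\<close>, \<open>gv\<close>,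
  \<open>guv\<close> is an involution, so the linear map sending \<open>t\<close> to
  \<open>cm u g\<close> and \<open>s\<close> to \<open>cm v g\<close> is invertible with a nonzero
  fixed vector, as in \<open>H32_structure\<close>. Prescribing commutators with \<open>v\<close>
  thereby determines those with \<open>u\<close>.\<close>

lemma H245_structure:
  assumes g0: "g0 \<in> carrier G" "q1 g0 \<or> q2 g0"
  obtains x y u v where "x \<in> carrier G" "y \<in> carrier G" "u \<in> carrier G" "v \<in> carrier G"
    "sq x = s" "sq y = t" "sq u = t" "sq v = s" "cm x y = s" "cm x u = t" "cm x v = s \<otimes> t"
    "cm y u = s \<otimes> t" "cm y v = s" "cm u v = \<one>" "spans x y u v"
proof -
  obtain w where w: "w \<in> carrier G" "\<not> B1 g0 w" "\<not> B2 g0 w" "q1 w \<or> q2 w" "q1 w \<noteq> q1 g0 \<or> q2 w \<noteq> q2 g0"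
    using centralizer_large[OF g0] by blast
  have wg: "\<not> B1 w g0" "\<not> B2 w g0" using B_sym[of w g0] w g0 by auto
  define f where "f j k = pw j g0 \<otimes> pw k w" for j k
  have f: "f j k \<in> carrier G" "q1 (f j k) \<longleftrightarrow> ((j \<and> q1 g0) \<noteq> (k \<and> q1 w))" "q2 (f j k) \<longleftrightarrow> ((j \<and> q2 g0) \<noteq> (k \<and> q2 w))" for j k
    using w g0 by (auto simp: f_def bool_simps)
  have ff: "\<not> B1 (f j k) (f j' k')" "\<not> B2 (f j k) (f j' k')" for j k j' k'
    using w g0 wg by (auto simp: f_def bool_simps)
  have gw: "q1 g0 \<noteq> q1 w \<or> q2 g0 \<noteq> q2 w" using w(5) by auto
  obtain j k where jk: "False = q1 (f j k)" "True = q2 (f j k)"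
    using bool_solve[OF g0(2) w(4) gw, of False True] unfolding f by blast
  obtain j' k' where jk': "True = q1 (f j' k')" "False = q2 (f j' k')"
    using bool_solve[OF g0(2) w(4) gw, of True False] unfolding f by blast
  define u v where "u = f j k" and "v = f j' k'"
  have uv: "u \<in> carrier G" "v \<in> carrier G" "\<not> q1 u" "q2 u" "q1 v" "\<not> q2 v" "\<not> B1 u v" "\<not> B2 u v"
    unfolding u_def v_def using jk jk' ff f(1) by blast+
  have vu: "\<not> B1 v u" "\<not> B2 v u" "\<not> B1 u u" "\<not> B2 u u" "\<not> B1 v v" "\<not> B2 v v"
    using B_sym[of u v] B_self uv by auto
  have quv: "q1 (u \<otimes> v)" "q2 (u \<otimes> v)" using uv by (auto simp: q_mult)
  obtain x0 where x0: "x0 \<in> carrier G" "B1 v x0" "B2 v x0" using surjective[of v True True] uv by blast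
  obtain y0 where y0: "y0 \<in> carrier G" "B1 v y0" "\<not> B2 v y0" using surjective[of v True False] uv by blast
  have nz: "B1 a g \<or> B2 a g" if "a \<in> carrier G" "q1 a \<or> q2 a" "\<not> B1 a v" "\<not> B2 a v" "g \<in> carrier G" "B1 v g \<or> B2 v g" for a g
    using centralizer_abelian[of a v g] that uv by blast
  have an: "q1 g \<or> q2 g" if "g \<in> carrier G" "B1 v g \<or> B2 v g" for g
    using anisotropic[of g v] that uv by blast
  have uvv: "\<not> B1 (u \<otimes> v) v" "\<not> B2 (u \<otimes> v) v" using uv vu by (simp_all add: B_mult)
  have nu: "B1 u g \<or> B2 u g" "B1 u g \<noteq> B1 v g \<or> B2 u g \<noteq> B2 v g" if "g \<in> carrier G" "B1 v g \<or> B2 v g" for g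
    using nz[of u g] nz[of "u \<otimes> v" g] that uv uvv quv by (auto simp: B_mult)
  have qm: "q1 g \<or> q2 g" "q1 g \<noteq> B1 u g \<or> q2 g \<noteq> (\<not> B2 u g)" "q1 g \<noteq> (\<not> B1 v g) \<or> q2 g \<noteq> B2 v g"
    "q1 g \<noteq> (\<not> (B1 u g \<noteq> B1 v g)) \<or> q2 g \<noteq> (\<not> (B2 u g \<noteq> B2 v g))"
    if g: "g \<in> carrier G" "B1 v g \<or> B2 v g" for g
  proof -
    have gs: "B1 g u = B1 u g" "B2 g u = B2 u g" "B1 g v = B1 v g" "B2 g v = B2 v g" using B_sym g uv by blast+
    show "q1 g \<or> q2 g" using an g by blast
    have "B1 v (g \<otimes> u) \<or> B2 v (g \<otimes> u)" using g uv vu by (simp add: B_mult)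
    then have "q1 (g \<otimes> u) \<or> q2 (g \<otimes> u)" using an[of "g \<otimes> u"] g uv by simp
    then show "q1 g \<noteq> B1 u g \<or> q2 g \<noteq> (\<not> B2 u g)" using uv unfolding q_mult gs by argo
    have "B1 v (g \<otimes> v) \<or> B2 v (g \<otimes> v)" using g uv vu by (simp add: B_mult)
    then have "q1 (g \<otimes> v) \<or> q2 (g \<otimes> v)" using an[of "g \<otimes> v"] g uv by simp
    then show "q1 g \<noteq> (\<not> B1 v g) \<or> q2 g \<noteq> B2 v g" using uv unfolding q_mult gs by argo
    have "B1 v (g \<otimes> (u \<otimes> v)) \<or> B2 v (g \<otimes> (u \<otimes> v))" using g uv vu by (simp add: B_mult)
    then have "q1 (g \<otimes> (u \<otimes> v)) \<or> q2 (g \<otimes> (u \<otimes> v))" using an[of "g \<otimes> (u \<otimes> v)"] g uv by simp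
    then show "q1 g \<noteq> (\<not> (B1 u g \<noteq> B1 v g)) \<or> q2 g \<noteq> (\<not> (B2 u g \<noteq> B2 v g))"
      using uv unfolding q_mult B_mult(3,4)[OF uv(1) g(1) uv(2)] gs by argo
  qed
  have xy: "x0 \<otimes> y0 \<in> carrier G" "\<not> B1 v (x0 \<otimes> y0)" "B2 v (x0 \<otimes> y0)" using x0 y0 uv by (auto simp: B_mult)
  \<comment> \<open>With \<open>s\<close> sent to \<open>st\<close>, the only invertible map having
    a fixed vector fixes \<open>t\<close>.\<close>
  have ux0: "\<not> B1 u x0" "B2 u x0" using nu[of x0] qm[of x0] x0 by argo+
  \<comment> \<open>With \<open>s\<close> fixed, \<open>t\<close> could still go to \<open>t\<close>
    or \<open>st\<close>. The map of \<open>x0 y0\<close> sends \<open>s\<close> to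
    \<open>t\<close>, so it must exchange the two, which leaves \<open>st\<close>.\<close>
  have uy0: "B1 u y0" "B2 u y0" using nu[of y0] nu[OF xy(1)] xy y0 x0 uv ux0 by (auto simp: B_mult)
  \<comment> \<open>The square of \<open>x0\<close> is \<open>s\<close> or \<open>st\<close> and
    that of \<open>y0\<close> is \<open>t\<close> or \<open>st\<close>; the factors \<open>v\<close>
    and \<open>u\<close> turn them into \<open>s\<close> and \<open>t\<close>.\<close>
  define x1 where "x1 = x0 \<otimes> pw (q2 x0) v"
  define y where "y = y0 \<otimes> pw (q1 y0) u"
  have xs: "B1 x0 v" "B2 x0 v" "\<not> B1 x0 u" "B2 x0 u" "B1 y0 u" "B2 y0 u" using B_sym[of x0 v] B_sym[of x0 u] B_sym[of y0 u] x0 y0 uv ux0 uy0 by auto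
  have x1: "x1 \<in> carrier G" "B1 v x1" "B2 v x1" "\<not> B1 u x1" "B2 u x1" "q1 x1" "\<not> q2 x1"
    using x0 uv vu ux0 xs qm[OF x0(1)] by (auto simp: x1_def bool_simps)
  have y: "y \<in> carrier G" "B1 v y" "\<not> B2 v y" "B1 u y" "B2 u y" "\<not> q1 y" "q2 y"
    using y0 uv vu uy0 xs qm[OF y0(1)] by (auto simp: y_def bool_simps)
  \<comment> \<open>The square of \<open>x1 y\<close> is neither 1 nor \<open>st\<close>, so
    \<open>cm x1 y\<close> is \<open>s\<close> or \<open>t\<close>. Multiplying \<open>x1\<close> by
    \<open>u\<close> exchanges the two and preserves the square of \<open>x1\<close>.\<close>
  have "B1 x1 y \<noteq> B2 x1 y"
    using qm[of "x1 \<otimes> y"] x1 y uv by (auto simp: bool_simps)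
  define x where "x = x1 \<otimes> pw (B2 x1 y) u"
  have "B1 x1 u = B1 u x1" "B2 x1 u = B2 u x1" using B_sym x1 uv by blast+
  then have x: "x \<in> carrier G" "B1 v x" "B2 v x" "\<not> B1 u x" "B2 u x" "q1 x" "\<not> q2 x" "B1 x y" "\<not> B2 x y"
    using x1 y uv vu \<open>B1 x1 y \<noteq> B2 x1 y\<close> by (auto simp: x_def bool_simps)
  have sym: "B1 x u = B1 u x" "B2 x u = B2 u x" "B1 x v = B1 v x" "B2 x v = B2 v x"
    "B1 y u = B1 u y" "B2 y u = B2 u y" "B1 y v = B1 v y" "B2 y v = B2 v y" using B_sym x y uv by blast+
  have sp: "spans x y u v"
  proof (rule spansI)
    fix g assume g: "g \<in> carrier G"
    define i j where "i = B2 v g" and "j = (B1 v g \<noteq> B2 v g)"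
    define h where "h = g \<otimes> (pw i x \<otimes> pw j y)"
    have h: "h \<in> carrier G" "\<not> B1 v h" "\<not> B2 v h" using g x y uv by (auto simp: h_def i_def j_def bool_simps)
    then have "\<not> B1 h u" "\<not> B2 h u" "\<not> B1 h v" "\<not> B2 h v"
      using centralizer_abelian[of v h u] B_sym[of v h] uv vu by auto
    then have "\<not> q1 (h \<otimes> (pw (q2 h) u \<otimes> pw (q1 h) v)) \<and> \<not> q2 (h \<otimes> (pw (q2 h) u \<otimes> pw (q1 h) v))"
      using h uv by (simp add: bool_simps)
    then show "\<exists>i j k l. \<not> q1 (g \<otimes> (pw i x \<otimes> (pw j y \<otimes> (pw k u \<otimes> pw l v)))) \<and> \<not> q2 (g \<otimes> (pw i x \<otimes> (pw j y \<otimes> (pw k u \<otimes> pw l v))))"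
      unfolding h_def using g x(1) y(1) uv(1,2) by (metis m_assoc m_closed pw_closed)
  qed (use x y uv in auto)
  show thesis
    by (rule that[of x y u v]) (use x y uv sym sp in \<open>simp_all add: sq_S cm_S S_simps\<close>)
qed

end

section \<open>Groups given by generators and relations\<close>

lemma word_eq_words: "word_eq S R u v \<Longrightarrow> u \<in> words S \<and> v \<in> words S"
  by (induction rule: word_eq.induct) (auto simp: words_def)

lemma words_append [simp]: "u @ v \<in> words S \<longleftrightarrow> u \<in> words S \<and> v \<in> words S"
  by (auto simp: words_def)

lemma words_Nil [simp]: "[] \<in> words S"
  by (simp add: words_def)

lemma word_inv_words [simp]: "w \<in> words S \<Longrightarrow> word_inv w \<in> words S"
  by (auto simp: words_def word_inv_def)

lemma word_eq_context:
  assumes "word_eq S R u v" "a \<in> words S" "b \<in> words S"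
  shows "word_eq S R (a @ u @ b) (a @ v @ b)"
  using assms
proof (induction rule: word_eq.induct)
  case (refl w)
  then show ?case by (simp add: word_eq.refl)
next
  case (sym v w)
  then show ?case using word_eq.sym by blast
next
  case (trans u v w)
  then show ?case using word_eq.trans by blast
next
  case (cancel u v x e)
  then show ?case using word_eq.cancel[of "a @ u" S "v @ b" x R e] by simp
next
  case (rel u v l r)
  then show ?case using word_eq.rel[of "a @ u" S "v @ b" l r R] by simp
qed

lemma word_eq_append:
  assumes "word_eq S R u u'" "word_eq S R v v'"
  shows "word_eq S R (u @ v) (u' @ v')"
  using word_eq_context[OF assms(1), of "[]" v] word_eq_context[OF assms(2), of u' "[]"]
    word_eq_words[OF assms(1)] word_eq_words[OF assms(2)]
  by (auto elim: word_eq.trans)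

lemma word_class_eq_iff:
  assumes "u \<in> words S"
  shows "word_class S R u = word_class S R v \<longleftrightarrow> word_eq S R u v"
proof
  assume "word_class S R u = word_class S R v"
  then have "u \<in> word_class S R v" using word_eq.refl[OF assms] by (auto simp: word_class_def)
  then have "word_eq S R v u" by (simp add: word_class_def)
  then show "word_eq S R u v" by (rule word_eq.sym)
next
  assume uv: "word_eq S R u v"
  have "word_eq S R u w \<longleftrightarrow> word_eq S R v w" for w
    using word_eq.trans[OF uv, of w] word_eq.trans[OF word_eq.sym[OF uv], of w] by blast
  then show "word_class S R u = word_class S R v"
    by (simp add: word_class_def)
qed

lemma presented_group_mult:
  assumes "u \<in> words S" "v \<in> words S"
  shows "word_class S R u \<otimes>\<^bsub>presented_group S R\<^esub> word_class S R v = word_class S R (u @ v)"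
proof -
  have eq: "word_class S R (u' @ v') = word_class S R (u @ v)"
    if "u' \<in> word_class S R u" "v' \<in> word_class S R v" for u' v'
    using word_eq_append[of S R u u' v v'] word_class_eq_iff[of "u @ v" S R "u' @ v'"] assms that by (simp add: word_class_def)
  have ne: "u \<in> word_class S R u" "v \<in> word_class S R v"
    using assms by (simp_all add: word_class_def word_eq.refl)
  have "(\<Union>u' \<in> word_class S R u. \<Union>v' \<in> word_class S R v. word_class S R (u' @ v')) = word_class S R (u @ v)"
  proof (intro subset_antisym subsetI)
    fix x assume "x \<in> (\<Union>u' \<in> word_class S R u. \<Union>v' \<in> word_class S R v. word_class S R (u' @ v'))"
    then obtain u' v' where "u' \<in> word_class S R u" "v' \<in> word_class S R v" "x \<in> word_class S R (u' @ v')" by blast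
    then show "x \<in> word_class S R (u @ v)" using eq by simp
  qed (use ne in blast)
  then show ?thesis by (simp add: presented_group_def)
qed

lemma word_inv_left:
  assumes "w \<in> words S"
  shows "word_eq S R (word_inv w @ w) []"
  using assms
proof (induction w)
  case Nil
  then show ?case by (simp add: word_inv_def word_eq.refl)
next
  case (Cons a w)
  obtain x e where a: "a = (x, e)" by fastforce
  have w: "w \<in> words S" "x \<in> S" using Cons a by (auto simp: words_def)
  have "word_eq S R (word_inv w @ [(x, \<not> e), (x, \<not> \<not> e)] @ w) (word_inv w @ w)"
    by (rule word_eq.cancel) (use w in simp_all)
  then have "word_eq S R (word_inv w @ [(x, \<not> e), (x, \<not> \<not> e)] @ w) []"
    using Cons.IH[OF w(1)] by (rule word_eq.trans)
  then show ?case by (simp add: a word_inv_def)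
qed

lemma presented_group_carrier: "carrier (presented_group S R) = word_class S R ` words S"
  and presented_group_one: "\<one>\<^bsub>presented_group S R\<^esub> = word_class S R []"
  by (simp_all add: presented_group_def)

lemma group_presented_group: "group (presented_group S R)"
proof (rule groupI)
  let ?P = "presented_group S R"
  show "x \<otimes>\<^bsub>?P\<^esub> y \<in> carrier ?P" if "x \<in> carrier ?P" "y \<in> carrier ?P" for x y
    using that by (auto simp: presented_group_carrier presented_group_mult)
  show "\<one>\<^bsub>?P\<^esub> \<in> carrier ?P"
    by (simp add: presented_group_carrier presented_group_one)
  show "x \<otimes>\<^bsub>?P\<^esub> y \<otimes>\<^bsub>?P\<^esub> z = x \<otimes>\<^bsub>?P\<^esub> (y \<otimes>\<^bsub>?P\<^esub> z)"
    if "x \<in> carrier ?P" "y \<in> carrier ?P" "z \<in> carrier ?P" for x y z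
    using that by (auto simp: presented_group_carrier presented_group_mult)
  show "\<one>\<^bsub>?P\<^esub> \<otimes>\<^bsub>?P\<^esub> x = x" if "x \<in> carrier ?P" for x
    using that by (auto simp: presented_group_carrier presented_group_one presented_group_mult)
  show "\<exists>y\<in>carrier ?P. y \<otimes>\<^bsub>?P\<^esub> x = \<one>\<^bsub>?P\<^esub>" if x: "x \<in> carrier ?P" for x
  proof -
    obtain w where w: "w \<in> words S" "x = word_class S R w" using x by (auto simp: presented_group_carrier)
    have "word_class S R (word_inv w @ w) = word_class S R []"
      using word_inv_left[OF w(1), of R] word_class_eq_iff[of "word_inv w @ w" S R "[]"] w by simp
    then show ?thesis using w
      by (intro bexI[of _ "word_class S R (word_inv w)"]) (auto simp: presented_group_carrier presented_group_one presented_group_mult)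
  qed
qed

definition eval_word :: "('g, 'm) monoid_scheme \<Rightarrow> ('x \<Rightarrow> 'g) \<Rightarrow> 'x word \<Rightarrow> 'g"
  where "eval_word G f w = foldr (\<lambda>(x, e) g. (if e then f x else inv\<^bsub>G\<^esub> f x) \<otimes>\<^bsub>G\<^esub> g) w \<one>\<^bsub>G\<^esub>"

lemma eval_word_Nil [simp]: "eval_word G f [] = \<one>\<^bsub>G\<^esub>"
  and eval_word_Cons [simp]: "eval_word G f ((x, e) # w) = (if e then f x else inv\<^bsub>G\<^esub> f x) \<otimes>\<^bsub>G\<^esub> eval_word G f w"
  by (simp_all add: eval_word_def)

context group
begin

lemma eval_word_closed:
  assumes "f ` S \<subseteq> carrier G" "w \<in> words S"
  shows "eval_word G f w \<in> carrier G"
  using assms(2)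
proof (induction w)
  case (Cons a w)
  then show ?case using assms(1) by (cases a) (auto simp: words_def)
qed simp

lemma eval_word_append:
  assumes f: "f ` S \<subseteq> carrier G" and "v \<in> words S" and w: "w \<in> words S"
  shows "eval_word G f (v @ w) = eval_word G f v \<otimes> eval_word G f w"
  using assms(2)
proof (induction v)
  case Nil
  then show ?case using eval_word_closed[OF f w] by simp
next
  case (Cons a v)
  obtain x e where a: "a = (x, e)" by fastforce
  have v: "v \<in> words S" "x \<in> S" using Cons a by (auto simp: words_def)
  then have "f x \<in> carrier G" using f by auto
  then show ?case using Cons.IH v eval_word_closed[OF f v(1)] eval_word_closed[OF f w]
    by (simp add: a m_assoc)
qed

lemma eval_word_eq:
  assumes f: "f ` S \<subseteq> carrier G" and R: "\<And>l r. (l, r) \<in> R \<Longrightarrow> eval_word G f l = eval_word G f r"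
    and "word_eq S R u v"
  shows "eval_word G f u = eval_word G f v"
  using assms(3)
proof (induction rule: word_eq.induct)
  case (cancel u v x e)
  have x: "f x \<in> carrier G" using f cancel by auto
  have c: "[(x, e), (x, \<not> e)] \<in> words S" using cancel by (simp add: words_def)
  have "eval_word G f [(x, e), (x, \<not> e)] = \<one>" using x by (cases e) simp_all
  then show ?case using cancel c eval_word_append[OF f] eval_word_closed[OF f]
    by (simp del: append_Cons)
next
  case (rel u v l r)
  then show ?case using R[of l r] eval_word_append[OF f] eval_word_closed[OF f] by simp
qed auto

text \<open>Von Dyck's theorem. The map evaluates an arbitrary representative of a class, which is
  legitimate by \<open>eval_word_eq\<close>.\<close>

theorem presented_group_hom:
  assumes f: "f ` S \<subseteq> carrier G" and R: "\<And>l r. (l, r) \<in> R \<Longrightarrow> eval_word G f l = eval_word G f r"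
  obtains \<psi> where "\<psi> \<in> hom (presented_group S R) G" "\<And>w. w \<in> words S \<Longrightarrow> \<psi> (word_class S R w) = eval_word G f w"
proof -
  define \<psi> where "\<psi> A = eval_word G f (SOME w. w \<in> A)" for A
  have \<psi>: "\<psi> (word_class S R w) = eval_word G f w" if w: "w \<in> words S" for w
  proof -
    have "w \<in> word_class S R w" using w by (simp add: word_class_def word_eq.refl)
    then have "(SOME v. v \<in> word_class S R w) \<in> word_class S R w" by (rule someI)
    then have "word_eq S R w (SOME v. v \<in> word_class S R w)" by (simp add: word_class_def)
    then show ?thesis using eval_word_eq[OF f R] by (simp add: \<psi>_def)
  qed
  have "\<psi> \<in> hom (presented_group S R) G"
    by (rule homI) (auto simp: presented_group_carrier presented_group_mult \<psi> eval_word_append[OF f] eval_word_closed[OF f])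
  then show thesis using \<psi> that by blast
qed

end

text \<open>Turns statements about classes of words into equations between group elements, so that
  the defining relations become available to the simplifier.\<close>

lemma presented_group_eval:
  assumes "w \<in> words S"
  shows "eval_word (presented_group S R) (\<lambda>x. word_class S R (gen x)) w = word_class S R w"
proof -
  interpret P: group "presented_group S R" by (rule group_presented_group)
  show ?thesis
    using assms
  proof (induction w)
    case Nil
    then show ?case by (simp add: presented_group_one)
  next
    case (Cons a w)
    obtain x e where a: "a = (x, e)" by fastforce
    have w: "w \<in> words S" "x \<in> S" using Cons a by (auto simp: words_def)
    have g: "[(x, b)] \<in> words S" for b using w by (simp add: words_def)
    have "word_class S R [(x, False)] \<otimes>\<^bsub>presented_group S R\<^esub> word_class S R [(x, True)] = \<one>\<^bsub>presented_group S R\<^esub>"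
      using g word_eq.cancel[of "[]" S "[]" x R False] word_class_eq_iff[of "[(x, False), (x, True)]" S R "[]"] w
      by (simp add: presented_group_mult presented_group_one words_def)
    then have "inv\<^bsub>presented_group S R\<^esub> word_class S R [(x, True)] = word_class S R [(x, False)]"
      using g by (intro P.inv_equality) (auto simp: presented_group_carrier)
    then show ?case using Cons.IH w g by (cases e) (simp_all add: a gen_def presented_group_mult)
  qed
qed

lemma presented_group_relation:
  assumes "(l, r) \<in> R" "l \<in> words S" "r \<in> words S"
  shows "eval_word (presented_group S R) (\<lambda>x. word_class S R (gen x)) l =
    eval_word (presented_group S R) (\<lambda>x. word_class S R (gen x)) r"
  using word_eq.rel[of "[]" S "[]" l r R] assms word_class_eq_iff[of l S R r] by (simp add: presented_group_eval)

section \<open>Cocycle models of the exceptional groups\<close>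

type_synonym vec4 = "bool \<times> bool \<times> bool \<times> bool"
type_synonym mat4 = "vec4 \<times> vec4 \<times> vec4 \<times> vec4"

fun vadd :: "vec4 \<Rightarrow> vec4 \<Rightarrow> vec4" where
  "vadd (a, b, c, d) (a', b', c', d') = (a \<noteq> a', b \<noteq> b', c \<noteq> c', d \<noteq> d')"

fun dot4 :: "vec4 \<Rightarrow> vec4 \<Rightarrow> bool" where
  "dot4 (a, b, c, d) (a', b', c', d') \<longleftrightarrow> ((a \<and> a') \<noteq> ((b \<and> b') \<noteq> ((c \<and> c') \<noteq> (d \<and> d'))))"

fun bilinear4 :: "mat4 \<Rightarrow> vec4 \<Rightarrow> vec4 \<Rightarrow> bool" where
  "bilinear4 (r1, r2, r3, r4) v w = dot4 v (dot4 r1 w, dot4 r2 w, dot4 r3 w, dot4 r4 w)"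

lemma and_xor: "(a \<and> (b \<noteq> c)) = ((a \<and> b) \<noteq> (a \<and> c))" "((b \<noteq> c) \<and> a) = ((b \<and> a) \<noteq> (c \<and> a))" for a b c :: bool
  by argo+

lemma dot4_vadd: "dot4 u (vadd v w) = (dot4 u v \<noteq> dot4 u w)" "dot4 (vadd v w) u = (dot4 v u \<noteq> dot4 w u)"
  by (cases u; cases v; cases w; simp only: dot4.simps vadd.simps and_xor; argo)+

lemma bilinear4_vadd:
  "bilinear4 M u (vadd v w) = (bilinear4 M u v \<noteq> bilinear4 M u w)"
  "bilinear4 M (vadd v w) u = (bilinear4 M v u \<noteq> bilinear4 M w u)"
proof -
  obtain r1 r2 r3 r4 where M: "M = (r1, r2, r3, r4)" by (metis prod.exhaust)
  have "(dot4 r1 (vadd v w), dot4 r2 (vadd v w), dot4 r3 (vadd v w), dot4 r4 (vadd v w)) =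
    vadd (dot4 r1 v, dot4 r2 v, dot4 r3 v, dot4 r4 v) (dot4 r1 w, dot4 r2 w, dot4 r3 w, dot4 r4 w)"
    by (simp only: dot4_vadd vadd.simps)
  then show "bilinear4 M u (vadd v w) = (bilinear4 M u v \<noteq> bilinear4 M u w)"
    unfolding M bilinear4.simps by (simp only: dot4_vadd)
  show "bilinear4 M (vadd v w) u = (bilinear4 M v u \<noteq> bilinear4 M w u)"
    unfolding M bilinear4.simps by (simp only: dot4_vadd)
qed

abbreviation "zero4 \<equiv> (False, False, False, False)"

lemma vadd_simps [simp]: "vadd v zero4 = v" "vadd zero4 v = v" "vadd v v = zero4"
  by (cases v; simp)+

lemma vadd_assoc: "vadd (vadd u v) w = vadd u (vadd v w)"
  by (cases u; cases v; cases w; simp; argo)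

lemma bilinear4_zero [simp]: "\<not> bilinear4 M v zero4" "\<not> bilinear4 M zero4 v"
  using bilinear4_vadd[of M v zero4 zero4] bilinear4_vadd(2)[of M zero4 zero4 v] by simp_all

text \<open>
  The central extension of the vectors of length 4 by two bits whose cocycle is given by the matrices
  \<open>T1\<close> and \<open>T2\<close>. The squares in it are the values of these forms on the diagonal.
  The flags \<open>m3\<close>, \<open>m4\<close> and \<open>mz\<close> say whether the third and fourth generator and the second
  coordinate of the central part are present.
\<close>

fun masked :: "bool \<Rightarrow> bool \<Rightarrow> vec4 \<Rightarrow> bool" where
  "masked m3 m4 (a, b, c, d) \<longleftrightarrow> (c \<longrightarrow> m3) \<and> (d \<longrightarrow> m4)"

lemma masked_vadd: "masked m3 m4 v \<Longrightarrow> masked m3 m4 w \<Longrightarrow> masked m3 m4 (vadd v w)"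
  by (cases v; cases w) auto

definition cocycle_group :: "mat4 \<Rightarrow> mat4 \<Rightarrow> bool \<Rightarrow> bool \<Rightarrow> bool \<Rightarrow> (vec4 \<times> bool \<times> bool) monoid" where
  "cocycle_group T1 T2 m3 m4 mz =
    \<lparr>carrier = {(v, z1, z2). masked m3 m4 v \<and> (z2 \<longrightarrow> mz)},
     monoid.mult = (\<lambda>(v, z1, z2) (w, y1, y2). (vadd v w, (z1 \<noteq> y1) \<noteq> bilinear4 T1 v w, (z2 \<noteq> y2) \<noteq> bilinear4 T2 v w)),
     one = (zero4, False, False)\<rparr>"

lemma cocycle_group_simps [simp]:
  "(v, z1, z2) \<in> carrier (cocycle_group T1 T2 m3 m4 mz) \<longleftrightarrow> masked m3 m4 v \<and> (z2 \<longrightarrow> mz)"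
  "(v, z1, z2) \<otimes>\<^bsub>cocycle_group T1 T2 m3 m4 mz\<^esub> (w, y1, y2) =
    (vadd v w, (z1 \<noteq> y1) \<noteq> bilinear4 T1 v w, (z2 \<noteq> y2) \<noteq> bilinear4 T2 v w)"
  "\<one>\<^bsub>cocycle_group T1 T2 m3 m4 mz\<^esub> = (zero4, False, False)"
  by (simp_all add: cocycle_group_def)

text \<open>When the second central bit is absent, the second form has to vanish, or products would
  leave the carrier.\<close>

locale cocycle =
  fixes T1 T2 :: mat4 and m3 m4 mz :: bool
  assumes mz: "mz \<or> (\<forall>v w. \<not> bilinear4 T2 v w)"
begin

lemma mzD: "bilinear4 T2 v w \<Longrightarrow> mz"
  using mz by blast

abbreviation "M \<equiv> cocycle_group T1 T2 m3 m4 mz"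

lemma carrierE:
  assumes "g \<in> carrier M"
  obtains v z1 z2 where "g = (v, z1, z2)" "masked m3 m4 v" "z2 \<longrightarrow> mz"
  using assms by (cases g) auto

text \<open>A bilinear form is a 2-cocycle: associativity is bilinearity of the two forms. An
  inverse differs from its element only by the diagonal values.\<close>

lemma group_M: "group M"
proof (rule groupI)
  show "g \<otimes>\<^bsub>M\<^esub> h \<in> carrier M" if "g \<in> carrier M" "h \<in> carrier M" for g h
    using that by (elim carrierE) (auto simp: masked_vadd dest: mzD)
  show "\<one>\<^bsub>M\<^esub> \<in> carrier M" by simp
  show "g \<otimes>\<^bsub>M\<^esub> h \<otimes>\<^bsub>M\<^esub> k = g \<otimes>\<^bsub>M\<^esub> (h \<otimes>\<^bsub>M\<^esub> k)"
    if "g \<in> carrier M" "h \<in> carrier M" "k \<in> carrier M" for g h k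
    using that by (elim carrierE) (simp only: cocycle_group_simps vadd_assoc bilinear4_vadd prod.inject, argo)
  show "\<one>\<^bsub>M\<^esub> \<otimes>\<^bsub>M\<^esub> g = g" if "g \<in> carrier M" for g
    using that by (elim carrierE) simp
  show "\<exists>h\<in>carrier M. h \<otimes>\<^bsub>M\<^esub> g = \<one>\<^bsub>M\<^esub>" if g: "g \<in> carrier M" for g
  proof -
    obtain v z1 z2 where v: "g = (v, z1, z2)" "masked m3 m4 v" "z2 \<longrightarrow> mz" using g by (rule carrierE)
    show ?thesis using v mzD[of v v]
      by (intro bexI[of _ "(v, z1 \<noteq> bilinear4 T1 v v, z2 \<noteq> bilinear4 T2 v v)"]) auto
  qed
qed

sublocale M: group M by (rule group_M)

lemma inv_M: "(v, z1, z2) \<in> carrier M \<Longrightarrow>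
    inv\<^bsub>M\<^esub> (v, z1, z2) = (v, z1 \<noteq> bilinear4 T1 v v, z2 \<noteq> bilinear4 T2 v v)"
  using mzD[of v v] by (intro M.inv_equality) auto

end

section \<open>Normal forms when squares and commutators are central\<close>

definition bpow :: "('g, 'm) monoid_scheme \<Rightarrow> bool \<Rightarrow> 'g \<Rightarrow> 'g" where
  "bpow G b x = (if b then x else \<one>\<^bsub>G\<^esub>)"

text \<open>Normal forms are indexed by elements of the cocycle models, so that a homomorphism into
  a model can be compared with the index itself.\<close>

definition nform :: "('g, 'm) monoid_scheme \<Rightarrow> 'g \<Rightarrow> 'g \<Rightarrow> 'g \<Rightarrow> 'g \<Rightarrow> 'g \<Rightarrow> 'g \<Rightarrow> vec4 \<times> bool \<times> bool \<Rightarrow> 'g" where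
  "nform G x1 x2 x3 x4 s t = (\<lambda>((a, b, c, d), z1, z2).
    bpow G a x1 \<otimes>\<^bsub>G\<^esub> (bpow G b x2 \<otimes>\<^bsub>G\<^esub> (bpow G c x3 \<otimes>\<^bsub>G\<^esub> (bpow G d x4 \<otimes>\<^bsub>G\<^esub> (bpow G z1 s \<otimes>\<^bsub>G\<^esub> bpow G z2 t)))))"

context group
begin

lemma bpow_closed [simp]: "x \<in> carrier G \<Longrightarrow> bpow G b x \<in> carrier G"
  by (simp add: bpow_def)

lemma nform_closed [simp]:
  assumes "x1 \<in> carrier G" "x2 \<in> carrier G" "x3 \<in> carrier G" "x4 \<in> carrier G" "s \<in> carrier G" "t \<in> carrier G"
  shows "nform G x1 x2 x3 x4 s t g \<in> carrier G"
  using assms by (cases g) (auto simp: nform_def)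

text \<open>As \<open>x^2\<close> lies in \<open>A\<close> and elements of \<open>A\<close> commute
  with \<open>x\<close> modulo \<open>C\<close>, the union of \<open>A\<close> and \<open>xA\<close>
  is closed. The last claim transfers commutation modulo \<open>C\<close> to the larger subgroup,
  ready for the next generator.\<close>

lemma central_extension_step:
  assumes A: "subgroup A G" and C: "subgroup C G" "C \<subseteq> A" and cen: "\<And>c g. c \<in> C \<Longrightarrow> g \<in> carrier G \<Longrightarrow> c \<otimes> g = g \<otimes> c"
    and x: "x \<in> carrier G" "x \<otimes> x \<in> C" and nc: "\<And>a. a \<in> A \<Longrightarrow> \<exists>c\<in>C. a \<otimes> x = x \<otimes> a \<otimes> c"
  defines "A' \<equiv> {bpow G i x \<otimes> a | i a. a \<in> A}"
  shows "subgroup A' G" "A \<subseteq> A'"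
    "\<And>y. y \<in> carrier G \<Longrightarrow> (\<And>a. a \<in> A \<Longrightarrow> \<exists>c\<in>C. a \<otimes> y = y \<otimes> a \<otimes> c) \<Longrightarrow> \<exists>c\<in>C. x \<otimes> y = y \<otimes> x \<otimes> c \<Longrightarrow>
      a \<in> A' \<Longrightarrow> \<exists>c\<in>C. a \<otimes> y = y \<otimes> a \<otimes> c"
proof -
  interpret A: subgroup A G by (rule A)
  interpret C: subgroup C G by (rule C)
  have A'I: "a \<in> A \<Longrightarrow> a \<in> A'" "a \<in> A \<Longrightarrow> x \<otimes> a \<in> A'" for a
    unfolding A'_def
    by (rule CollectI, rule exI[of _ False], rule exI[of _ a], simp add: bpow_def)
       (rule CollectI, rule exI[of _ True], rule exI[of _ a], simp add: bpow_def)
  have A'E: "\<exists>a \<in> A. g = a \<or> g = x \<otimes> a" if "g \<in> A'" for g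
    using that unfolding A'_def bpow_def by auto
  show "A \<subseteq> A'" using A'I by auto
  have mult: "g \<otimes> h \<in> A'" if g: "g \<in> A'" and h: "h \<in> A'" for g h
  proof -
    obtain a b where a: "a \<in> A" "g = a \<or> g = x \<otimes> a" and b: "b \<in> A" "h = b \<or> h = x \<otimes> b" using A'E g h by blast
    obtain c where c: "c \<in> C" "a \<otimes> x = x \<otimes> a \<otimes> c" using nc a by blast
    have cA: "c \<in> A" "x \<otimes> x \<in> A" "c \<in> carrier G" using c x C by auto
    have ax: "a \<otimes> (x \<otimes> b) = x \<otimes> (a \<otimes> c \<otimes> b)" using c x a b cA by (simp add: m_assoc[symmetric])
    have "x \<otimes> a \<otimes> (x \<otimes> b) = x \<otimes> (a \<otimes> (x \<otimes> b))" using x a b by (simp add: m_assoc)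
    also have "\<dots> = (x \<otimes> x) \<otimes> (a \<otimes> c \<otimes> b)" unfolding ax using x a b cA by (simp add: m_assoc)
    finally have xaxb: "x \<otimes> a \<otimes> (x \<otimes> b) = (x \<otimes> x) \<otimes> (a \<otimes> c \<otimes> b)" .
    have xab: "x \<otimes> a \<otimes> b = x \<otimes> (a \<otimes> b)" using x a b by (simp add: m_assoc)
    from a(2) b(2) show ?thesis
      by (elim disjE) (simp_all only: ax xaxb xab, use A'I a b cA in auto)
  qed
  show "subgroup A' G"
  proof
    show "A' \<subseteq> carrier G" unfolding A'_def using x by auto
    show "\<one> \<in> A'" using A'I by auto
    show "g \<otimes> h \<in> A'" if "g \<in> A'" "h \<in> A'" for g h using mult that .
    fix g assume "g \<in> A'"
    then obtain a where a: "a \<in> A" "g = a \<or> g = x \<otimes> a" using A'E by blast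
    have "inv x = x \<otimes> inv (x \<otimes> x)" using x by (simp add: inv_mult_group m_assoc[symmetric])
    moreover have "inv (x \<otimes> x) \<in> A" using x C by auto
    ultimately have "inv x \<in> A'" using A'I by simp
    then have "inv a \<otimes> inv x \<in> A'" using mult A'I a by auto
    then show "inv g \<in> A'" using a A'I x by (auto simp: inv_mult_group)
  qed
  fix y assume y: "y \<in> carrier G" and ay: "\<And>a. a \<in> A \<Longrightarrow> \<exists>c\<in>C. a \<otimes> y = y \<otimes> a \<otimes> c"
    and xy: "\<exists>c\<in>C. x \<otimes> y = y \<otimes> x \<otimes> c" and "a \<in> A'"
  then obtain b where b: "b \<in> A" "a = b \<or> a = x \<otimes> b" using A'E by blast
  obtain c where c: "c \<in> C" "b \<otimes> y = y \<otimes> b \<otimes> c" using ay b by blast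
  obtain d where d: "d \<in> C" "x \<otimes> y = y \<otimes> x \<otimes> d" using xy by blast
  have G: "b \<in> carrier G" "c \<in> carrier G" "d \<in> carrier G" using b c d by auto
  have "x \<otimes> b \<otimes> y = x \<otimes> y \<otimes> (b \<otimes> c)" using c(2) x y G by (simp add: m_assoc)
  also have "\<dots> = y \<otimes> x \<otimes> (d \<otimes> b) \<otimes> c" using d(2) x y G by (simp add: m_assoc)
  also have "d \<otimes> b = b \<otimes> d" using cen d G by blast
  finally have "x \<otimes> b \<otimes> y = y \<otimes> (x \<otimes> b) \<otimes> (d \<otimes> c)" using x y G by (simp add: m_assoc)
  then show "\<exists>c\<in>C. a \<otimes> y = y \<otimes> a \<otimes> c" using b c d by blast
qed

lemma nform_subgroup:
  assumes x: "x1 \<in> carrier G" "x2 \<in> carrier G" "x3 \<in> carrier G" "x4 \<in> carrier G"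
    and st: "s \<in> carrier G" "t \<in> carrier G" "s \<otimes> s = \<one>" "t \<otimes> t = \<one>"
    and cen: "\<And>g. g \<in> carrier G \<Longrightarrow> s \<otimes> g = g \<otimes> s" "\<And>g. g \<in> carrier G \<Longrightarrow> t \<otimes> g = g \<otimes> t"
  defines "C \<equiv> {\<one>, s, t, s \<otimes> t}"
  assumes sq: "x1 \<otimes> x1 \<in> C" "x2 \<otimes> x2 \<in> C" "x3 \<otimes> x3 \<in> C" "x4 \<otimes> x4 \<in> C"
    and cm: "\<exists>c\<in>C. x2 \<otimes> x1 = x1 \<otimes> x2 \<otimes> c" "\<exists>c\<in>C. x3 \<otimes> x1 = x1 \<otimes> x3 \<otimes> c" "\<exists>c\<in>C. x4 \<otimes> x1 = x1 \<otimes> x4 \<otimes> c"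
      "\<exists>c\<in>C. x3 \<otimes> x2 = x2 \<otimes> x3 \<otimes> c" "\<exists>c\<in>C. x4 \<otimes> x2 = x2 \<otimes> x4 \<otimes> c" "\<exists>c\<in>C. x4 \<otimes> x3 = x3 \<otimes> x4 \<otimes> c"
  shows "subgroup (range (nform G x1 x2 x3 x4 s t)) G" "{x1, x2, x3, x4} \<subseteq> range (nform G x1 x2 x3 x4 s t)"
proof -
  have stst: "s \<otimes> (s \<otimes> t) = t" "t \<otimes> (s \<otimes> t) = s" "s \<otimes> t \<otimes> s = t" "s \<otimes> t \<otimes> t = s" "t \<otimes> s = s \<otimes> t" "s \<otimes> t \<otimes> (s \<otimes> t) = \<one>"
  proof -
    show c: "t \<otimes> s = s \<otimes> t" using cen(2)[OF st(1)] .
    show a: "s \<otimes> (s \<otimes> t) = t" using st by (simp flip: m_assoc)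
    show b: "s \<otimes> t \<otimes> t = s" using st by (simp add: m_assoc)
    show "t \<otimes> (s \<otimes> t) = s" using cen(2)[of "s \<otimes> t"] st b by simp
    show "s \<otimes> t \<otimes> s = t" using cen(1)[of "s \<otimes> t"] st a by simp
    show "s \<otimes> t \<otimes> (s \<otimes> t) = \<one>" using st a b c by (metis m_assoc m_closed)
  qed
  have cenC: "c \<otimes> g = g \<otimes> c" if "c \<in> C" "g \<in> carrier G" for c g
    using that cen[OF that(2)] st unfolding C_def by (elim insertE emptyE) (simp_all, metis m_assoc)
  have C: "subgroup C G"
  proof
    show "C \<subseteq> carrier G" using st by (auto simp: C_def)
    show "\<one> \<in> C" by (simp add: C_def)
    show "a \<otimes> b \<in> C" if "a \<in> C" "b \<in> C" for a b
      using that st stst unfolding C_def by (elim insertE emptyE) simp_all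
    show "inv a \<in> C" if "a \<in> C" for a
    proof -
      have "a \<in> carrier G" "a \<otimes> a = \<one>" using that st stst unfolding C_def by (elim insertE emptyE; simp)+
      then show ?thesis using that inv_equality by metis
    qed
  qed
  have Cn: "\<exists>c\<in>C. a \<otimes> x = x \<otimes> a \<otimes> c" if "a \<in> C" "x \<in> carrier G" for a x
    using cenC[OF that] that st by (intro bexI[of _ \<one>]) (auto simp: C_def)
  \<comment> \<open>The subgroup grows from the right end of the normal form, each generator being
    adjoined on the left.\<close>
  define A4 where "A4 = {bpow G i x4 \<otimes> a | i a. a \<in> C}"
  define A3 where "A3 = {bpow G i x3 \<otimes> a | i a. a \<in> A4}"
  define A2 where "A2 = {bpow G i x2 \<otimes> a | i a. a \<in> A3}"
  define A1 where "A1 = {bpow G i x1 \<otimes> a | i a. a \<in> A2}"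
  note s4 = central_extension_step[OF C C subset_refl cenC x(4) sq(4) Cn[OF _ x(4)], folded A4_def]
  have n43: "\<And>a. a \<in> A4 \<Longrightarrow> \<exists>c\<in>C. a \<otimes> x3 = x3 \<otimes> a \<otimes> c" and n42: "\<And>a. a \<in> A4 \<Longrightarrow> \<exists>c\<in>C. a \<otimes> x2 = x2 \<otimes> a \<otimes> c"
    and n41: "\<And>a. a \<in> A4 \<Longrightarrow> \<exists>c\<in>C. a \<otimes> x1 = x1 \<otimes> a \<otimes> c"
    using s4(3) Cn x cm by blast+
  note s3 = central_extension_step[OF s4(1) C s4(2) cenC x(3) sq(3) n43, folded A3_def]
  have n32: "\<And>a. a \<in> A3 \<Longrightarrow> \<exists>c\<in>C. a \<otimes> x2 = x2 \<otimes> a \<otimes> c" and n31: "\<And>a. a \<in> A3 \<Longrightarrow> \<exists>c\<in>C. a \<otimes> x1 = x1 \<otimes> a \<otimes> c"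
    using s3(3) n42 n41 x cm by blast+
  have C3: "C \<subseteq> A3" using s4(2) s3(2) by blast
  note s2 = central_extension_step[OF s3(1) C C3 cenC x(2) sq(2) n32, folded A2_def]
  have n21: "\<And>a. a \<in> A2 \<Longrightarrow> \<exists>c\<in>C. a \<otimes> x1 = x1 \<otimes> a \<otimes> c"
    using s2(3) n31 x cm by blast
  have C2: "C \<subseteq> A2" using C3 s2(2) by blast
  note s1 = central_extension_step[OF s2(1) C C2 cenC x(1) sq(1) n21, folded A1_def]
  have CC: "C = {bpow G z1 s \<otimes> bpow G z2 t | z1 z2. True}"
  proof -
    have "{bpow G z1 s \<otimes> bpow G z2 t | z1 z2. True} = (\<lambda>(z1, z2). bpow G z1 s \<otimes> bpow G z2 t) ` UNIV" by auto
    also have "(UNIV :: (bool \<times> bool) set) = {(False, False), (True, False), (False, True), (True, True)}" by auto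
    finally show ?thesis using st by (auto simp: C_def bpow_def)
  qed
  have "g \<in> A1 \<longleftrightarrow> (\<exists>a b c d z1 z2. g = bpow G a x1 \<otimes> (bpow G b x2 \<otimes> (bpow G c x3 \<otimes> (bpow G d x4 \<otimes> (bpow G z1 s \<otimes> bpow G z2 t)))))" for g
  proof -
    have c: "a \<in> C \<longleftrightarrow> (\<exists>z1 z2. a = bpow G z1 s \<otimes> bpow G z2 t)" for a unfolding CC by blast
    have 4: "a \<in> A4 \<longleftrightarrow> (\<exists>d z1 z2. a = bpow G d x4 \<otimes> (bpow G z1 s \<otimes> bpow G z2 t))" for a
      unfolding A4_def mem_Collect_eq c by blast
    have 3: "a \<in> A3 \<longleftrightarrow> (\<exists>c d z1 z2. a = bpow G c x3 \<otimes> (bpow G d x4 \<otimes> (bpow G z1 s \<otimes> bpow G z2 t)))" for a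
      unfolding A3_def mem_Collect_eq 4 by blast
    have 2: "a \<in> A2 \<longleftrightarrow> (\<exists>b c d z1 z2. a = bpow G b x2 \<otimes> (bpow G c x3 \<otimes> (bpow G d x4 \<otimes> (bpow G z1 s \<otimes> bpow G z2 t))))" for a
      unfolding A2_def mem_Collect_eq 3 by blast
    show ?thesis unfolding A1_def mem_Collect_eq 2 by blast
  qed
  moreover have "g \<in> range (nform G x1 x2 x3 x4 s t) \<longleftrightarrow> (\<exists>a b c d z1 z2. g = bpow G a x1 \<otimes> (bpow G b x2 \<otimes> (bpow G c x3 \<otimes> (bpow G d x4 \<otimes> (bpow G z1 s \<otimes> bpow G z2 t)))))" for g
    unfolding image_iff bex_UNIV nform_def split_paired_Ex prod.case by simp
  ultimately have A1: "A1 = range (nform G x1 x2 x3 x4 s t)" by blast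
  then show "subgroup (range (nform G x1 x2 x3 x4 s t)) G" using s1(1) by simp
  have e: "\<one> \<in> C" by (simp add: C_def)
  have I: "x \<in> {bpow G i x \<otimes> a | i a. a \<in> A}" if "x \<in> carrier G" "\<one> \<in> A" for x A
    using that by (intro CollectI exI[of _ True] exI[of _ \<one>]) (simp add: bpow_def)
  have "\<one> \<in> A4" "\<one> \<in> A3" "\<one> \<in> A2" using e s4(2) C3 C2 by blast+
  then have "x4 \<in> A4" "x3 \<in> A3" "x2 \<in> A2" "x1 \<in> A1"
    using I[OF x(4) e] I[OF x(3), of A4] I[OF x(2), of A3] I[OF x(1), of A2]
    by (simp_all only: A4_def[symmetric] A3_def[symmetric] A2_def[symmetric] A1_def[symmetric])
  then have "{x1, x2, x3, x4} \<subseteq> A1" using s3(2) s2(2) s1(2) by blast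
  then show "{x1, x2, x3, x4} \<subseteq> range (nform G x1 x2 x3 x4 s t)" using A1 by simp
qed

end

lemma presented_group_subgroup_UNIV:
  assumes H: "subgroup H (presented_group S R)" and g: "\<And>x. x \<in> S \<Longrightarrow> word_class S R (gen x) \<in> H"
  shows "H = carrier (presented_group S R)"
proof
  interpret P: group "presented_group S R" by (rule group_presented_group)
  interpret H: subgroup H "presented_group S R" by (rule H)
  show "H \<subseteq> carrier (presented_group S R)" by (rule H.subset)
  have "eval_word (presented_group S R) (\<lambda>x. word_class S R (gen x)) w \<in> H" if "w \<in> words S" for w
    using that
  proof (induction w)
    case (Cons a w)
    then show ?case using g by (cases a) (auto simp: words_def)
  qed simp
  then show "carrier (presented_group S R) \<subseteq> H"
    by (auto simp: presented_group_carrier presented_group_eval)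
qed

context cocycle
begin

text \<open>Surjectivity of normal forms onto \<open>P\<close> bounds \<open>P\<close> from above,
  and \<open>\<psi>\<close> recovers the index of a normal form, which bounds it from below.\<close>

lemma nform_iso:
  assumes P: "group P" and hom: "\<psi> \<in> hom P M"
    and G: "x1 \<in> carrier P" "x2 \<in> carrier P" "x3 \<in> carrier P" "x4 \<in> carrier P" "s \<in> carrier P" "t \<in> carrier P"
    and gen: "carrier P = range (nform P x1 x2 x3 x4 s t)"
    and \<psi>: "\<psi> x1 = ((True, False, False, False), False, False)" "\<psi> x2 = ((False, True, False, False), False, False)"
      "if m3 then \<psi> x3 = ((False, False, True, False), False, False) else x3 = \<one>\<^bsub>P\<^esub>"
      "if m4 then \<psi> x4 = ((False, False, False, True), False, False) else x4 = \<one>\<^bsub>P\<^esub>"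
      "\<psi> s = (zero4, True, False)" "if mz then \<psi> t = (zero4, False, True) else t = \<one>\<^bsub>P\<^esub>"
    and tri: "T1 = ((a11, False, False, False), (a21, a22, False, False), (a31, a32, a33, False), a4)"
      "T2 = ((b11, False, False, False), (b21, b22, False, False), (b31, b32, b33, False), b4)"
  shows "\<psi> \<in> iso P M"
proof -
  interpret P: group P by (rule P)
  interpret \<psi>: group_hom P M \<psi> using hom by unfold_locales
  have one: "\<psi> \<one>\<^bsub>P\<^esub> = (zero4, False, False)" by simp
  \<comment> \<open>The matrices are lower triangular, so multiplying basis vectors in increasing
    order produces no cocycle terms.\<close>
  have val: "\<psi> (nform P x1 x2 x3 x4 s t ((a, b, c, d), z1, z2)) = ((a, b, c \<and> m3, d \<and> m4), z1, z2 \<and> mz)" for a b c d z1 z2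
  proof -
    have p1: "\<psi> (bpow P a x1) = ((a, False, False, False), False, False)" using \<psi>(1) one by (simp add: bpow_def)
    have p2: "\<psi> (bpow P b x2) = ((False, b, False, False), False, False)" using \<psi>(2) one by (simp add: bpow_def)
    have p3: "\<psi> (bpow P c x3) = ((False, False, c \<and> m3, False), False, False)" using \<psi>(3) one by (cases m3) (simp_all add: bpow_def)
    have p4: "\<psi> (bpow P d x4) = ((False, False, False, d \<and> m4), False, False)" using \<psi>(4) one by (cases m4) (simp_all add: bpow_def)
    have p5: "\<psi> (bpow P z1 s) = (zero4, z1, False)" using \<psi>(5) one by (simp add: bpow_def)
    have p6: "\<psi> (bpow P z2 t) = (zero4, False, z2 \<and> mz)" using \<psi>(6) one by (cases mz) (simp_all add: bpow_def)
    show ?thesis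
      unfolding nform_def using G by (simp add: p1 p2 p3 p4 p5 p6 tri)
  qed
  have "p = \<one>\<^bsub>P\<^esub>" if p0: "p \<in> carrier P" "\<psi> p = \<one>\<^bsub>M\<^esub>" for p
  proof -
    obtain a b c d z1 z2 where p: "p = nform P x1 x2 x3 x4 s t ((a, b, c, d), z1, z2)" using gen p0 by auto
    then have "\<not> a" "\<not> b" "\<not> (c \<and> m3)" "\<not> (d \<and> m4)" "\<not> z1" "\<not> (z2 \<and> mz)" using p0 val by simp_all
    then have "bpow P a x1 = \<one>\<^bsub>P\<^esub>" "bpow P b x2 = \<one>\<^bsub>P\<^esub>" "bpow P c x3 = \<one>\<^bsub>P\<^esub>" "bpow P d x4 = \<one>\<^bsub>P\<^esub>" "bpow P z1 s = \<one>\<^bsub>P\<^esub>" "bpow P z2 t = \<one>\<^bsub>P\<^esub>"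
      using \<psi> by (auto simp: bpow_def)
    then show "p = \<one>\<^bsub>P\<^esub>" by (simp add: p nform_def)
  qed
  moreover have "carrier M \<subseteq> \<psi> ` carrier P"
    proof
      fix m assume "m \<in> carrier M"
      then obtain a b c d z1 z2 where m: "m = ((a, b, c, d), z1, z2)" "c \<longrightarrow> m3" "d \<longrightarrow> m4" "z2 \<longrightarrow> mz"
        by (elim carrierE) auto
      then have "\<psi> (nform P x1 x2 x3 x4 s t m) = m" using val by auto
      moreover have "nform P x1 x2 x3 x4 s t m \<in> carrier P" using gen by auto
      ultimately show "m \<in> \<psi> ` carrier P" by force
    qed
  ultimately show ?thesis unfolding \<psi>.iso_iff by blast
qed

end

context group
begin

lemma swap_commutator:
  "a \<in> carrier G \<Longrightarrow> b \<in> carrier G \<Longrightarrow> b \<otimes> a = a \<otimes> b \<otimes> (inv b \<otimes> (inv a \<otimes> (b \<otimes> a)))"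
  by (simp add: m_assoc)

text \<open>The relation \<open>x^2 = [y, x]\<close> says that \<open>y\<close> inverts
  \<open>x\<close>; here it takes the inverse-free shape that \<open>inverted_squares\<close>
  expects.\<close>

lemma commutator_square_left:
  assumes G: "x \<in> carrier G" "y \<in> carrier G" and e: "x \<otimes> x = inv y \<otimes> (inv x \<otimes> (y \<otimes> x))"
  shows "x \<otimes> y \<otimes> x = y"
proof -
  have "x \<otimes> x = (inv y \<otimes> inv x \<otimes> y) \<otimes> x" using e G by (simp add: m_assoc)
  then have "x = inv y \<otimes> inv x \<otimes> y" by (rule r_cancel) (use G in auto)
  then have "x \<otimes> (y \<otimes> x) = x \<otimes> (y \<otimes> (inv y \<otimes> inv x \<otimes> y))" by simp
  then show ?thesis using G by (simp add: m_assoc)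
qed

text \<open>From \<open>u^2 = [u, x]\<close> follows \<open>x^-1 u x = u^3\<close>, and this is
  \<open>u^-1\<close> because \<open>u^4 = 1\<close>.\<close>

lemma commutator_square_right:
  assumes G: "x \<in> carrier G" "u \<in> carrier G" and e: "u \<otimes> u = inv u \<otimes> (inv x \<otimes> (u \<otimes> x))"
    and u4: "(u \<otimes> u) \<otimes> (u \<otimes> u) = \<one>"
  shows "u \<otimes> x \<otimes> u = x"
proof -
  have "x \<otimes> (u \<otimes> (u \<otimes> u)) = x \<otimes> (u \<otimes> (inv u \<otimes> (inv x \<otimes> (u \<otimes> x))))" using e by simp
  then have ux: "x \<otimes> (u \<otimes> (u \<otimes> u)) = u \<otimes> x" using G by simp
  have "u \<otimes> x \<otimes> u = x \<otimes> (u \<otimes> (u \<otimes> u)) \<otimes> u" using ux by simp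
  also have "\<dots> = x \<otimes> ((u \<otimes> u) \<otimes> (u \<otimes> u))" using G by (simp add: m_assoc)
  finally show ?thesis using u4 G by simp
qed

lemma inverted_squares:
  assumes G: "x \<in> carrier G" "y \<in> carrier G" and e: "x \<otimes> y \<otimes> x = y"
  shows "(y \<otimes> y) \<otimes> x = x \<otimes> (y \<otimes> y)"
    "(x \<otimes> x) \<otimes> (x \<otimes> x) = \<one> \<Longrightarrow> (x \<otimes> x) \<otimes> y = y \<otimes> (x \<otimes> x)"
    "(x \<otimes> x) \<otimes> (x \<otimes> x) = \<one> \<Longrightarrow> y \<otimes> x = x \<otimes> y \<otimes> (x \<otimes> x)"
proof -
  have xy: "x \<otimes> y = y \<otimes> inv x" using e G by (metis inv_solve_right m_closed)
  have "x \<otimes> (y \<otimes> y) = y \<otimes> inv x \<otimes> y" using xy G by (simp flip: m_assoc)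
  also have "\<dots> = y \<otimes> inv x \<otimes> (x \<otimes> y \<otimes> x)" using e by simp
  also have "\<dots> = (y \<otimes> y) \<otimes> x" using G by (simp add: m_assoc)
  finally show "(y \<otimes> y) \<otimes> x = x \<otimes> (y \<otimes> y)" by simp
  assume x4: "(x \<otimes> x) \<otimes> (x \<otimes> x) = \<one>"
  have i: "inv x = x \<otimes> (x \<otimes> x)" using x4 G by (intro inv_equality) (simp_all add: m_assoc)
  have "(x \<otimes> x) \<otimes> y = x \<otimes> (y \<otimes> inv x)" using G xy by (simp add: m_assoc)
  also have "\<dots> = y \<otimes> inv x \<otimes> inv x" using G xy by (simp flip: m_assoc)
  also have "\<dots> = y \<otimes> (x \<otimes> x) \<otimes> ((x \<otimes> x) \<otimes> (x \<otimes> x))" unfolding i using G by (simp add: m_assoc)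
  finally show s: "(x \<otimes> x) \<otimes> y = y \<otimes> (x \<otimes> x)" using x4 G by simp
  have "x \<otimes> y \<otimes> (x \<otimes> x) = y \<otimes> inv x \<otimes> (x \<otimes> x)" using xy by simp
  then show "y \<otimes> x = x \<otimes> y \<otimes> (x \<otimes> x)" using G by (simp add: m_assoc)
qed

lemma subgroup_commuting:
  assumes s: "s \<in> carrier G"
  shows "subgroup {g \<in> carrier G. s \<otimes> g = g \<otimes> s} G"
proof
  show "{g \<in> carrier G. s \<otimes> g = g \<otimes> s} \<subseteq> carrier G" by auto
  show "\<one> \<in> {g \<in> carrier G. s \<otimes> g = g \<otimes> s}" using s by simp
  fix g assume g: "g \<in> {g \<in> carrier G. s \<otimes> g = g \<otimes> s}"
  then have gG: "g \<in> carrier G" "s \<otimes> g = g \<otimes> s" by auto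
  have "inv g \<otimes> (s \<otimes> g) \<otimes> inv g = inv g \<otimes> (g \<otimes> s) \<otimes> inv g" using gG by simp
  then show "inv g \<in> {g \<in> carrier G. s \<otimes> g = g \<otimes> s}" using gG(1) s by (simp add: m_assoc)
  fix h assume "h \<in> {g \<in> carrier G. s \<otimes> g = g \<otimes> s}"
  then have h: "h \<in> carrier G" "s \<otimes> h = h \<otimes> s" by auto
  have "s \<otimes> (g \<otimes> h) = g \<otimes> s \<otimes> h" using gG h s by (simp flip: m_assoc)
  also have "\<dots> = g \<otimes> h \<otimes> s" using gG(1) h s by (simp add: m_assoc)
  finally show "g \<otimes> h \<in> {g \<in> carrier G. s \<otimes> g = g \<otimes> s}" using gG h by simp
qed

end

lemma presented_group_central:
  assumes s: "s \<in> carrier (presented_group S R)"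
    and "\<And>x. x \<in> S \<Longrightarrow> s \<otimes>\<^bsub>presented_group S R\<^esub> word_class S R (gen x) = word_class S R (gen x) \<otimes>\<^bsub>presented_group S R\<^esub> s"
    and g: "g \<in> carrier (presented_group S R)"
  shows "s \<otimes>\<^bsub>presented_group S R\<^esub> g = g \<otimes>\<^bsub>presented_group S R\<^esub> s"
proof -
  interpret P: group "presented_group S R" by (rule group_presented_group)
  have "word_class S R (gen x) \<in> carrier (presented_group S R)" if "x \<in> S" for x
    using that by (auto simp: presented_group_carrier gen_def words_def)
  then have "{g \<in> carrier (presented_group S R). s \<otimes>\<^bsub>presented_group S R\<^esub> g = g \<otimes>\<^bsub>presented_group S R\<^esub> s} = carrier (presented_group S R)"
    using assms by (intro presented_group_subgroup_UNIV P.subgroup_commuting) auto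
  then show ?thesis using g by blast
qed

lemma word_pow_simps: "word_pow w 2 = w @ w" "word_pow w 4 = w @ w @ w @ w"
  by (simp_all add: word_pow_def numeral_eq_Suc)

lemmas word_simps = word_pow_simps gen_def word_comm_def word_inv_def words_def Let_def

section \<open>The presented groups and their models\<close>

definition "zero_mat = (zero4, zero4, zero4, zero4)"
text \<open>The matrices are read off from the relations, with \<open>s = x^2\<close> for the first
  matrix and \<open>t = y^2\<close> for the second: diagonal entries are coordinates of the squares
  of the generators, entries below the diagonal those of their commutators. For \<open>Q8\<close>
  only \<open>s\<close> is present.\<close>

definition "Q8_mat = ((True, False, False, False), (True, True, False, False), zero4, zero4)"
definition "P16_mat1 = ((True, False, False, False), (True, False, False, False), zero4, zero4)"
definition "P16_mat2 = (zero4, (False, True, False, False), zero4, zero4)"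
definition "H32_mat1 = ((True, False, False, False), (True, False, False, False), (False, True, False, False), zero4)"
definition "H32_mat2 = (zero4, (False, True, False, False), (True, True, True, False), zero4)"
definition "H245_mat1 = ((True, False, False, False), (True, False, False, False), (False, True, False, False), (True, True, False, True))"
definition "H245_mat2 = (zero4, (False, True, False, False), (True, True, True, False), (True, False, False, False))"

abbreviation "Q8_model \<equiv> cocycle_group Q8_mat zero_mat False False False"
abbreviation "P16_model \<equiv> cocycle_group P16_mat1 P16_mat2 False False True"
abbreviation "H32_model \<equiv> cocycle_group H32_mat1 H32_mat2 True False True"
abbreviation "H245_model \<equiv> cocycle_group H245_mat1 H245_mat2 True True True"

lemma cocycle_Q8: "cocycle zero_mat False"
  by unfold_locales (auto simp: zero_mat_def)
lemma cocycle_True: "cocycle T2 True"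
  by unfold_locales auto

definition model_gen :: "generator \<Rightarrow> vec4 \<times> bool \<times> bool" where
  "model_gen g = (case g of Gx \<Rightarrow> ((True, False, False, False), False, False) | Gy \<Rightarrow> ((False, True, False, False), False, False)
     | Gu \<Rightarrow> ((False, False, True, False), False, False) | Gv \<Rightarrow> ((False, False, False, True), False, False))"

lemma model_gen_simps [simp]:
  "model_gen Gx = ((True, False, False, False), False, False)" "model_gen Gy = ((False, True, False, False), False, False)"
  "model_gen Gu = ((False, False, True, False), False, False)" "model_gen Gv = ((False, False, False, True), False, False)"
  by (simp_all add: model_gen_def)

lemma mat_bilinear:
  "bilinear4 zero_mat v w = False"
  "bilinear4 Q8_mat (a, b, c, d) (a', b', c', d') = ((a \<and> a') \<noteq> (b \<and> (a' \<noteq> b')))"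
  "bilinear4 P16_mat1 (a, b, c, d) (a', b', c', d') = ((a \<and> a') \<noteq> (b \<and> a'))"
  "bilinear4 P16_mat2 (a, b, c, d) (a', b', c', d') = (b \<and> b')"
  "bilinear4 H32_mat1 (a, b, c, d) (a', b', c', d') = ((a \<and> a') \<noteq> ((b \<and> a') \<noteq> (c \<and> b')))"
  "bilinear4 H32_mat2 (a, b, c, d) (a', b', c', d') = ((b \<and> b') \<noteq> (c \<and> (a' \<noteq> (b' \<noteq> c'))))"
  "bilinear4 H245_mat1 (a, b, c, d) (a', b', c', d') = ((a \<and> a') \<noteq> ((b \<and> a') \<noteq> ((c \<and> b') \<noteq> (d \<and> (a' \<noteq> (b' \<noteq> d'))))))"
  "bilinear4 H245_mat2 (a, b, c, d) (a', b', c', d') = ((b \<and> b') \<noteq> ((c \<and> (a' \<noteq> (b' \<noteq> c'))) \<noteq> (d \<and> a')))"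
  by (cases v; cases w; simp add: zero_mat_def)
     (simp_all add: Q8_mat_def P16_mat1_def P16_mat2_def H32_mat1_def H32_mat2_def H245_mat1_def H245_mat2_def)

text \<open>Two kinds of hypotheses meet here. The relations hold in the model, which gives a
  homomorphism; squares and commutators of the generators of \<open>P\<close> lie in the central
  subgroup \<open>{1, s, t, st}\<close>, which gives normal forms. The value on words is kept
  because the central product is described through the image of the particular element
  \<open>P16_x2y2\<close>.\<close>

lemma presented_model_iso:
  fixes S :: "generator set" and R :: "(generator word \<times> generator word) set"
  defines "P \<equiv> presented_group S R" and "c \<equiv> \<lambda>x. word_class S R (gen x)"
  assumes mz: "cocycle T2 mz" and M: "M = cocycle_group T1 T2 m3 m4 mz"
    and S: "S = {Gx, Gy} \<union> (if m3 then {Gu} else {}) \<union> (if m4 then {Gv} else {})"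
    and rel: "\<And>l r. (l, r) \<in> R \<Longrightarrow> eval_word M model_gen l = eval_word M model_gen r"
    and x: "x1 = c Gx" "x2 = c Gy" "x3 = (if m3 then c Gu else \<one>\<^bsub>P\<^esub>)" "x4 = (if m4 then c Gv else \<one>\<^bsub>P\<^esub>)"
    and w: "ws \<in> words S" "wt \<in> words S" "s = word_class S R ws" "t = word_class S R wt"
      "eval_word M model_gen ws = (zero4, True, False)"
      "if mz then eval_word M model_gen wt = (zero4, False, True) else t = \<one>\<^bsub>P\<^esub>"
    and st: "s \<otimes>\<^bsub>P\<^esub> s = \<one>\<^bsub>P\<^esub>" "t \<otimes>\<^bsub>P\<^esub> t = \<one>\<^bsub>P\<^esub>"
    and cen: "\<And>x. x \<in> S \<Longrightarrow> s \<otimes>\<^bsub>P\<^esub> c x = c x \<otimes>\<^bsub>P\<^esub> s" "\<And>x. x \<in> S \<Longrightarrow> t \<otimes>\<^bsub>P\<^esub> c x = c x \<otimes>\<^bsub>P\<^esub> t"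
    and sq: "x1 \<otimes>\<^bsub>P\<^esub> x1 \<in> {\<one>\<^bsub>P\<^esub>, s, t, s \<otimes>\<^bsub>P\<^esub> t}" "x2 \<otimes>\<^bsub>P\<^esub> x2 \<in> {\<one>\<^bsub>P\<^esub>, s, t, s \<otimes>\<^bsub>P\<^esub> t}"
      "x3 \<otimes>\<^bsub>P\<^esub> x3 \<in> {\<one>\<^bsub>P\<^esub>, s, t, s \<otimes>\<^bsub>P\<^esub> t}" "x4 \<otimes>\<^bsub>P\<^esub> x4 \<in> {\<one>\<^bsub>P\<^esub>, s, t, s \<otimes>\<^bsub>P\<^esub> t}"
    and cm: "\<exists>c\<in>{\<one>\<^bsub>P\<^esub>, s, t, s \<otimes>\<^bsub>P\<^esub> t}. x2 \<otimes>\<^bsub>P\<^esub> x1 = x1 \<otimes>\<^bsub>P\<^esub> x2 \<otimes>\<^bsub>P\<^esub> c"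
      "\<exists>c\<in>{\<one>\<^bsub>P\<^esub>, s, t, s \<otimes>\<^bsub>P\<^esub> t}. x3 \<otimes>\<^bsub>P\<^esub> x1 = x1 \<otimes>\<^bsub>P\<^esub> x3 \<otimes>\<^bsub>P\<^esub> c"
      "\<exists>c\<in>{\<one>\<^bsub>P\<^esub>, s, t, s \<otimes>\<^bsub>P\<^esub> t}. x4 \<otimes>\<^bsub>P\<^esub> x1 = x1 \<otimes>\<^bsub>P\<^esub> x4 \<otimes>\<^bsub>P\<^esub> c"
      "\<exists>c\<in>{\<one>\<^bsub>P\<^esub>, s, t, s \<otimes>\<^bsub>P\<^esub> t}. x3 \<otimes>\<^bsub>P\<^esub> x2 = x2 \<otimes>\<^bsub>P\<^esub> x3 \<otimes>\<^bsub>P\<^esub> c"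
      "\<exists>c\<in>{\<one>\<^bsub>P\<^esub>, s, t, s \<otimes>\<^bsub>P\<^esub> t}. x4 \<otimes>\<^bsub>P\<^esub> x2 = x2 \<otimes>\<^bsub>P\<^esub> x4 \<otimes>\<^bsub>P\<^esub> c"
      "\<exists>c\<in>{\<one>\<^bsub>P\<^esub>, s, t, s \<otimes>\<^bsub>P\<^esub> t}. x4 \<otimes>\<^bsub>P\<^esub> x3 = x3 \<otimes>\<^bsub>P\<^esub> x4 \<otimes>\<^bsub>P\<^esub> c"
    and tri: "T1 = ((a11, False, False, False), (a21, a22, False, False), (a31, a32, a33, False), a4)"
      "T2 = ((b11, False, False, False), (b21, b22, False, False), (b31, b32, b33, False), b4)"
  shows "\<exists>\<psi> \<in> iso P M. \<forall>w \<in> words S. \<psi> (word_class S R w) = eval_word M model_gen w"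
proof -
  interpret cocycle T1 T2 m3 m4 mz by (rule mz)
  interpret P: group P unfolding P_def by (rule group_presented_group)
  have cG: "c x \<in> carrier P" if "x \<in> S" for x
    using that by (auto simp: P_def c_def presented_group_carrier gen_def words_def)
  have inj: "model_gen ` S \<subseteq> carrier (cocycle_group T1 T2 m3 m4 mz)" by (auto simp: S)
  obtain \<psi> where \<psi>: "\<psi> \<in> hom P M" "\<And>w. w \<in> words S \<Longrightarrow> \<psi> (word_class S R w) = eval_word M model_gen w"
    using M.presented_group_hom[OF inj rel[unfolded M]] unfolding P_def M by blast
  have xG: "x1 \<in> carrier P" "x2 \<in> carrier P" "x3 \<in> carrier P" "x4 \<in> carrier P"
    using cG by (auto simp: x S)
  have stG: "s \<in> carrier P" "t \<in> carrier P" using w by (auto simp: P_def presented_group_carrier)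
  have scen: "s \<otimes>\<^bsub>P\<^esub> g = g \<otimes>\<^bsub>P\<^esub> s" "t \<otimes>\<^bsub>P\<^esub> g = g \<otimes>\<^bsub>P\<^esub> t" if "g \<in> carrier P" for g
    using presented_group_central[of s S R g] presented_group_central[of t S R g] stG cen that unfolding P_def c_def by blast+
  note N = P.nform_subgroup[OF xG stG st scen sq cm]
  have cN: "c x \<in> range (nform P x1 x2 x3 x4 s t)" if "x \<in> S" for x
    using N(2) that x by (auto simp: S split: if_splits)
  have gen: "carrier P = range (nform P x1 x2 x3 x4 s t)"
    using presented_group_subgroup_UNIV[of "range (nform P x1 x2 x3 x4 s t)" S R] N(1) cN unfolding P_def c_def by blast
  have ev: "\<psi> (c x) = model_gen x" if "x \<in> S" for x
  proof -
    have "model_gen x \<in> carrier M" using inj that M by blast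
    then show ?thesis using \<psi>(2)[of "gen x"] that M.r_one[of "model_gen x"] unfolding M by (simp add: c_def gen_def words_def)
  qed
  have "\<psi> \<in> iso P M"
    unfolding M
  proof (rule nform_iso[OF P.group_axioms \<psi>(1)[unfolded M] xG stG gen _ _ _ _ _ _ tri])
    show "\<psi> x1 = ((True, False, False, False), False, False)" "\<psi> x2 = ((False, True, False, False), False, False)"
      "if m3 then \<psi> x3 = ((False, False, True, False), False, False) else x3 = \<one>\<^bsub>P\<^esub>"
      "if m4 then \<psi> x4 = ((False, False, False, True), False, False) else x4 = \<one>\<^bsub>P\<^esub>"
      using ev by (auto simp: x S)
    show "\<psi> s = (zero4, True, False)" "if mz then \<psi> t = (zero4, False, True) else t = \<one>\<^bsub>P\<^esub>"
      using w \<psi>(2) by auto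
  qed
  then show ?thesis using \<psi>(2) by blast
qed

lemma Q8_iso: "\<exists>\<psi> \<in> iso Q8 Q8_model. \<forall>w \<in> words {Gx, Gy}. \<psi> (word_class {Gx, Gy} Q8_rels w) = eval_word Q8_model model_gen w"
proof -
  interpret cocycle Q8_mat zero_mat False False False by (rule cocycle_Q8)
  let ?S = "{Gx, Gy}" and ?R = Q8_rels
  define P where "P = presented_group ?S ?R"
  interpret P: group P unfolding P_def by (rule group_presented_group)
  define x y where "x = word_class ?S ?R (gen Gx)" and "y = word_class ?S ?R (gen Gy)"
  note defs = x_def y_def
  have G: "x \<in> carrier P" "y \<in> carrier P" by (auto simp: P_def defs presented_group_carrier word_simps)
  note R = presented_group_relation[of _ _ ?R ?S, folded P_def]
  note fold = defs[unfolded gen_def, symmetric]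
  have m: "(word_pow (gen Gx) 4, []) \<in> ?R" "(word_pow (gen Gy) 2, word_pow (gen Gx) 2) \<in> ?R" "(word_inv (gen Gy) @ gen Gx @ gen Gy, word_inv (gen Gx)) \<in> ?R" by (simp_all add: Q8_rels_def Let_def)
  have 1: "x \<otimes>\<^bsub>P\<^esub> x \<otimes>\<^bsub>P\<^esub> (x \<otimes>\<^bsub>P\<^esub> x) = \<one>\<^bsub>P\<^esub>" using R[OF m(1)] G by (simp add: word_simps fold P.m_assoc)
  have 2: "y \<otimes>\<^bsub>P\<^esub> y = x \<otimes>\<^bsub>P\<^esub> x" using R[OF m(2)] G by (simp add: word_simps fold)
  have "inv\<^bsub>P\<^esub> y \<otimes>\<^bsub>P\<^esub> (x \<otimes>\<^bsub>P\<^esub> y) = inv\<^bsub>P\<^esub> x" using R[OF m(3)] G by (simp add: word_simps fold)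
  then have "x \<otimes>\<^bsub>P\<^esub> y = y \<otimes>\<^bsub>P\<^esub> inv\<^bsub>P\<^esub> x" using G by (metis P.inv_solve_left P.m_closed P.inv_closed)
  then have 3: "x \<otimes>\<^bsub>P\<^esub> y \<otimes>\<^bsub>P\<^esub> x = y" using G by (simp add: P.m_assoc)
  note sq = P.inverted_squares[OF G 3]
  show ?thesis
    unfolding Q8_def P_def[symmetric]
  \<comment> \<open>The second central generator is absent and is represented by the empty
    word.\<close>
  proof (rule presented_model_iso[OF cocycle_Q8 HOL.refl, where S = ?S and R = ?R and ?T1.0 = Q8_mat and ?m3.0 = False and ?m4.0 = False and ?x1.0 = x and ?x2.0 = y and ?x3.0 = "\<one>\<^bsub>P\<^esub>" and ?x4.0 = "\<one>\<^bsub>P\<^esub>" and ws = "word_pow (gen Gx) 2" and wt = "[]" and s = "x \<otimes>\<^bsub>P\<^esub> x" and t = "\<one>\<^bsub>P\<^esub>", folded P_def])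
    show "eval_word M model_gen l = eval_word M model_gen r" if "(l, r) \<in> ?R" for l r
      using that by (auto simp: Q8_rels_def word_simps inv_M mat_bilinear)
    show "eval_word M model_gen (word_pow (gen Gx) 2) = (zero4, True, False)"
      by (simp add: word_simps mat_bilinear)
    show "x \<otimes>\<^bsub>P\<^esub> x = word_class ?S ?R (word_pow (gen Gx) 2)"
      using presented_group_eval[of "word_pow (gen Gx) 2" ?S ?R, folded P_def] G by (simp add: word_simps fold)
    show "\<one>\<^bsub>P\<^esub> = word_class ?S ?R []" by (simp add: P_def presented_group_one)
    show "x \<otimes>\<^bsub>P\<^esub> x \<otimes>\<^bsub>P\<^esub> word_class ?S ?R (gen g) = word_class ?S ?R (gen g) \<otimes>\<^bsub>P\<^esub> (x \<otimes>\<^bsub>P\<^esub> x)" if "g \<in> ?S" for g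
      using that sq(2)[OF 1] G by (auto simp: P.m_assoc simp flip: defs)
    show "\<exists>c\<in>{\<one>\<^bsub>P\<^esub>, x \<otimes>\<^bsub>P\<^esub> x, \<one>\<^bsub>P\<^esub>, x \<otimes>\<^bsub>P\<^esub> x \<otimes>\<^bsub>P\<^esub> \<one>\<^bsub>P\<^esub>}. y \<otimes>\<^bsub>P\<^esub> x = x \<otimes>\<^bsub>P\<^esub> y \<otimes>\<^bsub>P\<^esub> c"
      using sq(3)[OF 1] by blast
  qed (use G 1 2 in \<open>auto simp: defs word_simps mat_bilinear Q8_mat_def zero_mat_def\<close>)
qed

lemma P16_iso: "\<exists>\<psi> \<in> iso P16 P16_model. \<forall>w \<in> words {Gx, Gy}. \<psi> (word_class {Gx, Gy} P16_rels w) = eval_word P16_model model_gen w"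
proof -
  interpret cocycle P16_mat1 P16_mat2 False False True by (rule cocycle_True)
  let ?S = "{Gx, Gy}" and ?R = P16_rels
  define P where "P = presented_group ?S ?R"
  interpret P: group P unfolding P_def by (rule group_presented_group)
  define x y where "x = word_class ?S ?R (gen Gx)" and "y = word_class ?S ?R (gen Gy)"
  note defs = x_def y_def
  have G: "x \<in> carrier P" "y \<in> carrier P" by (auto simp: P_def defs presented_group_carrier word_simps)
  note R = presented_group_relation[of _ _ ?R ?S, folded P_def]
  note fold = defs[unfolded gen_def, symmetric]
  have m: "(word_pow (gen Gx) 4, []) \<in> ?R" "(word_pow (gen Gy) 4, []) \<in> ?R" "(word_pow (gen Gx) 2, word_comm (gen Gy) (gen Gx)) \<in> ?R" by (simp_all add: P16_rels_def Let_def)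
  have x4: "x \<otimes>\<^bsub>P\<^esub> x \<otimes>\<^bsub>P\<^esub> (x \<otimes>\<^bsub>P\<^esub> x) = \<one>\<^bsub>P\<^esub>" using R[OF m(1)] G by (simp add: word_simps fold P.m_assoc)
  have y4: "y \<otimes>\<^bsub>P\<^esub> y \<otimes>\<^bsub>P\<^esub> (y \<otimes>\<^bsub>P\<^esub> y) = \<one>\<^bsub>P\<^esub>" using R[OF m(2)] G by (simp add: word_simps fold P.m_assoc)
  have yx: "x \<otimes>\<^bsub>P\<^esub> x = inv\<^bsub>P\<^esub> y \<otimes>\<^bsub>P\<^esub> (inv\<^bsub>P\<^esub> x \<otimes>\<^bsub>P\<^esub> (y \<otimes>\<^bsub>P\<^esub> x))" using R[OF m(3)] G by (simp add: word_simps fold)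
  have xy: "x \<otimes>\<^bsub>P\<^esub> y \<otimes>\<^bsub>P\<^esub> x = y" by (rule P.commutator_square_left[OF G(1,2) yx])
  note sq = P.inverted_squares[OF G(1,2) xy]
  have sc: "x \<otimes>\<^bsub>P\<^esub> x \<otimes>\<^bsub>P\<^esub> x = x \<otimes>\<^bsub>P\<^esub> (x \<otimes>\<^bsub>P\<^esub> x)" "x \<otimes>\<^bsub>P\<^esub> x \<otimes>\<^bsub>P\<^esub> y = y \<otimes>\<^bsub>P\<^esub> (x \<otimes>\<^bsub>P\<^esub> x)" using sq(2)[OF x4] G by (simp_all add: P.m_assoc)
  have tc: "y \<otimes>\<^bsub>P\<^esub> y \<otimes>\<^bsub>P\<^esub> x = x \<otimes>\<^bsub>P\<^esub> (y \<otimes>\<^bsub>P\<^esub> y)" "y \<otimes>\<^bsub>P\<^esub> y \<otimes>\<^bsub>P\<^esub> y = y \<otimes>\<^bsub>P\<^esub> (y \<otimes>\<^bsub>P\<^esub> y)" using sq(1) G by (simp_all add: P.m_assoc)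
  show ?thesis
    unfolding P16_def P_def[symmetric]
  proof (rule presented_model_iso[OF cocycle_True HOL.refl, where S = ?S and R = ?R and ?T1.0 = P16_mat1 and ?m3.0 = False and ?m4.0 = False and ?x1.0 = x and ?x2.0 = y and ?x3.0 = "\<one>\<^bsub>P\<^esub>" and ?x4.0 = "\<one>\<^bsub>P\<^esub>" and ws = "word_pow (gen Gx) 2" and wt = "word_pow (gen Gy) 2" and s = "x \<otimes>\<^bsub>P\<^esub> x" and t = "y \<otimes>\<^bsub>P\<^esub> y", folded P_def])
    show "eval_word M model_gen l = eval_word M model_gen r" if "(l, r) \<in> ?R" for l r
      using that by (auto simp: P16_rels_def word_simps inv_M mat_bilinear)
    show "eval_word M model_gen (word_pow (gen Gx) 2) = (zero4, True, False)"
      by (simp add: word_simps mat_bilinear)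
    show "x \<otimes>\<^bsub>P\<^esub> x = word_class ?S ?R (word_pow (gen Gx) 2)"
      using presented_group_eval[of "word_pow (gen Gx) 2" ?S ?R, folded P_def] G by (simp add: word_simps fold)
    show "y \<otimes>\<^bsub>P\<^esub> y = word_class ?S ?R (word_pow (gen Gy) 2)"
      using presented_group_eval[of "word_pow (gen Gy) 2" ?S ?R, folded P_def] G by (simp add: word_simps fold)
    show "x \<otimes>\<^bsub>P\<^esub> x \<otimes>\<^bsub>P\<^esub> word_class ?S ?R (gen g) = word_class ?S ?R (gen g) \<otimes>\<^bsub>P\<^esub> (x \<otimes>\<^bsub>P\<^esub> x)" if "g \<in> ?S" for g
      using that sc unfolding defs by blast
    show "y \<otimes>\<^bsub>P\<^esub> y \<otimes>\<^bsub>P\<^esub> word_class ?S ?R (gen g) = word_class ?S ?R (gen g) \<otimes>\<^bsub>P\<^esub> (y \<otimes>\<^bsub>P\<^esub> y)" if "g \<in> ?S" for g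
      using that tc unfolding defs by blast
    show "\<exists>c\<in>{\<one>\<^bsub>P\<^esub>, x \<otimes>\<^bsub>P\<^esub> x, y \<otimes>\<^bsub>P\<^esub> y, x \<otimes>\<^bsub>P\<^esub> x \<otimes>\<^bsub>P\<^esub> (y \<otimes>\<^bsub>P\<^esub> y)}. y \<otimes>\<^bsub>P\<^esub> x = x \<otimes>\<^bsub>P\<^esub> y \<otimes>\<^bsub>P\<^esub> c"
      using sq(3)[OF x4] by blast
  qed (use G x4 y4 in \<open>auto simp: defs word_simps mat_bilinear P16_mat1_def P16_mat2_def zero_mat_def\<close>)
qed

lemma H32_iso: "\<exists>\<psi> \<in> iso H32 H32_model. \<forall>w \<in> words {Gx, Gy, Gu}. \<psi> (word_class {Gx, Gy, Gu} H32_rels w) = eval_word H32_model model_gen w"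
proof -
  interpret cocycle H32_mat1 H32_mat2 True False True by (rule cocycle_True)
  let ?S = "{Gx, Gy, Gu}" and ?R = H32_rels
  define P where "P = presented_group ?S ?R"
  interpret P: group P unfolding P_def by (rule group_presented_group)
  define x y u where "x = word_class ?S ?R (gen Gx)" and "y = word_class ?S ?R (gen Gy)" and "u = word_class ?S ?R (gen Gu)"
  note defs = x_def y_def u_def
  have G: "x \<in> carrier P" "y \<in> carrier P" "u \<in> carrier P" by (auto simp: P_def defs presented_group_carrier word_simps)
  note R = presented_group_relation[of _ _ ?R ?S, folded P_def]
  note fold = defs[unfolded gen_def, symmetric]
  have m: "(word_pow (gen Gx) 4, []) \<in> ?R" "(word_pow (gen Gy) 4, []) \<in> ?R" "(word_pow (gen Gx) 2, word_comm (gen Gy) (gen Gx)) \<in> ?R" "(word_pow (gen Gy) 2, word_pow (gen Gu) 2) \<in> ?R" "(word_pow (gen Gu) 2, word_comm (gen Gu) (gen Gx)) \<in> ?R" "(word_pow (gen Gx) 2 @ word_pow (gen Gy) 2, word_comm (gen Gu) (gen Gy)) \<in> ?R" by (simp_all add: H32_rels_def Let_def)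
  have x4: "x \<otimes>\<^bsub>P\<^esub> x \<otimes>\<^bsub>P\<^esub> (x \<otimes>\<^bsub>P\<^esub> x) = \<one>\<^bsub>P\<^esub>" using R[OF m(1)] G by (simp add: word_simps fold P.m_assoc)
  have y4: "y \<otimes>\<^bsub>P\<^esub> y \<otimes>\<^bsub>P\<^esub> (y \<otimes>\<^bsub>P\<^esub> y) = \<one>\<^bsub>P\<^esub>" using R[OF m(2)] G by (simp add: word_simps fold P.m_assoc)
  have yx: "x \<otimes>\<^bsub>P\<^esub> x = inv\<^bsub>P\<^esub> y \<otimes>\<^bsub>P\<^esub> (inv\<^bsub>P\<^esub> x \<otimes>\<^bsub>P\<^esub> (y \<otimes>\<^bsub>P\<^esub> x))" using R[OF m(3)] G by (simp add: word_simps fold)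
  have xy: "x \<otimes>\<^bsub>P\<^esub> y \<otimes>\<^bsub>P\<^esub> x = y" by (rule P.commutator_square_left[OF G(1,2) yx])
  note sq = P.inverted_squares[OF G(1,2) xy]
  have yu: "y \<otimes>\<^bsub>P\<^esub> y = u \<otimes>\<^bsub>P\<^esub> u" using R[OF m(4)] G by (simp add: word_simps fold)
  have ux: "u \<otimes>\<^bsub>P\<^esub> u = inv\<^bsub>P\<^esub> u \<otimes>\<^bsub>P\<^esub> (inv\<^bsub>P\<^esub> x \<otimes>\<^bsub>P\<^esub> (u \<otimes>\<^bsub>P\<^esub> x))" using R[OF m(5)] G by (simp add: word_simps fold)
  have uy: "x \<otimes>\<^bsub>P\<^esub> x \<otimes>\<^bsub>P\<^esub> (y \<otimes>\<^bsub>P\<^esub> y) = inv\<^bsub>P\<^esub> u \<otimes>\<^bsub>P\<^esub> (inv\<^bsub>P\<^esub> y \<otimes>\<^bsub>P\<^esub> (u \<otimes>\<^bsub>P\<^esub> y))" using R[OF m(6)] G by (simp add: word_simps fold P.m_assoc)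
  \<comment> \<open>The fourth power of \<open>u\<close> is trivial because \<open>u^2 = y^2\<close>
    and \<open>y^4 = 1\<close>.\<close>
  have uxu: "u \<otimes>\<^bsub>P\<^esub> x \<otimes>\<^bsub>P\<^esub> u = x" by (rule P.commutator_square_right[OF G(1,3) ux]) (use y4 yu in simp)
  note squ = P.inverted_squares[OF G(3,1) uxu]
  have cux: "u \<otimes>\<^bsub>P\<^esub> x = x \<otimes>\<^bsub>P\<^esub> u \<otimes>\<^bsub>P\<^esub> (y \<otimes>\<^bsub>P\<^esub> y)" using P.swap_commutator[OF G(1,3)] ux yu by simp
  have cuy: "u \<otimes>\<^bsub>P\<^esub> y = y \<otimes>\<^bsub>P\<^esub> u \<otimes>\<^bsub>P\<^esub> (x \<otimes>\<^bsub>P\<^esub> x \<otimes>\<^bsub>P\<^esub> (y \<otimes>\<^bsub>P\<^esub> y))" using P.swap_commutator[OF G(2,3)] uy by simp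
  have sc: "x \<otimes>\<^bsub>P\<^esub> x \<otimes>\<^bsub>P\<^esub> x = x \<otimes>\<^bsub>P\<^esub> (x \<otimes>\<^bsub>P\<^esub> x)" "x \<otimes>\<^bsub>P\<^esub> x \<otimes>\<^bsub>P\<^esub> y = y \<otimes>\<^bsub>P\<^esub> (x \<otimes>\<^bsub>P\<^esub> x)" "x \<otimes>\<^bsub>P\<^esub> x \<otimes>\<^bsub>P\<^esub> u = u \<otimes>\<^bsub>P\<^esub> (x \<otimes>\<^bsub>P\<^esub> x)"
    using sq(2)[OF x4] squ(1) G by (simp_all add: P.m_assoc)
  have tc: "y \<otimes>\<^bsub>P\<^esub> y \<otimes>\<^bsub>P\<^esub> x = x \<otimes>\<^bsub>P\<^esub> (y \<otimes>\<^bsub>P\<^esub> y)" "y \<otimes>\<^bsub>P\<^esub> y \<otimes>\<^bsub>P\<^esub> y = y \<otimes>\<^bsub>P\<^esub> (y \<otimes>\<^bsub>P\<^esub> y)" "y \<otimes>\<^bsub>P\<^esub> y \<otimes>\<^bsub>P\<^esub> u = u \<otimes>\<^bsub>P\<^esub> (y \<otimes>\<^bsub>P\<^esub> y)"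
  proof -
    show "y \<otimes>\<^bsub>P\<^esub> y \<otimes>\<^bsub>P\<^esub> x = x \<otimes>\<^bsub>P\<^esub> (y \<otimes>\<^bsub>P\<^esub> y)" by (rule sq(1))
    show "y \<otimes>\<^bsub>P\<^esub> y \<otimes>\<^bsub>P\<^esub> y = y \<otimes>\<^bsub>P\<^esub> (y \<otimes>\<^bsub>P\<^esub> y)" using G by (simp add: P.m_assoc)
    show "y \<otimes>\<^bsub>P\<^esub> y \<otimes>\<^bsub>P\<^esub> u = u \<otimes>\<^bsub>P\<^esub> (y \<otimes>\<^bsub>P\<^esub> y)" unfolding yu using G by (simp add: P.m_assoc)
  qed
  show ?thesis
    unfolding H32_def P_def[symmetric]
  proof (rule presented_model_iso[OF cocycle_True HOL.refl, where S = ?S and R = ?R and ?T1.0 = H32_mat1 and ?m3.0 = True and ?m4.0 = False and ?x1.0 = x and ?x2.0 = y and ?x3.0 = u and ?x4.0 = "\<one>\<^bsub>P\<^esub>" and ws = "word_pow (gen Gx) 2" and wt = "word_pow (gen Gy) 2" and s = "x \<otimes>\<^bsub>P\<^esub> x" and t = "y \<otimes>\<^bsub>P\<^esub> y", folded P_def])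
    show "eval_word M model_gen l = eval_word M model_gen r" if "(l, r) \<in> ?R" for l r
      using that by (auto simp: H32_rels_def word_simps inv_M mat_bilinear)
    show "eval_word M model_gen (word_pow (gen Gx) 2) = (zero4, True, False)"
      by (simp add: word_simps mat_bilinear)
    show "x \<otimes>\<^bsub>P\<^esub> x = word_class ?S ?R (word_pow (gen Gx) 2)"
      using presented_group_eval[of "word_pow (gen Gx) 2" ?S ?R, folded P_def] G by (simp add: word_simps fold)
    show "y \<otimes>\<^bsub>P\<^esub> y = word_class ?S ?R (word_pow (gen Gy) 2)"
      using presented_group_eval[of "word_pow (gen Gy) 2" ?S ?R, folded P_def] G by (simp add: word_simps fold)
    show "x \<otimes>\<^bsub>P\<^esub> x \<otimes>\<^bsub>P\<^esub> word_class ?S ?R (gen g) = word_class ?S ?R (gen g) \<otimes>\<^bsub>P\<^esub> (x \<otimes>\<^bsub>P\<^esub> x)" if "g \<in> ?S" for g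
      using that sc unfolding defs by blast
    show "y \<otimes>\<^bsub>P\<^esub> y \<otimes>\<^bsub>P\<^esub> word_class ?S ?R (gen g) = word_class ?S ?R (gen g) \<otimes>\<^bsub>P\<^esub> (y \<otimes>\<^bsub>P\<^esub> y)" if "g \<in> ?S" for g
      using that tc unfolding defs by blast
    show "\<exists>c\<in>{\<one>\<^bsub>P\<^esub>, x \<otimes>\<^bsub>P\<^esub> x, y \<otimes>\<^bsub>P\<^esub> y, x \<otimes>\<^bsub>P\<^esub> x \<otimes>\<^bsub>P\<^esub> (y \<otimes>\<^bsub>P\<^esub> y)}. y \<otimes>\<^bsub>P\<^esub> x = x \<otimes>\<^bsub>P\<^esub> y \<otimes>\<^bsub>P\<^esub> c"
      using sq(3)[OF x4] by blast
    show "\<exists>c\<in>{\<one>\<^bsub>P\<^esub>, x \<otimes>\<^bsub>P\<^esub> x, y \<otimes>\<^bsub>P\<^esub> y, x \<otimes>\<^bsub>P\<^esub> x \<otimes>\<^bsub>P\<^esub> (y \<otimes>\<^bsub>P\<^esub> y)}. u \<otimes>\<^bsub>P\<^esub> x = x \<otimes>\<^bsub>P\<^esub> u \<otimes>\<^bsub>P\<^esub> c"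
      using cux by blast
    show "\<exists>c\<in>{\<one>\<^bsub>P\<^esub>, x \<otimes>\<^bsub>P\<^esub> x, y \<otimes>\<^bsub>P\<^esub> y, x \<otimes>\<^bsub>P\<^esub> x \<otimes>\<^bsub>P\<^esub> (y \<otimes>\<^bsub>P\<^esub> y)}. u \<otimes>\<^bsub>P\<^esub> y = y \<otimes>\<^bsub>P\<^esub> u \<otimes>\<^bsub>P\<^esub> c"
      using cuy by blast
  qed (use G x4 y4 yu in \<open>auto simp: defs word_simps mat_bilinear H32_mat1_def H32_mat2_def zero_mat_def\<close>)
qed

lemma H245_iso: "\<exists>\<psi> \<in> iso H245 H245_model. \<forall>w \<in> words {Gx, Gy, Gu, Gv}. \<psi> (word_class {Gx, Gy, Gu, Gv} H245_rels w) = eval_word H245_model model_gen w"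
proof -
  interpret cocycle H245_mat1 H245_mat2 True True True by (rule cocycle_True)
  let ?S = "{Gx, Gy, Gu, Gv}" and ?R = H245_rels
  define P where "P = presented_group ?S ?R"
  interpret P: group P unfolding P_def by (rule group_presented_group)
  define x y u v where "x = word_class ?S ?R (gen Gx)" and "y = word_class ?S ?R (gen Gy)" and "u = word_class ?S ?R (gen Gu)" and "v = word_class ?S ?R (gen Gv)"
  note defs = x_def y_def u_def v_def
  have G: "x \<in> carrier P" "y \<in> carrier P" "u \<in> carrier P" "v \<in> carrier P" by (auto simp: P_def defs presented_group_carrier word_simps)
  note R = presented_group_relation[of _ _ ?R ?S, folded P_def]
  note fold = defs[unfolded gen_def, symmetric]
  have m: "(word_pow (gen Gx) 4, []) \<in> ?R" "(word_pow (gen Gy) 4, []) \<in> ?R" "(word_pow (gen Gv) 2, word_comm (gen Gy) (gen Gx)) \<in> ?R" "(word_pow (gen Gy) 2, word_pow (gen Gu) 2) \<in> ?R" "(word_pow (gen Gu) 2, word_comm (gen Gu) (gen Gx)) \<in> ?R" "(word_pow (gen Gx) 2 @ word_pow (gen Gy) 2, word_comm (gen Gu) (gen Gy)) \<in> ?R" "(word_comm (gen Gv) (gen Gu), []) \<in> ?R" "(word_pow (gen Gx) 2, word_pow (gen Gv) 2) \<in> ?R" "(word_comm (gen Gy) (gen Gx), word_comm (gen Gv) (gen Gy)) \<in> ?R" "(word_comm (gen Gu) (gen Gy), word_comm (gen Gv) (gen Gx)) \<in> ?R" by (simp_all add: H245_rels_def Let_def)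
  have x4: "x \<otimes>\<^bsub>P\<^esub> x \<otimes>\<^bsub>P\<^esub> (x \<otimes>\<^bsub>P\<^esub> x) = \<one>\<^bsub>P\<^esub>" using R[OF m(1)] G by (simp add: word_simps fold P.m_assoc)
  have y4: "y \<otimes>\<^bsub>P\<^esub> y \<otimes>\<^bsub>P\<^esub> (y \<otimes>\<^bsub>P\<^esub> y) = \<one>\<^bsub>P\<^esub>" using R[OF m(2)] G by (simp add: word_simps fold P.m_assoc)
  have xv: "x \<otimes>\<^bsub>P\<^esub> x = v \<otimes>\<^bsub>P\<^esub> v" using R[OF m(8)] G by (simp add: word_simps fold)
  have yx: "x \<otimes>\<^bsub>P\<^esub> x = inv\<^bsub>P\<^esub> y \<otimes>\<^bsub>P\<^esub> (inv\<^bsub>P\<^esub> x \<otimes>\<^bsub>P\<^esub> (y \<otimes>\<^bsub>P\<^esub> x))" using R[OF m(3)] G xv by (simp add: word_simps fold)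
  have xy: "x \<otimes>\<^bsub>P\<^esub> y \<otimes>\<^bsub>P\<^esub> x = y" by (rule P.commutator_square_left[OF G(1,2) yx])
  note sq = P.inverted_squares[OF G(1,2) xy]
  have yu: "y \<otimes>\<^bsub>P\<^esub> y = u \<otimes>\<^bsub>P\<^esub> u" using R[OF m(4)] G by (simp add: word_simps fold)
  have ux: "u \<otimes>\<^bsub>P\<^esub> u = inv\<^bsub>P\<^esub> u \<otimes>\<^bsub>P\<^esub> (inv\<^bsub>P\<^esub> x \<otimes>\<^bsub>P\<^esub> (u \<otimes>\<^bsub>P\<^esub> x))" using R[OF m(5)] G by (simp add: word_simps fold)
  have uy: "x \<otimes>\<^bsub>P\<^esub> x \<otimes>\<^bsub>P\<^esub> (y \<otimes>\<^bsub>P\<^esub> y) = inv\<^bsub>P\<^esub> u \<otimes>\<^bsub>P\<^esub> (inv\<^bsub>P\<^esub> y \<otimes>\<^bsub>P\<^esub> (u \<otimes>\<^bsub>P\<^esub> y))" using R[OF m(6)] G by (simp add: word_simps fold P.m_assoc)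
  have uxu: "u \<otimes>\<^bsub>P\<^esub> x \<otimes>\<^bsub>P\<^esub> u = x" by (rule P.commutator_square_right[OF G(1,3) ux]) (use y4 yu in simp)
  note squ = P.inverted_squares[OF G(3,1) uxu]
  have cux: "u \<otimes>\<^bsub>P\<^esub> x = x \<otimes>\<^bsub>P\<^esub> u \<otimes>\<^bsub>P\<^esub> (y \<otimes>\<^bsub>P\<^esub> y)" using P.swap_commutator[OF G(1,3)] ux yu by simp
  have cuy: "u \<otimes>\<^bsub>P\<^esub> y = y \<otimes>\<^bsub>P\<^esub> u \<otimes>\<^bsub>P\<^esub> (x \<otimes>\<^bsub>P\<^esub> x \<otimes>\<^bsub>P\<^esub> (y \<otimes>\<^bsub>P\<^esub> y))" using P.swap_commutator[OF G(2,3)] uy by simp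
  have sc: "x \<otimes>\<^bsub>P\<^esub> x \<otimes>\<^bsub>P\<^esub> x = x \<otimes>\<^bsub>P\<^esub> (x \<otimes>\<^bsub>P\<^esub> x)" "x \<otimes>\<^bsub>P\<^esub> x \<otimes>\<^bsub>P\<^esub> y = y \<otimes>\<^bsub>P\<^esub> (x \<otimes>\<^bsub>P\<^esub> x)" "x \<otimes>\<^bsub>P\<^esub> x \<otimes>\<^bsub>P\<^esub> u = u \<otimes>\<^bsub>P\<^esub> (x \<otimes>\<^bsub>P\<^esub> x)"
    using sq(2)[OF x4] squ(1) G by (simp_all add: P.m_assoc)
  have tc: "y \<otimes>\<^bsub>P\<^esub> y \<otimes>\<^bsub>P\<^esub> x = x \<otimes>\<^bsub>P\<^esub> (y \<otimes>\<^bsub>P\<^esub> y)" "y \<otimes>\<^bsub>P\<^esub> y \<otimes>\<^bsub>P\<^esub> y = y \<otimes>\<^bsub>P\<^esub> (y \<otimes>\<^bsub>P\<^esub> y)" "y \<otimes>\<^bsub>P\<^esub> y \<otimes>\<^bsub>P\<^esub> u = u \<otimes>\<^bsub>P\<^esub> (y \<otimes>\<^bsub>P\<^esub> y)"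
  proof -
    show "y \<otimes>\<^bsub>P\<^esub> y \<otimes>\<^bsub>P\<^esub> x = x \<otimes>\<^bsub>P\<^esub> (y \<otimes>\<^bsub>P\<^esub> y)" by (rule sq(1))
    show "y \<otimes>\<^bsub>P\<^esub> y \<otimes>\<^bsub>P\<^esub> y = y \<otimes>\<^bsub>P\<^esub> (y \<otimes>\<^bsub>P\<^esub> y)" using G by (simp add: P.m_assoc)
    show "y \<otimes>\<^bsub>P\<^esub> y \<otimes>\<^bsub>P\<^esub> u = u \<otimes>\<^bsub>P\<^esub> (y \<otimes>\<^bsub>P\<^esub> y)" unfolding yu using G by (simp add: P.m_assoc)
  qed
  have vu: "\<one>\<^bsub>P\<^esub> = inv\<^bsub>P\<^esub> v \<otimes>\<^bsub>P\<^esub> (inv\<^bsub>P\<^esub> u \<otimes>\<^bsub>P\<^esub> (v \<otimes>\<^bsub>P\<^esub> u))" using R[OF m(7)] G by (simp add: word_simps fold)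
  have vy: "inv\<^bsub>P\<^esub> y \<otimes>\<^bsub>P\<^esub> (inv\<^bsub>P\<^esub> x \<otimes>\<^bsub>P\<^esub> (y \<otimes>\<^bsub>P\<^esub> x)) = inv\<^bsub>P\<^esub> v \<otimes>\<^bsub>P\<^esub> (inv\<^bsub>P\<^esub> y \<otimes>\<^bsub>P\<^esub> (v \<otimes>\<^bsub>P\<^esub> y))" using R[OF m(9)] G by (simp add: word_simps fold)
  have vx: "inv\<^bsub>P\<^esub> u \<otimes>\<^bsub>P\<^esub> (inv\<^bsub>P\<^esub> y \<otimes>\<^bsub>P\<^esub> (u \<otimes>\<^bsub>P\<^esub> y)) = inv\<^bsub>P\<^esub> v \<otimes>\<^bsub>P\<^esub> (inv\<^bsub>P\<^esub> x \<otimes>\<^bsub>P\<^esub> (v \<otimes>\<^bsub>P\<^esub> x))" using R[OF m(10)] G by (simp add: word_simps fold)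
  have vvy: "v \<otimes>\<^bsub>P\<^esub> v = inv\<^bsub>P\<^esub> v \<otimes>\<^bsub>P\<^esub> (inv\<^bsub>P\<^esub> y \<otimes>\<^bsub>P\<^esub> (v \<otimes>\<^bsub>P\<^esub> y))" using vy yx xv by simp
  have vyv: "v \<otimes>\<^bsub>P\<^esub> y \<otimes>\<^bsub>P\<^esub> v = y" by (rule P.commutator_square_right[OF G(2,4) vvy]) (use x4 xv in simp)
  note sqv = P.inverted_squares[OF G(4,2) vyv]
  have cvy: "v \<otimes>\<^bsub>P\<^esub> y = y \<otimes>\<^bsub>P\<^esub> v \<otimes>\<^bsub>P\<^esub> (x \<otimes>\<^bsub>P\<^esub> x)" using P.swap_commutator[OF G(2,4)] vvy xv by simp
  have cvx: "v \<otimes>\<^bsub>P\<^esub> x = x \<otimes>\<^bsub>P\<^esub> v \<otimes>\<^bsub>P\<^esub> (x \<otimes>\<^bsub>P\<^esub> x \<otimes>\<^bsub>P\<^esub> (y \<otimes>\<^bsub>P\<^esub> y))" using P.swap_commutator[OF G(1,4)] uy vx by simp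
  have cvu: "v \<otimes>\<^bsub>P\<^esub> u = u \<otimes>\<^bsub>P\<^esub> v \<otimes>\<^bsub>P\<^esub> \<one>\<^bsub>P\<^esub>" using P.swap_commutator[OF G(3,4)] vu by simp
  have "x \<otimes>\<^bsub>P\<^esub> x \<otimes>\<^bsub>P\<^esub> v = v \<otimes>\<^bsub>P\<^esub> (x \<otimes>\<^bsub>P\<^esub> x)" unfolding xv using G by (simp add: P.m_assoc)
  note sc = sc this
  note tc = tc sqv(1)
  show ?thesis
    unfolding H245_def P_def[symmetric]
  proof (rule presented_model_iso[OF cocycle_True HOL.refl, where S = ?S and R = ?R and ?T1.0 = H245_mat1 and ?m3.0 = True and ?m4.0 = True and ?x1.0 = x and ?x2.0 = y and ?x3.0 = u and ?x4.0 = v and ws = "word_pow (gen Gx) 2" and wt = "word_pow (gen Gy) 2" and s = "x \<otimes>\<^bsub>P\<^esub> x" and t = "y \<otimes>\<^bsub>P\<^esub> y", folded P_def])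
    show "eval_word M model_gen l = eval_word M model_gen r" if "(l, r) \<in> ?R" for l r
      using that by (auto simp: H245_rels_def word_simps inv_M mat_bilinear)
    show "eval_word M model_gen (word_pow (gen Gx) 2) = (zero4, True, False)"
      by (simp add: word_simps mat_bilinear)
    show "x \<otimes>\<^bsub>P\<^esub> x = word_class ?S ?R (word_pow (gen Gx) 2)"
      using presented_group_eval[of "word_pow (gen Gx) 2" ?S ?R, folded P_def] G by (simp add: word_simps fold)
    show "y \<otimes>\<^bsub>P\<^esub> y = word_class ?S ?R (word_pow (gen Gy) 2)"
      using presented_group_eval[of "word_pow (gen Gy) 2" ?S ?R, folded P_def] G by (simp add: word_simps fold)
    show "x \<otimes>\<^bsub>P\<^esub> x \<otimes>\<^bsub>P\<^esub> word_class ?S ?R (gen g) = word_class ?S ?R (gen g) \<otimes>\<^bsub>P\<^esub> (x \<otimes>\<^bsub>P\<^esub> x)" if "g \<in> ?S" for g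
      using that sc unfolding defs by blast
    show "y \<otimes>\<^bsub>P\<^esub> y \<otimes>\<^bsub>P\<^esub> word_class ?S ?R (gen g) = word_class ?S ?R (gen g) \<otimes>\<^bsub>P\<^esub> (y \<otimes>\<^bsub>P\<^esub> y)" if "g \<in> ?S" for g
      using that tc unfolding defs by blast
    show "\<exists>c\<in>{\<one>\<^bsub>P\<^esub>, x \<otimes>\<^bsub>P\<^esub> x, y \<otimes>\<^bsub>P\<^esub> y, x \<otimes>\<^bsub>P\<^esub> x \<otimes>\<^bsub>P\<^esub> (y \<otimes>\<^bsub>P\<^esub> y)}. y \<otimes>\<^bsub>P\<^esub> x = x \<otimes>\<^bsub>P\<^esub> y \<otimes>\<^bsub>P\<^esub> c"
      using sq(3)[OF x4] by blast
    show "\<exists>c\<in>{\<one>\<^bsub>P\<^esub>, x \<otimes>\<^bsub>P\<^esub> x, y \<otimes>\<^bsub>P\<^esub> y, x \<otimes>\<^bsub>P\<^esub> x \<otimes>\<^bsub>P\<^esub> (y \<otimes>\<^bsub>P\<^esub> y)}. u \<otimes>\<^bsub>P\<^esub> x = x \<otimes>\<^bsub>P\<^esub> u \<otimes>\<^bsub>P\<^esub> c"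
      using cux by blast
    show "\<exists>c\<in>{\<one>\<^bsub>P\<^esub>, x \<otimes>\<^bsub>P\<^esub> x, y \<otimes>\<^bsub>P\<^esub> y, x \<otimes>\<^bsub>P\<^esub> x \<otimes>\<^bsub>P\<^esub> (y \<otimes>\<^bsub>P\<^esub> y)}. v \<otimes>\<^bsub>P\<^esub> x = x \<otimes>\<^bsub>P\<^esub> v \<otimes>\<^bsub>P\<^esub> c"
      using cvx by blast
    show "\<exists>c\<in>{\<one>\<^bsub>P\<^esub>, x \<otimes>\<^bsub>P\<^esub> x, y \<otimes>\<^bsub>P\<^esub> y, x \<otimes>\<^bsub>P\<^esub> x \<otimes>\<^bsub>P\<^esub> (y \<otimes>\<^bsub>P\<^esub> y)}. u \<otimes>\<^bsub>P\<^esub> y = y \<otimes>\<^bsub>P\<^esub> u \<otimes>\<^bsub>P\<^esub> c"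
      using cuy by blast
    show "\<exists>c\<in>{\<one>\<^bsub>P\<^esub>, x \<otimes>\<^bsub>P\<^esub> x, y \<otimes>\<^bsub>P\<^esub> y, x \<otimes>\<^bsub>P\<^esub> x \<otimes>\<^bsub>P\<^esub> (y \<otimes>\<^bsub>P\<^esub> y)}. v \<otimes>\<^bsub>P\<^esub> y = y \<otimes>\<^bsub>P\<^esub> v \<otimes>\<^bsub>P\<^esub> c"
      using cvy by blast
    show "\<exists>c\<in>{\<one>\<^bsub>P\<^esub>, x \<otimes>\<^bsub>P\<^esub> x, y \<otimes>\<^bsub>P\<^esub> y, x \<otimes>\<^bsub>P\<^esub> x \<otimes>\<^bsub>P\<^esub> (y \<otimes>\<^bsub>P\<^esub> y)}. v \<otimes>\<^bsub>P\<^esub> u = u \<otimes>\<^bsub>P\<^esub> v \<otimes>\<^bsub>P\<^esub> c"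
      using cvu by blast
  qed (use G x4 y4 yu xv in \<open>auto simp: defs word_simps mat_bilinear H245_mat1_def H245_mat2_def zero_mat_def\<close>)
qed

section \<open>Splitting off an elementary abelian factor\<close>

context char2_exponent4_group
begin

text \<open>A vector space complement over the field with two elements, of possibly infinite
  dimension. Zorn's lemma gives a subgroup maximal among those meeting \<open>C\<close> trivially;
  an involution outside \<open>EC\<close> could still be adjoined to it.\<close>

lemma complement_in_Om:
  assumes C: "subgroup C G" "C \<subseteq> Om"
  obtains E where "subgroup E G" "E \<subseteq> Om" "E \<inter> C = {\<one>}" "\<And>w. w \<in> Om \<Longrightarrow> \<exists>e\<in>E. \<exists>c\<in>C. w = e \<otimes> c"
proof -
  define \<A> where "\<A> = {E. subgroup E G \<and> E \<subseteq> Om \<and> E \<inter> C = {\<one>}}"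
  interpret C: subgroup C G by (rule C)
  have tr: "{\<one>} \<in> \<A>" by (auto simp: \<A>_def intro: triv_subgroup)
  have "\<exists>F\<in>\<A>. \<forall>Y\<in>\<A>. F \<subseteq> Y \<longrightarrow> Y = F"
  proof (rule subset_Zorn_nonempty)
    show "\<A> \<noteq> {}" using tr by blast
    fix K assume K: "K \<noteq> {}" "subset.chain \<A> K"
    then have sub: "subgroup E G" "E \<subseteq> Om" "E \<inter> C = {\<one>}" if "E \<in> K" for E
      using that by (auto simp: \<A>_def subset.chain_def)
    have "subgroup (\<Union>K) G"
    proof
      show "\<Union>K \<subseteq> carrier G" using sub(2) Om_closed by blast
      show "\<one> \<in> \<Union>K"
      proof -
        obtain E where "E \<in> K" using K(1) by blast
        then show ?thesis using subgroup.one_closed[OF sub(1)] by blast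
      qed
      show "inv x \<in> \<Union>K" if x: "x \<in> \<Union>K" for x
      proof -
        obtain E where "E \<in> K" "x \<in> E" using x by blast
        then show ?thesis using subgroup.m_inv_closed[OF sub(1)] by blast
      qed
      show "x \<otimes> y \<in> \<Union>K" if xy: "x \<in> \<Union>K" "y \<in> \<Union>K" for x y
      proof -
        obtain E F where EF: "E \<in> K" "F \<in> K" "x \<in> E" "y \<in> F" using xy by blast
        then have "E \<subseteq> F \<or> F \<subseteq> E" using K(2) by (auto simp: subset.chain_def)
        then show ?thesis using EF subgroup.m_closed[OF sub(1)[OF EF(1)], of x y] subgroup.m_closed[OF sub(1)[OF EF(2)], of x y] by blast
      qed
    qed
    moreover have "\<Union>K \<subseteq> Om" using sub(2) by blast
    moreover have "\<Union>K \<inter> C = {\<one>}" using sub(3) K(1) by blast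
    ultimately show "\<Union>K \<in> \<A>" by (simp add: \<A>_def)
  qed
  then obtain E where E: "E \<in> \<A>" and max: "\<And>Y. Y \<in> \<A> \<Longrightarrow> E \<subseteq> Y \<Longrightarrow> Y = E" by blast
  have Es: "subgroup E G" "E \<subseteq> Om" "E \<inter> C = {\<one>}" using E by (auto simp: \<A>_def)
  interpret E: subgroup E G by (rule Es)
  have "\<exists>e\<in>E. \<exists>c\<in>C. w = e \<otimes> c" if w: "w \<in> Om" for w
  proof (rule ccontr)
    assume n: "\<not> ?thesis"
    have wG: "w \<in> carrier G" "w \<otimes> w = \<one>" using w Om_closed Om_sq by auto
    define F where "F = E \<union> (\<lambda>e. e \<otimes> w) ` E"
    have EO: "e \<in> Om" "e \<in> carrier G" if "e \<in> E" for e using that Es by auto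
    have ewf: "(e \<otimes> w) \<otimes> (f \<otimes> w) = e \<otimes> f" "e \<otimes> (f \<otimes> w) = (e \<otimes> f) \<otimes> w" "(e \<otimes> w) \<otimes> f = (e \<otimes> f) \<otimes> w" if "e \<in> E" "f \<in> E" for e f
      using EO[OF that(1)] EO[OF that(2)] w wG by (simp_all add: Om_simps)
    have "subgroup F G"
    proof
      show "F \<subseteq> carrier G" using wG by (auto simp: F_def)
      show "\<one> \<in> F" by (simp add: F_def)
      show "x \<otimes> y \<in> F" if "x \<in> F" "y \<in> F" for x y
        using that ewf unfolding F_def by auto
      show "inv x \<in> F" if "x \<in> F" for x
      proof -
        have "x \<in> Om" using that EO w by (auto simp: F_def)
        then have "inv x = x" by (intro inv_equality) (auto simp: Om_def)
        then show ?thesis using that by simp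
      qed
    qed
    moreover have "F \<subseteq> Om" using EO w by (auto simp: F_def)
    moreover have "F \<inter> C = {\<one>}"
    proof -
      have "e \<otimes> w \<notin> C" if e: "e \<in> E" for e
      proof
        assume "e \<otimes> w \<in> C"
        moreover have "w = e \<otimes> (e \<otimes> w)" using Om_sq2[OF EO(1)[OF e] wG(1)] by simp
        ultimately show False using n e by blast
      qed
      then show ?thesis using Es(3) by (auto simp: F_def)
    qed
    ultimately have "F \<in> \<A>" by (simp add: \<A>_def)
    then have "F = E" using max by (auto simp: F_def)
    moreover have "\<one> \<otimes> w \<in> F" by (auto simp: F_def)
    ultimately have "w \<in> E" using wG by simp
    then show False using n C.one_closed wG by (metis r_one)
  qed
  then show thesis using that Es by blast
qed

end

context quadratic_group
begin

text \<open>A bilinear form with diagonal \<open>q1\<close> on the span of the four elements. Being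
  lower triangular, it is the cocycle that appears when two products in normal order are multiplied;
  see \<open>prod4_mult\<close>.\<close>

definition mat1 where "mat1 x1 x2 x3 x4 = ((q1 x1, False, False, False), (B1 x2 x1, q1 x2, False, False),
   (B1 x3 x1, B1 x3 x2, q1 x3, False), (B1 x4 x1, B1 x4 x2, B1 x4 x3, q1 x4))"
definition mat2 where "mat2 x1 x2 x3 x4 = ((q2 x1, False, False, False), (B2 x2 x1, q2 x2, False, False),
   (B2 x3 x1, B2 x3 x2, q2 x3, False), (B2 x4 x1, B2 x4 x2, B2 x4 x3, q2 x4))"

lemma pw_mult_pw: "x \<in> carrier G \<Longrightarrow> pw v x \<otimes> pw w x = pw (v \<noteq> w) x \<otimes> S (v \<and> w \<and> q1 x) (v \<and> w \<and> q2 x)"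
  using sq_S[of x] by (cases v; cases w) (simp_all add: S_simps sq_def)

text \<open>One step of collecting, from the right end: moving \<open>pw w x\<close> to the left
  past \<open>A\<close> costs a central commutator, and merging it with \<open>pw v x\<close> may
  cost the square of \<open>x\<close>.\<close>

lemma pw_step:
  assumes G: "x \<in> carrier G" "A \<in> carrier G" "A' \<in> carrier G" "C \<in> carrier G" and e: "A \<otimes> A' = C \<otimes> S a b"
  shows "(pw v x \<otimes> A) \<otimes> (pw w x \<otimes> A') = (pw (v \<noteq> w) x \<otimes> C) \<otimes>
    S (a \<noteq> ((v \<and> w \<and> q1 x) \<noteq> (w \<and> B1 A x))) (b \<noteq> ((v \<and> w \<and> q2 x) \<noteq> (w \<and> B2 A x)))"
proof -
  have Sc: "S c d \<otimes> g = g \<otimes> S c d" if "g \<in> carrier G" for c d g using Om_comm that by simp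
  have Ax: "A \<otimes> pw w x = pw w x \<otimes> A \<otimes> S (w \<and> B1 A x) (w \<and> B2 A x)"
    using swap[of "pw w x" A] cm_S[of "pw w x" A] B_sym[of x A] G by (simp add: B_pw)
  have "(pw v x \<otimes> A) \<otimes> (pw w x \<otimes> A') = pw v x \<otimes> (A \<otimes> pw w x) \<otimes> A'" using G by (simp add: m_assoc)
  also have "\<dots> = (pw v x \<otimes> pw w x) \<otimes> A \<otimes> (S (w \<and> B1 A x) (w \<and> B2 A x) \<otimes> A')" unfolding Ax using G by (simp add: m_assoc)
  also have "\<dots> = (pw v x \<otimes> pw w x) \<otimes> (A \<otimes> A') \<otimes> S (w \<and> B1 A x) (w \<and> B2 A x)"
    using G Sc[OF G(3)] by (simp add: m_assoc)
  also have "\<dots> = pw (v \<noteq> w) x \<otimes> (S (v \<and> w \<and> q1 x) (v \<and> w \<and> q2 x) \<otimes> C) \<otimes> S a b \<otimes> S (w \<and> B1 A x) (w \<and> B2 A x)"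
    unfolding e pw_mult_pw[OF G(1)] using G by (simp add: m_assoc)
  also have "\<dots> = pw (v \<noteq> w) x \<otimes> C \<otimes> (S (v \<and> w \<and> q1 x) (v \<and> w \<and> q2 x) \<otimes> (S a b \<otimes> S (w \<and> B1 A x) (w \<and> B2 A x)))"
    unfolding Sc[OF G(4)] using G by (simp add: m_assoc)
  moreover have "(p \<noteq> (a' \<noteq> q)) = (a' \<noteq> (p \<noteq> q))" for p a' q by argo
  ultimately show ?thesis by (simp only: S_mult)
qed

fun prod4 where "prod4 x1 x2 x3 x4 (a, b, c, d) = pw a x1 \<otimes> (pw b x2 \<otimes> (pw c x3 \<otimes> pw d x4))"

lemma prod4_closed [simp]:
  "x1 \<in> carrier G \<Longrightarrow> x2 \<in> carrier G \<Longrightarrow> x3 \<in> carrier G \<Longrightarrow> x4 \<in> carrier G \<Longrightarrow> prod4 x1 x2 x3 x4 v \<in> carrier G"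
  by (cases v) simp

lemma prod4_mult:
  assumes G: "x1 \<in> carrier G" "x2 \<in> carrier G" "x3 \<in> carrier G" "x4 \<in> carrier G"
  shows "prod4 x1 x2 x3 x4 v \<otimes> prod4 x1 x2 x3 x4 w = prod4 x1 x2 x3 x4 (vadd v w) \<otimes>
    S (bilinear4 (mat1 x1 x2 x3 x4) v w) (bilinear4 (mat2 x1 x2 x3 x4) v w)"
proof -
  obtain a b c d where v: "v = (a, b, c, d)" by (metis prod.exhaust)
  obtain a' b' c' d' where w: "w = (a', b', c', d')" by (metis prod.exhaust)
  have S_eq: "g \<otimes> S e f = g \<otimes> S e' f'" if "e = e'" "f = f'" for g e f e' f' using that by simp
  note 4 = pw_mult_pw[OF G(4), of d d']
  note 3 = pw_step[OF G(3) _ _ _ 4, of c c']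
  note 2 = pw_step[OF G(2) _ _ _ 3, of b b']
  note 1 = pw_step[OF G(1) _ _ _ 2, of a a']
  show ?thesis
    unfolding v w prod4.simps vadd.simps
  proof (rule HOL.trans[OF 1 S_eq])
    have b: "B1 (pw d x4) x3 = (d \<and> B1 x4 x3)" "B2 (pw d x4) x3 = (d \<and> B2 x4 x3)"
      "B1 (pw c x3 \<otimes> pw d x4) x2 = ((c \<and> B1 x3 x2) \<noteq> (d \<and> B1 x4 x2))"
      "B2 (pw c x3 \<otimes> pw d x4) x2 = ((c \<and> B2 x3 x2) \<noteq> (d \<and> B2 x4 x2))"
      "B1 (pw b x2 \<otimes> (pw c x3 \<otimes> pw d x4)) x1 = ((b \<and> B1 x2 x1) \<noteq> ((c \<and> B1 x3 x1) \<noteq> (d \<and> B1 x4 x1)))"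
      "B2 (pw b x2 \<otimes> (pw c x3 \<otimes> pw d x4)) x1 = ((b \<and> B2 x2 x1) \<noteq> ((c \<and> B2 x3 x1) \<noteq> (d \<and> B2 x4 x1)))"
      using G by (simp_all add: B_mult B_pw)
    show "((((d \<and> d' \<and> q1 x4) \<noteq> ((c \<and> c' \<and> q1 x3) \<noteq> (c' \<and> B1 (pw d x4) x3))) \<noteq>
          ((b \<and> b' \<and> q1 x2) \<noteq> (b' \<and> B1 (pw c x3 \<otimes> pw d x4) x2))) \<noteq>
         ((a \<and> a' \<and> q1 x1) \<noteq> (a' \<and> B1 (pw b x2 \<otimes> (pw c x3 \<otimes> pw d x4)) x1))) =
      bilinear4 (mat1 x1 x2 x3 x4) (a, b, c, d) (a', b', c', d')"
      by (simp only: b mat1_def bilinear4.simps dot4.simps) argo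
    show "((((d \<and> d' \<and> q2 x4) \<noteq> ((c \<and> c' \<and> q2 x3) \<noteq> (c' \<and> B2 (pw d x4) x3))) \<noteq>
          ((b \<and> b' \<and> q2 x2) \<noteq> (b' \<and> B2 (pw c x3 \<otimes> pw d x4) x2))) \<noteq>
         ((a \<and> a' \<and> q2 x1) \<noteq> (a' \<and> B2 (pw b x2 \<otimes> (pw c x3 \<otimes> pw d x4)) x1))) =
      bilinear4 (mat2 x1 x2 x3 x4) (a, b, c, d) (a', b', c', d')"
      by (simp only: b mat2_def bilinear4.simps dot4.simps) argo
  qed (use G in simp_all)
qed

definition emb where "emb x1 x2 x3 x4 = (\<lambda>(v, z1, z2). prod4 x1 x2 x3 x4 v \<otimes> S z1 z2)"

text \<open>By \<open>anis\<close>, a product with nonzero vector part has nontrivial square, so the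
  kernel lies in the central part, where \<open>S\<close> is injective. The last claim is the same
  argument for involutions and later makes the image disjoint from a complement.\<close>

lemma emb_iso:
  assumes G: "x1 \<in> carrier G" "x2 \<in> carrier G" "x3 \<in> carrier G" "x4 \<in> carrier G"
    and mat: "mat1 x1 x2 x3 x4 = T1" "mat2 x1 x2 x3 x4 = T2" and coc: "cocycle T2 mz"
    and anis: "\<And>v. masked m3 m4 v \<Longrightarrow> \<not> bilinear4 T1 v v \<Longrightarrow> \<not> bilinear4 T2 v v \<Longrightarrow> v = zero4"
  defines "M \<equiv> cocycle_group T1 T2 m3 m4 mz"
  defines "H \<equiv> emb x1 x2 x3 x4 ` carrier M"
  shows "subgroup H G" "emb x1 x2 x3 x4 \<in> iso M (G\<lparr>carrier := H\<rparr>)"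
    "\<And>v z1 z2. (v, z1, z2) \<in> carrier M \<Longrightarrow> emb x1 x2 x3 x4 (v, z1, z2) \<in> Om \<Longrightarrow> v = zero4"
proof -
  interpret cocycle T1 T2 m3 m4 mz by (rule coc)
  have Sc: "S c d \<otimes> g = g \<otimes> S c d" if "g \<in> carrier G" for c d g using Om_comm that by simp
  have p: "prod4 x1 x2 x3 x4 v \<in> carrier G" for v using G by simp
  have hom: "emb x1 x2 x3 x4 \<in> hom M G"
  proof (rule homI)
    show "emb x1 x2 x3 x4 g \<in> carrier G" for g using G by (cases g) (simp add: emb_def)
    fix g h :: "vec4 \<times> bool \<times> bool"
    obtain v z1 z2 where g: "g = (v, z1, z2)" by (metis prod.exhaust)
    obtain w y1 y2 where h: "h = (w, y1, y2)" by (metis prod.exhaust)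
    have "emb x1 x2 x3 x4 g \<otimes> emb x1 x2 x3 x4 h = prod4 x1 x2 x3 x4 v \<otimes> (S z1 z2 \<otimes> prod4 x1 x2 x3 x4 w) \<otimes> S y1 y2"
      using p by (simp add: emb_def g h m_assoc)
    also have "\<dots> = (prod4 x1 x2 x3 x4 v \<otimes> prod4 x1 x2 x3 x4 w) \<otimes> (S z1 z2 \<otimes> S y1 y2)"
      unfolding Sc[OF p] using p by (simp add: m_assoc)
    also have "\<dots> = prod4 x1 x2 x3 x4 (vadd v w) \<otimes> (S (bilinear4 T1 v w) (bilinear4 T2 v w) \<otimes> (S z1 z2 \<otimes> S y1 y2))"
      unfolding prod4_mult[OF G] mat using p by (simp add: m_assoc)
    also have "\<dots> = emb x1 x2 x3 x4 (g \<otimes>\<^bsub>M\<^esub> h)"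
    proof -
      have "S (bilinear4 T1 v w \<noteq> (z1 \<noteq> y1)) (bilinear4 T2 v w \<noteq> (z2 \<noteq> y2)) =
        S ((z1 \<noteq> y1) \<noteq> bilinear4 T1 v w) ((z2 \<noteq> y2) \<noteq> bilinear4 T2 v w)"
        unfolding S_inj by argo
      then show ?thesis by (simp only: emb_def g h M_def cocycle_group_simps prod.case S_mult)
    qed
    finally show "emb x1 x2 x3 x4 (g \<otimes>\<^bsub>M\<^esub> h) = emb x1 x2 x3 x4 g \<otimes> emb x1 x2 x3 x4 h" by simp
  qed
  have Mg: "group M" unfolding M_def by (rule group_M)
  interpret h: group_hom M G "emb x1 x2 x3 x4"
    using hom Mg group_axioms by (simp add: group_hom_def group_hom_axioms_def)
  show Om: "v = zero4" if "(v, z1, z2) \<in> carrier M" "emb x1 x2 x3 x4 (v, z1, z2) \<in> Om" for v z1 z2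
  proof -
    have "prod4 x1 x2 x3 x4 v = emb x1 x2 x3 x4 (v, z1, z2) \<otimes> S z1 z2" using p by (simp add: emb_def m_assoc S_mult S_simps)
    then have "prod4 x1 x2 x3 x4 v \<in> Om" using that by simp
    then have "prod4 x1 x2 x3 x4 zero4 \<otimes> S (bilinear4 T1 v v) (bilinear4 T2 v v) = \<one>"
      using prod4_mult[OF G, of v v] by (simp add: Om_sq mat)
    then have "S (bilinear4 T1 v v) (bilinear4 T2 v v) = S False False" by (simp add: S_simps)
    then show ?thesis using anis[of v] that by (simp add: S_inj M_def)
  qed
  show "subgroup H G" unfolding H_def by (rule h.img_is_subgroup)
  have "inj_on (emb x1 x2 x3 x4) (carrier M)"
    unfolding h.inj_on_one_iff
  proof (intro allI impI)
    fix g assume g: "g \<in> carrier M" "emb x1 x2 x3 x4 g = \<one>"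
    obtain v z1 z2 where ge: "g = (v, z1, z2)" by (metis prod.exhaust)
    have "v = zero4" using Om[of v z1 z2] g by (simp add: ge)
    then have "S z1 z2 = S False False" using g by (simp add: ge emb_def S_simps)
    then show "g = \<one>\<^bsub>M\<^esub>" using \<open>v = zero4\<close> by (simp add: ge S_inj M_def)
  qed
  then show "emb x1 x2 x3 x4 \<in> iso M (G\<lparr>carrier := H\<rparr>)"
    using hom by (auto simp: iso_def hom_def bij_betw_def H_def)
qed

text \<open>\<open>H\<close> meets \<open>Om\<close> exactly in \<open>C\<close>, so a complement
  \<open>E\<close> of \<open>C\<close> in \<open>Om\<close> meets \<open>H\<close> trivially. By
  \<open>spans\<close>, each \<open>g\<close> lies in \<open>Om\<close> times \<open>H\<close>, and
  \<open>Om\<close> is \<open>EC\<close> with \<open>C\<close> inside \<open>H\<close>. Centrality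
  of \<open>E\<close> makes multiplication a homomorphism.\<close>

theorem direct_product_decomposition:
  assumes G: "x1 \<in> carrier G" "x2 \<in> carrier G" "x3 \<in> carrier G" "x4 \<in> carrier G"
    and mat: "mat1 x1 x2 x3 x4 = T1" "mat2 x1 x2 x3 x4 = T2"
    and anis: "\<And>v. masked m3 m4 v \<Longrightarrow> \<not> bilinear4 T1 v v \<Longrightarrow> \<not> bilinear4 T2 v v \<Longrightarrow> v = zero4"
    and sp: "spans x1 x2 x3 x4" and m: "m3 \<or> x3 = \<one>" "m4 \<or> x4 = \<one>"
  defines "M \<equiv> cocycle_group T1 T2 m3 m4 True"
  defines "H \<equiv> emb x1 x2 x3 x4 ` carrier M"
  obtains E where "internal_direct_product G E H" "elementary_abelian_two_group (G\<lparr>carrier := E\<rparr>)"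
proof -
  have e: "subgroup H G" "emb x1 x2 x3 x4 \<in> iso M (G\<lparr>carrier := H\<rparr>)"
    "\<And>v z1 z2. (v, z1, z2) \<in> carrier M \<Longrightarrow> emb x1 x2 x3 x4 (v, z1, z2) \<in> Om \<Longrightarrow> v = zero4"
    unfolding H_def M_def using emb_iso[OF G mat cocycle_True] anis by blast+
  define C where "C = range (\<lambda>(a, b). S a b)"
  have SC: "S a b \<in> C" for a b by (auto simp: C_def)
  have CE: "\<exists>a b. c = S a b" if "c \<in> C" for c using that by (auto simp: C_def)
  have C: "subgroup C G"
  proof
    show "C \<subseteq> carrier G" by (auto simp: C_def)
    show "\<one> \<in> C" using SC[of False False] by (simp add: S_simps)
    show "x \<otimes> y \<in> C" if "x \<in> C" "y \<in> C" for x y using CE[OF that(1)] CE[OF that(2)] SC by (auto simp: S_mult)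
    show "inv x \<in> C" if x: "x \<in> C" for x
    proof -
      obtain a b where "x = S a b" using CE[OF x] by blast
      then have "x \<otimes> x = \<one>" "x \<in> carrier G" by (simp_all add: S_mult S_simps)
      then show ?thesis using x inv_equality by metis
    qed
  qed
  have "C \<subseteq> Om" by (auto simp: C_def)
  then obtain E where E: "subgroup E G" "E \<subseteq> Om" "E \<inter> C = {\<one>}" and EC: "\<And>w. w \<in> Om \<Longrightarrow> \<exists>e\<in>E. \<exists>c\<in>C. w = e \<otimes> c"
    using complement_in_Om[OF C] by metis
  interpret E: subgroup E G by (rule E)
  interpret H: subgroup H G by (rule e(1))
  have EO: "a \<in> Om" if "a \<in> E" for a using that E by blast
  have EH: "E \<inter> H = {\<one>}"
  proof -
    have "h = \<one>" if h: "h \<in> E" "h \<in> H" for h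
    proof -
      obtain v z1 z2 where v: "(v, z1, z2) \<in> carrier M" "h = emb x1 x2 x3 x4 (v, z1, z2)"
      proof -
        obtain m where "m \<in> carrier M" "h = emb x1 x2 x3 x4 m" using h(2) unfolding H_def by blast
        then show thesis using that[of "fst m" "fst (snd m)" "snd (snd m)"] by simp
      qed
      then have "v = zero4" using e(3) EO[OF h(1)] by blast
      then have "h \<in> C" using v SC by (simp add: emb_def)
      then show ?thesis using h E(3) by blast
    qed
    then show ?thesis by auto
  qed
  have CH: "S a b \<in> H" for a b
  proof -
    have "emb x1 x2 x3 x4 (zero4, a, b) \<in> H" unfolding H_def by (rule imageI) (simp add: M_def)
    then show ?thesis by (simp add: emb_def)
  qed
  have PH: "prod4 x1 x2 x3 x4 v \<in> H" for v
  proof -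
    obtain a b c d where v: "v = (a, b, c, d)" by (metis prod.exhaust)
    have "prod4 x1 x2 x3 x4 v = emb x1 x2 x3 x4 ((a, b, c \<and> m3, d \<and> m4), False, False)"
      using m G by (auto simp: emb_def S_simps v pw_def)
    moreover have "emb x1 x2 x3 x4 ((a, b, c \<and> m3, d \<and> m4), False, False) \<in> H"
      unfolding H_def by (rule imageI) (simp add: M_def)
    ultimately show ?thesis by simp
  qed
  have idp: "internal_direct_product G E H"
    unfolding internal_direct_product_def
  proof (intro conjI)
    show "subgroup E G" by (rule E)
    show "subgroup H G" by (rule e(1))
    let ?f = "\<lambda>(a, b). a \<otimes> b"
    have hom: "?f \<in> hom (G\<lparr>carrier := E\<rparr> \<times>\<times> G\<lparr>carrier := H\<rparr>) G"
    proof (rule homI)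
      fix p r assume "p \<in> carrier (G\<lparr>carrier := E\<rparr> \<times>\<times> G\<lparr>carrier := H\<rparr>)" "r \<in> carrier (G\<lparr>carrier := E\<rparr> \<times>\<times> G\<lparr>carrier := H\<rparr>)"
      then obtain a b a' b' where p: "p = (a, b)" "a \<in> E" "b \<in> H" "r = (a', b')" "a' \<in> E" "b' \<in> H" by auto
      have "a \<otimes> b \<otimes> (a' \<otimes> b') = a \<otimes> (b \<otimes> a') \<otimes> b'" using p by (simp add: m_assoc)
      also have "b \<otimes> a' = a' \<otimes> b" using Om_comm[of a' b] EO p by simp
      finally show "?f (p \<otimes>\<^bsub>G\<lparr>carrier := E\<rparr> \<times>\<times> G\<lparr>carrier := H\<rparr>\<^esub> r) = ?f p \<otimes> ?f r" using p by (simp add: m_assoc)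
    qed auto
    interpret f: group_hom "G\<lparr>carrier := E\<rparr> \<times>\<times> G\<lparr>carrier := H\<rparr>" G ?f
      using hom DirProd_group[OF subgroup_imp_group[OF E(1)] subgroup_imp_group[OF e(1)]] group_axioms
      by (simp add: group_hom_def group_hom_axioms_def)
    show "?f \<in> iso (G\<lparr>carrier := E\<rparr> \<times>\<times> G\<lparr>carrier := H\<rparr>) G"
      unfolding f.iso_iff
    proof (intro conjI subsetI ballI impI)
      fix g assume g: "g \<in> carrier G"
      obtain i j k l where "sq (g \<otimes> prod4 x1 x2 x3 x4 (i, j, k, l)) = \<one>" using sp g unfolding spans_def by auto
      then obtain v where v: "g \<otimes> prod4 x1 x2 x3 x4 v \<in> Om" using sq_eq_one G g by (metis m_closed prod4_closed)
      then obtain a c where ac: "a \<in> E" "c \<in> C" "g \<otimes> prod4 x1 x2 x3 x4 v = a \<otimes> c" using EC by blast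
      obtain z1 z2 where c: "c = S z1 z2" using CE ac by blast
      have h: "c \<otimes> inv (prod4 x1 x2 x3 x4 v) \<in> H" using CH PH c by auto
      have "g = a \<otimes> c \<otimes> inv (prod4 x1 x2 x3 x4 v)" unfolding ac(3)[symmetric] using g G by (simp add: m_assoc)
      also have "\<dots> = a \<otimes> (c \<otimes> inv (prod4 x1 x2 x3 x4 v))" using ac c G by (simp add: m_assoc)
      finally show "g \<in> ?f ` carrier (G\<lparr>carrier := E\<rparr> \<times>\<times> G\<lparr>carrier := H\<rparr>)" using ac h
        by (intro image_eqI[of _ _ "(a, c \<otimes> inv (prod4 x1 x2 x3 x4 v))"]) auto
    next
      fix p assume "p \<in> carrier (G\<lparr>carrier := E\<rparr> \<times>\<times> G\<lparr>carrier := H\<rparr>)" "?f p = \<one>"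
      then obtain a b where p: "p = (a, b)" "a \<in> E" "b \<in> H" "a \<otimes> b = \<one>" by auto
      have "b = a" using Om_eq[of a b] EO p by simp
      then have "a = \<one>" using EH p by auto
      then show "p = \<one>\<^bsub>G\<lparr>carrier := E\<rparr> \<times>\<times> G\<lparr>carrier := H\<rparr>\<^esub>" using \<open>b = a\<close> p by simp
    qed
  qed
  have "comm_group (G\<lparr>carrier := E\<rparr>)"
    by (rule group.group_comm_groupI[OF subgroup_imp_group[OF E(1)]]) (auto intro: Om_comm2 EO)
  moreover have "a [^]\<^bsub>G\<lparr>carrier := E\<rparr>\<^esub> (2::nat) = \<one>" if "a \<in> E" for a
    using Om_sq[OF EO[OF that]] that by (simp add: numeral_2_eq_2 nat_pow_def)
  ultimately have "elementary_abelian_two_group (G\<lparr>carrier := E\<rparr>)"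
    by (simp add: elementary_abelian_two_group_def)
  then show thesis using that idp by blast
qed

end

section \<open>Recognition of the exceptional factors\<close>

definition "Q8C4_mat = (zero4, zero4, (False, False, True, False), zero4)"
definition "Q8Q8_mat = (zero4, zero4, (False, False, True, False), (False, False, True, True))"
text \<open>The quaternion block occurs in both matrices, because the squares in that factor are the
  shared element \<open>st\<close>, which has both coordinates.\<close>

definition "P16Q8_mat1 = ((True, False, False, False), (True, False, False, False), (False, False, True, False), (False, False, True, True))"
definition "P16Q8_mat2 = (zero4, (False, True, False, False), (False, False, True, False), (False, False, True, True))"

abbreviation "Q8C4_model \<equiv> cocycle_group Q8_mat Q8C4_mat True False True"
abbreviation "Q8Q8_model \<equiv> cocycle_group Q8_mat Q8Q8_mat True True True"

lemma mat_bilinear':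
  "bilinear4 Q8C4_mat (a, b, c, d) (a', b', c', d') = (c \<and> c')"
  "bilinear4 Q8Q8_mat (a, b, c, d) (a', b', c', d') = ((c \<and> c') \<noteq> (d \<and> (c' \<noteq> d')))"
  "bilinear4 P16Q8_mat1 (a, b, c, d) (a', b', c', d') = ((a \<and> a') \<noteq> ((b \<and> a') \<noteq> ((c \<and> c') \<noteq> (d \<and> (c' \<noteq> d')))))"
  "bilinear4 P16Q8_mat2 (a, b, c, d) (a', b', c', d') = ((b \<and> b') \<noteq> ((c \<and> c') \<noteq> (d \<and> (c' \<noteq> d'))))"
  by (simp_all add: Q8C4_mat_def Q8Q8_mat_def P16Q8_mat1_def P16Q8_mat2_def)

lemma group_Q8: "group Q8"
  by (simp add: Q8_def group_presented_group)

lemma Q8_is_iso: "Q8 \<cong> Q8_model" and P16_is_iso: "P16 \<cong> P16_model" and H32_is_iso: "H32 \<cong> H32_model" and H245_is_iso: "H245 \<cong> H245_model"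
  using Q8_iso P16_iso H32_iso H245_iso by (auto intro: is_isoI)

text \<open>The second cocycle \<open>c \<and> c'\<close> is the carry of binary addition: the third
  vector bit and the second central bit are the binary digits of an element of the cyclic group of
  order 4.\<close>

lemma Q8C4_iso: "Q8C4_model \<cong> Q8 \<times>\<times> integer_mod_group 4"
proof -
  interpret Q: cocycle Q8_mat zero_mat False False False by (rule cocycle_Q8)
  interpret M: cocycle Q8_mat Q8C4_mat True False True by (rule cocycle_True)
  define f :: "vec4 \<times> bool \<times> bool \<Rightarrow> (vec4 \<times> bool \<times> bool) \<times> int"
    where "f = (\<lambda>((a, b, c, d), z1, z2). (((a, b, False, False), z1, False), of_bool c + 2 * of_bool z2))"
  have hom: "f \<in> hom M.M (Q.M \<times>\<times> integer_mod_group 4)"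
  proof (rule homI)
    show "f g \<in> carrier (Q.M \<times>\<times> integer_mod_group 4)" if "g \<in> carrier M.M" for g
    proof -
      obtain a b c d z1 z2 where g: "g = ((a, b, c, d), z1, z2)" by (metis prod.exhaust)
      show ?thesis by (cases c; cases z2; simp add: g f_def carrier_integer_mod_group)
    qed
    show "f (g \<otimes>\<^bsub>M.M\<^esub> h) = f g \<otimes>\<^bsub>Q.M \<times>\<times> integer_mod_group 4\<^esub> f h" for g h
    proof -
      obtain a b c d z1 z2 where g: "g = ((a, b, c, d), z1, z2)" by (metis prod.exhaust)
      obtain a' b' c' d' z1' z2' where h: "h = ((a', b', c', d'), z1', z2')" by (metis prod.exhaust)
      show ?thesis unfolding g h
        by (cases c; cases c'; cases z2; cases z2'; simp add: f_def mat_bilinear mat_bilinear')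
    qed
  qed
  interpret f: group_hom M.M "Q.M \<times>\<times> integer_mod_group 4" f
    using hom M.group_M DirProd_group[OF Q.group_M, of "integer_mod_group 4"] by (simp add: group_hom_def group_hom_axioms_def)
  have "f \<in> iso M.M (Q.M \<times>\<times> integer_mod_group 4)"
    unfolding f.iso_iff
  proof (intro conjI subsetI ballI impI)
    fix p assume "p \<in> carrier (Q.M \<times>\<times> integer_mod_group 4)"
    then obtain a b z n where p: "p = (((a, b, False, False), z, False), n)" "n \<in> {0..<4}"
      by (auto simp: carrier_integer_mod_group elim!: Q.carrierE)
    have "n = 0 \<or> n = 1 \<or> n = 2 \<or> n = 3" using p by auto
    then have "\<exists>c z2. n = of_bool c + 2 * of_bool z2"
      by - (rule exI[of _ "n = 1 \<or> n = 3"], rule exI[of _ "n = 2 \<or> n = 3"], elim disjE; simp)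
    then obtain c z2 where n: "n = of_bool c + 2 * of_bool z2" by blast
    show "p \<in> f ` carrier M.M"
      by (rule image_eqI[of _ _ "((a, b, c, False), z, z2)"]) (simp_all add: p n f_def)
  next
    fix g assume g: "g \<in> carrier M.M" "f g = \<one>\<^bsub>Q.M \<times>\<times> integer_mod_group 4\<^esub>"
    obtain a b c d z1 z2 where ge: "g = ((a, b, c, d), z1, z2)" by (metis prod.exhaust)
    have "of_bool c + 2 * of_bool z2 = (0::int)" using g by (simp add: ge f_def)
    then have "\<not> c" "\<not> z2" by (cases c; cases z2; simp)+
    then show "g = \<one>\<^bsub>M.M\<^esub>" using g by (simp add: ge f_def)
  qed
  then have "M.M \<cong> Q.M \<times>\<times> integer_mod_group 4" by (rule is_isoI)
  also have "Q.M \<times>\<times> integer_mod_group 4 \<cong> Q8 \<times>\<times> integer_mod_group 4"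
    by (intro group.DirProd_iso_trans[OF Q.group_M] group.iso_sym[OF group_Q8 Q8_is_iso] iso_refl)
  finally show ?thesis .
qed

lemma Q8Q8_iso: "Q8Q8_model \<cong> Q8 \<times>\<times> Q8"
proof -
  interpret Q: cocycle Q8_mat zero_mat False False False by (rule cocycle_Q8)
  interpret M: cocycle Q8_mat Q8Q8_mat True True True by (rule cocycle_True)
  define f :: "vec4 \<times> bool \<times> bool \<Rightarrow> (vec4 \<times> bool \<times> bool) \<times> (vec4 \<times> bool \<times> bool)"
    where "f = (\<lambda>((a, b, c, d), z1, z2). (((a, b, False, False), z1, False), ((c, d, False, False), z2, False)))"
  have hom: "f \<in> hom M.M (Q.M \<times>\<times> Q.M)"
  proof (rule homI)
    show "f g \<in> carrier (Q.M \<times>\<times> Q.M)" if "g \<in> carrier M.M" for g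
    proof -
      obtain a b c d z1 z2 where g: "g = ((a, b, c, d), z1, z2)" by (metis prod.exhaust)
      show ?thesis by (simp add: g f_def)
    qed
    show "f (g \<otimes>\<^bsub>M.M\<^esub> h) = f g \<otimes>\<^bsub>Q.M \<times>\<times> Q.M\<^esub> f h" for g h
    proof -
      obtain a b c d z1 z2 where g: "g = ((a, b, c, d), z1, z2)" by (metis prod.exhaust)
      obtain a' b' c' d' z1' z2' where h: "h = ((a', b', c', d'), z1', z2')" by (metis prod.exhaust)
      show ?thesis unfolding g h by (simp add: f_def mat_bilinear mat_bilinear')
    qed
  qed
  interpret f: group_hom M.M "Q.M \<times>\<times> Q.M" f
    using hom M.group_M DirProd_group[OF Q.group_M Q.group_M] by (simp add: group_hom_def group_hom_axioms_def)
  have "f \<in> iso M.M (Q.M \<times>\<times> Q.M)"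
    unfolding f.iso_iff
  proof (intro conjI subsetI ballI impI)
    fix p assume "p \<in> carrier (Q.M \<times>\<times> Q.M)"
    then obtain a b z c d z' where p: "p = (((a, b, False, False), z, False), ((c, d, False, False), z', False))"
      by (auto elim!: Q.carrierE)
    show "p \<in> f ` carrier M.M"
      by (rule image_eqI[of _ _ "((a, b, c, d), z, z')"]) (simp_all add: p f_def)
  next
    fix g assume g: "g \<in> carrier M.M" "f g = \<one>\<^bsub>Q.M \<times>\<times> Q.M\<^esub>"
    obtain a b c d z1 z2 where ge: "g = ((a, b, c, d), z1, z2)" by (metis prod.exhaust)
    then show "g = \<one>\<^bsub>M.M\<^esub>" using g by (simp add: ge f_def)
  qed
  then have "M.M \<cong> Q.M \<times>\<times> Q.M" by (rule is_isoI)
  also have "Q.M \<times>\<times> Q.M \<cong> Q8 \<times>\<times> Q8"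
    by (intro group.DirProd_iso_trans[OF Q.group_M] group.iso_sym[OF group_Q8 Q8_is_iso])
  finally show ?thesis .
qed

context quadratic_group
begin

lemma coords:
  "sq g = \<one> \<Longrightarrow> \<not> q1 g" "sq g = \<one> \<Longrightarrow> \<not> q2 g" "sq g = s \<Longrightarrow> q1 g" "sq g = s \<Longrightarrow> \<not> q2 g"
  "sq g = t \<Longrightarrow> \<not> q1 g" "sq g = t \<Longrightarrow> q2 g" "sq g = s \<otimes> t \<Longrightarrow> q1 g" "sq g = s \<otimes> t \<Longrightarrow> q2 g"
  using s t st st_distinct unfolding q1_def q2_def by metis+

lemma coords_cm:
  assumes "g \<in> carrier G" "h \<in> carrier G"
  shows "cm g h = \<one> \<Longrightarrow> \<not> B1 h g" "cm g h = \<one> \<Longrightarrow> \<not> B2 h g" "cm g h = s \<Longrightarrow> B1 h g" "cm g h = s \<Longrightarrow> \<not> B2 h g"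
    "cm g h = t \<Longrightarrow> \<not> B1 h g" "cm g h = t \<Longrightarrow> B2 h g" "cm g h = s \<otimes> t \<Longrightarrow> B1 h g" "cm g h = s \<otimes> t \<Longrightarrow> B2 h g"
  using S_inj[of "B1 h g" "B2 h g"] cm_S[OF assms(2,1)] cm_sym[OF assms] S_simps by metis+

lemma exceptional_if_iso:
  assumes G: "x1 \<in> carrier G" "x2 \<in> carrier G" "x3 \<in> carrier G" "x4 \<in> carrier G"
    and mat: "mat1 x1 x2 x3 x4 = T1" "mat2 x1 x2 x3 x4 = T2"
    and anis: "\<And>v. masked m3 m4 v \<Longrightarrow> \<not> bilinear4 T1 v v \<Longrightarrow> \<not> bilinear4 T2 v v \<Longrightarrow> v = zero4"
    and sp: "spans x1 x2 x3 x4" and m: "m3 \<or> x3 = \<one>" "m4 \<or> x4 = \<one>"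
    and iso: "\<And>H :: ('a, 'b) monoid_scheme. H \<cong> cocycle_group T1 T2 m3 m4 True \<Longrightarrow> exceptional_group H"
  shows "\<exists>E H. internal_direct_product G E H \<and> elementary_abelian_two_group (G\<lparr>carrier := E\<rparr>) \<and> exceptional_group (G\<lparr>carrier := H\<rparr>)"
proof -
  define H where "H = emb x1 x2 x3 x4 ` carrier (cocycle_group T1 T2 m3 m4 True)"
  have "emb x1 x2 x3 x4 \<in> iso (cocycle_group T1 T2 m3 m4 True) (G\<lparr>carrier := H\<rparr>)"
    unfolding H_def using emb_iso(2)[OF G mat cocycle_True] anis by blast
  then have "cocycle_group T1 T2 m3 m4 True \<cong> G\<lparr>carrier := H\<rparr>" by (rule is_isoI)
  then have "exceptional_group (G\<lparr>carrier := H\<rparr>)"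
    by (intro iso group.iso_sym[OF cocycle.group_M[OF cocycle_True]])
  moreover obtain E where "internal_direct_product G E H" "elementary_abelian_two_group (G\<lparr>carrier := E\<rparr>)"
    unfolding H_def using direct_product_decomposition[OF G mat _ sp m] anis by blast
  ultimately show ?thesis by blast
qed

lemma central_case:
  assumes G: "x \<in> carrier G" "y \<in> carrier G" "c \<in> carrier G"
    and e: "sq x = s" "sq y = s" "sq c = t" "cm x y = s" "\<And>g. g \<in> carrier G \<Longrightarrow> cm c g = \<one>"
    and sp: "\<And>g. g \<in> carrier G \<Longrightarrow> \<exists>i j k. sq (g \<otimes> (pw i x \<otimes> (pw j y \<otimes> pw k c))) = \<one>"
  shows "\<exists>E H. internal_direct_product G E H \<and> elementary_abelian_two_group (G\<lparr>carrier := E\<rparr>) \<and> exceptional_group (G\<lparr>carrier := H\<rparr>)"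
proof (rule exceptional_if_iso[of x y c \<one> Q8_mat Q8C4_mat True False])
  have cc: "cm x c = \<one>" "cm y c = \<one>" using e(5) G cm_sym by metis+
  show "mat1 x y c \<one> = Q8_mat" "mat2 x y c \<one> = Q8C4_mat"
    using e cc G coords coords_cm q_one B_one unfolding mat1_def mat2_def Q8_mat_def Q8C4_mat_def by simp_all
  show "v = zero4" if "masked True False v" "\<not> bilinear4 Q8_mat v v" "\<not> bilinear4 Q8C4_mat v v" for v
    using that by (cases v) (auto simp: mat_bilinear mat_bilinear')
  show "spans x y c \<one>" unfolding spans_def
  proof
    fix g assume g: "g \<in> carrier G"
    obtain i j k where "sq (g \<otimes> (pw i x \<otimes> (pw j y \<otimes> pw k c))) = \<one>" using sp[OF g] by blast
    then have "sq (g \<otimes> (pw i x \<otimes> (pw j y \<otimes> (pw k c \<otimes> pw False \<one>)))) = \<one>" using G by simp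
    then show "\<exists>i j k l. sq (g \<otimes> (pw i x \<otimes> (pw j y \<otimes> (pw k c \<otimes> pw l \<one>)))) = \<one>" by blast
  qed
  show "exceptional_group H" if "H \<cong> Q8C4_model" for H :: "('a, 'b) monoid_scheme"
    using iso_trans[OF that Q8C4_iso] by (simp add: exceptional_group_def)
qed (use G in auto)

lemma H32_case:
  assumes G: "x \<in> carrier G" "y \<in> carrier G" "u \<in> carrier G"
    and e: "sq x = s" "sq y = t" "sq u = t" "cm x y = s" "cm x u = t" "cm y u = s \<otimes> t" and sp: "spans x y u \<one>"
  shows "\<exists>E H. internal_direct_product G E H \<and> elementary_abelian_two_group (G\<lparr>carrier := E\<rparr>) \<and> exceptional_group (G\<lparr>carrier := H\<rparr>)"
proof (rule exceptional_if_iso[of x y u \<one> H32_mat1 H32_mat2 True False])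
  show "mat1 x y u \<one> = H32_mat1" "mat2 x y u \<one> = H32_mat2"
    using e G coords coords_cm q_one B_one unfolding mat1_def mat2_def H32_mat1_def H32_mat2_def by simp_all
  show "v = zero4" if "masked True False v" "\<not> bilinear4 H32_mat1 v v" "\<not> bilinear4 H32_mat2 v v" for v
    using that by (cases v) (auto simp: mat_bilinear)
  show "exceptional_group H" if "H \<cong> H32_model" for H :: "('a, 'b) monoid_scheme"
    using iso_trans[OF that group.iso_sym[OF _ H32_is_iso]] by (simp add: exceptional_group_def H32_def group_presented_group)
qed (use G sp in auto)

lemma H245_case:
  assumes G: "x \<in> carrier G" "y \<in> carrier G" "u \<in> carrier G" "v \<in> carrier G"
    and e: "sq x = s" "sq y = t" "sq u = t" "sq v = s" "cm x y = s" "cm x u = t" "cm x v = s \<otimes> t"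
    "cm y u = s \<otimes> t" "cm y v = s" "cm u v = \<one>" and sp: "spans x y u v"
  shows "\<exists>E H. internal_direct_product G E H \<and> elementary_abelian_two_group (G\<lparr>carrier := E\<rparr>) \<and> exceptional_group (G\<lparr>carrier := H\<rparr>)"
proof (rule exceptional_if_iso[of x y u v H245_mat1 H245_mat2 True True])
  show "mat1 x y u v = H245_mat1" "mat2 x y u v = H245_mat2"
    using e G coords coords_cm unfolding mat1_def mat2_def H245_mat1_def H245_mat2_def by simp_all
  show "v = zero4" if "masked True True v" "\<not> bilinear4 H245_mat1 v v" "\<not> bilinear4 H245_mat2 v v" for v
    using that by (cases v) (auto simp: mat_bilinear)
  show "exceptional_group H" if "H \<cong> H245_model" for H :: "('a, 'b) monoid_scheme"
    using iso_trans[OF that group.iso_sym[OF _ H245_is_iso]] by (simp add: exceptional_group_def H245_def group_presented_group)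
qed (use G sp in auto)

lemma Q8Q8_case:
  assumes G: "x \<in> carrier G" "y \<in> carrier G" "u \<in> carrier G" "v \<in> carrier G"
    and e: "sq x = s" "sq y = s" "cm x y = s" "sq u = t" "sq v = t" "cm u v = t"
    "cm x u = \<one>" "cm x v = \<one>" "cm y u = \<one>" "cm y v = \<one>" and sp: "spans x y u v"
  shows "\<exists>E H. internal_direct_product G E H \<and> elementary_abelian_two_group (G\<lparr>carrier := E\<rparr>) \<and> exceptional_group (G\<lparr>carrier := H\<rparr>)"
proof (rule exceptional_if_iso[of x y u v Q8_mat Q8Q8_mat True True])
  show "mat1 x y u v = Q8_mat" "mat2 x y u v = Q8Q8_mat"
    using e G coords coords_cm unfolding mat1_def mat2_def Q8_mat_def Q8Q8_mat_def by simp_all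
  show "v = zero4" if "masked True True v" "\<not> bilinear4 Q8_mat v v" "\<not> bilinear4 Q8Q8_mat v v" for v
    using that by (cases v) (auto simp: mat_bilinear mat_bilinear')
  show "exceptional_group H" if "H \<cong> Q8Q8_model" for H :: "('a, 'b) monoid_scheme"
    using iso_trans[OF that Q8Q8_iso] by (simp add: exceptional_group_def)
qed (use G sp in auto)

end

context quadratic_group
begin

text \<open>The exceptional factor is recognized by exhibiting its two subgroups: the restriction of
  the embedding to the first two coordinates and an embedding of \<open>Q8_model\<close> for the
  last two. For the latter the basis of square values is changed to \<open>st\<close>,
  \<open>t\<close>, so that the squares of \<open>u\<close> and \<open>v\<close> become the first
  basis vector.\<close>

lemma P16Q8_case:
  assumes G: "x \<in> carrier G" "y \<in> carrier G" "u \<in> carrier G" "v \<in> carrier G"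
    and e: "sq x = s" "sq y = t" "cm x y = s" "sq u = s \<otimes> t" "sq v = s \<otimes> t" "cm u v = s \<otimes> t"
    "cm x u = \<one>" "cm x v = \<one>" "cm y u = \<one>" "cm y v = \<one>" and sp: "spans x y u v"
  shows "\<exists>E H. internal_direct_product G E H \<and> elementary_abelian_two_group (G\<lparr>carrier := E\<rparr>) \<and> exceptional_group (G\<lparr>carrier := H\<rparr>)"
proof -
  interpret Q: quadratic_group G "s \<otimes> t" t
    using rebase[of "s \<otimes> t" t] st_distinct by simp
  let ?PQ = "cocycle_group P16Q8_mat1 P16Q8_mat2 True True True"
  have mat: "mat1 x y u v = P16Q8_mat1" "mat2 x y u v = P16Q8_mat2"
    using e G coords coords_cm unfolding mat1_def mat2_def P16Q8_mat1_def P16Q8_mat2_def by simp_all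
  have matA: "mat1 x y \<one> \<one> = P16_mat1" "mat2 x y \<one> \<one> = P16_mat2"
    using e G coords coords_cm q_one B_one unfolding mat1_def mat2_def P16_mat1_def P16_mat2_def by simp_all
  have matB: "Q.mat1 u v \<one> \<one> = Q8_mat" "Q.mat2 u v \<one> \<one> = zero_mat"
    using e G Q.coords Q.coords_cm Q.q_one Q.B_one unfolding Q.mat1_def Q.mat2_def Q8_mat_def zero_mat_def by simp_all
  have anis: "w = zero4" if "masked True True w" "\<not> bilinear4 P16Q8_mat1 w w" "\<not> bilinear4 P16Q8_mat2 w w" for w
    using that by (cases w) (auto simp: mat_bilinear')
  have anisA: "w = zero4" if "masked False False w" "\<not> bilinear4 P16_mat1 w w" "\<not> bilinear4 P16_mat2 w w" for w
    using that by (cases w) (auto simp: mat_bilinear)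
  have anisB: "w = zero4" if "masked False False w" "\<not> bilinear4 Q8_mat w w" "\<not> bilinear4 zero_mat w w" for w
    using that by (cases w) (auto simp: mat_bilinear)
  define H where "H = emb x y u v ` carrier ?PQ"
  define A where "A = emb x y \<one> \<one> ` carrier P16_model"
  define B where "B = Q.emb u v \<one> \<one> ` carrier Q8_model"
  have eH: "subgroup H G" "emb x y u v \<in> iso ?PQ (G\<lparr>carrier := H\<rparr>)"
    unfolding H_def using emb_iso[OF G mat cocycle_True] anis by blast+
  have eA: "subgroup A G" "emb x y \<one> \<one> \<in> iso P16_model (G\<lparr>carrier := A\<rparr>)"
    unfolding A_def using emb_iso[OF G(1,2) one_closed one_closed matA cocycle_True] anisA by blast+
  have eB: "subgroup B G" "Q.emb u v \<one> \<one> \<in> iso Q8_model (G\<lparr>carrier := B\<rparr>)"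
    unfolding B_def using Q.emb_iso[OF G(3,4) one_closed one_closed matB cocycle_Q8] anisB by blast+
  \<comment> \<open>The only central bit of the quaternion factor is its coordinate at
    \<open>st\<close>, which appears as two equal bits in the basis \<open>s\<close>,
    \<open>t\<close>.\<close>
  have QS: "Q.S z False = S z z" for z by (cases z) (simp_all add: Q.S_def S_def)
  have embA: "emb x y \<one> \<one> ((a, b, c, d), z1, z2) = emb x y u v ((a, b, False, False), z1, z2)" for a b c d z1 z2
    using G by (cases c; cases d; simp add: emb_def)
  have embB: "Q.emb u v \<one> \<one> ((a, b, c, d), z, False) = emb x y u v ((False, False, a, b), z, z)" for a b c d z
    using G by (cases c; cases d; simp add: emb_def Q.emb_def QS)
  have inj: "inj_on (emb x y u v) (carrier ?PQ)" using eH(2) by (simp add: iso_def bij_betw_def)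
  have AE: "\<exists>a b z1 z2. g = emb x y u v ((a, b, False, False), z1, z2)" if "g \<in> A" for g
  proof -
    obtain m where "g = emb x y \<one> \<one> m" using \<open>g \<in> A\<close> unfolding A_def by blast
    moreover obtain a b c d z1 z2 where "m = ((a, b, c, d), z1, z2)" by (metis prod.exhaust)
    ultimately show ?thesis using embA by blast
  qed
  have BE: "\<exists>a b z. g = emb x y u v ((False, False, a, b), z, z)" if "g \<in> B" for g
  proof -
    obtain m where m: "g = Q.emb u v \<one> \<one> m" "m \<in> carrier Q8_model" using \<open>g \<in> B\<close> unfolding B_def by blast
    obtain a b c d z1 z2 where "m = ((a, b, c, d), z1, z2)" by (metis prod.exhaust)
    then have "g = Q.emb u v \<one> \<one> ((a, b, c, d), z1, False)" using m by simp
    then show ?thesis unfolding embB by blast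
  qed
  have AI: "emb x y u v ((a, b, False, False), z1, z2) \<in> A" for a b z1 z2
    unfolding A_def by (rule image_eqI[of _ _ "((a, b, False, False), z1, z2)"]) (simp_all add: embA)
  have BI: "emb x y u v ((False, False, a, b), z, z) \<in> B" for a b z
    unfolding B_def by (rule image_eqI[of _ _ "((a, b, False, False), z, False)"]) (simp_all add: embB)
  have HI: "emb x y u v m \<in> H" for m
    unfolding H_def by (rule imageI) (cases m, auto)
  have sub: "A \<subseteq> H" "B \<subseteq> H" using AE BE HI by blast+
  interpret H: subgroup H G by (rule eH)
  let ?H = "G\<lparr>carrier := H\<rparr>"
  have hom: "emb x y u v (m \<otimes>\<^bsub>?PQ\<^esub> n) = emb x y u v m \<otimes> emb x y u v n" for m n
  proof -
    have c: "m \<in> carrier ?PQ" "n \<in> carrier ?PQ" by (cases m, auto) (cases n, auto)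
    then show ?thesis using eH(2) by (simp add: iso_def hom_def)
  qed
  have prod: "emb x y u v ((a, b, False, False), z1, z2) \<otimes> emb x y u v ((False, False, c, d), z, z) =
      emb x y u v ((a, b, c, d), z1 \<noteq> z, z2 \<noteq> z)" for a b c d z1 z2 z
    by (simp add: mat_bilinear' flip: hom)
  have prod': "emb x y u v ((False, False, c, d), z, z) \<otimes> emb x y u v ((a, b, False, False), z1, z2) =
      emb x y u v ((a, b, c, d), z1 \<noteq> z, z2 \<noteq> z)" for a b c d z1 z2 z
    by (simp add: mat_bilinear' flip: hom) (rule arg_cong[where f = "emb x y u v"], auto)
  obtain \<psi> where \<psi>: "\<psi> \<in> iso P16 P16_model" "\<And>w. w \<in> words {Gx, Gy} \<Longrightarrow> \<psi> (word_class {Gx, Gy} P16_rels w) = eval_word P16_model model_gen w"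
    using P16_iso by blast
  let ?\<phi> = "emb x y \<one> \<one> \<circ> \<psi>"
  have \<phi>: "?\<phi> \<in> iso P16 (?H\<lparr>carrier := A\<rparr>)" using iso_set_trans[OF \<psi>(1) eA(2)] by (simp add: comp_def)
  have "\<psi> P16_x2y2 = (zero4, True, True)"
    unfolding P16_x2y2_def by (subst \<psi>(2)) (auto simp: word_simps mat_bilinear)
  then have \<phi>z: "?\<phi> P16_x2y2 = s \<otimes> t" by (simp add: emb_def S_simps)
  have Q8B: "Q8 \<cong> ?H\<lparr>carrier := B\<rparr>" using iso_trans[OF Q8_is_iso is_isoI[OF eB(2)]] by simp
  have AB: "A \<inter> B = {\<one>, s \<otimes> t}"
  proof
    show "A \<inter> B \<subseteq> {\<one>, s \<otimes> t}"
    proof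
      fix g assume g: "g \<in> A \<inter> B"
      obtain a b z1 z2 where 1: "g = emb x y u v ((a, b, False, False), z1, z2)" using AE g by blast
      obtain c d z where 2: "g = emb x y u v ((False, False, c, d), z, z)" using BE g by blast
      have "((a, b, False, False), z1, z2) = ((False, False, c, d), z, z)"
        using inj_onD[OF inj, of "((a, b, False, False), z1, z2)" "((False, False, c, d), z, z)"] 1 2 by simp
      then show "g \<in> {\<one>, s \<otimes> t}" using 2 by (cases z) (auto simp: emb_def S_simps)
    qed
    show "{\<one>, s \<otimes> t} \<subseteq> A \<inter> B"
      using AI[of False False False False] BI[of False False False] AI[of False False True True] BI[of False False True]
      by (simp add: emb_def S_simps)
  qed
  have "A <#>\<^bsub>?H\<^esub> B = H"
  proof
    show "A <#>\<^bsub>?H\<^esub> B \<subseteq> H" using sub by (auto simp: set_mult_def)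
    show "H \<subseteq> A <#>\<^bsub>?H\<^esub> B"
    proof
      fix g assume "g \<in> H"
      then obtain m where "g = emb x y u v m" unfolding H_def by blast
      moreover obtain a b c d z1 z2 where "m = ((a, b, c, d), z1, z2)" by (metis prod.exhaust)
      ultimately have "g = emb x y u v ((a, b, False, False), z1, z2) \<otimes> emb x y u v ((False, False, c, d), False, False)"
        by (simp add: prod)
      then show "g \<in> A <#>\<^bsub>?H\<^esub> B" unfolding set_mult_def using AI[of a b z1 z2] BI[of c d False] by auto
    qed
  qed
  moreover have "\<forall>a\<in>A. \<forall>b\<in>B. a \<otimes> b = b \<otimes> a"
  proof (intro ballI)
    fix a b assume "a \<in> A" "b \<in> B"
    then obtain a1 a2 z1 z2 b1 b2 z where "a = emb x y u v ((a1, a2, False, False), z1, z2)" "b = emb x y u v ((False, False, b1, b2), z, z)"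
      using AE BE by metis
    then show "a \<otimes> b = b \<otimes> a" by (simp add: prod prod')
  qed
  moreover have "subgroup A ?H" "subgroup B ?H" using subgroup_incl eA eB eH sub by blast+
  ultimately have "central_product_P16_Q8 ?H"
    unfolding central_product_P16_Q8_def using \<phi> Q8B AB \<phi>z st_distinct
    by - (rule exI[of _ A], rule exI[of _ B], rule exI[of _ ?\<phi>], simp)
  then have "exceptional_group ?H" by (simp add: exceptional_group_def)
  moreover obtain E where "internal_direct_product G E H" "elementary_abelian_two_group (G\<lparr>carrier := E\<rparr>)"
    unfolding H_def using direct_product_decomposition[OF G mat _ sp] anis by blast
  ultimately show ?thesis by blast
qed

section \<open>Conclusion of the classification\<close>

text \<open>If some noninvolution \<open>r\<close> has commutators in \<open>{1, d}\<close> only,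
  \<open>d\<close> becomes the first basis vector, so that \<open>B2 r\<close> vanishes; whether the
  centralizer of \<open>r\<close> is abelian then decides between \<open>H32\<close> and two
  orthogonal planes. If there is no such \<open>r\<close>, \<open>quadratic_group_no_radical\<close>
  applies and yields \<open>H245\<close>.\<close>

theorem nondegenerate_case:
  assumes nd: "\<And>c. c \<in> carrier G \<Longrightarrow> (\<And>g. g \<in> carrier G \<Longrightarrow> cm c g = \<one>) \<Longrightarrow> sq c = \<one>"
    and ni: "\<not> has_inverted_index2_subgroup G" and na: "\<not> comm_group G"
  shows "\<exists>E H. internal_direct_product G E H \<and> elementary_abelian_two_group (G\<lparr>carrier := E\<rparr>) \<and> exceptional_group (G\<lparr>carrier := H\<rparr>)"
    (is ?thesis)
proof -
  have radical: ?thesis if r: "r \<in> carrier G" "sq r \<noteq> \<one>" "d \<in> {s, t, s \<otimes> t}" "\<And>g. g \<in> carrier G \<Longrightarrow> cm r g = \<one> \<or> cm r g = d" for r d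
  proof -
    obtain d' where d': "d' \<in> {s, t, s \<otimes> t}" "d \<noteq> d'" using st by (cases "d = s") auto
    interpret Q: quadratic_group G d d' by (rule rebase[OF r(3) d'])
    have B2: "\<not> Q.B2 r g" if "g \<in> carrier G" for g
      using r(4)[OF that] Q.coords_cm[OF that r(1)] cm_sym[OF that r(1)] by metis
    have "\<exists>x\<in>carrier G. Q.B1 r x"
    proof (rule ccontr)
      assume "\<not> ?thesis"
      then have "cm r g = \<one>" if "g \<in> carrier G" for g using that B2 Q.cm_one_iff r(1) by blast
      then show False using nd r by blast
    qed
    then obtain x where x: "x \<in> carrier G" "Q.B1 r x" by blast
    show ?thesis
    proof (cases "\<exists>u\<in>carrier G. \<exists>v\<in>carrier G. \<not> Q.B1 r u \<and> \<not> Q.B1 r v \<and> (Q.B1 u v \<or> Q.B2 u v)")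
      case True
      then obtain u v where uv: "u \<in> carrier G" "v \<in> carrier G" "\<not> Q.B1 r u" "\<not> Q.B1 r v" "Q.B1 u v \<or> Q.B2 u v" by blast
      show ?thesis
      proof (rule Q.two_plane_structure[OF r(1) x(1) uv(1,2) _ x(2) uv(3-5)])
        show "\<not> Q.B2 r g" if "g \<in> carrier G" for g using B2 that .
      next
        fix s' t' x y u v
        assume 1: "s' \<in> {d, d', d \<otimes> d'}" "t' \<in> {d, d', d \<otimes> d'}" "s' \<noteq> t'"
          "x \<in> carrier G" "y \<in> carrier G" "u \<in> carrier G" "v \<in> carrier G"
          "sq x = s'" "sq y = s'" "cm x y = s'" "sq u = t'" "sq v = t'" "cm u v = t'"
          "cm x u = \<one>" "cm x v = \<one>" "cm y u = \<one>" "cm y v = \<one>" "spans x y u v"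
        interpret R: quadratic_group G s' t' by (rule Q.rebase[OF 1(1-3)])
        show ?thesis by (rule R.Q8Q8_case[OF 1(4-)])
      next
        fix s' t' x y u v
        assume 2: "s' \<in> {d, d', d \<otimes> d'}" "t' \<in> {d, d', d \<otimes> d'}" "s' \<noteq> t'"
          "x \<in> carrier G" "y \<in> carrier G" "u \<in> carrier G" "v \<in> carrier G"
          "sq x = s'" "sq y = t'" "cm x y = s'" "sq u = s' \<otimes> t'" "sq v = s' \<otimes> t'" "cm u v = s' \<otimes> t'"
          "cm x u = \<one>" "cm x v = \<one>" "cm y u = \<one>" "cm y v = \<one>" "spans x y u v"
        interpret R: quadratic_group G s' t' by (rule Q.rebase[OF 2(1-3)])
        show ?thesis by (rule R.P16Q8_case[OF 2(4-)])
      qed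
    next
      case False
      then have ab: "\<not> Q.B1 m n \<and> \<not> Q.B2 m n" if "m \<in> carrier G" "n \<in> carrier G" "\<not> Q.B1 r m" "\<not> Q.B1 r n" for m n
        using that by blast
      obtain s' t' x y u where h: "s' \<in> {d, d', d \<otimes> d'}" "t' \<in> {d, d', d \<otimes> d'}" "s' \<noteq> t'"
        "x \<in> carrier G" "y \<in> carrier G" "u \<in> carrier G"
        "sq x = s'" "sq y = t'" "sq u = t'" "cm x y = s'" "cm x u = t'" "cm y u = s' \<otimes> t'" "spans x y u \<one>"
        using Q.H32_structure[OF nd r(1) x(1) B2 x(2) ab ni] by blast
      interpret R: quadratic_group G s' t' by (rule Q.rebase[OF h(1-3)])
      show ?thesis by (rule R.H32_case[OF h(4-)])
    qed
  qed
  show ?thesis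
  proof (cases "\<exists>r d. r \<in> carrier G \<and> sq r \<noteq> \<one> \<and> d \<in> {s, t, s \<otimes> t} \<and> (\<forall>g \<in> carrier G. cm r g = \<one> \<or> cm r g = d)")
    case True
    then show ?thesis using radical by blast
  next
    case False
    interpret N: quadratic_group_no_radical G s t
    proof
      fix r assume r: "r \<in> carrier G" "q1 r \<or> q2 r"
      have F: "\<exists>g\<in>carrier G. cm r g \<noteq> \<one> \<and> cm r g \<noteq> d" if "d \<in> {s, t, s \<otimes> t}" for d
        using False r that sq_one_iff[OF r(1)] by blast
      have c: "cm r g = S (B1 r g) (B2 r g)" if "g \<in> carrier G" for g using cm_S r that by blast
      obtain g where "g \<in> carrier G" "cm r g \<noteq> \<one>" "cm r g \<noteq> t" using F[of t] by blast
      then show "\<exists>g\<in>carrier G. B1 r g" using c[of g] S_simps by metis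
      obtain g where "g \<in> carrier G" "cm r g \<noteq> \<one>" "cm r g \<noteq> s" using F[of s] by blast
      then show "\<exists>g\<in>carrier G. B2 r g" using c[of g] S_simps by metis
      obtain g where "g \<in> carrier G" "cm r g \<noteq> \<one>" "cm r g \<noteq> s \<otimes> t" using F[of "s \<otimes> t"] by blast
      then show "\<exists>g\<in>carrier G. B1 r g \<noteq> B2 r g" using c[of g] S_simps by metis
    qed
    obtain g h where gh: "g \<in> carrier G" "h \<in> carrier G" "cm g h \<noteq> \<one>"
      using na group_comm_groupI commute_iff by metis
    then have "q1 g \<or> q2 g" using anisotropic[of g h] cm_one_iff by blast
    then obtain x y u v where "x \<in> carrier G" "y \<in> carrier G" "u \<in> carrier G" "v \<in> carrier G"
      "sq x = s" "sq y = t" "sq u = t" "sq v = s" "cm x y = s" "cm x u = t" "cm x v = s \<otimes> t"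
      "cm y u = s \<otimes> t" "cm y v = s" "cm u v = \<one>" "spans x y u v"
      using N.H245_structure[OF gh(1)] by blast
    then show ?thesis by (rule H245_case)
  qed
qed

end

lemma (in group) internal_direct_product_trivial:
  "internal_direct_product G {\<one>} (carrier G)" "elementary_abelian_two_group (G\<lparr>carrier := {\<one>}\<rparr>)"
proof -
  have "(\<lambda>(a, b). a \<otimes> b) \<in> iso (G\<lparr>carrier := {\<one>}\<rparr> \<times>\<times> G\<lparr>carrier := carrier G\<rparr>) G"
    by (auto simp: iso_def hom_def bij_betw_def inj_on_def image_def)
  then show "internal_direct_product G {\<one>} (carrier G)"
    by (simp add: internal_direct_product_def triv_subgroup subgroup_self)
  have "comm_group (G\<lparr>carrier := {\<one>}\<rparr>)"
    by (rule group.group_comm_groupI[OF subgroup_imp_group[OF triv_subgroup]]) auto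
  then show "elementary_abelian_two_group (G\<lparr>carrier := {\<one>}\<rparr>)"
    by (simp add: elementary_abelian_two_group_def nat_pow_def numeral_2_eq_2)
qed

text \<open>An inverted abelian subgroup of index 2 makes \<open>G\<close> itself exceptional, with
  trivial elementary abelian factor. Otherwise no element has a nontrivial fourth power, and the
  analysis of exponent 4 applies.\<close>

theorem (in char2_group) classification:
  assumes na: "\<not> comm_group G"
  shows "\<exists>E H. internal_direct_product G E H \<and> elementary_abelian_two_group (G\<lparr>carrier := E\<rparr>) \<and> exceptional_group (G\<lparr>carrier := H\<rparr>)"
proof (cases "has_inverted_index2_subgroup G")
  case True
  then have "exceptional_group (G\<lparr>carrier := carrier G\<rparr>)" by (simp add: exceptional_group_def)
  then show ?thesis using internal_direct_product_trivial by blast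
next
  case False
  interpret char2_exponent4_group G
    using long_element_has_inverted_index2 na False by unfold_locales blast
  show ?thesis
  proof (cases rule: trichotomy[OF na False, case_names central nondegenerate])
    case 1: (central s t x y c)
    interpret quadratic_group G s t by (rule 1(1))
    show ?thesis by (rule central_case[OF 1(2-9)]) (use 1(10) in blast)+
  next
    case 2: (nondegenerate s t)
    interpret quadratic_group G s t by (rule 2(1))
    show ?thesis by (rule nondegenerate_case[OF _ False na]) (use 2(2) in blast)
  qed
qed

section \<open>The condition holds in the exceptional groups\<close>

lemma char2_condition_iso:
  assumes G: "group G" and H: "group H" and iso: "G \<cong> H" and c: "char2_condition H"
  shows "char2_condition G"
proof -
  interpret G: group G by (rule G)
  interpret H: group H by (rule H)
  obtain f where f: "f \<in> iso G H" using iso by (auto simp: is_iso_def)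
  then have hom: "f \<in> hom G H" and inj: "inj_on f (carrier G)" by (auto simp: iso_def bij_betw_def)
  interpret f: group_hom G H f using hom by unfold_locales
  have eq: "x = y \<longleftrightarrow> f x = f y" if "x \<in> carrier G" "y \<in> carrier G" for x y
    using inj that by (auto dest: inj_onD)
  show ?thesis
    unfolding char2_condition_def
  proof (intro conjI ballI impI)
    fix t h assume th: "t \<in> carrier G" "h \<in> carrier G" "t \<otimes>\<^bsub>G\<^esub> t = \<one>\<^bsub>G\<^esub>"
    have "f t \<otimes>\<^bsub>H\<^esub> f t = \<one>\<^bsub>H\<^esub>" using th(1) th(3) f.hom_mult[of t t] by simp
    then show "t \<otimes>\<^bsub>G\<^esub> h = h \<otimes>\<^bsub>G\<^esub> t" using c th(1,2) unfolding char2_condition_def by (subst eq) auto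
  next
    fix g h assume gh: "g \<in> carrier G" "h \<in> carrier G"
    then have "f g \<otimes>\<^bsub>H\<^esub> f h = f h \<otimes>\<^bsub>H\<^esub> f g \<or> f g \<otimes>\<^bsub>H\<^esub> f h \<otimes>\<^bsub>H\<^esub> f g = f h \<or> f h \<otimes>\<^bsub>H\<^esub> f g \<otimes>\<^bsub>H\<^esub> f h = f g \<or>
      (f g \<otimes>\<^bsub>H\<^esub> f g = f h \<otimes>\<^bsub>H\<^esub> f h \<and> (f g \<otimes>\<^bsub>H\<^esub> f g) \<otimes>\<^bsub>H\<^esub> (f g \<otimes>\<^bsub>H\<^esub> f g) = \<one>\<^bsub>H\<^esub>)"
      using c unfolding char2_condition_def by simp
    then show "g \<otimes>\<^bsub>G\<^esub> h = h \<otimes>\<^bsub>G\<^esub> g \<or> g \<otimes>\<^bsub>G\<^esub> h \<otimes>\<^bsub>G\<^esub> g = h \<or> h \<otimes>\<^bsub>G\<^esub> g \<otimes>\<^bsub>G\<^esub> h = g \<or>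
      (g \<otimes>\<^bsub>G\<^esub> g = h \<otimes>\<^bsub>G\<^esub> h \<and> (g \<otimes>\<^bsub>G\<^esub> g) \<otimes>\<^bsub>G\<^esub> (g \<otimes>\<^bsub>G\<^esub> g) = \<one>\<^bsub>G\<^esub>)"
      using gh eq[of "g \<otimes>\<^bsub>G\<^esub> h" "h \<otimes>\<^bsub>G\<^esub> g"] eq[of "g \<otimes>\<^bsub>G\<^esub> h \<otimes>\<^bsub>G\<^esub> g" h] eq[of "h \<otimes>\<^bsub>G\<^esub> g \<otimes>\<^bsub>G\<^esub> h" g]
        eq[of "g \<otimes>\<^bsub>G\<^esub> g" "h \<otimes>\<^bsub>G\<^esub> h"] eq[of "(g \<otimes>\<^bsub>G\<^esub> g) \<otimes>\<^bsub>G\<^esub> (g \<otimes>\<^bsub>G\<^esub> g)" "\<one>\<^bsub>G\<^esub>"] by simp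
  qed
qed

text \<open>If two of the squares of \<open>g\<close>, \<open>h\<close> and \<open>gh\<close> agree, one of the alternatives holds; if they are
  all different, their product is trivial and \<open>g\<close> and \<open>h\<close> commute.\<close>

lemma (in group) char2_conditionI:
  assumes st: "s \<in> carrier G" "t \<in> carrier G" "s \<otimes> s = \<one>" "t \<otimes> t = \<one>"
    and sq: "\<And>g. g \<in> carrier G \<Longrightarrow> g \<otimes> g \<in> {\<one>, s, t, s \<otimes> t}"
    and cen: "\<And>t h. t \<in> carrier G \<Longrightarrow> h \<in> carrier G \<Longrightarrow> t \<otimes> t = \<one> \<Longrightarrow> t \<otimes> h = h \<otimes> t"
  shows "char2_condition G"
  unfolding char2_condition_def
proof (intro conjI ballI impI)
  fix t h assume "t \<in> carrier G" "h \<in> carrier G" "t \<otimes> t = \<one>"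
  then show "t \<otimes> h = h \<otimes> t" by (rule cen)
next
  fix g h assume g: "g \<in> carrier G" and h: "h \<in> carrier G"
  have c: "t \<otimes> s = s \<otimes> t" using cen st by simp
  have a: "s \<otimes> (s \<otimes> t) = t" using st by (simp flip: m_assoc)
  have b: "s \<otimes> t \<otimes> t = s" using st by (simp add: m_assoc)
  have V: "s \<otimes> t \<otimes> s = t" "t \<otimes> (s \<otimes> t) = s" "s \<otimes> t \<otimes> (s \<otimes> t) = \<one>"
    using cen[of s "s \<otimes> t"] cen[of t "s \<otimes> t"] st a b by (auto simp: m_assoc)
  show "g \<otimes> h = h \<otimes> g \<or> g \<otimes> h \<otimes> g = h \<or> h \<otimes> g \<otimes> h = g \<or> (g \<otimes> g = h \<otimes> h \<and> (g \<otimes> g) \<otimes> (g \<otimes> g) = \<one>)"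
  proof (cases "g \<otimes> h = h \<otimes> g")
    case False
    have gh: "(g \<otimes> h) \<otimes> g \<noteq> g \<otimes> (g \<otimes> h)"
    proof
      assume "(g \<otimes> h) \<otimes> g = g \<otimes> (g \<otimes> h)"
      then have "g \<otimes> (h \<otimes> g) = g \<otimes> (g \<otimes> h)" using g h by (simp add: m_assoc)
      then have "h \<otimes> g = g \<otimes> h" by (rule l_cancel) (use g h in auto)
      then show False using False by simp
    qed
    have n: "g \<otimes> g \<noteq> \<one>" "h \<otimes> h \<noteq> \<one>" "(g \<otimes> h) \<otimes> (g \<otimes> h) \<noteq> \<one>"
      using cen[of g h] cen[of h g] cen[of "g \<otimes> h" g] g h False gh by auto
    have d: "g \<otimes> g \<in> {s, t, s \<otimes> t}" "h \<otimes> h \<in> {s, t, s \<otimes> t}" "(g \<otimes> h) \<otimes> (g \<otimes> h) \<in> {s, t, s \<otimes> t}"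
      using sq[OF g] sq[OF h] sq[of "g \<otimes> h"] n g h by auto
    have g4: "(g \<otimes> g) \<otimes> (g \<otimes> g) = \<one>" using d(1) st V by (elim insertE emptyE) simp_all
    consider "g \<otimes> g = h \<otimes> h" | "(g \<otimes> h) \<otimes> (g \<otimes> h) = h \<otimes> h" | "(g \<otimes> h) \<otimes> (g \<otimes> h) = g \<otimes> g"
      | "(g \<otimes> h) \<otimes> (g \<otimes> h) = (g \<otimes> g) \<otimes> (h \<otimes> h)"
    proof -
      have "g \<otimes> g = h \<otimes> h \<or> (g \<otimes> h) \<otimes> (g \<otimes> h) = h \<otimes> h \<or> (g \<otimes> h) \<otimes> (g \<otimes> h) = g \<otimes> g \<or>
        (g \<otimes> h) \<otimes> (g \<otimes> h) = (g \<otimes> g) \<otimes> (h \<otimes> h)"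
        using d by (elim insertE emptyE) (simp_all add: a b c V)
      then show thesis using that by blast
    qed
    then show ?thesis
    proof cases
      case 1 then show ?thesis using g4 by blast
    next
      case 2
      then have "(g \<otimes> h \<otimes> g) \<otimes> h = h \<otimes> h" using g h by (simp add: m_assoc)
      then have "g \<otimes> h \<otimes> g = h" by (rule r_cancel) (use g h in auto)
      then show ?thesis by blast
    next
      case 3
      then have "g \<otimes> (h \<otimes> g \<otimes> h) = g \<otimes> g" using g h by (simp add: m_assoc)
      then have "h \<otimes> g \<otimes> h = g" by (rule l_cancel) (use g h in auto)
      then show ?thesis by blast
    next
      case 4
      then have "g \<otimes> (h \<otimes> g \<otimes> h) = g \<otimes> (g \<otimes> h \<otimes> h)" using g h by (simp add: m_assoc)
      then have "h \<otimes> g \<otimes> h = g \<otimes> h \<otimes> h" by (rule l_cancel) (use g h in auto)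
      then have "h \<otimes> g = g \<otimes> h" by (rule r_cancel) (use g h in auto)
      then show ?thesis by simp
    qed
  qed simp
qed

lemma (in cocycle) char2_condition_model:
  assumes anis: "\<And>v. masked m3 m4 v \<Longrightarrow> \<not> bilinear4 T1 v v \<Longrightarrow> \<not> bilinear4 T2 v v \<Longrightarrow> v = zero4"
  shows "char2_condition M"
proof (rule M.char2_conditionI)
  \<comment> \<open>For \<open>mz = False\<close> the second central element degenerates to the
    identity.\<close>
  let ?s = "(zero4, True, False)" and ?t = "(zero4, False, mz)"
  show "?s \<in> carrier M" "?t \<in> carrier M" "?s \<otimes>\<^bsub>M\<^esub> ?s = \<one>\<^bsub>M\<^esub>" "?t \<otimes>\<^bsub>M\<^esub> ?t = \<one>\<^bsub>M\<^esub>" by simp_all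
  show "g \<otimes>\<^bsub>M\<^esub> g \<in> {\<one>\<^bsub>M\<^esub>, ?s, ?t, ?s \<otimes>\<^bsub>M\<^esub> ?t}" if "g \<in> carrier M" for g
  proof -
    obtain v z1 z2 where g: "g = (v, z1, z2)" by (metis prod.exhaust)
    show ?thesis using mzD[of v v] by (cases "bilinear4 T1 v v"; cases "bilinear4 T2 v v"; simp add: g)
  qed
  show "g \<otimes>\<^bsub>M\<^esub> h = h \<otimes>\<^bsub>M\<^esub> g" if gh: "g \<in> carrier M" "h \<in> carrier M" "g \<otimes>\<^bsub>M\<^esub> g = \<one>\<^bsub>M\<^esub>" for g h
  proof -
    obtain v z1 z2 where g: "g = (v, z1, z2)" by (metis prod.exhaust)
    obtain w y1 y2 where h: "h = (w, y1, y2)" by (metis prod.exhaust)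
    have "v = zero4" using anis[of v] gh by (simp add: g)
    then show ?thesis by (auto simp: g h)
  qed
qed

text \<open>Elements outside \<open>M\<close> have the form \<open>mb\<close>. They all invert
  \<open>M\<close> and share the square \<open>b^2\<close>, which is an involution. So a pair inside
  \<open>M\<close> commutes, a mixed pair is in the relation of inversion, and a pair outside has
  equal squares; involutions lie in \<open>M\<close> and coincide with their inverses.\<close>

lemma has_inverted_index2_char2_condition:
  assumes H: "group H" and "has_inverted_index2_subgroup H"
  shows "char2_condition H"
proof -
  interpret group H by (rule H)
  obtain M b where M: "subgroup M H" "comm_group (H\<lparr>carrier := M\<rparr>)" "card (rcosets\<^bsub>H\<^esub> M) = 2"
    and b: "b \<in> carrier H" "ord b = 4" and inv: "\<And>m. m \<in> M \<Longrightarrow> inv\<^bsub>H\<^esub> b \<otimes>\<^bsub>H\<^esub> m \<otimes>\<^bsub>H\<^esub> b = inv\<^bsub>H\<^esub> m"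
    using assms(2) unfolding has_inverted_index2_subgroup_def by blast
  interpret M: subgroup M H by (rule M)
  have comm: "m \<otimes>\<^bsub>H\<^esub> n = n \<otimes>\<^bsub>H\<^esub> m" if "m \<in> M" "n \<in> M" for m n
    using comm_groupE(4)[OF M(2)] that by simp
  have b4: "(b \<otimes>\<^bsub>H\<^esub> b) \<otimes>\<^bsub>H\<^esub> (b \<otimes>\<^bsub>H\<^esub> b) = \<one>\<^bsub>H\<^esub>"
    using pow_ord_eq_1[OF b(1)] b by (simp add: numeral_eq_Suc m_assoc)
  have b2: "b \<otimes>\<^bsub>H\<^esub> b \<noteq> \<one>\<^bsub>H\<^esub>"
  proof -
    have "b [^]\<^bsub>H\<^esub> (2::nat) \<noteq> \<one>\<^bsub>H\<^esub>" using pow_eq_id[OF b(1), of 2] b(2) by simp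
    then show ?thesis using b(1) by (simp add: numeral_2_eq_2)
  qed
  have bM: "b \<notin> M"
  proof
    assume bM: "b \<in> M"
    then have "inv\<^bsub>H\<^esub> b \<otimes>\<^bsub>H\<^esub> b \<otimes>\<^bsub>H\<^esub> b = inv\<^bsub>H\<^esub> b" by (rule inv)
    then have "b = inv\<^bsub>H\<^esub> b" using b by simp
    then have "b \<otimes>\<^bsub>H\<^esub> b = \<one>\<^bsub>H\<^esub>" using b(1) r_inv by metis
    then show False using b2 by simp
  qed
  have bb: "b \<in> M #>\<^bsub>H\<^esub> b" using b M by (simp add: rcos_self)
  have r1: "M \<in> rcosets\<^bsub>H\<^esub> M" using rcosetsI[OF M.subset one_closed] M.subset by simp
  have r2: "M #>\<^bsub>H\<^esub> b \<in> rcosets\<^bsub>H\<^esub> M" using rcosetsI[OF M.subset b(1)] .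
  have ne: "M \<noteq> M #>\<^bsub>H\<^esub> b" using bb bM by auto
  obtain U V where UV: "rcosets\<^bsub>H\<^esub> M = {U, V}" using M(3) unfolding card_2_iff by blast
  have "(M = U \<and> M #>\<^bsub>H\<^esub> b = V) \<or> (M = V \<and> M #>\<^bsub>H\<^esub> b = U)"
    using r1 r2 ne unfolding UV by (metis insertE singletonD)
  then have rc: "rcosets\<^bsub>H\<^esub> M = {M, M #>\<^bsub>H\<^esub> b}" unfolding UV by (elim disjE conjE) (simp_all only: insert_commute)
  have split: "g \<in> M \<or> (\<exists>m\<in>M. g = m \<otimes>\<^bsub>H\<^esub> b)" if g: "g \<in> carrier H" for g
  proof -
    have "M #>\<^bsub>H\<^esub> g \<in> {M, M #>\<^bsub>H\<^esub> b}" using rcosetsI[OF M.subset g] rc by simp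
    moreover have "g \<in> M #>\<^bsub>H\<^esub> g" using g M by (simp add: rcos_self)
    ultimately show ?thesis by (auto simp: r_coset_def)
  qed
  have bm: "b \<otimes>\<^bsub>H\<^esub> m = inv\<^bsub>H\<^esub> m \<otimes>\<^bsub>H\<^esub> b" if m: "m \<in> M" for m
  proof -
    have "b \<otimes>\<^bsub>H\<^esub> (inv\<^bsub>H\<^esub> b \<otimes>\<^bsub>H\<^esub> inv\<^bsub>H\<^esub> m \<otimes>\<^bsub>H\<^esub> b) = b \<otimes>\<^bsub>H\<^esub> inv\<^bsub>H\<^esub> (inv\<^bsub>H\<^esub> m)" using inv[of "inv\<^bsub>H\<^esub> m"] m by simp
    then show ?thesis using m b by (simp add: m_assoc)
  qed
  have mbn: "(m \<otimes>\<^bsub>H\<^esub> b) \<otimes>\<^bsub>H\<^esub> n = (m \<otimes>\<^bsub>H\<^esub> inv\<^bsub>H\<^esub> n) \<otimes>\<^bsub>H\<^esub> b" if "m \<in> M" "n \<in> M" for m n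
    using bm[OF that(2)] that b by (simp add: m_assoc)
  have sqmb: "(m \<otimes>\<^bsub>H\<^esub> b) \<otimes>\<^bsub>H\<^esub> (m \<otimes>\<^bsub>H\<^esub> b) = b \<otimes>\<^bsub>H\<^esub> b" if m: "m \<in> M" for m
  proof -
    have "(m \<otimes>\<^bsub>H\<^esub> b) \<otimes>\<^bsub>H\<^esub> (m \<otimes>\<^bsub>H\<^esub> b) = ((m \<otimes>\<^bsub>H\<^esub> b) \<otimes>\<^bsub>H\<^esub> m) \<otimes>\<^bsub>H\<^esub> b" using m b by (simp add: m_assoc)
    then show ?thesis unfolding mbn[OF m m] using m b by (simp add: m_assoc)
  qed
  have mgm: "m \<otimes>\<^bsub>H\<^esub> (n \<otimes>\<^bsub>H\<^esub> b) \<otimes>\<^bsub>H\<^esub> m = n \<otimes>\<^bsub>H\<^esub> b" if mn: "m \<in> M" "n \<in> M" for m n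
  proof -
    have "m \<otimes>\<^bsub>H\<^esub> (n \<otimes>\<^bsub>H\<^esub> b) \<otimes>\<^bsub>H\<^esub> m = m \<otimes>\<^bsub>H\<^esub> ((n \<otimes>\<^bsub>H\<^esub> b) \<otimes>\<^bsub>H\<^esub> m)" using mn b by (simp add: m_assoc)
    also have "\<dots> = (m \<otimes>\<^bsub>H\<^esub> n) \<otimes>\<^bsub>H\<^esub> inv\<^bsub>H\<^esub> m \<otimes>\<^bsub>H\<^esub> b" unfolding mbn[OF mn(2,1)] using mn b by (simp add: m_assoc)
    also have "m \<otimes>\<^bsub>H\<^esub> n = n \<otimes>\<^bsub>H\<^esub> m" using comm mn by simp
    finally show ?thesis using mn b by (simp add: m_assoc)
  qed
  show ?thesis
    unfolding char2_condition_def
  proof (intro conjI ballI impI)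
    fix t h assume t: "t \<in> carrier H" "t \<otimes>\<^bsub>H\<^esub> t = \<one>\<^bsub>H\<^esub>" and h: "h \<in> carrier H"
    have tM: "t \<in> M" using split[OF t(1)] sqmb b2 t by auto
    have it: "inv\<^bsub>H\<^esub> t = t" using t by (intro inv_equality)
    from split[OF h] show "t \<otimes>\<^bsub>H\<^esub> h = h \<otimes>\<^bsub>H\<^esub> t"
    proof
      assume "h \<in> M" then show ?thesis using comm tM by simp
    next
      assume "\<exists>m\<in>M. h = m \<otimes>\<^bsub>H\<^esub> b"
      then obtain m where m: "m \<in> M" "h = m \<otimes>\<^bsub>H\<^esub> b" by blast
      have "h \<otimes>\<^bsub>H\<^esub> t = (m \<otimes>\<^bsub>H\<^esub> t) \<otimes>\<^bsub>H\<^esub> b" using mbn[OF m(1) tM] it m by simp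
      also have "m \<otimes>\<^bsub>H\<^esub> t = t \<otimes>\<^bsub>H\<^esub> m" using comm m tM by simp
      finally show ?thesis using m t b by (simp add: m_assoc)
    qed
  next
    fix g h assume g: "g \<in> carrier H" and h: "h \<in> carrier H"
    from split[OF g] split[OF h] show "g \<otimes>\<^bsub>H\<^esub> h = h \<otimes>\<^bsub>H\<^esub> g \<or> g \<otimes>\<^bsub>H\<^esub> h \<otimes>\<^bsub>H\<^esub> g = h \<or> h \<otimes>\<^bsub>H\<^esub> g \<otimes>\<^bsub>H\<^esub> h = g \<or>
      (g \<otimes>\<^bsub>H\<^esub> g = h \<otimes>\<^bsub>H\<^esub> h \<and> (g \<otimes>\<^bsub>H\<^esub> g) \<otimes>\<^bsub>H\<^esub> (g \<otimes>\<^bsub>H\<^esub> g) = \<one>\<^bsub>H\<^esub>)"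
      using comm[of g h] mgm sqmb b4 by auto
  qed
qed

text \<open>Squares of \<open>A\<close> are 1, \<open>s\<close> or \<open>t\<close>, those of
  \<open>B\<close> are 1 or the shared element \<open>st\<close>. As \<open>st\<close> is not a
  square in \<open>A\<close>, an involution \<open>ab\<close> has \<open>a^2 = b^2 = 1\<close>; both
  factors are then central in their subgroups.\<close>

lemma central_product_char2_condition:
  assumes H: "group H" and "central_product_P16_Q8 H"
  shows "char2_condition H"
proof -
  interpret group H by (rule H)
  interpret P: cocycle P16_mat1 P16_mat2 False False True by (rule cocycle_True)
  interpret Q: cocycle Q8_mat zero_mat False False False by (rule cocycle_Q8)
  obtain A B \<phi> where AB: "subgroup A H" "subgroup B H" "\<phi> \<in> iso P16 (H\<lparr>carrier := A\<rparr>)" "Q8 \<cong> H\<lparr>carrier := B\<rparr>"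
    and comm: "\<And>a b. a \<in> A \<Longrightarrow> b \<in> B \<Longrightarrow> a \<otimes>\<^bsub>H\<^esub> b = b \<otimes>\<^bsub>H\<^esub> a" and prod: "A <#>\<^bsub>H\<^esub> B = carrier H"
    and z: "\<phi> P16_x2y2 \<noteq> \<one>\<^bsub>H\<^esub>" "A \<inter> B = {\<one>\<^bsub>H\<^esub>, \<phi> P16_x2y2}"
    using assms(2) unfolding central_product_P16_Q8_def by blast
  interpret A: subgroup A H by (rule AB)
  interpret B: subgroup B H by (rule AB)
  obtain \<psi> where \<psi>: "\<psi> \<in> iso P16 P16_model" "\<And>w. w \<in> words {Gx, Gy} \<Longrightarrow> \<psi> (word_class {Gx, Gy} P16_rels w) = eval_word P16_model model_gen w"
    using P16_iso by blast
  have P16: "group P16" by (simp add: P16_def group_presented_group)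
  define \<sigma> where "\<sigma> = \<phi> \<circ> inv_into (carrier P16) \<psi>"
  have \<sigma>: "\<sigma> \<in> iso P16_model (H\<lparr>carrier := A\<rparr>)"
    unfolding \<sigma>_def by (rule iso_set_trans[OF group.iso_set_sym[OF P16 \<psi>(1)] AB(3)])
  have xy: "word_pow (gen Gx) 2 @ word_pow (gen Gy) 2 \<in> words {Gx, Gy}" by (simp add: word_simps)
  have "\<psi> P16_x2y2 = (zero4, True, True)"
    unfolding P16_x2y2_def \<psi>(2)[OF xy] by (simp add: word_simps mat_bilinear)
  moreover have "P16_x2y2 \<in> carrier P16" unfolding P16_x2y2_def P16_def using xy by (auto simp: presented_group_carrier)
  moreover have "inj_on \<psi> (carrier P16)" using \<psi>(1) by (simp add: iso_def bij_betw_def)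
  ultimately have \<sigma>z: "\<sigma> (zero4, True, True) = \<phi> P16_x2y2"
    unfolding \<sigma>_def by (metis comp_apply inv_into_f_f)
  obtain \<tau> where \<tau>: "\<tau> \<in> iso Q8_model (H\<lparr>carrier := B\<rparr>)"
    using iso_trans[OF group.iso_sym[OF group_Q8 Q8_is_iso] AB(4)] by (auto simp: is_iso_def)
  have \<sigma>m: "\<sigma> (m \<otimes>\<^bsub>P16_model\<^esub> n) = \<sigma> m \<otimes>\<^bsub>H\<^esub> \<sigma> n" if "m \<in> carrier P16_model" "n \<in> carrier P16_model" for m n
    using \<sigma> that by (simp add: iso_def hom_def)
  have \<tau>m: "\<tau> (m \<otimes>\<^bsub>Q8_model\<^esub> n) = \<tau> m \<otimes>\<^bsub>H\<^esub> \<tau> n" if "m \<in> carrier Q8_model" "n \<in> carrier Q8_model" for m n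
    using \<tau> that by (simp add: iso_def hom_def)
  have \<sigma>1: "\<sigma> (zero4, False, False) = \<one>\<^bsub>H\<^esub>" and \<tau>1: "\<tau> (zero4, False, False) = \<one>\<^bsub>H\<^esub>"
    using hom_one[of \<sigma> P16_model "H\<lparr>carrier := A\<rparr>"] hom_one[of \<tau> Q8_model "H\<lparr>carrier := B\<rparr>"] \<sigma> \<tau> P.group_M Q.group_M
      subgroup_imp_group[OF AB(1)] subgroup_imp_group[OF AB(2)] by (simp_all add: iso_def)
  have \<sigma>b: "bij_betw \<sigma> (carrier P16_model) A" and \<tau>b: "bij_betw \<tau> (carrier Q8_model) B"
    using \<sigma> \<tau> by (simp_all add: iso_def)
  define s t where "s = \<sigma> (zero4, True, False)" and "t = \<sigma> (zero4, False, True)"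
  have stA: "s \<in> A" "t \<in> A" using bij_betwE[OF \<sigma>b] by (simp_all add: s_def t_def)
  have st: "s \<otimes>\<^bsub>H\<^esub> t = \<phi> P16_x2y2" using \<sigma>m[of "(zero4, True, False)" "(zero4, False, True)"] \<sigma>z by (simp add: s_def t_def)
  have ts: "t \<otimes>\<^bsub>H\<^esub> s = \<phi> P16_x2y2" using \<sigma>m[of "(zero4, False, True)" "(zero4, True, False)"] \<sigma>z by (simp add: s_def t_def)
  have s2: "s \<otimes>\<^bsub>H\<^esub> s = \<one>\<^bsub>H\<^esub>" using \<sigma>m[of "(zero4, True, False)" "(zero4, True, False)"] \<sigma>1 by (simp add: s_def)
  have t2: "t \<otimes>\<^bsub>H\<^esub> t = \<one>\<^bsub>H\<^esub>" using \<sigma>m[of "(zero4, False, True)" "(zero4, False, True)"] \<sigma>1 by (simp add: t_def)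
  have inj\<sigma>: "m = n" if "\<sigma> m = \<sigma> n" "m \<in> carrier P16_model" "n \<in> carrier P16_model" for m n
    using \<sigma>b that by (auto simp: bij_betw_def dest: inj_onD)
  have inj\<tau>: "m = n" if "\<tau> m = \<tau> n" "m \<in> carrier Q8_model" "n \<in> carrier Q8_model" for m n
    using \<tau>b that by (auto simp: bij_betw_def dest: inj_onD)
  have sne: "s \<noteq> s \<otimes>\<^bsub>H\<^esub> t" "t \<noteq> s \<otimes>\<^bsub>H\<^esub> t"
    using inj\<sigma>[of "(zero4, True, False)" "(zero4, True, True)"] inj\<sigma>[of "(zero4, False, True)" "(zero4, True, True)"] st \<sigma>z
    by (auto simp: s_def t_def)
  have A: "a \<otimes>\<^bsub>H\<^esub> a \<in> {\<one>\<^bsub>H\<^esub>, s, t} \<and> (a \<otimes>\<^bsub>H\<^esub> a = \<one>\<^bsub>H\<^esub> \<longrightarrow> (\<forall>a'\<in>A. a \<otimes>\<^bsub>H\<^esub> a' = a' \<otimes>\<^bsub>H\<^esub> a))" if aA: "a \<in> A" for a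
  proof -
    have "a \<in> \<sigma> ` carrier P16_model" using \<sigma>b aA by (simp add: bij_betw_def)
    then obtain m where m: "m \<in> carrier P16_model" "a = \<sigma> m" by blast
    obtain e f c d z1 z2 where me: "m = ((e, f, c, d), z1, z2)" by (metis prod.exhaust)
    have sq: "a \<otimes>\<^bsub>H\<^esub> a = \<sigma> (zero4, e \<and> \<not> f, f)"
      unfolding m(2) \<sigma>m[OF m(1) m(1), symmetric] by (simp add: me mat_bilinear) (rule arg_cong[where f = \<sigma>], auto)
    have "a \<otimes>\<^bsub>H\<^esub> a' = a' \<otimes>\<^bsub>H\<^esub> a" if "a \<otimes>\<^bsub>H\<^esub> a = \<one>\<^bsub>H\<^esub>" "a' \<in> A" for a'
    proof -
      have "(zero4, e \<and> \<not> f, f) = (zero4, False, False)" by (rule inj\<sigma>) (use sq that \<sigma>1 in auto)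
      then have "\<not> e" "\<not> f" by auto
      then have mz: "m = (zero4, z1, z2)" using m by (simp add: me)
      have "a' \<in> \<sigma> ` carrier P16_model" using \<sigma>b \<open>a' \<in> A\<close> by (simp add: bij_betw_def)
      then obtain n where n: "n \<in> carrier P16_model" "a' = \<sigma> n" by blast
      obtain w y1 y2 where "n = (w, y1, y2)" by (metis prod.exhaust)
      then have "m \<otimes>\<^bsub>P16_model\<^esub> n = n \<otimes>\<^bsub>P16_model\<^esub> m" by (auto simp: mz)
      then show ?thesis unfolding m(2) n(2) by (metis \<sigma>m m(1) n(1))
    qed
    moreover have "a \<otimes>\<^bsub>H\<^esub> a \<in> {\<one>\<^bsub>H\<^esub>, s, t}" unfolding sq by (cases e; cases f; simp add: \<sigma>1 s_def t_def)
    ultimately show ?thesis by blast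
  qed
  \<comment> \<open>The isomorphism with \<open>Q8\<close> does not prescribe which element of
    \<open>B\<close> is shared. But a shared element lies in \<open>A\<close>, hence commutes with
    \<open>B\<close>, and the only nontrivial central element of \<open>Q8\<close> is the square of
    its generators.\<close>
  have "\<phi> P16_x2y2 \<in> \<tau> ` carrier Q8_model" using \<tau>b z(2) by (auto simp: bij_betw_def)
  then obtain m where m: "m \<in> carrier Q8_model" "\<phi> P16_x2y2 = \<tau> m" by blast
  obtain e f c d z1 z2 where me: "m = ((e, f, c, d), z1, z2)" by (metis prod.exhaust)
  have mc: "m \<otimes>\<^bsub>Q8_model\<^esub> n = n \<otimes>\<^bsub>Q8_model\<^esub> m" if n: "n \<in> carrier Q8_model" for n
  proof -
    have "\<tau> n \<in> B" using bij_betwE[OF \<tau>b] n by blast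
    moreover have "\<tau> m \<in> A" using m(2) z(2) by auto
    ultimately have "\<tau> (m \<otimes>\<^bsub>Q8_model\<^esub> n) = \<tau> (n \<otimes>\<^bsub>Q8_model\<^esub> m)" using comm \<tau>m m n by simp
    then show ?thesis by (rule inj\<tau>) (use m n Q.M.m_closed in auto)
  qed
  have "\<not> e" "\<not> f" using mc[of "((True, False, False, False), False, False)"] mc[of "((False, True, False, False), False, False)"]
    by (auto simp: me mat_bilinear)
  moreover have "m \<noteq> (zero4, False, False)" using z(1) m(2) \<tau>1 by auto
  ultimately have mz: "m = (zero4, True, False)" using m(1) by (auto simp: me)
  have B: "b \<otimes>\<^bsub>H\<^esub> b \<in> {\<one>\<^bsub>H\<^esub>, s \<otimes>\<^bsub>H\<^esub> t} \<and> (b \<otimes>\<^bsub>H\<^esub> b = \<one>\<^bsub>H\<^esub> \<longrightarrow> (\<forall>b'\<in>B. b \<otimes>\<^bsub>H\<^esub> b' = b' \<otimes>\<^bsub>H\<^esub> b))" if bB: "b \<in> B" for b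
  proof -
    have "b \<in> \<tau> ` carrier Q8_model" using \<tau>b bB by (simp add: bij_betw_def)
    then obtain l where l: "l \<in> carrier Q8_model" "b = \<tau> l" by blast
    obtain e f c d z1 z2 where le: "l = ((e, f, c, d), z1, z2)" by (metis prod.exhaust)
    have sq: "b \<otimes>\<^bsub>H\<^esub> b = \<tau> (zero4, e \<or> f, False)"
      unfolding l(2) \<tau>m[OF l(1) l(1), symmetric] by (simp add: le mat_bilinear) (rule arg_cong[where f = \<tau>], auto)
    have "b \<otimes>\<^bsub>H\<^esub> b' = b' \<otimes>\<^bsub>H\<^esub> b" if "b \<otimes>\<^bsub>H\<^esub> b = \<one>\<^bsub>H\<^esub>" "b' \<in> B" for b'
    proof -
      have "(zero4, e \<or> f, False) = (zero4, False, False)" by (rule inj\<tau>) (use sq that \<tau>1 in auto)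
      then have "\<not> e" "\<not> f" by auto
      then have lz: "l = (zero4, z1, z2)" using l by (simp add: le)
      have "b' \<in> \<tau> ` carrier Q8_model" using \<tau>b \<open>b' \<in> B\<close> by (simp add: bij_betw_def)
      then obtain n where n: "n \<in> carrier Q8_model" "b' = \<tau> n" by blast
      obtain w y1 y2 where "n = (w, y1, y2)" by (metis prod.exhaust)
      then have "l \<otimes>\<^bsub>Q8_model\<^esub> n = n \<otimes>\<^bsub>Q8_model\<^esub> l" by (auto simp: lz)
      then show ?thesis unfolding l(2) n(2) by (metis \<tau>m l(1) n(1))
    qed
    moreover have "b \<otimes>\<^bsub>H\<^esub> b \<in> {\<one>\<^bsub>H\<^esub>, s \<otimes>\<^bsub>H\<^esub> t}" unfolding sq by (cases "e \<or> f") (simp_all add: \<tau>1 st m(2) mz)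
    ultimately show ?thesis by blast
  qed
  have G: "s \<in> carrier H" "t \<in> carrier H" using stA by auto
  have V1: "s \<otimes>\<^bsub>H\<^esub> (s \<otimes>\<^bsub>H\<^esub> t) = t" using G s2 by (simp flip: m_assoc)
  have "t \<otimes>\<^bsub>H\<^esub> (t \<otimes>\<^bsub>H\<^esub> s) = s" using G t2 by (simp flip: m_assoc)
  then have V: "s \<otimes>\<^bsub>H\<^esub> (s \<otimes>\<^bsub>H\<^esub> t) = t" "t \<otimes>\<^bsub>H\<^esub> (s \<otimes>\<^bsub>H\<^esub> t) = s" using V1 ts st by simp_all
  show ?thesis
  proof (rule char2_conditionI[OF G s2 t2])
    fix g assume "g \<in> carrier H"
    then have "g \<in> A <#>\<^bsub>H\<^esub> B" using prod by simp
    then obtain a b where ab: "a \<in> A" "b \<in> B" "g = a \<otimes>\<^bsub>H\<^esub> b" unfolding set_mult_def by blast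
    have sq: "g \<otimes>\<^bsub>H\<^esub> g = (a \<otimes>\<^bsub>H\<^esub> a) \<otimes>\<^bsub>H\<^esub> (b \<otimes>\<^bsub>H\<^esub> b)"
      unfolding ab(3) by (rule square_mult_commuting) (use ab comm in auto)
    then show "g \<otimes>\<^bsub>H\<^esub> g \<in> {\<one>\<^bsub>H\<^esub>, s, t, s \<otimes>\<^bsub>H\<^esub> t}" using A[OF ab(1)] B[OF ab(2)] V G by auto
    fix h assume h: "h \<in> carrier H" and g2: "g \<otimes>\<^bsub>H\<^esub> g = \<one>\<^bsub>H\<^esub>"
    have "h \<in> A <#>\<^bsub>H\<^esub> B" using h prod by simp
    then obtain a' b' where h: "a' \<in> A" "b' \<in> B" "h = a' \<otimes>\<^bsub>H\<^esub> b'" unfolding set_mult_def by blast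
    have c: "a \<in> carrier H" "b \<in> carrier H" "a' \<in> carrier H" "b' \<in> carrier H" using ab h by auto
    have "a \<otimes>\<^bsub>H\<^esub> a = \<one>\<^bsub>H\<^esub> \<and> b \<otimes>\<^bsub>H\<^esub> b = \<one>\<^bsub>H\<^esub>"
    proof -
      have "b \<otimes>\<^bsub>H\<^esub> b \<noteq> s \<otimes>\<^bsub>H\<^esub> t"
      proof
        assume e: "b \<otimes>\<^bsub>H\<^esub> b = s \<otimes>\<^bsub>H\<^esub> t"
        consider "a \<otimes>\<^bsub>H\<^esub> a = \<one>\<^bsub>H\<^esub>" | "a \<otimes>\<^bsub>H\<^esub> a = s" | "a \<otimes>\<^bsub>H\<^esub> a = t" using A[OF ab(1)] by blast
        then have "s \<otimes>\<^bsub>H\<^esub> t = \<one>\<^bsub>H\<^esub> \<or> t = \<one>\<^bsub>H\<^esub> \<or> s = \<one>\<^bsub>H\<^esub>"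
          using g2 V m_closed[OF G] unfolding sq e by cases (metis l_one, metis+)
        then show False
        proof (elim disjE)
          assume "s \<otimes>\<^bsub>H\<^esub> t = \<one>\<^bsub>H\<^esub>" then show False using z(1) st by metis
        next
          assume "t = \<one>\<^bsub>H\<^esub>" then show False using sne(1) G by (metis r_one)
        next
          assume "s = \<one>\<^bsub>H\<^esub>" then show False using sne(2) G by (metis l_one)
        qed
      qed
      then show ?thesis using B[OF ab(2)] g2 c unfolding sq by auto
    qed
    then have 1: "a \<otimes>\<^bsub>H\<^esub> a' = a' \<otimes>\<^bsub>H\<^esub> a" and 2: "b \<otimes>\<^bsub>H\<^esub> b' = b' \<otimes>\<^bsub>H\<^esub> b" using A B ab h by blast+
    have "a \<otimes>\<^bsub>H\<^esub> b \<otimes>\<^bsub>H\<^esub> (a' \<otimes>\<^bsub>H\<^esub> b') = a \<otimes>\<^bsub>H\<^esub> (b \<otimes>\<^bsub>H\<^esub> a') \<otimes>\<^bsub>H\<^esub> b'" using c by (simp add: m_assoc)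
    also have "\<dots> = (a \<otimes>\<^bsub>H\<^esub> a') \<otimes>\<^bsub>H\<^esub> (b \<otimes>\<^bsub>H\<^esub> b')" unfolding comm[OF h(1) ab(2), symmetric] using c by (simp add: m_assoc)
    also have "\<dots> = a' \<otimes>\<^bsub>H\<^esub> (a \<otimes>\<^bsub>H\<^esub> b') \<otimes>\<^bsub>H\<^esub> b" unfolding 1 2 using c by (simp add: m_assoc)
    also have "\<dots> = a' \<otimes>\<^bsub>H\<^esub> b' \<otimes>\<^bsub>H\<^esub> (a \<otimes>\<^bsub>H\<^esub> b)" unfolding comm[OF ab(1) h(2)] using c by (simp add: m_assoc)
    finally show "g \<otimes>\<^bsub>H\<^esub> h = h \<otimes>\<^bsub>H\<^esub> g" by (simp add: ab(3) h(3))
  qed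
qed

theorem exceptional_group_char2_condition:
  assumes H: "group H" and "exceptional_group H"
  shows "char2_condition H"
proof -
  have c: "char2_condition H" if iso: "H \<cong> cocycle_group T1 T2 m3 m4 True"
    and anis: "\<And>v. masked m3 m4 v \<Longrightarrow> \<not> bilinear4 T1 v v \<Longrightarrow> \<not> bilinear4 T2 v v \<Longrightarrow> v = zero4" for T1 T2 m3 m4
    using char2_condition_iso[OF H cocycle.group_M[OF cocycle_True] iso] cocycle.char2_condition_model[OF cocycle_True] anis by blast
  have group: "group Q8C4_model" "group Q8Q8_model" by (rule cocycle.group_M[OF cocycle_True])+
  consider "has_inverted_index2_subgroup H" | "H \<cong> Q8 \<times>\<times> integer_mod_group 4" | "H \<cong> Q8 \<times>\<times> Q8" | "central_product_P16_Q8 H" | "H \<cong> H32" | "H \<cong> H245"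
    using assms(2) unfolding exceptional_group_def by blast
  then show ?thesis
  proof cases
    case 1 then show ?thesis using has_inverted_index2_char2_condition[OF H] by simp
  next
    case 2
    have "H \<cong> Q8C4_model" using iso_trans[OF 2 group.iso_sym[OF group(1) Q8C4_iso]] .
    then show ?thesis by (rule c) (auto simp: mat_bilinear mat_bilinear')
  next
    case 3
    have "H \<cong> Q8Q8_model" using iso_trans[OF 3 group.iso_sym[OF group(2) Q8Q8_iso]] .
    then show ?thesis by (rule c) (auto simp: mat_bilinear mat_bilinear')
  next
    case 4 then show ?thesis using central_product_char2_condition[OF H] by simp
  next
    case 5
    have "H \<cong> H32_model" using iso_trans[OF 5 H32_is_iso] .
    then show ?thesis by (rule c) (auto simp: mat_bilinear)
  next
    case 6
    have "H \<cong> H245_model" using iso_trans[OF 6 H245_is_iso] .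
    then show ?thesis by (rule c) (auto simp: mat_bilinear)
  qed
qed

theorem direct_product_char2_condition:
  assumes G: "group G" and EH: "internal_direct_product G E H" "elementary_abelian_two_group (G\<lparr>carrier := E\<rparr>)"
    and c: "char2_condition (G\<lparr>carrier := H\<rparr>)"
  shows "char2_condition G"
proof -
  interpret group G by (rule G)
  have E: "subgroup E G" and H: "subgroup H G" and f: "(\<lambda>(a, b). a \<otimes>\<^bsub>G\<^esub> b) \<in> iso (G\<lparr>carrier := E\<rparr> \<times>\<times> G\<lparr>carrier := H\<rparr>) G"
    using EH(1) unfolding internal_direct_product_def by auto
  interpret E: subgroup E G by (rule E)
  interpret H: subgroup H G by (rule H)
  have surj: "\<exists>e\<in>E. \<exists>h\<in>H. g = e \<otimes>\<^bsub>G\<^esub> h" if "g \<in> carrier G" for g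
  proof -
    have "g \<in> (\<lambda>(a, b). a \<otimes>\<^bsub>G\<^esub> b) ` (E \<times> H)" using f that unfolding iso_def bij_betw_def by simp
    then show ?thesis by auto
  qed
  have hom: "(e \<otimes>\<^bsub>G\<^esub> e') \<otimes>\<^bsub>G\<^esub> (h \<otimes>\<^bsub>G\<^esub> h') = (e \<otimes>\<^bsub>G\<^esub> h) \<otimes>\<^bsub>G\<^esub> (e' \<otimes>\<^bsub>G\<^esub> h')" if "e \<in> E" "e' \<in> E" "h \<in> H" "h' \<in> H" for e e' h h'
    using hom_mult[of "\<lambda>(a, b). a \<otimes>\<^bsub>G\<^esub> b" "G\<lparr>carrier := E\<rparr> \<times>\<times> G\<lparr>carrier := H\<rparr>" G "(e, h)" "(e', h')"] f that
    by (simp add: iso_def)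
  have ee: "e \<otimes>\<^bsub>G\<^esub> e = \<one>\<^bsub>G\<^esub>" if "e \<in> E" for e
    using EH(2) that unfolding elementary_abelian_two_group_def by (simp add: numeral_2_eq_2 nat_pow_def)
  have ecomm: "e \<otimes>\<^bsub>G\<^esub> e' = e' \<otimes>\<^bsub>G\<^esub> e" if "e \<in> E" "e' \<in> E" for e e'
    using EH(2) comm_groupE(4)[of "G\<lparr>carrier := E\<rparr>"] that unfolding elementary_abelian_two_group_def by simp
  have sq: "(e \<otimes>\<^bsub>G\<^esub> h) \<otimes>\<^bsub>G\<^esub> (e \<otimes>\<^bsub>G\<^esub> h) = h \<otimes>\<^bsub>G\<^esub> h" if "e \<in> E" "h \<in> H" for e h
    using hom[of e e h h] ee that by simp
  have triple: "(e \<otimes>\<^bsub>G\<^esub> g) \<otimes>\<^bsub>G\<^esub> (e' \<otimes>\<^bsub>G\<^esub> h) \<otimes>\<^bsub>G\<^esub> (e \<otimes>\<^bsub>G\<^esub> g) = e' \<otimes>\<^bsub>G\<^esub> (g \<otimes>\<^bsub>G\<^esub> h \<otimes>\<^bsub>G\<^esub> g)" if m: "e \<in> E" "e' \<in> E" "g \<in> H" "h \<in> H" for e e' g h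
  proof -
    have "(e \<otimes>\<^bsub>G\<^esub> g) \<otimes>\<^bsub>G\<^esub> (e' \<otimes>\<^bsub>G\<^esub> h) \<otimes>\<^bsub>G\<^esub> (e \<otimes>\<^bsub>G\<^esub> g) = (e \<otimes>\<^bsub>G\<^esub> e' \<otimes>\<^bsub>G\<^esub> e) \<otimes>\<^bsub>G\<^esub> (g \<otimes>\<^bsub>G\<^esub> h \<otimes>\<^bsub>G\<^esub> g)"
      using hom[of "e \<otimes>\<^bsub>G\<^esub> e'" e "g \<otimes>\<^bsub>G\<^esub> h" g] hom[of e e' g h] m by simp
    also have "e \<otimes>\<^bsub>G\<^esub> e' \<otimes>\<^bsub>G\<^esub> e = e'" unfolding ecomm[OF m(1,2)] using m ee[OF m(1)] by (simp add: m_assoc)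
    finally show ?thesis .
  qed
  show ?thesis
    unfolding char2_condition_def
  proof (intro conjI ballI impI)
    fix t g assume t: "t \<in> carrier G" "t \<otimes>\<^bsub>G\<^esub> t = \<one>\<^bsub>G\<^esub>" and g: "g \<in> carrier G"
    obtain e h e' h' where eh: "e \<in> E" "h \<in> H" "t = e \<otimes>\<^bsub>G\<^esub> h" "e' \<in> E" "h' \<in> H" "g = e' \<otimes>\<^bsub>G\<^esub> h'" using surj t g by metis
    have "h \<otimes>\<^bsub>G\<^esub> h = \<one>\<^bsub>G\<^esub>" using sq eh t by simp
    then have "h \<otimes>\<^bsub>G\<^esub> h' = h' \<otimes>\<^bsub>G\<^esub> h" using c eh unfolding char2_condition_def by simp
    then show "t \<otimes>\<^bsub>G\<^esub> g = g \<otimes>\<^bsub>G\<^esub> t" using hom[of e e' h h'] hom[of e' e h' h] ecomm eh by simp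
  next
    fix g1 g2 assume g: "g1 \<in> carrier G" "g2 \<in> carrier G"
    obtain e h e' h' where eh: "e \<in> E" "h \<in> H" "g1 = e \<otimes>\<^bsub>G\<^esub> h" "e' \<in> E" "h' \<in> H" "g2 = e' \<otimes>\<^bsub>G\<^esub> h'" using surj g by metis
    have "h \<otimes>\<^bsub>G\<^esub> h' = h' \<otimes>\<^bsub>G\<^esub> h \<or> h \<otimes>\<^bsub>G\<^esub> h' \<otimes>\<^bsub>G\<^esub> h = h' \<or> h' \<otimes>\<^bsub>G\<^esub> h \<otimes>\<^bsub>G\<^esub> h' = h \<or>
      (h \<otimes>\<^bsub>G\<^esub> h = h' \<otimes>\<^bsub>G\<^esub> h' \<and> (h \<otimes>\<^bsub>G\<^esub> h) \<otimes>\<^bsub>G\<^esub> (h \<otimes>\<^bsub>G\<^esub> h) = \<one>\<^bsub>G\<^esub>)"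
      using c eh unfolding char2_condition_def by simp
    then show "g1 \<otimes>\<^bsub>G\<^esub> g2 = g2 \<otimes>\<^bsub>G\<^esub> g1 \<or> g1 \<otimes>\<^bsub>G\<^esub> g2 \<otimes>\<^bsub>G\<^esub> g1 = g2 \<or> g2 \<otimes>\<^bsub>G\<^esub> g1 \<otimes>\<^bsub>G\<^esub> g2 = g1 \<or>
      (g1 \<otimes>\<^bsub>G\<^esub> g1 = g2 \<otimes>\<^bsub>G\<^esub> g2 \<and> (g1 \<otimes>\<^bsub>G\<^esub> g1) \<otimes>\<^bsub>G\<^esub> (g1 \<otimes>\<^bsub>G\<^esub> g1) = \<one>\<^bsub>G\<^esub>)"
      using hom[of e e' h h'] hom[of e' e h' h] ecomm[of e e'] triple[of e e' h h'] triple[of e' e h' h] sq[of e h] sq[of e' h'] eh by auto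
  qed
qed

section \<open>Hamiltonian 2-groups\<close>

text \<open>The counterpart of \<open>char2_condition\<close> for characteristic different from \<open>2\<close>.\<close>

definition odd_condition :: "('g, 'm) monoid_scheme \<Rightarrow> bool"
  where "odd_condition G \<longleftrightarrow>
    (\<forall>t\<in>carrier G. \<forall>h\<in>carrier G. t \<otimes>\<^bsub>G\<^esub> t = \<one>\<^bsub>G\<^esub> \<longrightarrow> t \<otimes>\<^bsub>G\<^esub> h = h \<otimes>\<^bsub>G\<^esub> t) \<and>
    (\<forall>g\<in>carrier G. \<forall>h\<in>carrier G. g \<otimes>\<^bsub>G\<^esub> h = h \<otimes>\<^bsub>G\<^esub> g \<or> g \<otimes>\<^bsub>G\<^esub> h \<otimes>\<^bsub>G\<^esub> g = h \<or> h \<otimes>\<^bsub>G\<^esub> g \<otimes>\<^bsub>G\<^esub> h = g)"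

text \<open>Any two noncommuting elements generate a quaternion group of order 8. This symmetric
  strengthening of \<open>odd_condition\<close> is what normality of subgroups and the exponent are
  read off from.\<close>

definition quaternionic :: "('g, 'm) monoid_scheme \<Rightarrow> bool"
  where "quaternionic G \<longleftrightarrow>
    (\<forall>t\<in>carrier G. \<forall>h\<in>carrier G. t \<otimes>\<^bsub>G\<^esub> t = \<one>\<^bsub>G\<^esub> \<longrightarrow> t \<otimes>\<^bsub>G\<^esub> h = h \<otimes>\<^bsub>G\<^esub> t) \<and>
    (\<forall>g\<in>carrier G. \<forall>h\<in>carrier G. g \<otimes>\<^bsub>G\<^esub> h \<noteq> h \<otimes>\<^bsub>G\<^esub> g \<longrightarrow>
       g \<otimes>\<^bsub>G\<^esub> h \<otimes>\<^bsub>G\<^esub> g = h \<and> g \<otimes>\<^bsub>G\<^esub> g = h \<otimes>\<^bsub>G\<^esub> h \<and> (g \<otimes>\<^bsub>G\<^esub> g) \<otimes>\<^bsub>G\<^esub> (g \<otimes>\<^bsub>G\<^esub> g) = \<one>\<^bsub>G\<^esub>)"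

context group
begin

text \<open>\<open>gh\<close> and \<open>h\<close> do not commute either, and both alternatives for
  them make \<open>g^2\<close> a power of \<open>h\<close>. Then \<open>g^2\<close> commutes with
  \<open>h\<close> and is inverted by it, so \<open>g^4 = 1\<close>, and the equality of squares
  follows.\<close>

lemma odd_condition_quaternionic:
  assumes "odd_condition G"
  shows "quaternionic G"
proof -
  have inv: "t \<otimes> h = h \<otimes> t" if "t \<in> carrier G" "h \<in> carrier G" "t \<otimes> t = \<one>" for t h
    using assms that unfolding odd_condition_def by blast
  have w: "g \<otimes> h \<otimes> g = h \<or> h \<otimes> g \<otimes> h = g" if "g \<in> carrier G" "h \<in> carrier G" "g \<otimes> h \<noteq> h \<otimes> g" for g h
    using assms that unfolding odd_condition_def by blast
  have key: "g \<otimes> g = h \<otimes> h \<and> (g \<otimes> g) \<otimes> (g \<otimes> g) = \<one> \<and> h \<otimes> g \<otimes> h = g"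
    if g: "g \<in> carrier G" and h: "h \<in> carrier G" and n: "g \<otimes> h \<noteq> h \<otimes> g" and e: "g \<otimes> h \<otimes> g = h" for g h
  proof -
    have ne: "(g \<otimes> h) \<otimes> h \<noteq> h \<otimes> (g \<otimes> h)"
    proof
      assume "(g \<otimes> h) \<otimes> h = h \<otimes> (g \<otimes> h)"
      then have "(g \<otimes> h) \<otimes> h = (h \<otimes> g) \<otimes> h" using g h by (simp add: m_assoc)
      then have "g \<otimes> h = h \<otimes> g" by (rule r_cancel) (use g h in auto)
      then show False using n by simp
    qed
    have 4: "(g \<otimes> g) \<otimes> (g \<otimes> g) = \<one>" if c: "(g \<otimes> g) \<otimes> h = h \<otimes> (g \<otimes> g)"
    proof -
      have "h = g \<otimes> (g \<otimes> h \<otimes> g) \<otimes> g" using e by simp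
      also have "\<dots> = ((g \<otimes> g) \<otimes> h) \<otimes> (g \<otimes> g)" using g h by (simp add: m_assoc)
      finally have "h \<otimes> \<one> = h \<otimes> ((g \<otimes> g) \<otimes> (g \<otimes> g))" using c g h by (simp add: m_assoc)
      then show ?thesis using g h by (metis l_cancel m_closed one_closed)
    qed
    have A: "h \<otimes> h = g \<otimes> g \<and> (g \<otimes> g) \<otimes> (g \<otimes> g) = \<one>"
      using w[OF m_closed[OF g h] h ne]
    proof
      assume "g \<otimes> h \<otimes> h \<otimes> (g \<otimes> h) = h"
      then have "(g \<otimes> (h \<otimes> h) \<otimes> g) \<otimes> h = \<one> \<otimes> h" using g h by (simp add: m_assoc)
      then have 1: "g \<otimes> (h \<otimes> h) \<otimes> g = \<one>" by (rule r_cancel) (use g h in auto)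
      then have "g \<otimes> (g \<otimes> (h \<otimes> h)) = \<one>" using g h by (metis inv_comm m_closed)
      then have 2: "(g \<otimes> g) \<otimes> (h \<otimes> h) = \<one>" using g h by (simp add: m_assoc)
      then have gg: "g \<otimes> g = inv (h \<otimes> h)" using g h by (metis inv_equality m_closed)
      have "inv (h \<otimes> h) \<otimes> h = h \<otimes> inv (h \<otimes> h)" using h by (simp add: inv_mult_group m_assoc)
      then have 3: "(g \<otimes> g) \<otimes> (g \<otimes> g) = \<one>" using 4 gg by simp
      have "(g \<otimes> g) \<otimes> (h \<otimes> h) = (g \<otimes> g) \<otimes> (g \<otimes> g)" using 2 3 by simp
      then have "h \<otimes> h = g \<otimes> g" by (rule l_cancel) (use g h in auto)
      then show ?thesis using 3 by simp
    next
      assume "h \<otimes> (g \<otimes> h) \<otimes> h = g \<otimes> h"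
      then have "(h \<otimes> g \<otimes> h) \<otimes> h = g \<otimes> h" using g h by (simp add: m_assoc)
      then have 1: "h \<otimes> g \<otimes> h = g" by (rule r_cancel) (use g h in auto)
      have "h \<otimes> h = (g \<otimes> h \<otimes> g) \<otimes> h" using e by simp
      also have "\<dots> = g \<otimes> (h \<otimes> g \<otimes> h)" using g h by (simp add: m_assoc)
      finally have 2: "h \<otimes> h = g \<otimes> g" using 1 by simp
      have "(h \<otimes> h) \<otimes> h = h \<otimes> (h \<otimes> h)" using h by (simp add: m_assoc)
      then show ?thesis using 2 4 by simp
    qed
    have "h \<otimes> g \<otimes> h = g"
    proof -
      have "g \<otimes> (h \<otimes> g \<otimes> h) = (g \<otimes> h \<otimes> g) \<otimes> h" using g h by (simp add: m_assoc)
      also have "\<dots> = g \<otimes> g" using e A by simp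
      finally show ?thesis by (rule l_cancel) (use g h in auto)
    qed
    then show ?thesis using A by simp
  qed
  have "g \<otimes> h \<otimes> g = h \<and> g \<otimes> g = h \<otimes> h \<and> (g \<otimes> g) \<otimes> (g \<otimes> g) = \<one>"
    if gh: "g \<in> carrier G" "h \<in> carrier G" "g \<otimes> h \<noteq> h \<otimes> g" for g h
    using w[OF gh]
  proof
    assume "g \<otimes> h \<otimes> g = h" then show ?thesis using key[OF gh] by blast
  next
    assume e: "h \<otimes> g \<otimes> h = g" then show ?thesis using key[OF gh(2,1) _ e] gh(3) by metis
  qed
  then show ?thesis using inv unfolding quaternionic_def by blast
qed

text \<open>Conjugation fixes or inverts each element, so subgroups are normal. A noncentral element
  has trivial fourth power; for a central \<open>x\<close>, the elements \<open>gx\<close> and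
  \<open>h\<close> still do not commute, so \<open>(gx)^2 = h^2 = g^2\<close> and \<open>x\<close>
  is an involution.\<close>

lemma quaternionic_hamiltonian:
  assumes q: "quaternionic G" and nab: "\<not> comm_group G"
  shows "hamiltonian_group G" "two_group G"
proof -
  have Q: "g \<otimes> h \<otimes> g = h" "g \<otimes> g = h \<otimes> h" "(g \<otimes> g) \<otimes> (g \<otimes> g) = \<one>"
    if "g \<in> carrier G" "h \<in> carrier G" "g \<otimes> h \<noteq> h \<otimes> g" for g h
    using q that unfolding quaternionic_def by blast+
  have "N \<lhd> G" if N: "subgroup N G" for N
    unfolding normal_inv_iff
  proof (intro conjI ballI N)
    fix x n assume x: "x \<in> carrier G" and n: "n \<in> N"
    have nG: "n \<in> carrier G" "inv n \<in> N" using N n subgroup.mem_carrier subgroup.m_inv_closed by metis+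
    show "x \<otimes> n \<otimes> inv x \<in> N"
    proof (cases "n \<otimes> x = x \<otimes> n")
      case True
      then have "x \<otimes> n \<otimes> inv x = n" using x nG by (simp add: m_assoc flip: True)
      then show ?thesis using n by simp
    next
      case False
      then have "n \<otimes> x \<otimes> n = x" using Q nG x by blast
      then have "inv n \<otimes> (n \<otimes> (x \<otimes> n)) = inv n \<otimes> x" using nG x by (simp add: m_assoc)
      then have "x \<otimes> n = inv n \<otimes> x" using nG x by simp
      then have "x \<otimes> n \<otimes> inv x = inv n" using nG x by (simp add: m_assoc)
      then show ?thesis using nG by simp
    qed
  qed
  then show "hamiltonian_group G" using nab is_group by (simp add: hamiltonian_group_def)
  obtain g h where gh: "g \<in> carrier G" "h \<in> carrier G" "g \<otimes> h \<noteq> h \<otimes> g"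
    using nab group_comm_groupI by blast
  have 4: "x [^] (4::nat) = \<one>" if x: "x \<in> carrier G" for x
  proof (cases "\<exists>y\<in>carrier G. x \<otimes> y \<noteq> y \<otimes> x")
    case True
    then have "(x \<otimes> x) \<otimes> (x \<otimes> x) = \<one>" using Q x by blast
    then show ?thesis using x by (simp add: numeral_eq_Suc m_assoc)
  next
    case False
    then have c: "x \<otimes> y = y \<otimes> x" if "y \<in> carrier G" for y using that by blast
    have gx: "(g \<otimes> x) \<otimes> h \<noteq> h \<otimes> (g \<otimes> x)"
    proof
      assume "(g \<otimes> x) \<otimes> h = h \<otimes> (g \<otimes> x)"
      moreover have "(g \<otimes> x) \<otimes> h = (g \<otimes> h) \<otimes> x" using c[OF gh(2)] gh x by (simp add: m_assoc)
      ultimately have "(g \<otimes> h) \<otimes> x = (h \<otimes> g) \<otimes> x" using gh x by (simp add: m_assoc)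
      then have "g \<otimes> h = h \<otimes> g" by (rule r_cancel) (use gh x in auto)
      then show False using gh by simp
    qed
    have "(g \<otimes> g) \<otimes> (x \<otimes> x) = (g \<otimes> x) \<otimes> (g \<otimes> x)" using square_mult_commuting(1)[OF gh(1) x] c[OF gh(1)] by simp
    also have "\<dots> = g \<otimes> g" using Q(2)[of "g \<otimes> x" h] Q(2)[OF gh] gx gh x by simp
    finally have "x \<otimes> x = \<one>" using gh x by simp
    then show ?thesis using x by (simp add: numeral_eq_Suc m_assoc)
  qed
  have "\<exists>k::nat. ord x = 2 ^ k" if x: "x \<in> carrier G" for x
  proof -
    have "ord x dvd 2 ^ 2" using 4[OF x] pow_eq_id[OF x, of 4] by simp
    then show ?thesis using divides_primepow_nat[of 2 "ord x" 2] by auto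
  qed
  then show "two_group G" using is_group by (simp add: two_group_def)
qed

section \<open>Normal cyclic subgroups and the exponent of hamiltonian 2-groups\<close>

lemma generate_singleton_nat:
  assumes a: "a \<in> carrier G" "ord a \<noteq> 0" and g: "g \<in> generate G {a}"
  obtains n :: nat where "g = a [^] n"
proof -
  obtain k :: int where k: "g = a [^] k" using g generate_pow[OF a(1)] by auto
  have "a [^] k = a [^] int (nat (k mod int (ord a)))"
    using a by (subst int_pow_eq) (simp_all add: minus_mod_eq_mult_div [symmetric] mod_eq_dvd_iff [symmetric])
  then have "g = a [^] nat (k mod int (ord a))" using k by (simp add: int_pow_int)
  then show thesis by (rule that)
qed

lemma involution_centralI:
  assumes D: "\<And>N. subgroup N G \<Longrightarrow> N \<lhd> G" and t: "t \<in> carrier G" "t \<otimes> t = \<one>" and h: "h \<in> carrier G"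
  shows "t \<otimes> h = h \<otimes> t"
proof -
  have sub: "subgroup {\<one>, t} G"
  proof
    fix x y assume "x \<in> {\<one>, t}" "y \<in> {\<one>, t}" then show "x \<otimes> y \<in> {\<one>, t}" using t by auto
  next
    fix x assume "x \<in> {\<one>, t}" then show "inv x \<in> {\<one>, t}" using t inv_equality[OF t(2) t(1) t(1)] by auto
  qed (use t in auto)
  have "h \<otimes> t \<otimes> inv h \<in> {\<one>, t}" using normal.inv_op_closed2[OF D[OF sub] h] by simp
  then consider "h \<otimes> t \<otimes> inv h = \<one>" | "h \<otimes> t \<otimes> inv h = t" by blast
  then have "h \<otimes> t \<otimes> inv h \<otimes> h = t \<otimes> h"
  proof cases
    case 1
    then have "h \<otimes> t = h" using h t inv_equality[OF 1] by (metis inv_inv inv_closed m_closed)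
    then have "t = \<one>" using h t by simp
    then show ?thesis using h by simp
  qed simp
  then show ?thesis using h t by (simp add: m_assoc)
qed

lemma cyclic_normal_power:
  assumes D: "\<And>N. subgroup N G \<Longrightarrow> N \<lhd> G" and a: "a \<in> carrier G" "ord a \<noteq> 0" and h: "h \<in> carrier G"
  obtains n :: nat where "h \<otimes> a = a [^] n \<otimes> h"
proof -
  have "generate G {a} \<lhd> G" using D generate_is_subgroup[of "{a}"] a by simp
  then have "h \<otimes> a \<otimes> inv h \<in> generate G {a}" by (rule normal.inv_op_closed2[OF _ h generate.incl]) simp
  then obtain n :: nat where "h \<otimes> a \<otimes> inv h = a [^] n" using generate_singleton_nat[OF a] by blast
  then have "h \<otimes> a \<otimes> inv h \<otimes> h = a [^] n \<otimes> h" by simp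
  then show thesis using that h a by (simp add: m_assoc)
qed

lemma commute_pow:
  assumes "x \<in> carrier G" "y \<in> carrier G" "x \<otimes> y = y \<otimes> x"
  shows "x [^] (n::nat) \<otimes> y = y \<otimes> x [^] n"
proof (induction n)
  case (Suc n)
  have "x [^] Suc n \<otimes> y = x [^] n \<otimes> y \<otimes> x" using assms by (simp add: m_assoc)
  then show ?case unfolding Suc using assms by (simp add: m_assoc)
qed (use assms in simp)

lemma even_pow: "x \<in> carrier G \<Longrightarrow> x [^] (2 * n :: nat) = (x \<otimes> x) [^] n"
  using nat_pow_pow[of x 2 n] by (simp add: numeral_2_eq_2)

text \<open>Conjugation by \<open>b\<close> takes \<open>a\<close> to a power of \<open>a\<close>.
  The exponent is odd, since even powers commute with \<open>b\<close> and \<open>a\<close> does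
  not; so the commutator is an even power. Conjugating \<open>a^2\<close>, which \<open>b\<close>
  fixes, shows that its square is trivial.\<close>

lemma commutator_is_power:
  assumes D: "\<And>N. subgroup N G \<Longrightarrow> N \<lhd> G" and a: "a \<in> carrier G" "ord a \<noteq> 0" and b: "b \<in> carrier G"
    and ne: "a \<otimes> b \<noteq> b \<otimes> a" and aab: "(a \<otimes> a) \<otimes> b = b \<otimes> (a \<otimes> a)"
  obtains m :: nat where "b \<otimes> a = a \<otimes> b \<otimes> a [^] (2 * m)" "a [^] (2 * m) \<otimes> a [^] (2 * m) = \<one>"
proof -
  have ev: "a [^] (2 * m) \<otimes> b = b \<otimes> a [^] (2 * m)" for m :: nat
  proof -
    have "a [^] (2 * m) = (a \<otimes> a) [^] m" using even_pow a by simp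
    then show ?thesis using commute_pow[OF _ b aab] a by simp
  qed
  obtain n :: nat where n: "b \<otimes> a = a [^] n \<otimes> b" using cyclic_normal_power[OF D a b] by blast
  have "odd n"
  proof
    assume "even n"
    then obtain m where m: "n = 2 * m" by blast
    then have "b \<otimes> a = b \<otimes> a [^] n" using n ev by simp
    then have "a = a [^] n" by (rule l_cancel) (use a b in auto)
    then show False using ne n by simp
  qed
  then obtain m where m: "n = Suc (2 * m)" by (auto elim: oddE)
  define c where "c = a [^] (2 * m)"
  have c: "c \<in> carrier G" "c \<otimes> b = b \<otimes> c" "c \<otimes> a = a \<otimes> c"
    using ev a commute_pow[OF a(1) a(1), of "2 * m"] by (simp_all add: c_def)
  have 1: "b \<otimes> a = a \<otimes> b \<otimes> c"
    using n m a b c by (simp add: m_assoc flip: c_def)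
  have "b \<otimes> (a \<otimes> a) = (a \<otimes> b \<otimes> c) \<otimes> a" using a b 1 by (simp flip: m_assoc)
  also have "\<dots> = a \<otimes> (b \<otimes> a) \<otimes> c" using a b c by (simp add: m_assoc)
  also have "\<dots> = (a \<otimes> a) \<otimes> b \<otimes> (c \<otimes> c)" unfolding 1 using a b c by (simp add: m_assoc)
  finally have "b \<otimes> (a \<otimes> a) \<otimes> \<one> = b \<otimes> (a \<otimes> a) \<otimes> (c \<otimes> c)" using aab a b by simp
  then have "\<one> = c \<otimes> c" by (rule l_cancel) (use a b c in auto)
  then show thesis using that[of m] 1 by (simp add: c_def)
qed

text \<open>A cyclic 2-group has only one involution; that it is a square forces the order to be at
  least 4.\<close>

lemma two_power_involution:
  assumes a: "a \<in> carrier G" and k: "ord a = 2 ^ k" and c: "c = a [^] (2 * m :: nat)" "c \<noteq> \<one>" "c \<otimes> c = \<one>"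
  shows "2 \<le> k \<and> c = a [^] (2 ^ (k - 1) :: nat)"
proof -
  have d: "2 ^ k dvd 4 * m" using c(3) a k pow_eq_id[OF a, of "4 * m"] by (simp add: c(1) nat_pow_mult)
  have nd: "\<not> 2 ^ k dvd 2 * m" using c(2) a k pow_eq_id[OF a, of "2 * m"] by (simp add: c(1))
  have k2: "2 \<le> k"
  proof (rule ccontr)
    assume "\<not> 2 \<le> k"
    then have "k = 0 \<or> k = 1" by auto
    then show False using nd by auto
  qed
  define M :: nat where "M = 2 ^ (k - 1)"
  have kM: "2 ^ k = 2 * M" using k2 by (cases k) (auto simp: M_def)
  from d obtain r where r: "2 * m = M * r" unfolding kM by auto
  have "odd r" using nd unfolding r kM by auto
  then obtain s where s: "r = Suc (2 * s)" by (auto elim: oddE)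
  have "2 * m = M + 2 ^ k * s" unfolding r s kM by (simp add: algebra_simps)
  then have "c = a [^] M \<otimes> a [^] (2 ^ k * s)" using a by (simp add: c(1) nat_pow_mult)
  also have "a [^] (2 ^ k * s) = \<one>" using pow_eq_id[OF a, of "2 ^ k * s"] k by simp
  finally show ?thesis using a k2 by (simp add: M_def)
qed

text \<open>A noncommuting pair with the least possible orders generates a quaternion group of order 8.\<close>

lemma hamiltonian_quaternion_pair:
  assumes D: "\<And>N. subgroup N G \<Longrightarrow> N \<lhd> G" and tg: "two_group G" and nab: "\<not> comm_group G"
  obtains a b where "a \<in> carrier G" "b \<in> carrier G" "a \<otimes> b \<noteq> b \<otimes> a" "a \<otimes> a = b \<otimes> b" "(a \<otimes> a) \<otimes> (a \<otimes> a) = \<one>"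
    "b \<otimes> a = a \<otimes> b \<otimes> (a \<otimes> a)"
proof -
  have two: "\<exists>k::nat. ord g = 2 ^ k" if "g \<in> carrier G" for g using tg that unfolding two_group_def by blast
  have ord0: "ord g \<noteq> 0" if "g \<in> carrier G" for g using two[OF that] by auto
  define P where "P = (\<lambda>q. fst q \<in> carrier G \<and> snd q \<in> carrier G \<and> fst q \<otimes> snd q \<noteq> snd q \<otimes> fst q)"
  obtain g h where "g \<in> carrier G" "h \<in> carrier G" "g \<otimes> h \<noteq> h \<otimes> g" using nab group_comm_groupI by blast
  then have "P (g, h)" by (simp add: P_def)
  then obtain q where q: "P q" "\<forall>y. P y \<longrightarrow> ord (fst q) + ord (snd q) \<le> ord (fst y) + ord (snd y)"
    using ex_has_least_nat[of P "(g, h)" "\<lambda>q. ord (fst q) + ord (snd q)"] by blast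
  obtain a b where a: "a \<in> carrier G" and b: "b \<in> carrier G" and ne: "a \<otimes> b \<noteq> b \<otimes> a" and le: "ord b \<le> ord a"
    and "ord a + ord b = ord (fst q) + ord (snd q)"
  proof (cases "ord (snd q) \<le> ord (fst q)")
    case True then show ?thesis using that[of "fst q" "snd q"] q(1) unfolding P_def by auto
  next
    case False then show ?thesis using that[of "snd q" "fst q"] q(1) unfolding P_def by auto
  qed
  then have min: "ord a + ord b \<le> ord x + ord y" if "x \<in> carrier G" "y \<in> carrier G" "x \<otimes> y \<noteq> y \<otimes> x" for x y
    using q(2)[rule_format, of "(x, y)"] that by (simp add: P_def)
  obtain k l where kl: "ord a = 2 ^ k" "ord b = 2 ^ l" using two a b by blast
  have sq: "x \<otimes> x \<in> carrier G \<and> ord (x \<otimes> x) < ord x" if x: "x \<in> carrier G" "x \<noteq> \<one>" for x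
  proof -
    obtain n where n: "ord x = 2 ^ n" using two x by blast
    have "n \<noteq> 0" using n ord_eq_1[OF x(1)] x(2) by auto
    then obtain n' where n': "n = Suc n'" by (cases n) auto
    have "(x \<otimes> x) [^] (2 ^ n' :: nat) = \<one>"
      using pow_ord_eq_1[OF x(1)] even_pow[OF x(1)] n n' by simp
    then have "ord (x \<otimes> x) dvd 2 ^ n'" using pow_eq_id x by blast
    then have "ord (x \<otimes> x) \<le> 2 ^ n'" by (simp add: dvd_imp_le)
    also have "\<dots> < 2 ^ n" by (simp add: n')
    finally show ?thesis using x n by simp
  qed
  have "a \<noteq> \<one>" "b \<noteq> \<one>" using ne a b by auto
  then have sqab: "ord (a \<otimes> a) < ord a" "ord (b \<otimes> b) < ord b" using sq a b by blast+
  \<comment> \<open>\<open>a^2\<close> has smaller order than \<open>a\<close>, so by minimality it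
    commutes with \<open>b\<close>.\<close>
  have aab: "(a \<otimes> a) \<otimes> b = b \<otimes> (a \<otimes> a)"
  proof (rule ccontr)
    assume "(a \<otimes> a) \<otimes> b \<noteq> b \<otimes> (a \<otimes> a)"
    from min[OF m_closed[OF a a] b this] show False using sqab by simp
  qed
  have bba: "(b \<otimes> b) \<otimes> a = a \<otimes> (b \<otimes> b)"
  proof (rule ccontr)
    assume "(b \<otimes> b) \<otimes> a \<noteq> a \<otimes> (b \<otimes> b)"
    from min[OF m_closed[OF b b] a this] show False using sqab by simp
  qed
  obtain m :: nat where m: "b \<otimes> a = a \<otimes> b \<otimes> a [^] (2 * m)" "a [^] (2 * m) \<otimes> a [^] (2 * m) = \<one>"
    by (rule commutator_is_power[OF D a ord0[OF a] b ne aab])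
  obtain m' :: nat where m': "a \<otimes> b = b \<otimes> a \<otimes> b [^] (2 * m')" "b [^] (2 * m') \<otimes> b [^] (2 * m') = \<one>"
    by (rule commutator_is_power[OF D b ord0[OF b] a ne[symmetric] bba])
  define c where "c = a [^] (2 * m)"
  define d where "d = b [^] (2 * m')"
  have c: "c \<in> carrier G" "c \<otimes> c = \<one>" "b \<otimes> a = a \<otimes> b \<otimes> c" using a m by (simp_all add: c_def)
  have d: "d \<in> carrier G" "d \<otimes> d = \<one>" "a \<otimes> b = b \<otimes> a \<otimes> d" using b m' by (simp_all add: d_def)
  have cen: "c \<otimes> x = x \<otimes> c" if "x \<in> carrier G" for x using involution_centralI[OF D c(1,2) that] by blast
  have "a \<otimes> b \<otimes> \<one> = a \<otimes> b \<otimes> (c \<otimes> d)" using d(3) c(1,3) d(1) a b by (metis m_assoc m_closed r_one)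
  then have "\<one> = c \<otimes> d" by (rule l_cancel) (use a b c d in auto)
  then have "c \<otimes> c = c \<otimes> d" using c by simp
  then have cd: "c = d" by (rule l_cancel) (use c d in auto)
  have c1: "c \<noteq> \<one>" using c(3) ne a b by auto
  have A: "2 \<le> k" "c = a [^] (2 ^ (k - 1) :: nat)" using two_power_involution[OF a kl(1) c_def c1 c(2)] by auto
  have B: "2 \<le> l" "c = b [^] (2 ^ (l - 1) :: nat)" using two_power_involution[OF b kl(2) d_def] cd c1 c(2) by auto
  have "l \<le> k" using le kl by simp
  \<comment> \<open>Minimality in the form used twice below: an element that does not commute with
    \<open>a\<close> cannot have smaller order than \<open>b\<close>.\<close>
  have small: "False" if x: "x \<in> carrier G" "a \<otimes> x \<noteq> x \<otimes> a" "x [^] (2 ^ (l - 1) :: nat) = \<one>" for x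
  proof -
    have "ord x dvd 2 ^ (l - 1)" using pow_eq_id x by blast
    then have "ord x \<le> 2 ^ (l - 1)" by (simp add: dvd_imp_le)
    also have "\<dots> < ord b" using B(1) kl by simp
    finally show False using min[OF a x(1,2)] by simp
  qed
  have nex: "a \<otimes> (a [^] n \<otimes> b) \<noteq> (a [^] n \<otimes> b) \<otimes> a" for n :: nat
  proof
    assume "a \<otimes> (a [^] n \<otimes> b) = (a [^] n \<otimes> b) \<otimes> a"
    then have "a [^] n \<otimes> (a \<otimes> b) = a [^] n \<otimes> (b \<otimes> a)"
      using a b commute_pow[OF a a HOL.refl, of n, symmetric] by (simp add: m_assoc[symmetric])
    then have "a \<otimes> b = b \<otimes> a" by (rule l_cancel) (use a b in auto)
    then show False using ne by simp
  qed
  \<comment> \<open>If \<open>a\<close> had larger order, a suitable even power \<open>a^n\<close>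
    would satisfy \<open>(a^n)^(2^(l-1)) = c = b^(2^(l-1))\<close>. As it commutes with
    \<open>b\<close>, the product \<open>a^n b\<close> would contradict
    \<open>small\<close>.\<close>
  have kl': "k = l"
  proof (rule ccontr)
    assume "k \<noteq> l"
    then obtain e where e: "k = Suc (l + e)" using \<open>l \<le> k\<close> by (metis le_eq_less_or_eq less_imp_Suc_add)
    define n :: nat where "n = 2 ^ Suc e"
    have "a [^] n = (a \<otimes> a) [^] (2 ^ e :: nat)" using even_pow a by (simp add: n_def)
    then have cm: "a [^] n \<otimes> b = b \<otimes> a [^] n" using commute_pow[OF _ b aab] a by simp
    have n2: "n * 2 ^ (l - 1) = 2 ^ (k - 1)"
      unfolding n_def power_add[symmetric] by (rule arg_cong[where f = "power 2"]) (use e B in simp)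
    have "(a [^] n \<otimes> b) [^] (2 ^ (l - 1) :: nat) = (a [^] n) [^] (2 ^ (l - 1) :: nat) \<otimes> b [^] (2 ^ (l - 1) :: nat)"
      using pow_mult_distrib[OF cm] a b by simp
    also have "(a [^] n) [^] (2 ^ (l - 1) :: nat) = a [^] (2 ^ (k - 1) :: nat)"
      using a n2 by (simp add: nat_pow_pow)
    finally have "(a [^] n \<otimes> b) [^] (2 ^ (l - 1) :: nat) = \<one>" using A(2) B(2) c by simp
    then show False using small[of "a [^] n \<otimes> b"] nex[of n] a b by simp
  qed
  \<comment> \<open>Here \<open>(ab)^2 = a^2 b^2 c\<close>. For larger \<open>k\<close>, passing to
    the power \<open>2^(l-1)\<close> turns the contributions of \<open>a\<close> and
    \<open>b\<close> into \<open>c\<close> each and that of \<open>c\<close> into 1, so that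
    \<open>ab\<close> contradicts \<open>small\<close>.\<close>
  have "k = 2"
  proof (rule ccontr)
    assume "k \<noteq> 2"
    then obtain e where e: "k = 3 + e" using A(1) by (metis add_2_eq_Suc add_Suc_shift le_Suc_ex numeral_3_eq_3 add_0_right not0_implies_Suc numeral_2_eq_2 add_Suc)
    have bbaa: "(a \<otimes> a) \<otimes> (b \<otimes> b) = (b \<otimes> b) \<otimes> (a \<otimes> a)"
      using square_mult_commuting(2)[of "a \<otimes> a" b] aab a b commute_pow[of b "a \<otimes> a" 2] by (simp add: numeral_2_eq_2)
    have "(a \<otimes> b) \<otimes> (a \<otimes> b) = a \<otimes> (b \<otimes> a) \<otimes> b" using a b by (simp add: m_assoc)
    also have "\<dots> = (a \<otimes> a) \<otimes> (b \<otimes> b) \<otimes> c" unfolding c(3) using a b c(1) cen[OF b] by (simp add: m_assoc)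
    finally have s: "(a \<otimes> b) \<otimes> (a \<otimes> b) = (a \<otimes> a) \<otimes> (b \<otimes> b) \<otimes> c" .
    have sqp: "x [^] (2 ^ Suc n :: nat) = (x \<otimes> x) [^] (2 ^ n :: nat)" if "x \<in> carrier G" for x n
      using even_pow that by simp
    have "(a \<otimes> b) [^] (2 ^ (l - 1) :: nat) = ((a \<otimes> a) \<otimes> (b \<otimes> b) \<otimes> c) [^] (2 ^ Suc e :: nat)"
      using sqp[of "a \<otimes> b" "Suc e"] s a b e kl' by simp
    also have "\<dots> = ((a \<otimes> a) \<otimes> (b \<otimes> b)) [^] (2 ^ Suc e :: nat) \<otimes> c [^] (2 ^ Suc e :: nat)"
      by (rule pow_mult_distrib) (use cen[of "(a \<otimes> a) \<otimes> (b \<otimes> b)"] a b c(1) in simp_all)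
    also have "((a \<otimes> a) \<otimes> (b \<otimes> b)) [^] (2 ^ Suc e :: nat) = (a \<otimes> a) [^] (2 ^ Suc e :: nat) \<otimes> (b \<otimes> b) [^] (2 ^ Suc e :: nat)"
      using pow_mult_distrib[OF bbaa] a b by simp
    also have "(a \<otimes> a) [^] (2 ^ Suc e :: nat) = c" using sqp[OF a, of "Suc e"] A(2) e by simp
    also have "(b \<otimes> b) [^] (2 ^ Suc e :: nat) = c" using sqp[OF b, of "Suc e"] B(2) e kl' by simp
    also have "c [^] (2 ^ Suc e :: nat) = \<one>" using sqp[OF c(1), of e] c by simp
    finally have "(a \<otimes> b) [^] (2 ^ (l - 1) :: nat) = \<one>" using c by simp
    then show False using small[of "a \<otimes> b"] nex[of 1] a b by simp
  qed
  then have "c = a \<otimes> a" "c = b \<otimes> b" using A(2) B(2) kl' a b by (simp_all add: numeral_2_eq_2)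
  then show thesis using that[of a b] a b ne c by metis
qed

text \<open>
  Given a quaternion subgroup generated by \<open>a\<close> and \<open>b\<close>, every element is a multiple by \<open>1\<close>, \<open>a\<close>, \<open>b\<close>
  or \<open>ab\<close> of one that centralizes it, and the centralizer has exponent 2.
\<close>

lemma hamiltonian_two_group_exponent:
  assumes D: "\<And>N. subgroup N G \<Longrightarrow> N \<lhd> G" and tg: "two_group G" and nab: "\<not> comm_group G" and x: "x \<in> carrier G"
  shows "(x \<otimes> x) \<otimes> (x \<otimes> x) = \<one>"
proof -
  have two: "\<exists>k::nat. ord g = 2 ^ k" if "g \<in> carrier G" for g using tg that unfolding two_group_def by blast
  have ord0: "ord g \<noteq> 0" if "g \<in> carrier G" for g using two[OF that] by auto
  obtain a b where a: "a \<in> carrier G" and b: "b \<in> carrier G" and ne: "a \<otimes> b \<noteq> b \<otimes> a" and ab: "a \<otimes> a = b \<otimes> b"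
    and a4: "(a \<otimes> a) \<otimes> (a \<otimes> a) = \<one>" and ba: "b \<otimes> a = a \<otimes> b \<otimes> (a \<otimes> a)"
    using hamiltonian_quaternion_pair[OF D tg nab] by blast
  define c where "c = a \<otimes> a"
  have c: "c \<in> carrier G" "c \<otimes> c = \<one>" "b \<otimes> a = a \<otimes> b \<otimes> c" "b \<otimes> b = c" using a b a4 ba ab unfolding c_def by simp_all
  have icen: "t \<otimes> g = g \<otimes> t" if "t \<in> carrier G" "t \<otimes> t = \<one>" "g \<in> carrier G" for t g
    using involution_centralI[OF D that] by blast
  note cen = icen[OF c(1,2)]
  have cen2: "g \<otimes> (c \<otimes> h) = c \<otimes> (g \<otimes> h)" if "g \<in> carrier G" "h \<in> carrier G" for g h
    using that cen[OF that(1)] c(1) by (simp flip: m_assoc)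
  have cc: "c \<otimes> (c \<otimes> h) = h" if "h \<in> carrier G" for h using that c by (simp flip: m_assoc)
  have c1: "c \<noteq> \<one>" using c(3) ne a b by auto
  have ba': "b \<otimes> a = c \<otimes> (a \<otimes> b)" using c a b cen[of "a \<otimes> b"] by simp
  have ab': "a \<otimes> b = c \<otimes> (b \<otimes> a)" unfolding ba' using cc a b by simp
  \<comment> \<open>The commutator \<open>c\<close> of \<open>ya\<close> and \<open>b\<close> is a
    power \<open>(y^2 c)^m\<close> of \<open>(ya)^2\<close>. For even \<open>m\<close> it would be
    the square of \<open>w = y^m\<close>, and \<open>wa\<close> would be an involution that does not
    commute with \<open>b\<close>. For odd \<open>m\<close>, \<open>y^(2m) = 1\<close>, and
    \<open>y^2 = 1\<close> because the order of \<open>y\<close> is a power of 2.\<close>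
  have cent: "y \<otimes> y = \<one>" if y: "y \<in> carrier G" "y \<otimes> a = a \<otimes> y" "y \<otimes> b = b \<otimes> y" for y
  proof -
    have ya: "y \<otimes> a \<in> carrier G" using y a by simp
    have yaya: "(y \<otimes> a) \<otimes> (y \<otimes> a) = (y \<otimes> y) \<otimes> c" using square_mult_commuting[OF y(1) a y(2)] by (simp add: c_def)
    have com: "b \<otimes> (y \<otimes> a) = (y \<otimes> a) \<otimes> b \<otimes> c"
    proof -
      have "b \<otimes> (y \<otimes> a) = y \<otimes> (b \<otimes> a)" using a b y by (metis m_assoc)
      then show ?thesis using a b c(1,3) y(1) by (simp add: m_assoc)
    qed
    have n: "(y \<otimes> a) \<otimes> b \<noteq> b \<otimes> (y \<otimes> a)"
    proof
      assume "(y \<otimes> a) \<otimes> b = b \<otimes> (y \<otimes> a)"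
      then have "(y \<otimes> a) \<otimes> b \<otimes> \<one> = (y \<otimes> a) \<otimes> b \<otimes> c" using com ya b by simp
      then have "\<one> = c" by (rule l_cancel) (use ya b c in auto)
      then show False using c1 by simp
    qed
    have sqb: "((y \<otimes> a) \<otimes> (y \<otimes> a)) \<otimes> b = b \<otimes> ((y \<otimes> a) \<otimes> (y \<otimes> a))"
    proof -
      have "((y \<otimes> y) \<otimes> c) \<otimes> b = (y \<otimes> y) \<otimes> b \<otimes> c" using y(1) b c(1) cen[OF b] by (simp add: m_assoc)
      also have "(y \<otimes> y) \<otimes> b = b \<otimes> (y \<otimes> y)" using y b by (metis m_assoc)
      finally show ?thesis unfolding yaya using y(1) b c(1) by (simp add: m_assoc)
    qed
    obtain m :: nat where m: "b \<otimes> (y \<otimes> a) = (y \<otimes> a) \<otimes> b \<otimes> (y \<otimes> a) [^] (2 * m)"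
        "(y \<otimes> a) [^] (2 * m) \<otimes> (y \<otimes> a) [^] (2 * m) = \<one>"
      by (rule commutator_is_power[OF D ya ord0[OF ya] b n sqb])
    have "(y \<otimes> a) \<otimes> b \<otimes> c = (y \<otimes> a) \<otimes> b \<otimes> (y \<otimes> a) [^] (2 * m)" using m(1) com by simp
    then have "c = (y \<otimes> a) [^] (2 * m)" by (rule l_cancel) (use ya b c in auto)
    also have "\<dots> = ((y \<otimes> y) \<otimes> c) [^] m" using even_pow[OF ya] yaya by simp
    also have "\<dots> = (y \<otimes> y) [^] m \<otimes> c [^] m"
      by (rule pow_mult_distrib) (use cen[of "y \<otimes> y"] y(1) c(1) in simp_all)
    finally have e: "c = (y \<otimes> y) [^] m \<otimes> c [^] m" .
    show ?thesis
    proof (cases "even m")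
      case True
      then obtain r where r: "m = 2 * r" by blast
      define w where "w = y [^] m"
      have w: "w \<in> carrier G" "w \<otimes> a = a \<otimes> w" "w \<otimes> b = b \<otimes> w"
        using commute_pow y a b by (simp_all add: w_def)
      have "c [^] m = \<one>" using even_pow[OF c(1)] c r by simp
      then have "w \<otimes> w = c" using e y pow_mult_distrib[OF HOL.refl, of y m] by (simp add: w_def)
      then have "(w \<otimes> a) \<otimes> (w \<otimes> a) = \<one>" using square_mult_commuting[OF w(1) a w(2)] c by (simp add: c_def)
      then have "(w \<otimes> a) \<otimes> b = b \<otimes> (w \<otimes> a)" using icen w a b by simp
      also have "\<dots> = w \<otimes> (b \<otimes> a)" using w a b by (metis m_assoc)
      finally have "w \<otimes> (a \<otimes> b) = w \<otimes> (b \<otimes> a)" using w(1) a b by (simp add: m_assoc)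
      then have "a \<otimes> b = b \<otimes> a" by (rule l_cancel) (use w a b in auto)
      then show ?thesis using ne by simp
    next
      case False
      then obtain r where r: "m = Suc (2 * r)" by (auto elim: oddE)
      have "c [^] m = c" using even_pow[OF c(1)] c r by simp
      then have "\<one> \<otimes> c = (y \<otimes> y) [^] m \<otimes> c" using e c by simp
      then have "\<one> = (y \<otimes> y) [^] m" by (rule r_cancel) (use y c in auto)
      then have "y [^] (2 * m) = \<one>" using even_pow[OF y(1)] by simp
      then have "ord y dvd 2 * m" using pow_eq_id[OF y(1)] by blast
      moreover obtain j where j: "ord y = 2 ^ j" using two[OF y(1)] by blast
      moreover have "coprime (2 ^ j) m" using False by simp
      ultimately have "2 ^ j dvd (2::nat)" using coprime_dvd_mult_left_iff by metis
      then have "y [^] (2::nat) = \<one>" using pow_eq_id[OF y(1)] j by simp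
      then show ?thesis using y by (simp add: numeral_2_eq_2)
    qed
  qed
  \<comment> \<open>Conjugation by \<open>x\<close> takes \<open>g\<close> to an odd power of
    \<open>g\<close>; as \<open>g^2 = c\<close> is an involution, this is \<open>g\<close> or
    \<open>cg\<close>.\<close>
  have swap: "x \<otimes> g = g \<otimes> x \<or> x \<otimes> g = c \<otimes> (g \<otimes> x)" if g: "g \<in> carrier G" "g \<otimes> g = c" and ng: "h \<in> carrier G" "g \<otimes> h \<noteq> h \<otimes> g" for g h
  proof -
    obtain n :: nat where n: "x \<otimes> g = g [^] n \<otimes> x" using cyclic_normal_power[OF D g(1) ord0[OF g(1)] x] by blast
    have "odd n"
    proof
      assume "even n"
      then obtain r where r: "n = 2 * r" by blast
      have "g [^] n \<otimes> x = x \<otimes> g [^] n"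
        using commute_pow[OF c(1) x cen[OF x]] even_pow[OF g(1)] g(2) r by simp
      then have "x \<otimes> g = x \<otimes> g [^] n" using n by simp
      then have "g = g [^] n" by (rule l_cancel) (use x g in auto)
      moreover have "g [^] n \<otimes> h = h \<otimes> g [^] n"
        using commute_pow[OF c(1) ng(1) cen[OF ng(1)]] even_pow[OF g(1)] g(2) r by simp
      ultimately show False using ng(2) by simp
    qed
    then obtain r where r: "n = Suc (2 * r)" by (auto elim: oddE)
    then have "g [^] n = c [^] r \<otimes> g" using even_pow[OF g(1)] g(2) by simp
    moreover have "c [^] r = \<one> \<or> c [^] r = c" by (induction r) (use c in auto)
    ultimately show ?thesis using n g x c by (auto simp: m_assoc)
  qed
  have xa: "x \<otimes> a = a \<otimes> x \<or> x \<otimes> a = c \<otimes> (a \<otimes> x)" using swap[OF a _ b ne] by (simp add: c_def)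
  have xb: "x \<otimes> b = b \<otimes> x \<or> x \<otimes> b = c \<otimes> (b \<otimes> x)" using swap[OF b c(4) a] ne by simp
  have "\<exists>q\<in>{\<one>, a, b, a \<otimes> b}. (x \<otimes> q) \<otimes> a = a \<otimes> (x \<otimes> q) \<and> (x \<otimes> q) \<otimes> b = b \<otimes> (x \<otimes> q)"
  proof -
    have A: "a \<otimes> (a \<otimes> z) = c \<otimes> z" "b \<otimes> (b \<otimes> z) = c \<otimes> z" if "z \<in> carrier G" for z
      using m_assoc[OF a a that] m_assoc[OF b b that] c(4) by (simp_all add: c_def)
    have B: "b \<otimes> (a \<otimes> z) = c \<otimes> (a \<otimes> (b \<otimes> z))" if "z \<in> carrier G" for z
      using m_assoc[OF b a that] m_assoc[of c "a \<otimes> b" z] m_assoc[OF a b that] that a b c(1) ba' by simp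
    have aa: "a \<otimes> a = c" by (simp add: c_def)
    \<comment> \<open>Rewriting to a normal form: \<open>c\<close> moves to the front,
      \<open>ba\<close> becomes \<open>c(ab)\<close>, and repeated letters collapse to
      \<open>c\<close>.\<close>
    note norm = m_assoc A B ba' cen2[OF a] cen2[OF b] cen2[OF x] cc cen[OF a, symmetric] cen[OF b, symmetric] cen[OF x, symmetric] aa c(2,4)
    from xa xb show ?thesis
    proof (elim disjE)
      assume 1: "x \<otimes> a = a \<otimes> x" "x \<otimes> b = b \<otimes> x"
      then show ?thesis using x by simp
    next
      assume 1: "x \<otimes> a = a \<otimes> x" "x \<otimes> b = c \<otimes> (b \<otimes> x)"
      have "x \<otimes> (a \<otimes> b) = a \<otimes> (x \<otimes> b)" using 1(1) x a b by (simp flip: m_assoc)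
      then show ?thesis by (intro bexI[of _ a]) (use 1 x a b c(1) in \<open>simp_all add: norm\<close>)
    next
      assume 1: "x \<otimes> a = c \<otimes> (a \<otimes> x)" "x \<otimes> b = b \<otimes> x"
      have "x \<otimes> (a \<otimes> b) = c \<otimes> (a \<otimes> (x \<otimes> b))" using 1(1) x a b c by (simp flip: m_assoc)
      then show ?thesis by (intro bexI[of _ b]) (use 1 x a b c(1) in \<open>simp_all add: norm\<close>)
    next
      assume 1: "x \<otimes> a = c \<otimes> (a \<otimes> x)" "x \<otimes> b = c \<otimes> (b \<otimes> x)"
      have "x \<otimes> (a \<otimes> b) = c \<otimes> (a \<otimes> (x \<otimes> b))" using 1(1) x a b c by (simp flip: m_assoc)
      then show ?thesis by (intro bexI[of _ "a \<otimes> b"]) (use 1 x a b c(1) in \<open>simp_all add: norm\<close>)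
    qed
  qed
  then obtain q where q: "q \<in> {\<one>, a, b, a \<otimes> b}" "(x \<otimes> q) \<otimes> a = a \<otimes> (x \<otimes> q)" "(x \<otimes> q) \<otimes> b = b \<otimes> (x \<otimes> q)" by blast
  have qG: "q \<in> carrier G" using q(1) a b by auto
  have "(a \<otimes> b) \<otimes> (a \<otimes> b) = a \<otimes> (b \<otimes> a) \<otimes> b" using a b by (simp add: m_assoc)
  also have "\<dots> = c \<otimes> ((a \<otimes> a) \<otimes> (b \<otimes> b))" unfolding ba' using a b c(1) cen2 by (simp add: m_assoc)
  finally have "(a \<otimes> b) \<otimes> (a \<otimes> b) = c" using c by (simp add: c_def)
  then have q4: "(q \<otimes> q) \<otimes> (q \<otimes> q) = \<one>" using q(1) c by (auto simp: c_def)
  define y where "y = x \<otimes> q"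
  have y: "y \<in> carrier G" "y \<otimes> y = \<one>" using cent[of y] q x qG by (simp_all add: y_def)
  have yq: "y \<otimes> inv q = inv q \<otimes> y" by (rule icen) (use y qG in auto)
  have x': "x = y \<otimes> inv q" using x qG by (simp add: y_def m_assoc)
  have "x \<otimes> x = inv (q \<otimes> q)" unfolding x' using square_mult_commuting[OF y(1) _ yq] y qG by (simp add: inv_mult_group)
  then have "(x \<otimes> x) \<otimes> (x \<otimes> x) = inv ((q \<otimes> q) \<otimes> (q \<otimes> q))" using qG by (simp add: inv_mult_group m_assoc)
  then show ?thesis using q4 by simp
qed

text \<open>In exponent 4, conjugation takes \<open>g\<close> to a power of itself: an even power
  would commute with \<open>h\<close>, and so would \<open>g\<close>; an odd power is
  \<open>g\<close> or \<open>g^-1\<close>.\<close>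

lemma hamiltonian_odd_condition:
  assumes D: "\<And>N. subgroup N G \<Longrightarrow> N \<lhd> G" and tg: "two_group G" and nab: "\<not> comm_group G"
  shows "odd_condition G"
  unfolding odd_condition_def
proof (intro conjI ballI impI)
  fix t h assume "t \<in> carrier G" "h \<in> carrier G" "t \<otimes> t = \<one>"
  then show "t \<otimes> h = h \<otimes> t" using involution_centralI[OF D] by blast
next
  fix g h assume g: "g \<in> carrier G" and h: "h \<in> carrier G"
  have 4: "(g \<otimes> g) \<otimes> (g \<otimes> g) = \<one>" using hamiltonian_two_group_exponent[OF D tg nab g] by blast
  have cen: "(g \<otimes> g) \<otimes> y = y \<otimes> (g \<otimes> g)" if "y \<in> carrier G" for y
    using involution_centralI[OF D _ 4 that] g by simp
  have "ord g \<noteq> 0" using tg g unfolding two_group_def by fastforce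
  then obtain n :: nat where n: "h \<otimes> g = g [^] n \<otimes> h" using cyclic_normal_power[OF D g _ h] by blast
  obtain r where r: "n = 2 * r \<or> n = Suc (2 * r)" by (metis oddE evenE add.commute plus_1_eq_Suc)
  have sq: "(g \<otimes> g) [^] r = \<one> \<or> (g \<otimes> g) [^] r = g \<otimes> g" by (induction r) (use g 4 in auto)
  show "g \<otimes> h = h \<otimes> g \<or> g \<otimes> h \<otimes> g = h \<or> h \<otimes> g \<otimes> h = g"
    using r
  proof
    assume "n = 2 * r"
    then have e: "h \<otimes> g = h \<otimes> (g \<otimes> g) [^] r"
      using n even_pow[OF g] commute_pow[OF _ h cen[OF h], of r] g by simp
    then have "g = (g \<otimes> g) [^] r" by (rule l_cancel) (use g h in auto)
    then have "g \<otimes> h = h \<otimes> g" using commute_pow[OF _ h cen[OF h], of r] g by simp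
    then show ?thesis by blast
  next
    assume "n = Suc (2 * r)"
    then have e: "h \<otimes> g = (g \<otimes> g) [^] r \<otimes> g \<otimes> h" using n even_pow[OF g] by simp
    show ?thesis using sq
    proof
      assume "(g \<otimes> g) [^] r = \<one>" then show ?thesis using e g h by simp
    next
      assume "(g \<otimes> g) [^] r = g \<otimes> g"
      then have "g \<otimes> (h \<otimes> g) = ((g \<otimes> g) \<otimes> (g \<otimes> g)) \<otimes> h" using e g h by (simp add: m_assoc)
      then show ?thesis using 4 g h by (simp add: m_assoc)
    qed
  qed
qed

end

section \<open>The group ring and its involution\<close>

lemma (in abelian_monoid) finsum_swap:
  assumes "finite A" "finite B" "\<And>a b. a \<in> A \<Longrightarrow> b \<in> B \<Longrightarrow> f a b \<in> carrier G"
  shows "(\<Oplus>a\<in>A. \<Oplus>b\<in>B. f a b) = (\<Oplus>b\<in>B. \<Oplus>a\<in>A. f a b)"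
  using assms(1,3)
proof (induction A)
  case empty then show ?case by simp
next
  case (insert c A)
  have 1: "(\<Oplus>a\<in>A. f a b) \<in> carrier G" if "b \<in> B" for b
    using insert.prems that by (intro finsum_closed) auto
  have 2: "(\<Oplus>b\<in>B. f a b) \<in> carrier G" if "a \<in> insert c A" for a
    using insert.prems that by (intro finsum_closed) auto
  have "(\<Oplus>a\<in>insert c A. \<Oplus>b\<in>B. f a b) = (\<Oplus>b\<in>B. f c b) \<oplus> (\<Oplus>a\<in>A. \<Oplus>b\<in>B. f a b)"
    using insert.hyps 2 by (intro finsum_insert) auto
  also have "\<dots> = (\<Oplus>b\<in>B. f c b) \<oplus> (\<Oplus>b\<in>B. \<Oplus>a\<in>A. f a b)"
    using insert by simp
  also have "\<dots> = (\<Oplus>b\<in>B. f c b \<oplus> (\<Oplus>a\<in>A. f a b))"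
    using insert.prems 1 by (intro finsum_addf [symmetric]) auto
  also have "\<dots> = (\<Oplus>b\<in>B. \<Oplus>a\<in>insert c A. f a b)"
    using insert 1 by (intro finsum_cong') (auto intro!: finsum_insert [symmetric])
  finally show ?case .
qed

lemma (in abelian_monoid) finsum_reindex_mono_neutral:
  assumes "finite B" "inj_on \<phi> A" "\<phi> ` A \<subseteq> B" "\<And>b. b \<in> B \<Longrightarrow> f b \<in> carrier G"
    "\<And>b. b \<in> B \<Longrightarrow> b \<notin> \<phi> ` A \<Longrightarrow> f b = \<zero>"
  shows "(\<Oplus>b\<in>B. f b) = (\<Oplus>a\<in>A. f (\<phi> a))"
proof -
  have "(\<Oplus>b\<in>B. f b) = (\<Oplus>b\<in>\<phi> ` A. f b)"
    using assms by (intro add.finprod_mono_neutral_cong_right) auto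
  also have "\<dots> = (\<Oplus>a\<in>A. f (\<phi> a))"
    using assms by (intro finsum_reindex) auto
  finally show ?thesis .
qed

definition delta :: "('k, 'n) ring_scheme \<Rightarrow> 'k \<Rightarrow> 'g \<Rightarrow> 'g \<Rightarrow> 'k"
  where "delta K \<alpha> g = (\<lambda>x. if x = g then \<alpha> else \<zero>\<^bsub>K\<^esub>)"

locale group_algebra = group G + K: domain K for G (structure) and K (structure)
begin

abbreviation KG where "KG \<equiv> group_ring K G"
abbreviation \<delta> where "\<delta> \<equiv> delta K"

lemma mem_KG: "f \<in> carrier KG \<longleftrightarrow> range f \<subseteq> carrier K \<and> supp K f \<subseteq> carrier G \<and> finite (supp K f)"
  by (simp add: group_ring_def)

lemma coeff_closed [simp]: "f \<in> carrier KG \<Longrightarrow> f x \<in> carrier K"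
  by (auto simp: mem_KG)

lemma coeff_outside: "f \<in> carrier KG \<Longrightarrow> x \<notin> carrier G \<Longrightarrow> f x = \<zero>\<^bsub>K\<^esub>"
  by (auto simp: mem_KG supp_def)

lemma KG_memI:
  assumes "\<And>x. f x \<in> carrier K" "finite A" "A \<subseteq> carrier G" "\<And>x. x \<notin> A \<Longrightarrow> f x = \<zero>\<^bsub>K\<^esub>"
  shows "f \<in> carrier KG"
proof -
  have "supp K f \<subseteq> A" using assms(4) by (auto simp: supp_def)
  then show ?thesis using assms finite_subset by (auto simp: mem_KG)
qed

lemma KG_eqI: "f \<in> carrier KG \<Longrightarrow> h \<in> carrier KG \<Longrightarrow> (\<And>x. x \<in> carrier G \<Longrightarrow> f x = h x) \<Longrightarrow> f = h"
  by (rule ext) (metis coeff_outside)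

lemma add_KG: "(f \<oplus>\<^bsub>KG\<^esub> h) x = f x \<oplus>\<^bsub>K\<^esub> h x"
  by (simp add: group_ring_def)

lemma zero_KG: "\<zero>\<^bsub>KG\<^esub> x = \<zero>\<^bsub>K\<^esub>"
  by (simp add: group_ring_def)

lemma one_KG: "\<one>\<^bsub>KG\<^esub> = \<delta> \<one>\<^bsub>K\<^esub> \<one>"
  by (simp add: group_ring_def delta_def)

lemma mult_KG_def: "(f \<otimes>\<^bsub>KG\<^esub> h) x =
    (\<Oplus>\<^bsub>K\<^esub>p \<in> {p \<in> supp K f \<times> supp K h. fst p \<otimes> snd p = x}. f (fst p) \<otimes>\<^bsub>K\<^esub> h (snd p))"
  by (simp add: group_ring_def)

text \<open>A sum over one variable, running over any finite superset of the support, can be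
  exchanged and reindexed, unlike the sum over pairs in the definition.\<close>

lemma mult_KG:
  assumes f: "f \<in> carrier KG" and h: "h \<in> carrier KG" and x: "x \<in> carrier G"
    and A: "finite A" "supp K f \<subseteq> A" "A \<subseteq> carrier G"
  shows "(f \<otimes>\<^bsub>KG\<^esub> h) x = (\<Oplus>\<^bsub>K\<^esub>a\<in>A. f a \<otimes>\<^bsub>K\<^esub> h (inv a \<otimes> x))"
proof -
  define P where "P = {p \<in> supp K f \<times> supp K h. fst p \<otimes> snd p = x}"
  have PG: "fst p \<in> carrier G \<and> snd p \<in> carrier G \<and> snd p = inv (fst p) \<otimes> x" if "p \<in> P" for p
    using that f h by (auto simp: P_def mem_KG subset_iff)
  have "inj_on fst P" using PG by (intro inj_onI) (metis prod.expand)
  moreover have "f a \<otimes>\<^bsub>K\<^esub> h (inv a \<otimes> x) = \<zero>\<^bsub>K\<^esub>" if a: "a \<in> A" "a \<notin> fst ` P" for a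
  proof (rule ccontr)
    assume ne: "f a \<otimes>\<^bsub>K\<^esub> h (inv a \<otimes> x) \<noteq> \<zero>\<^bsub>K\<^esub>"
    then have "f a \<noteq> \<zero>\<^bsub>K\<^esub>" "h (inv a \<otimes> x) \<noteq> \<zero>\<^bsub>K\<^esub>" using f h by auto
    then have "(a, inv a \<otimes> x) \<in> P" using a A x by (auto simp: P_def supp_def simp flip: m_assoc)
    then show False using a(2) by force
  qed
  moreover have "fst ` P \<subseteq> A" using A by (auto simp: P_def)
  ultimately have "(\<Oplus>\<^bsub>K\<^esub>a\<in>A. f a \<otimes>\<^bsub>K\<^esub> h (inv a \<otimes> x)) = (\<Oplus>\<^bsub>K\<^esub>p\<in>P. f (fst p) \<otimes>\<^bsub>K\<^esub> h (inv (fst p) \<otimes> x))"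
    using A f h by (intro K.finsum_reindex_mono_neutral) auto
  also have "\<dots> = (\<Oplus>\<^bsub>K\<^esub>p\<in>P. f (fst p) \<otimes>\<^bsub>K\<^esub> h (snd p))"
    using PG f h by (intro K.finsum_cong') auto
  finally show ?thesis by (simp add: group_ring_def P_def)
qed

lemma delta_closed [simp]: "\<alpha> \<in> carrier K \<Longrightarrow> g \<in> carrier G \<Longrightarrow> \<delta> \<alpha> g \<in> carrier KG"
  by (rule KG_memI[of _ "{g}"]) (auto simp: delta_def simp del: coeff_closed)

lemma add_closed_KG: "f \<in> carrier KG \<Longrightarrow> h \<in> carrier KG \<Longrightarrow> f \<oplus>\<^bsub>KG\<^esub> h \<in> carrier KG"
  by (rule KG_memI[of _ "supp K f \<union> supp K h"]) (auto simp: mem_KG add_KG supp_def)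

lemma mult_closed_KG:
  assumes f: "f \<in> carrier KG" and h: "h \<in> carrier KG"
  shows "f \<otimes>\<^bsub>KG\<^esub> h \<in> carrier KG"
    and "supp K (f \<otimes>\<^bsub>KG\<^esub> h) \<subseteq> (\<lambda>(a, b). a \<otimes> b) ` (supp K f \<times> supp K h)"
proof -
  have fin: "finite (supp K f)" "finite (supp K h)" "supp K f \<subseteq> carrier G" "supp K h \<subseteq> carrier G"
    using f h by (auto simp: mem_KG)
  have cl: "(f \<otimes>\<^bsub>KG\<^esub> h) x \<in> carrier K" for x
    using f h by (auto simp: group_ring_def intro!: K.finsum_closed)
  have z: "(f \<otimes>\<^bsub>KG\<^esub> h) x = \<zero>\<^bsub>K\<^esub>" if "x \<notin> (\<lambda>(a, b). a \<otimes> b) ` (supp K f \<times> supp K h)" for x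
  proof -
    have "{p \<in> supp K f \<times> supp K h. fst p \<otimes> snd p = x} = {}" using that by force
    then show ?thesis unfolding mult_KG_def by (simp only: K.finsum_empty)
  qed
  show "supp K (f \<otimes>\<^bsub>KG\<^esub> h) \<subseteq> (\<lambda>(a, b). a \<otimes> b) ` (supp K f \<times> supp K h)"
    using z by (auto simp: supp_def)
  show "f \<otimes>\<^bsub>KG\<^esub> h \<in> carrier KG"
    by (rule KG_memI[OF cl, of "(\<lambda>(a, b). a \<otimes> b) ` (supp K f \<times> supp K h)"]) (use fin z in auto)
qed

lemma delta_mult_left:
  assumes "\<alpha> \<in> carrier K" "g \<in> carrier G" "f \<in> carrier KG" "x \<in> carrier G"
  shows "(\<delta> \<alpha> g \<otimes>\<^bsub>KG\<^esub> f) x = \<alpha> \<otimes>\<^bsub>K\<^esub> f (inv g \<otimes> x)"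
proof -
  have "(\<delta> \<alpha> g \<otimes>\<^bsub>KG\<^esub> f) x = (\<Oplus>\<^bsub>K\<^esub>a\<in>{g}. \<delta> \<alpha> g a \<otimes>\<^bsub>K\<^esub> f (inv a \<otimes> x))"
    using assms by (intro mult_KG) (simp_all add: supp_def, auto simp: delta_def)
  then show ?thesis using assms by (simp add: delta_def)
qed

lemma delta_mult_right:
  assumes "\<alpha> \<in> carrier K" "g \<in> carrier G" "f \<in> carrier KG" "x \<in> carrier G"
  shows "(f \<otimes>\<^bsub>KG\<^esub> \<delta> \<alpha> g) x = f (x \<otimes> inv g) \<otimes>\<^bsub>K\<^esub> \<alpha>"
proof -
  define A where "A = insert (x \<otimes> inv g) (supp K f)"
  have A: "finite A" "supp K f \<subseteq> A" "A \<subseteq> carrier G" using assms by (auto simp: A_def mem_KG)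
  have "(f \<otimes>\<^bsub>KG\<^esub> \<delta> \<alpha> g) x = (\<Oplus>\<^bsub>K\<^esub>a\<in>A. f a \<otimes>\<^bsub>K\<^esub> \<delta> \<alpha> g (inv a \<otimes> x))"
    using assms A by (intro mult_KG) auto
  also have "\<dots> = (\<Oplus>\<^bsub>K\<^esub>a\<in>{x \<otimes> inv g}. f a \<otimes>\<^bsub>K\<^esub> \<delta> \<alpha> g (inv a \<otimes> x))"
  proof (intro K.add.finprod_mono_neutral_cong_right)
    fix a assume a: "a \<in> A - {x \<otimes> inv g}"
    then have aG: "a \<in> carrier G" using A by auto
    have "inv a \<otimes> x \<noteq> g"
    proof
      assume "inv a \<otimes> x = g"
      then have "x = a \<otimes> g" using aG assms by auto
      then show False using a aG assms by (simp add: m_assoc)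
    qed
    then show "f a \<otimes>\<^bsub>K\<^esub> \<delta> \<alpha> g (inv a \<otimes> x) = \<zero>\<^bsub>K\<^esub>" using assms by (simp add: delta_def)
  qed (use assms A in \<open>auto simp: A_def\<close>)
  also have "\<dots> = f (x \<otimes> inv g) \<otimes>\<^bsub>K\<^esub> \<alpha>"
    using assms by (simp add: delta_def inv_mult_group m_assoc)
  finally show ?thesis .
qed

lemma mult_assoc_KG:
  assumes f: "f \<in> carrier KG" and h: "h \<in> carrier KG" and k: "k \<in> carrier KG"
  shows "(f \<otimes>\<^bsub>KG\<^esub> h) \<otimes>\<^bsub>KG\<^esub> k = f \<otimes>\<^bsub>KG\<^esub> (h \<otimes>\<^bsub>KG\<^esub> k)"
proof (rule KG_eqI)
  fix x assume x: "x \<in> carrier G"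
  define A where "A = supp K f"
  define C where "C = supp K h"
  \<comment> \<open>\<open>B\<close> contains all products \<open>ac\<close>, so for each
    \<open>a\<close> the sum over \<open>B\<close> can be reindexed by \<open>b = ac\<close>; the
    other terms vanish.\<close>
  define B where "B = (\<lambda>(a, b). a \<otimes> b) ` (A \<times> C)"
  have A: "finite A" "A \<subseteq> carrier G" and C: "finite C" "C \<subseteq> carrier G"
    using f h by (auto simp: A_def C_def mem_KG)
  have B: "finite B" "B \<subseteq> carrier G" "supp K (f \<otimes>\<^bsub>KG\<^esub> h) \<subseteq> B"
    using A C mult_closed_KG(2)[OF f h] by (auto simp: B_def A_def C_def)
  have "((f \<otimes>\<^bsub>KG\<^esub> h) \<otimes>\<^bsub>KG\<^esub> k) x = (\<Oplus>\<^bsub>K\<^esub>b\<in>B. (f \<otimes>\<^bsub>KG\<^esub> h) b \<otimes>\<^bsub>K\<^esub> k (inv b \<otimes> x))"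
    using mult_closed_KG(1)[OF f h] k x B by (intro mult_KG) auto
  also have "\<dots> = (\<Oplus>\<^bsub>K\<^esub>b\<in>B. \<Oplus>\<^bsub>K\<^esub>a\<in>A. f a \<otimes>\<^bsub>K\<^esub> h (inv a \<otimes> b) \<otimes>\<^bsub>K\<^esub> k (inv b \<otimes> x))"
  proof (rule K.finsum_cong')
    fix b assume "b \<in> B"
    then have b: "b \<in> carrier G" using B by auto
    have "(f \<otimes>\<^bsub>KG\<^esub> h) b = (\<Oplus>\<^bsub>K\<^esub>a\<in>A. f a \<otimes>\<^bsub>K\<^esub> h (inv a \<otimes> b))"
      using f h b A by (intro mult_KG) (auto simp: A_def)
    then show "(f \<otimes>\<^bsub>KG\<^esub> h) b \<otimes>\<^bsub>K\<^esub> k (inv b \<otimes> x) = (\<Oplus>\<^bsub>K\<^esub>a\<in>A. f a \<otimes>\<^bsub>K\<^esub> h (inv a \<otimes> b) \<otimes>\<^bsub>K\<^esub> k (inv b \<otimes> x))"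
      using f h k A by (simp add: K.finsum_ldistr)
  qed (use f h k in auto)
  also have "\<dots> = (\<Oplus>\<^bsub>K\<^esub>a\<in>A. \<Oplus>\<^bsub>K\<^esub>b\<in>B. f a \<otimes>\<^bsub>K\<^esub> h (inv a \<otimes> b) \<otimes>\<^bsub>K\<^esub> k (inv b \<otimes> x))"
    using A B f h k by (intro K.finsum_swap) auto
  also have "\<dots> = (\<Oplus>\<^bsub>K\<^esub>a\<in>A. f a \<otimes>\<^bsub>K\<^esub> (h \<otimes>\<^bsub>KG\<^esub> k) (inv a \<otimes> x))"
  proof (rule K.finsum_cong')
    fix a assume a: "a \<in> A"
    then have aG: "a \<in> carrier G" using A by auto
    have "(\<Oplus>\<^bsub>K\<^esub>b\<in>B. f a \<otimes>\<^bsub>K\<^esub> h (inv a \<otimes> b) \<otimes>\<^bsub>K\<^esub> k (inv b \<otimes> x)) =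
        (\<Oplus>\<^bsub>K\<^esub>c\<in>C. f a \<otimes>\<^bsub>K\<^esub> h (inv a \<otimes> (a \<otimes> c)) \<otimes>\<^bsub>K\<^esub> k (inv (a \<otimes> c) \<otimes> x))"
    proof (rule K.finsum_reindex_mono_neutral[OF B(1)])
      show "inj_on ((\<otimes>) a) C" by (rule inj_onI) (metis l_cancel aG C(2) subsetD)
      show "(\<otimes>) a ` C \<subseteq> B" using a by (auto simp: B_def)
      fix b assume b: "b \<in> B" "b \<notin> (\<otimes>) a ` C"
      have "b \<in> carrier G" using b B by auto
      then have "inv a \<otimes> b \<notin> C" using b(2) aG image_eqI[of b "(\<otimes>) a" "inv a \<otimes> b" C] by (auto simp flip: m_assoc)
      then have "h (inv a \<otimes> b) = \<zero>\<^bsub>K\<^esub>" by (simp add: C_def supp_def)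
      then show "f a \<otimes>\<^bsub>K\<^esub> h (inv a \<otimes> b) \<otimes>\<^bsub>K\<^esub> k (inv b \<otimes> x) = \<zero>\<^bsub>K\<^esub>" using f k by simp
    qed (use f h k in auto)
    also have "\<dots> = (\<Oplus>\<^bsub>K\<^esub>c\<in>C. f a \<otimes>\<^bsub>K\<^esub> (h c \<otimes>\<^bsub>K\<^esub> k (inv c \<otimes> (inv a \<otimes> x))))"
      using C aG x f h k by (intro K.finsum_cong') (auto simp: inv_mult_group m_assoc K.m_assoc subset_iff simp flip: m_assoc[of "inv a" a])
    also have "\<dots> = f a \<otimes>\<^bsub>K\<^esub> (\<Oplus>\<^bsub>K\<^esub>c\<in>C. h c \<otimes>\<^bsub>K\<^esub> k (inv c \<otimes> (inv a \<otimes> x)))"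
      using f h k C by (intro K.finsum_rdistr [symmetric]) auto
    also have "(\<Oplus>\<^bsub>K\<^esub>c\<in>C. h c \<otimes>\<^bsub>K\<^esub> k (inv c \<otimes> (inv a \<otimes> x))) = (h \<otimes>\<^bsub>KG\<^esub> k) (inv a \<otimes> x)"
      using h k C aG x by (intro mult_KG [symmetric]) (auto simp: C_def)
    finally show "(\<Oplus>\<^bsub>K\<^esub>b\<in>B. f a \<otimes>\<^bsub>K\<^esub> h (inv a \<otimes> b) \<otimes>\<^bsub>K\<^esub> k (inv b \<otimes> x)) = f a \<otimes>\<^bsub>K\<^esub> (h \<otimes>\<^bsub>KG\<^esub> k) (inv a \<otimes> x)" .
  qed (use f mult_closed_KG(1)[OF h k] in auto)
  also have "\<dots> = (f \<otimes>\<^bsub>KG\<^esub> (h \<otimes>\<^bsub>KG\<^esub> k)) x"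
    using f mult_closed_KG(1)[OF h k] x A by (intro mult_KG [symmetric]) (auto simp: A_def)
  finally show "((f \<otimes>\<^bsub>KG\<^esub> h) \<otimes>\<^bsub>KG\<^esub> k) x = (f \<otimes>\<^bsub>KG\<^esub> (h \<otimes>\<^bsub>KG\<^esub> k)) x" .
qed (simp_all add: mult_closed_KG assms)

lemma l_distr_KG:
  assumes f: "f \<in> carrier KG" and h: "h \<in> carrier KG" and k: "k \<in> carrier KG"
  shows "(f \<oplus>\<^bsub>KG\<^esub> h) \<otimes>\<^bsub>KG\<^esub> k = f \<otimes>\<^bsub>KG\<^esub> k \<oplus>\<^bsub>KG\<^esub> h \<otimes>\<^bsub>KG\<^esub> k"
proof (rule KG_eqI)
  fix x assume x: "x \<in> carrier G"
  define A where "A = supp K f \<union> supp K h"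
  have A: "finite A" "A \<subseteq> carrier G" "supp K f \<subseteq> A" "supp K h \<subseteq> A" "supp K (f \<oplus>\<^bsub>KG\<^esub> h) \<subseteq> A"
    using f h by (auto simp: A_def mem_KG supp_def add_KG)
  show "((f \<oplus>\<^bsub>KG\<^esub> h) \<otimes>\<^bsub>KG\<^esub> k) x = (f \<otimes>\<^bsub>KG\<^esub> k \<oplus>\<^bsub>KG\<^esub> h \<otimes>\<^bsub>KG\<^esub> k) x"
    unfolding add_KG[of "f \<otimes>\<^bsub>KG\<^esub> k"] mult_KG[OF f k x A(1,3,2)] mult_KG[OF h k x A(1,4,2)]
      mult_KG[OF add_closed_KG[OF f h] k x A(1,5,2)]
    using f h k by (subst K.finsum_addf [symmetric]) (auto simp: add_KG K.l_distr intro!: K.finsum_cong')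
qed (simp_all add: mult_closed_KG add_closed_KG assms)

lemma r_distr_KG:
  assumes f: "f \<in> carrier KG" and h: "h \<in> carrier KG" and k: "k \<in> carrier KG"
  shows "k \<otimes>\<^bsub>KG\<^esub> (f \<oplus>\<^bsub>KG\<^esub> h) = k \<otimes>\<^bsub>KG\<^esub> f \<oplus>\<^bsub>KG\<^esub> k \<otimes>\<^bsub>KG\<^esub> h"
proof (rule KG_eqI)
  fix x assume x: "x \<in> carrier G"
  have A: "finite (supp K k)" "supp K k \<subseteq> supp K k" "supp K k \<subseteq> carrier G"
    using k by (auto simp: mem_KG)
  show "(k \<otimes>\<^bsub>KG\<^esub> (f \<oplus>\<^bsub>KG\<^esub> h)) x = (k \<otimes>\<^bsub>KG\<^esub> f \<oplus>\<^bsub>KG\<^esub> k \<otimes>\<^bsub>KG\<^esub> h) x"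
    unfolding add_KG[of "k \<otimes>\<^bsub>KG\<^esub> f"] mult_KG[OF k f x A] mult_KG[OF k h x A] mult_KG[OF k add_closed_KG[OF f h] x A]
    using f h k by (subst K.finsum_addf [symmetric]) (auto simp: add_KG K.r_distr intro!: K.finsum_cong')
qed (simp_all add: mult_closed_KG add_closed_KG assms)

lemma ring_KG: "ring KG"
proof (rule ringI)
  show "abelian_group KG"
  proof (rule abelian_groupI)
    show "\<zero>\<^bsub>KG\<^esub> \<in> carrier KG" by (rule KG_memI[of _ "{}"]) (auto simp: zero_KG)
    fix f assume f: "f \<in> carrier KG"
    show "\<zero>\<^bsub>KG\<^esub> \<oplus>\<^bsub>KG\<^esub> f = f" using f by (auto simp: add_KG zero_KG)
    have "(\<lambda>x. \<ominus>\<^bsub>K\<^esub> f x) \<in> carrier KG"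
      by (rule KG_memI[of _ "supp K f"]) (use f in \<open>auto simp: mem_KG supp_def\<close>)
    moreover have "(\<lambda>x. \<ominus>\<^bsub>K\<^esub> f x) \<oplus>\<^bsub>KG\<^esub> f = \<zero>\<^bsub>KG\<^esub>"
      by (rule ext) (use f in \<open>auto simp: add_KG zero_KG K.l_neg\<close>)
    ultimately show "\<exists>h\<in>carrier KG. h \<oplus>\<^bsub>KG\<^esub> f = \<zero>\<^bsub>KG\<^esub>" by blast
    fix h assume h: "h \<in> carrier KG"
    show "f \<oplus>\<^bsub>KG\<^esub> h = h \<oplus>\<^bsub>KG\<^esub> f" by (rule ext) (use f h in \<open>simp add: add_KG K.a_comm\<close>)
    fix k assume k: "k \<in> carrier KG"
    show "f \<oplus>\<^bsub>KG\<^esub> h \<oplus>\<^bsub>KG\<^esub> k = f \<oplus>\<^bsub>KG\<^esub> (h \<oplus>\<^bsub>KG\<^esub> k)" by (rule ext) (use f h k in \<open>simp add: add_KG K.a_assoc\<close>)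
  qed (rule add_closed_KG)
  show "monoid KG"
  proof (rule monoidI)
    fix f assume f: "f \<in> carrier KG"
    show "\<one>\<^bsub>KG\<^esub> \<otimes>\<^bsub>KG\<^esub> f = f" "f \<otimes>\<^bsub>KG\<^esub> \<one>\<^bsub>KG\<^esub> = f"
      by (rule KG_eqI; use f in \<open>simp add: one_KG mult_closed_KG delta_mult_left delta_mult_right\<close>)+
  qed (simp_all add: mult_closed_KG mult_assoc_KG one_KG)
qed (simp_all add: l_distr_KG r_distr_KG)

sublocale KG: ring KG by (rule ring_KG)

lemma uminus_KG: "f \<in> carrier KG \<Longrightarrow> (\<ominus>\<^bsub>KG\<^esub> f) x = \<ominus>\<^bsub>K\<^esub> f x"
proof -
  assume f: "f \<in> carrier KG"
  have "(\<ominus>\<^bsub>KG\<^esub> f) x \<oplus>\<^bsub>K\<^esub> f x = \<zero>\<^bsub>K\<^esub>" using KG.l_neg[OF f] by (simp add: zero_KG flip: add_KG)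
  then show ?thesis using f by (intro K.minus_equality [symmetric]) auto
qed

lemma delta_mult:
  assumes "\<alpha> \<in> carrier K" "\<beta> \<in> carrier K" "g \<in> carrier G" "h \<in> carrier G"
  shows "\<delta> \<alpha> g \<otimes>\<^bsub>KG\<^esub> \<delta> \<beta> h = \<delta> (\<alpha> \<otimes>\<^bsub>K\<^esub> \<beta>) (g \<otimes> h)"
proof (rule KG_eqI)
  fix x assume x: "x \<in> carrier G"
  have "inv g \<otimes> x = h \<longleftrightarrow> x = g \<otimes> h" using assms x by (auto simp flip: m_assoc)
  then show "(\<delta> \<alpha> g \<otimes>\<^bsub>KG\<^esub> \<delta> \<beta> h) x = \<delta> (\<alpha> \<otimes>\<^bsub>K\<^esub> \<beta>) (g \<otimes> h) x"
    using assms x by (simp add: delta_mult_left) (simp add: delta_def)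
qed (use assms in \<open>simp_all add: mult_closed_KG\<close>)

lemma delta_central:
  assumes "\<alpha> \<in> carrier K" "f \<in> carrier KG"
  shows "\<delta> \<alpha> \<one> \<otimes>\<^bsub>KG\<^esub> f = f \<otimes>\<^bsub>KG\<^esub> \<delta> \<alpha> \<one>"
  by (rule KG_eqI) (use assms in \<open>simp_all add: mult_closed_KG delta_mult_left delta_mult_right K.m_comm\<close>)

lemma star_closed [simp]: "f \<in> carrier KG \<Longrightarrow> star K G f \<in> carrier KG"
proof -
  assume f: "f \<in> carrier KG"
  show ?thesis
  proof (rule KG_memI[of _ "m_inv G ` supp K f"])
    fix x assume x: "x \<notin> m_inv G ` supp K f"
    have "f (inv x) = \<zero>\<^bsub>K\<^esub>" if "x \<in> carrier G"
      using x inv_inv[OF that] by (force simp: supp_def image_iff)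
    then show "star K G f x = \<zero>\<^bsub>K\<^esub>" by (simp add: star_def)
  qed (use f in \<open>auto simp: mem_KG star_def\<close>)
qed

lemma star_add: "star K G (f \<oplus>\<^bsub>KG\<^esub> h) = star K G f \<oplus>\<^bsub>KG\<^esub> star K G h"
  by (rule ext) (simp add: star_def add_KG)

lemma star_uminus: "f \<in> carrier KG \<Longrightarrow> star K G (\<ominus>\<^bsub>KG\<^esub> f) = \<ominus>\<^bsub>KG\<^esub> star K G f"
  by (rule ext) (simp add: uminus_KG, simp add: star_def uminus_KG)

lemma star_delta: "g \<in> carrier G \<Longrightarrow> star K G (\<delta> \<alpha> g) = \<delta> \<alpha> (inv g)"
  by (rule ext) (auto simp: star_def delta_def)

lemma star_mult:
  assumes f: "f \<in> carrier KG" and h: "h \<in> carrier KG"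
  shows "star K G (f \<otimes>\<^bsub>KG\<^esub> h) = star K G h \<otimes>\<^bsub>KG\<^esub> star K G f"
proof (rule KG_eqI)
  fix x assume x: "x \<in> carrier G"
  define A where "A = supp K f"
  \<comment> \<open>The substitution \<open>b = xa\<close> turns the product of the starred
    functions at \<open>x\<close> into that of \<open>f\<close> and \<open>h\<close> at
    \<open>x^-1\<close>; \<open>B\<close> is made large enough to contain its range.\<close>
  define B where "B = (\<otimes>) x ` A \<union> supp K (star K G h)"
  have A: "finite A" "A \<subseteq> carrier G" using f by (auto simp: A_def mem_KG)
  have B: "finite B" "supp K (star K G h) \<subseteq> B" "B \<subseteq> carrier G"
    using A x star_closed[OF h] by (auto simp: B_def mem_KG)
  have "(star K G h \<otimes>\<^bsub>KG\<^esub> star K G f) x = (\<Oplus>\<^bsub>K\<^esub>b\<in>B. star K G h b \<otimes>\<^bsub>K\<^esub> star K G f (inv b \<otimes> x))"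
    using f h x B by (intro mult_KG) auto
  also have "\<dots> = (\<Oplus>\<^bsub>K\<^esub>a\<in>A. star K G h (x \<otimes> a) \<otimes>\<^bsub>K\<^esub> star K G f (inv (x \<otimes> a) \<otimes> x))"
  proof (rule K.finsum_reindex_mono_neutral[OF B(1)])
    show "inj_on ((\<otimes>) x) A" by (rule inj_onI) (metis l_cancel x A(2) subsetD)
    show "(\<otimes>) x ` A \<subseteq> B" by (auto simp: B_def)
    fix b assume b: "b \<in> B" "b \<notin> (\<otimes>) x ` A"
    have bG: "b \<in> carrier G" using b B by auto
    then have "inv x \<otimes> b \<notin> A" using b(2) x image_eqI[of b "(\<otimes>) x" "inv x \<otimes> b" A] by (auto simp flip: m_assoc)
    then have "f (inv x \<otimes> b) = \<zero>\<^bsub>K\<^esub>" by (simp add: A_def supp_def)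
    then show "star K G h b \<otimes>\<^bsub>K\<^esub> star K G f (inv b \<otimes> x) = \<zero>\<^bsub>K\<^esub>"
      using x bG star_closed[OF h] by (simp add: star_def[of K G f] inv_mult_group)
  qed (use f h in auto)
  also have "\<dots> = (\<Oplus>\<^bsub>K\<^esub>a\<in>A. f a \<otimes>\<^bsub>K\<^esub> h (inv a \<otimes> inv x))"
    using A x f h by (intro K.finsum_cong') (auto simp: star_def inv_mult_group m_assoc subset_iff K.m_comm)
  also have "\<dots> = (f \<otimes>\<^bsub>KG\<^esub> h) (inv x)"
    using f h x A by (intro mult_KG [symmetric]) (auto simp: A_def)
  finally show "star K G (f \<otimes>\<^bsub>KG\<^esub> h) x = (star K G h \<otimes>\<^bsub>KG\<^esub> star K G f) x"
    using x by (simp add: star_def)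
qed (simp_all add: mult_closed_KG assms)

end

section \<open>Commuting symmetric units\<close>

context group_algebra
begin

lemma star_one: "star K G \<one>\<^bsub>KG\<^esub> = \<one>\<^bsub>KG\<^esub>"
  by (simp add: one_KG star_delta)

lemma star_Units:
  assumes f: "f \<in> Units KG" and s: "star K G f = f"
  shows "star K G (inv\<^bsub>KG\<^esub> f) = inv\<^bsub>KG\<^esub> f"
proof -
  have c: "f \<in> carrier KG" "inv\<^bsub>KG\<^esub> f \<in> carrier KG" using f by auto
  have "star K G (inv\<^bsub>KG\<^esub> f) \<otimes>\<^bsub>KG\<^esub> f = star K G (f \<otimes>\<^bsub>KG\<^esub> inv\<^bsub>KG\<^esub> f)"
    using star_mult[OF c] s by simp
  also have "\<dots> = \<one>\<^bsub>KG\<^esub>" using f by (simp add: star_one)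
  finally show ?thesis
    using KG.inv_unique[of "star K G (inv\<^bsub>KG\<^esub> f)" f "inv\<^bsub>KG\<^esub> f"] c f by simp
qed

text \<open>For symmetric \<open>f\<close> and \<open>h\<close> the involution takes
  \<open>fh\<close> to \<open>hf\<close>, so closure under products is commutativity. Inverses of
  symmetric units are always symmetric.\<close>

lemma symmetric_units_subgroup_iff_commute:
  "subgroup (symmetric_units K G) (units_of KG) \<longleftrightarrow>
    (\<forall>f\<in>symmetric_units K G. \<forall>h\<in>symmetric_units K G. f \<otimes>\<^bsub>KG\<^esub> h = h \<otimes>\<^bsub>KG\<^esub> f)"
proof
  assume sub: "subgroup (symmetric_units K G) (units_of KG)"
  show "\<forall>f\<in>symmetric_units K G. \<forall>h\<in>symmetric_units K G. f \<otimes>\<^bsub>KG\<^esub> h = h \<otimes>\<^bsub>KG\<^esub> f"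
  proof (intro ballI)
    fix f h assume fh: "f \<in> symmetric_units K G" "h \<in> symmetric_units K G"
    then have "f \<otimes>\<^bsub>KG\<^esub> h \<in> symmetric_units K G"
      using subgroup.m_closed[OF sub] by (simp add: units_of_mult)
    then have "f \<otimes>\<^bsub>KG\<^esub> h = star K G (f \<otimes>\<^bsub>KG\<^esub> h)" by (simp add: symmetric_units_def)
    also have "\<dots> = h \<otimes>\<^bsub>KG\<^esub> f" using fh by (simp add: symmetric_units_def star_mult KG.Units_closed)
    finally show "f \<otimes>\<^bsub>KG\<^esub> h = h \<otimes>\<^bsub>KG\<^esub> f" .
  qed
next
  assume com: "\<forall>f\<in>symmetric_units K G. \<forall>h\<in>symmetric_units K G. f \<otimes>\<^bsub>KG\<^esub> h = h \<otimes>\<^bsub>KG\<^esub> f"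
  show "subgroup (symmetric_units K G) (units_of KG)"
  proof (rule group.subgroupI[OF KG.units_group])
    show "symmetric_units K G \<subseteq> carrier (units_of KG)"
      by (auto simp: symmetric_units_def units_of_carrier)
    have "\<one>\<^bsub>KG\<^esub> \<in> symmetric_units K G" by (simp add: symmetric_units_def star_one)
    then show "symmetric_units K G \<noteq> {}" by blast
    fix f assume f: "f \<in> symmetric_units K G"
    then show "inv\<^bsub>units_of KG\<^esub> f \<in> symmetric_units K G"
      by (simp add: symmetric_units_def KG.units_of_inv star_Units)
    fix h assume h: "h \<in> symmetric_units K G"
    have "star K G (f \<otimes>\<^bsub>KG\<^esub> h) = h \<otimes>\<^bsub>KG\<^esub> f"
      using f h by (simp add: symmetric_units_def star_mult KG.Units_closed)
    also have "\<dots> = f \<otimes>\<^bsub>KG\<^esub> h" using com f h by simp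
    finally show "f \<otimes>\<^bsub>units_of KG\<^esub> h \<in> symmetric_units K G"
      using f h by (simp add: symmetric_units_def units_of_mult)
  qed
qed

definition sym_pair
  where "sym_pair \<alpha> g = \<delta> \<alpha> g \<oplus>\<^bsub>KG\<^esub> \<delta> \<alpha> (inv g)"

lemma sym_pair_closed [simp]: "\<alpha> \<in> carrier K \<Longrightarrow> g \<in> carrier G \<Longrightarrow> sym_pair \<alpha> g \<in> carrier KG"
  by (simp add: sym_pair_def)

lemma sym_pair_mult:
  assumes "\<alpha> \<in> carrier K" "\<beta> \<in> carrier K" "g \<in> carrier G" "h \<in> carrier G"
  shows "sym_pair \<alpha> g \<otimes>\<^bsub>KG\<^esub> sym_pair \<beta> h =
    (\<delta> (\<alpha> \<otimes>\<^bsub>K\<^esub> \<beta>) (g \<otimes> h) \<oplus>\<^bsub>KG\<^esub> \<delta> (\<alpha> \<otimes>\<^bsub>K\<^esub> \<beta>) (g \<otimes> inv h)) \<oplus>\<^bsub>KG\<^esub>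
    (\<delta> (\<alpha> \<otimes>\<^bsub>K\<^esub> \<beta>) (inv g \<otimes> h) \<oplus>\<^bsub>KG\<^esub> \<delta> (\<alpha> \<otimes>\<^bsub>K\<^esub> \<beta>) (inv g \<otimes> inv h))"
  using assms by (simp add: sym_pair_def KG.l_distr KG.r_distr delta_mult KG.a_ac)

lemma inv_eq_self_iff: "g \<in> carrier G \<Longrightarrow> inv g = g \<longleftrightarrow> g \<otimes> g = \<one>"
  by (metis inv_equality r_inv)

lemma symmetric_induct [consumes 2, case_names zero add involution pair]:
  assumes f: "f \<in> carrier KG" and s: "star K G f = f"
    and zero: "P \<zero>\<^bsub>KG\<^esub>"
    and add: "\<And>f h. f \<in> carrier KG \<Longrightarrow> h \<in> carrier KG \<Longrightarrow> P f \<Longrightarrow> P h \<Longrightarrow> P (f \<oplus>\<^bsub>KG\<^esub> h)"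
    and involution: "\<And>\<alpha> t. \<alpha> \<in> carrier K \<Longrightarrow> t \<in> carrier G \<Longrightarrow> t \<otimes> t = \<one> \<Longrightarrow> P (\<delta> \<alpha> t)"
    and pair: "\<And>\<alpha> g. \<alpha> \<in> carrier K \<Longrightarrow> g \<in> carrier G \<Longrightarrow> g \<otimes> g \<noteq> \<one> \<Longrightarrow> P (sym_pair \<alpha> g)"
  shows "P f"
  using f s
proof (induction "card (supp K f)" arbitrary: f rule: less_induct)
  case less
  have fin: "finite (supp K f)" "supp K f \<subseteq> carrier G" using less.prems by (auto simp: mem_KG)
  show ?case
  proof (cases "supp K f = {}")
    case True
    then have "f = \<zero>\<^bsub>KG\<^esub>" by (intro ext) (auto simp: supp_def zero_KG)
    then show ?thesis using zero by simp
  next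
    case False
    then obtain g where gs: "g \<in> supp K f" by blast
    then have g: "g \<in> carrier G" using fin by blast
    define \<alpha> where "\<alpha> = f g"
    have \<alpha>: "\<alpha> \<in> carrier K" using less.prems by (simp add: \<alpha>_def)
    have sy: "f (inv x) = f x" if "x \<in> carrier G" for x
      using fun_cong[OF less.prems(2), of x] that by (simp add: star_def)
    \<comment> \<open>Symmetry makes the coefficients at \<open>g\<close> and \<open>g^-1\<close>
      equal. Removing both keeps the rest symmetric and shrinks the support, whether or not they
      coincide.\<close>
    define f' where "f' = (\<lambda>x. if x = g \<or> x = inv g then \<zero>\<^bsub>K\<^esub> else f x)"
    have f': "f' \<in> carrier KG"
      by (rule KG_memI[of _ "supp K f"]) (use fin less.prems(1) in \<open>auto simp: f'_def supp_def simp del: coeff_closed intro: coeff_closed\<close>)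
    have "inv x = g \<longleftrightarrow> x = inv g" "inv x = inv g \<longleftrightarrow> x = g" if "x \<in> carrier G" for x
      using that g by (metis inv_inv)+
    then have "star K G f' x = f' x" for x
      using sy coeff_outside[OF less.prems(1)] by (auto simp: star_def f'_def)
    then have s': "star K G f' = f'" by blast
    have "supp K f' \<subseteq> supp K f - {g}" by (auto simp: supp_def f'_def)
    then have "card (supp K f') \<le> card (supp K f - {g})" using fin by (intro card_mono) auto
    also have "\<dots> < card (supp K f)" using fin gs by (intro psubset_card_mono) auto
    finally have P': "P f'" using less.hyps f' s' by blast
    define s where "s = (if g \<otimes> g = \<one> then \<delta> \<alpha> g else sym_pair \<alpha> g)"
    have "P s" "s \<in> carrier KG" using involution[OF \<alpha> g] pair[OF \<alpha> g] \<alpha> g by (auto simp: s_def)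
    moreover have "f = f' \<oplus>\<^bsub>KG\<^esub> s"
    proof (rule KG_eqI)
      fix x assume x: "x \<in> carrier G"
      have fx: "f x \<in> carrier K" using less.prems(1) by simp
      show "f x = (f' \<oplus>\<^bsub>KG\<^esub> s) x"
        unfolding add_KG f'_def s_def sym_pair_def delta_def
        using inv_eq_self_iff[OF g] sy[OF g] fx \<alpha> by (auto simp: add_KG \<alpha>_def)
    qed (use less.prems(1) f' calculation add_closed_KG in auto)
    ultimately show ?thesis using add[OF f' _ P'] by metis
  qed
qed

lemma commute_add:
  assumes "f \<in> carrier KG" "h \<in> carrier KG" "k \<in> carrier KG" "f \<otimes>\<^bsub>KG\<^esub> k = k \<otimes>\<^bsub>KG\<^esub> f" "h \<otimes>\<^bsub>KG\<^esub> k = k \<otimes>\<^bsub>KG\<^esub> h"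
  shows "(f \<oplus>\<^bsub>KG\<^esub> h) \<otimes>\<^bsub>KG\<^esub> k = k \<otimes>\<^bsub>KG\<^esub> (f \<oplus>\<^bsub>KG\<^esub> h)"
  using assms by (simp add: KG.l_distr KG.r_distr)

lemma delta_involution_commute:
  assumes cen: "\<And>h. h \<in> carrier G \<Longrightarrow> t \<otimes> h = h \<otimes> t" and t: "t \<in> carrier G" and \<alpha>: "\<alpha> \<in> carrier K" and f: "f \<in> carrier KG"
  shows "\<delta> \<alpha> t \<otimes>\<^bsub>KG\<^esub> f = f \<otimes>\<^bsub>KG\<^esub> \<delta> \<alpha> t"
proof (rule KG_eqI)
  fix x assume x: "x \<in> carrier G"
  have "x \<otimes> inv t = inv t \<otimes> (t \<otimes> x) \<otimes> inv t" using t x by simp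
  also have "\<dots> = inv t \<otimes> x" unfolding cen[OF x] using t x by (simp add: m_assoc)
  finally show "(\<delta> \<alpha> t \<otimes>\<^bsub>KG\<^esub> f) x = (f \<otimes>\<^bsub>KG\<^esub> \<delta> \<alpha> t) x"
    using t \<alpha> f x by (simp add: delta_mult_left delta_mult_right K.m_comm)
qed (use t \<alpha> f in \<open>simp_all add: mult_closed_KG\<close>)

text \<open>If \<open>g\<close> and \<open>h\<close> commute or \<open>h\<close> inverts
  \<open>g\<close>, both products have the same four terms up to order. In the last alternative
  \<open>gh = g^-1 h^-1\<close> and \<open>g h^-1 = g^-1 h\<close>, so the terms cancel in pairs in
  characteristic 2 and both products vanish.\<close>

lemma sym_pair_commute:
  assumes \<alpha>: "\<alpha> \<in> carrier K" and \<beta>: "\<beta> \<in> carrier K" and g: "g \<in> carrier G" and h: "h \<in> carrier G"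
    and c: "g \<otimes> h = h \<otimes> g \<or> g \<otimes> h \<otimes> g = h \<or>
      (\<one>\<^bsub>K\<^esub> \<oplus>\<^bsub>K\<^esub> \<one>\<^bsub>K\<^esub> = \<zero>\<^bsub>K\<^esub> \<and> g \<otimes> g = h \<otimes> h \<and> (g \<otimes> g) \<otimes> (g \<otimes> g) = \<one>)"
  shows "sym_pair \<alpha> g \<otimes>\<^bsub>KG\<^esub> sym_pair \<beta> h = sym_pair \<beta> h \<otimes>\<^bsub>KG\<^esub> sym_pair \<alpha> g"
proof -
  define \<gamma> where "\<gamma> = \<alpha> \<otimes>\<^bsub>K\<^esub> \<beta>"
  have \<gamma>: "\<gamma> \<in> carrier K" "\<alpha> \<otimes>\<^bsub>K\<^esub> \<beta> = \<gamma>" "\<beta> \<otimes>\<^bsub>K\<^esub> \<alpha> = \<gamma>" using \<alpha> \<beta> by (simp_all add: \<gamma>_def K.m_comm)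
  note e = sym_pair_mult[OF \<alpha> \<beta> g h] sym_pair_mult[OF \<beta> \<alpha> h g]
  have m: "inv g \<otimes> inv h = inv (h \<otimes> g)" "inv h \<otimes> inv g = inv (g \<otimes> h)"
      "inv g \<otimes> h = inv (inv h \<otimes> g)" "g \<otimes> inv h = inv (h \<otimes> inv g)"
    using g h by (simp_all add: inv_mult_group)
  have d: "\<delta> \<gamma> x \<in> carrier KG" if "x \<in> carrier G" for x using that \<gamma> by simp
  from c consider "g \<otimes> h = h \<otimes> g" | "g \<otimes> h \<otimes> g = h" |
    "\<one>\<^bsub>K\<^esub> \<oplus>\<^bsub>K\<^esub> \<one>\<^bsub>K\<^esub> = \<zero>\<^bsub>K\<^esub>" "g \<otimes> g = h \<otimes> h" "(g \<otimes> g) \<otimes> (g \<otimes> g) = \<one>" by blast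
  then show ?thesis
  proof cases
    case 1
    have "inv g \<otimes> (g \<otimes> h) \<otimes> inv g = inv g \<otimes> (h \<otimes> g) \<otimes> inv g" using 1 by simp
    then have "h \<otimes> inv g = inv g \<otimes> h" using g h by (simp add: m_assoc)
    moreover from this have "inv h \<otimes> g = g \<otimes> inv h" using m(3,4) g h by (metis inv_inv inv_mult_group inv_closed)
    ultimately show ?thesis unfolding e using 1 \<gamma> g h m d by (simp add: KG.a_ac)
  next
    case 2
    have 3: "g \<otimes> h = h \<otimes> inv g" using 2 g h by (metis inv_solve_right' m_closed)
    have "inv g \<otimes> (g \<otimes> h \<otimes> g) = inv g \<otimes> h" using 2 by simp
    then have 4: "inv g \<otimes> h = h \<otimes> g" using g h by (simp add: m_assoc)
    have 5: "inv h \<otimes> inv g = g \<otimes> inv h" "inv h \<otimes> g = inv g \<otimes> inv h" unfolding m(1,2,4) using 3 4 g h by (simp_all add: inv_mult_group flip: 4)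
    show ?thesis unfolding e 3 4 5 using \<gamma> g h d by (simp add: KG.a_ac)
  next
    case 3
    have dd: "\<delta> \<gamma> x \<oplus>\<^bsub>KG\<^esub> \<delta> \<gamma> x = \<zero>\<^bsub>KG\<^esub>" for x
    proof
      have "\<gamma> \<oplus>\<^bsub>K\<^esub> \<gamma> = (\<one>\<^bsub>K\<^esub> \<oplus>\<^bsub>K\<^esub> \<one>\<^bsub>K\<^esub>) \<otimes>\<^bsub>K\<^esub> \<gamma>" using \<gamma> by (subst K.l_distr) auto
      also have "\<dots> = \<zero>\<^bsub>K\<^esub>" using 3(1) \<gamma> by simp
      finally show "(\<delta> \<gamma> x \<oplus>\<^bsub>KG\<^esub> \<delta> \<gamma> x) y = \<zero>\<^bsub>KG\<^esub> y" for y
        by (simp add: add_KG zero_KG delta_def)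
    qed
    have key: "sym_pair \<beta>' b \<otimes>\<^bsub>KG\<^esub> sym_pair \<alpha>' a = \<zero>\<^bsub>KG\<^esub>"
      if "a \<in> carrier G" "b \<in> carrier G" "a \<otimes> a = b \<otimes> b" "(a \<otimes> a) \<otimes> (a \<otimes> a) = \<one>"
        "\<alpha>' \<in> carrier K" "\<beta>' \<in> carrier K" "\<beta>' \<otimes>\<^bsub>K\<^esub> \<alpha>' = \<gamma>" for a b \<alpha>' \<beta>'
    proof -
      have "inv b \<otimes> (b \<otimes> b) \<otimes> inv a = inv b \<otimes> (a \<otimes> a) \<otimes> inv a" using that by simp
      then have 1: "b \<otimes> inv a = inv b \<otimes> a" using that(1,2) by (simp add: m_assoc)
      have "inv b \<otimes> ((b \<otimes> b) \<otimes> (a \<otimes> a)) \<otimes> inv a = inv b \<otimes> inv a" using that by simp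
      then have 2: "b \<otimes> a = inv b \<otimes> inv a" using that(1,2) by (simp add: m_assoc)
      have "sym_pair \<beta>' b \<otimes>\<^bsub>KG\<^esub> sym_pair \<alpha>' a =
          (\<delta> \<gamma> (inv b \<otimes> inv a) \<oplus>\<^bsub>KG\<^esub> \<delta> \<gamma> (inv b \<otimes> inv a)) \<oplus>\<^bsub>KG\<^esub> (\<delta> \<gamma> (inv b \<otimes> a) \<oplus>\<^bsub>KG\<^esub> \<delta> \<gamma> (inv b \<otimes> a))"
        unfolding sym_pair_mult[OF that(6,5,2,1)] 1 2 that(7) using that d by (simp add: KG.a_ac)
      then show ?thesis by (simp add: dd)
    qed
    show ?thesis using key[of g h \<alpha> \<beta>] key[of h g \<beta> \<alpha>] 3 g h \<alpha> \<beta> \<gamma> by simp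
  qed
qed

lemma symmetric_commute:
  assumes cen: "\<And>t h. t \<in> carrier G \<Longrightarrow> h \<in> carrier G \<Longrightarrow> t \<otimes> t = \<one> \<Longrightarrow> t \<otimes> h = h \<otimes> t"
    and c: "\<And>g h. g \<in> carrier G \<Longrightarrow> h \<in> carrier G \<Longrightarrow> g \<otimes> h = h \<otimes> g \<or> g \<otimes> h \<otimes> g = h \<or> h \<otimes> g \<otimes> h = g \<or>
      (\<one>\<^bsub>K\<^esub> \<oplus>\<^bsub>K\<^esub> \<one>\<^bsub>K\<^esub> = \<zero>\<^bsub>K\<^esub> \<and> g \<otimes> g = h \<otimes> h \<and> (g \<otimes> g) \<otimes> (g \<otimes> g) = \<one>)"
    and f: "f \<in> carrier KG" "star K G f = f" and h: "h \<in> carrier KG" "star K G h = h"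
  shows "f \<otimes>\<^bsub>KG\<^esub> h = h \<otimes>\<^bsub>KG\<^esub> f"
  using f
proof (induction f rule: symmetric_induct)
  case zero then show ?case using h by simp
next
  case (add f k) then show ?case using h by (intro commute_add)
next
  case (involution \<alpha> t) then show ?case using cen h by (intro delta_involution_commute)
next
  case (pair \<alpha> g)
  have "h \<otimes>\<^bsub>KG\<^esub> sym_pair \<alpha> g = sym_pair \<alpha> g \<otimes>\<^bsub>KG\<^esub> h"
    using h
  proof (induction h rule: symmetric_induct)
    case zero then show ?case using pair by simp
  next
    case (add f k) then show ?case using pair by (intro commute_add) auto
  next
    case (involution \<beta> t) then show ?case using cen pair by (intro delta_involution_commute) auto
  next
    case (pair \<beta> k)
    note gk = \<open>g \<in> carrier G\<close> \<open>\<alpha> \<in> carrier K\<close> pair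
    show ?case
    proof (cases "k \<otimes> g \<otimes> k = g")
      case True then show ?thesis using gk by (intro sym_pair_commute) auto
    next
      case False then show ?thesis using gk c[of g k] by (intro sym_pair_commute [symmetric]) auto
    qed
  qed
  then show ?case by simp
qed

lemma delta_pow:
  assumes "\<alpha> \<in> carrier K" "g \<in> carrier G"
  shows "\<delta> \<alpha> g [^]\<^bsub>KG\<^esub> (n::nat) = \<delta> (\<alpha> [^]\<^bsub>K\<^esub> n) (g [^] n)"
  by (induction n) (use assms in \<open>simp_all add: delta_mult one_KG\<close>)

text \<open>The inverse is, up to a scalar, a finite geometric series.\<close>

lemma one_minus_delta_Units:
  assumes \<alpha>: "\<alpha> \<in> carrier K" and g: "g \<in> carrier G" and n: "g [^] (n::nat) = \<one>"
    and u: "\<one>\<^bsub>K\<^esub> \<ominus>\<^bsub>K\<^esub> \<alpha> [^]\<^bsub>K\<^esub> n \<in> Units K"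
  shows "\<one>\<^bsub>KG\<^esub> \<ominus>\<^bsub>KG\<^esub> \<delta> \<alpha> g \<in> Units KG"
proof -
  define x where "x = \<delta> \<alpha> g"
  have x: "x \<in> carrier KG" using \<alpha> g by (simp add: x_def)
  define a where "a = \<one>\<^bsub>KG\<^esub> \<ominus>\<^bsub>KG\<^esub> x"
  have a: "a \<in> carrier KG" using x by (simp add: a_def)
  have "\<exists>y\<in>carrier KG. a \<otimes>\<^bsub>KG\<^esub> y = \<one>\<^bsub>KG\<^esub> \<ominus>\<^bsub>KG\<^esub> x [^]\<^bsub>KG\<^esub> m \<and> y \<otimes>\<^bsub>KG\<^esub> a = \<one>\<^bsub>KG\<^esub> \<ominus>\<^bsub>KG\<^esub> x [^]\<^bsub>KG\<^esub> m" for m :: nat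
  proof (induction m)
    case 0
    show ?case by (rule bexI[of _ "\<zero>\<^bsub>KG\<^esub>"]) (use a in \<open>simp_all add: KG.minus_eq KG.r_neg\<close>)
  next
    case (Suc m)
    then obtain y where y: "y \<in> carrier KG" "a \<otimes>\<^bsub>KG\<^esub> y = \<one>\<^bsub>KG\<^esub> \<ominus>\<^bsub>KG\<^esub> x [^]\<^bsub>KG\<^esub> m" "y \<otimes>\<^bsub>KG\<^esub> a = \<one>\<^bsub>KG\<^esub> \<ominus>\<^bsub>KG\<^esub> x [^]\<^bsub>KG\<^esub> m" by blast
    define p where "p = x [^]\<^bsub>KG\<^esub> m"
    have p: "p \<in> carrier KG" using x by (simp add: p_def)
    have xp: "x \<otimes>\<^bsub>KG\<^esub> p = x [^]\<^bsub>KG\<^esub> Suc m" "p \<otimes>\<^bsub>KG\<^esub> x = x [^]\<^bsub>KG\<^esub> Suc m" using KG.nat_pow_Suc2[OF x, of m] by (simp_all add: p_def)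
    define q where "q = x [^]\<^bsub>KG\<^esub> Suc m"
    have q: "q \<in> carrier KG" using x by (simp add: q_def)
    have ap: "a \<otimes>\<^bsub>KG\<^esub> p = p \<ominus>\<^bsub>KG\<^esub> q" "p \<otimes>\<^bsub>KG\<^esub> a = p \<ominus>\<^bsub>KG\<^esub> q"
      using x p xp by (simp_all add: a_def q_def KG.minus_eq KG.l_distr KG.r_distr KG.l_minus KG.r_minus)
    have t: "(\<one>\<^bsub>KG\<^esub> \<ominus>\<^bsub>KG\<^esub> p) \<oplus>\<^bsub>KG\<^esub> (p \<ominus>\<^bsub>KG\<^esub> q) = \<one>\<^bsub>KG\<^esub> \<ominus>\<^bsub>KG\<^esub> q"
      using p q by (simp add: KG.minus_eq KG.a_assoc KG.r_neg2 KG.r_neg1)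
    have "a \<otimes>\<^bsub>KG\<^esub> (y \<oplus>\<^bsub>KG\<^esub> p) = \<one>\<^bsub>KG\<^esub> \<ominus>\<^bsub>KG\<^esub> q" "(y \<oplus>\<^bsub>KG\<^esub> p) \<otimes>\<^bsub>KG\<^esub> a = \<one>\<^bsub>KG\<^esub> \<ominus>\<^bsub>KG\<^esub> q"
      using a y p ap t by (simp_all add: KG.r_distr KG.l_distr p_def)
    then show ?case using y(1) p unfolding q_def by (intro bexI[of _ "y \<oplus>\<^bsub>KG\<^esub> p"]) auto
  qed
  then obtain y where y: "y \<in> carrier KG" "a \<otimes>\<^bsub>KG\<^esub> y = \<one>\<^bsub>KG\<^esub> \<ominus>\<^bsub>KG\<^esub> x [^]\<^bsub>KG\<^esub> n" "y \<otimes>\<^bsub>KG\<^esub> a = \<one>\<^bsub>KG\<^esub> \<ominus>\<^bsub>KG\<^esub> x [^]\<^bsub>KG\<^esub> n" by blast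
  define u where "u = \<one>\<^bsub>K\<^esub> \<ominus>\<^bsub>K\<^esub> \<alpha> [^]\<^bsub>K\<^esub> n"
  have uU: "u \<in> Units K" "u \<in> carrier K" using u by (auto simp: u_def)
  define v where "v = \<delta> (inv\<^bsub>K\<^esub> u) \<one>"
  have v: "v \<in> carrier KG" using uU by (simp add: v_def)
  have "\<one>\<^bsub>KG\<^esub> \<ominus>\<^bsub>KG\<^esub> x [^]\<^bsub>KG\<^esub> n = \<delta> u \<one>"
  proof (rule ext)
    fix z
    have "\<delta> (\<alpha> [^]\<^bsub>K\<^esub> n) \<one> \<in> carrier KG" using \<alpha> by simp
    then show "(\<one>\<^bsub>KG\<^esub> \<ominus>\<^bsub>KG\<^esub> x [^]\<^bsub>KG\<^esub> n) z = \<delta> u \<one> z"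
      using \<alpha> by (simp add: x_def delta_pow[OF \<alpha> g] n KG.minus_eq add_KG uminus_KG one_KG) (simp add: delta_def u_def K.minus_eq)
  qed
  then have "v \<otimes>\<^bsub>KG\<^esub> (a \<otimes>\<^bsub>KG\<^esub> y) = \<one>\<^bsub>KG\<^esub>" "v \<otimes>\<^bsub>KG\<^esub> (y \<otimes>\<^bsub>KG\<^esub> a) = \<one>\<^bsub>KG\<^esub>"
    using y uU by (simp_all add: v_def delta_mult one_KG)
  moreover have "v \<otimes>\<^bsub>KG\<^esub> a = a \<otimes>\<^bsub>KG\<^esub> v"
    using delta_central[of "inv\<^bsub>K\<^esub> u" a] a uU by (simp add: v_def)
  then have "v \<otimes>\<^bsub>KG\<^esub> (a \<otimes>\<^bsub>KG\<^esub> y) = a \<otimes>\<^bsub>KG\<^esub> (v \<otimes>\<^bsub>KG\<^esub> y)"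
    using KG.m_assoc[OF v a y(1)] KG.m_assoc[OF a v y(1)] by simp
  ultimately have "a \<otimes>\<^bsub>KG\<^esub> (v \<otimes>\<^bsub>KG\<^esub> y) = \<one>\<^bsub>KG\<^esub>" "(v \<otimes>\<^bsub>KG\<^esub> y) \<otimes>\<^bsub>KG\<^esub> a = \<one>\<^bsub>KG\<^esub>"
    using a y v by (simp_all add: KG.m_assoc)
  then show ?thesis using a y v unfolding Units_def a_def x_def by blast
qed

lemma involution_symmetric_unit:
  assumes "t \<in> carrier G" "t \<otimes> t = \<one>"
  shows "\<delta> \<one>\<^bsub>K\<^esub> t \<in> symmetric_units K G"
proof -
  have "\<delta> \<one>\<^bsub>K\<^esub> t \<otimes>\<^bsub>KG\<^esub> \<delta> \<one>\<^bsub>K\<^esub> t = \<one>\<^bsub>KG\<^esub>" using assms by (simp add: delta_mult one_KG)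
  moreover have "\<delta> \<one>\<^bsub>K\<^esub> t \<in> carrier KG" using assms by simp
  ultimately have "\<delta> \<one>\<^bsub>K\<^esub> t \<in> Units KG" unfolding Units_def by blast
  moreover have "inv t = t" using inv_eq_self_iff assms by blast
  ultimately show ?thesis using assms by (simp add: symmetric_units_def star_delta)
qed

text \<open>The symmetric unit is \<open>(1 - \<alpha> g) (1 - \<alpha> g\<^sup>-\<^sup>1) = (1 + \<alpha>\<^sup>2) - \<alpha> (g + g\<^sup>-\<^sup>1)\<close>, whose first summand is central.\<close>

lemma symmetric_unit_sym_pair:
  assumes \<alpha>: "\<alpha> \<in> carrier K" and g: "g \<in> carrier G" and n: "g [^] (n::nat) = \<one>"
    and u: "\<one>\<^bsub>K\<^esub> \<ominus>\<^bsub>K\<^esub> \<alpha> [^]\<^bsub>K\<^esub> n \<in> Units K"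
  obtains w where "w \<in> symmetric_units K G"
    "\<And>f. f \<in> carrier KG \<Longrightarrow> w \<otimes>\<^bsub>KG\<^esub> f = f \<otimes>\<^bsub>KG\<^esub> w \<Longrightarrow> sym_pair \<alpha> g \<otimes>\<^bsub>KG\<^esub> f = f \<otimes>\<^bsub>KG\<^esub> sym_pair \<alpha> g"
proof -
  define x where "x = \<delta> \<alpha> g"
  define x' where "x' = \<delta> \<alpha> (inv g)"
  define d where "d = \<delta> (\<alpha> \<otimes>\<^bsub>K\<^esub> \<alpha>) \<one>"
  define w where "w = (\<one>\<^bsub>KG\<^esub> \<ominus>\<^bsub>KG\<^esub> x) \<otimes>\<^bsub>KG\<^esub> (\<one>\<^bsub>KG\<^esub> \<ominus>\<^bsub>KG\<^esub> x')"
  have x: "x \<in> carrier KG" "x' \<in> carrier KG" "d \<in> carrier KG" "x \<otimes>\<^bsub>KG\<^esub> x' = d"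
    using \<alpha> g by (simp_all add: x_def x'_def d_def delta_mult)
  have n': "inv g [^] n = \<one>" using n g by (simp add: nat_pow_inv)
  have U: "\<one>\<^bsub>KG\<^esub> \<ominus>\<^bsub>KG\<^esub> x \<in> Units KG" "\<one>\<^bsub>KG\<^esub> \<ominus>\<^bsub>KG\<^esub> x' \<in> Units KG"
    using one_minus_delta_Units[OF \<alpha> g n u] one_minus_delta_Units[OF \<alpha> inv_closed[OF g] n' u]
    by (simp_all add: x_def x'_def)
  then have wU: "w \<in> Units KG" by (simp add: w_def)
  have wc: "w \<in> carrier KG" using wU by auto
  have "star K G (\<one>\<^bsub>KG\<^esub> \<ominus>\<^bsub>KG\<^esub> x) = \<one>\<^bsub>KG\<^esub> \<ominus>\<^bsub>KG\<^esub> x'" "star K G (\<one>\<^bsub>KG\<^esub> \<ominus>\<^bsub>KG\<^esub> x') = \<one>\<^bsub>KG\<^esub> \<ominus>\<^bsub>KG\<^esub> x"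
    using x g by (simp_all add: KG.minus_eq star_add star_uminus star_one, simp_all add: x_def x'_def star_delta)
  then have "star K G w = w" using x by (simp add: w_def star_mult)
  then have ws: "w \<in> symmetric_units K G" using wU by (simp add: symmetric_units_def)
  define c where "c = \<one>\<^bsub>KG\<^esub> \<oplus>\<^bsub>KG\<^esub> d"
  have c: "c \<in> carrier KG" using x by (simp add: c_def)
  have sp: "sym_pair \<alpha> g = x \<oplus>\<^bsub>KG\<^esub> x'" by (simp add: sym_pair_def x_def x'_def)
  have "w = c \<ominus>\<^bsub>KG\<^esub> (x \<oplus>\<^bsub>KG\<^esub> x')"
    using x by (simp add: w_def c_def KG.minus_eq KG.l_distr KG.r_distr KG.l_minus KG.r_minus KG.minus_add KG.a_ac)
  then have s: "sym_pair \<alpha> g = c \<oplus>\<^bsub>KG\<^esub> (\<ominus>\<^bsub>KG\<^esub> w)"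
    unfolding sp using x c by (simp add: KG.minus_eq KG.minus_add KG.r_neg2)
  show thesis
  proof (rule that[OF ws])
    fix f assume f: "f \<in> carrier KG" "w \<otimes>\<^bsub>KG\<^esub> f = f \<otimes>\<^bsub>KG\<^esub> w"
    show "sym_pair \<alpha> g \<otimes>\<^bsub>KG\<^esub> f = f \<otimes>\<^bsub>KG\<^esub> sym_pair \<alpha> g"
      unfolding s c_def
    proof (intro commute_add)
      show "d \<otimes>\<^bsub>KG\<^esub> f = f \<otimes>\<^bsub>KG\<^esub> d" using delta_central \<alpha> f by (simp add: d_def)
      show "(\<ominus>\<^bsub>KG\<^esub> w) \<otimes>\<^bsub>KG\<^esub> f = f \<otimes>\<^bsub>KG\<^esub> (\<ominus>\<^bsub>KG\<^esub> w)" using f wc by (simp add: KG.l_minus KG.r_minus)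
    qed (use f x wc in simp_all)
  qed
qed

text \<open>A unit \<open>w\<close> enters only through the fact that whatever commutes with it
  commutes with \<open>sym_pair \<alpha> g\<close>. Used once for each factor, this makes symmetric
  pairs commute, with nonzero coefficients that may differ for \<open>g\<close> and
  \<open>h\<close>.\<close>

lemma commuting_symmetric_units:
  assumes com: "\<And>f h. f \<in> symmetric_units K G \<Longrightarrow> h \<in> symmetric_units K G \<Longrightarrow> f \<otimes>\<^bsub>KG\<^esub> h = h \<otimes>\<^bsub>KG\<^esub> f"
    and fav: "\<And>g. g \<in> carrier G \<Longrightarrow> \<exists>n::nat. g [^] n = \<one> \<and>
      (\<exists>\<alpha>\<in>carrier K. \<alpha> \<noteq> \<zero>\<^bsub>K\<^esub> \<and> \<one>\<^bsub>K\<^esub> \<ominus>\<^bsub>K\<^esub> \<alpha> [^]\<^bsub>K\<^esub> n \<in> Units K)"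
  shows involutions_central: "\<lbrakk>t \<in> carrier G; h \<in> carrier G; t \<otimes> t = \<one>\<rbrakk> \<Longrightarrow> t \<otimes> h = h \<otimes> t"
    and commuting_trichotomy: "\<lbrakk>g \<in> carrier G; h \<in> carrier G\<rbrakk> \<Longrightarrow> g \<otimes> h = h \<otimes> g \<or> g \<otimes> h \<otimes> g = h \<or> h \<otimes> g \<otimes> h = g \<or>
      (\<one>\<^bsub>K\<^esub> \<oplus>\<^bsub>K\<^esub> \<one>\<^bsub>K\<^esub> = \<zero>\<^bsub>K\<^esub> \<and> g \<otimes> g = h \<otimes> h \<and> (g \<otimes> g) \<otimes> (g \<otimes> g) = \<one>)"
proof -
  have pairE: "\<exists>\<alpha> w. \<alpha> \<in> carrier K \<and> \<alpha> \<noteq> \<zero>\<^bsub>K\<^esub> \<and> w \<in> symmetric_units K G \<and>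
      (\<forall>f\<in>carrier KG. w \<otimes>\<^bsub>KG\<^esub> f = f \<otimes>\<^bsub>KG\<^esub> w \<longrightarrow> sym_pair \<alpha> g \<otimes>\<^bsub>KG\<^esub> f = f \<otimes>\<^bsub>KG\<^esub> sym_pair \<alpha> g)"
    if g: "g \<in> carrier G" for g
  proof -
    obtain n :: nat and \<alpha> where n: "g [^] n = \<one>" "\<alpha> \<in> carrier K" "\<alpha> \<noteq> \<zero>\<^bsub>K\<^esub>" "\<one>\<^bsub>K\<^esub> \<ominus>\<^bsub>K\<^esub> \<alpha> [^]\<^bsub>K\<^esub> n \<in> Units K"
      using fav[OF g] by blast
    obtain w where "w \<in> symmetric_units K G"
      "\<And>f. f \<in> carrier KG \<Longrightarrow> w \<otimes>\<^bsub>KG\<^esub> f = f \<otimes>\<^bsub>KG\<^esub> w \<Longrightarrow> sym_pair \<alpha> g \<otimes>\<^bsub>KG\<^esub> f = f \<otimes>\<^bsub>KG\<^esub> sym_pair \<alpha> g"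
      by (rule symmetric_unit_sym_pair[OF n(2) g n(1,4)]) (rule that)
    then show ?thesis using n by blast
  qed
  have SU: "f \<in> carrier KG" if "f \<in> symmetric_units K G" for f
    using that by (auto simp: symmetric_units_def)
  have invol: "s \<otimes> t = t \<otimes> s" if st: "s \<in> carrier G" "s \<otimes> s = \<one>" "t \<in> carrier G" "t \<otimes> t = \<one>" for s t
  proof -
    have "\<delta> \<one>\<^bsub>K\<^esub> s \<otimes>\<^bsub>KG\<^esub> \<delta> \<one>\<^bsub>K\<^esub> t = \<delta> \<one>\<^bsub>K\<^esub> t \<otimes>\<^bsub>KG\<^esub> \<delta> \<one>\<^bsub>K\<^esub> s"
      using st by (intro com involution_symmetric_unit)
    then have "\<delta> \<one>\<^bsub>K\<^esub> (s \<otimes> t) (s \<otimes> t) = \<delta> \<one>\<^bsub>K\<^esub> (t \<otimes> s) (s \<otimes> t)" using st by (simp add: delta_mult)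
    then show ?thesis by (simp add: delta_def split: if_splits)
  qed
  show cen: "t \<otimes> g = g \<otimes> t" if t: "t \<in> carrier G" "t \<otimes> t = \<one>" and g: "g \<in> carrier G" for t g
  proof (cases "g \<otimes> g = \<one>")
    case True then show ?thesis using invol t g by blast
  next
    case False
    then have ng: "inv g \<noteq> g" using inv_eq_self_iff[OF g] by simp
    obtain \<alpha> w where w: "\<alpha> \<in> carrier K" "\<alpha> \<noteq> \<zero>\<^bsub>K\<^esub>" "w \<in> symmetric_units K G"
      "\<And>f. f \<in> carrier KG \<Longrightarrow> w \<otimes>\<^bsub>KG\<^esub> f = f \<otimes>\<^bsub>KG\<^esub> w \<Longrightarrow> sym_pair \<alpha> g \<otimes>\<^bsub>KG\<^esub> f = f \<otimes>\<^bsub>KG\<^esub> sym_pair \<alpha> g"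
      using pairE[OF g] by blast
    have "w \<otimes>\<^bsub>KG\<^esub> \<delta> \<one>\<^bsub>K\<^esub> t = \<delta> \<one>\<^bsub>K\<^esub> t \<otimes>\<^bsub>KG\<^esub> w" using w t by (intro com involution_symmetric_unit)
    then have "sym_pair \<alpha> g \<otimes>\<^bsub>KG\<^esub> \<delta> \<one>\<^bsub>K\<^esub> t = \<delta> \<one>\<^bsub>K\<^esub> t \<otimes>\<^bsub>KG\<^esub> sym_pair \<alpha> g" using w(4) t by simp
    then have "\<delta> \<alpha> (g \<otimes> t) \<oplus>\<^bsub>KG\<^esub> \<delta> \<alpha> (inv g \<otimes> t) = \<delta> \<alpha> (t \<otimes> g) \<oplus>\<^bsub>KG\<^esub> \<delta> \<alpha> (t \<otimes> inv g)"
      using w(1) t g by (simp add: sym_pair_def KG.l_distr KG.r_distr delta_mult)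
    then have eq: "(\<delta> \<alpha> (g \<otimes> t) \<oplus>\<^bsub>KG\<^esub> \<delta> \<alpha> (inv g \<otimes> t)) (t \<otimes> g) = (\<delta> \<alpha> (t \<otimes> g) \<oplus>\<^bsub>KG\<^esub> \<delta> \<alpha> (t \<otimes> inv g)) (t \<otimes> g)"
      by simp
    have "t \<otimes> g \<noteq> t \<otimes> inv g"
    proof
      assume "t \<otimes> g = t \<otimes> inv g"
      then have "g = inv g" by (rule l_cancel) (use t g in auto)
      then show False using ng by simp
    qed
    then have "t \<otimes> g = g \<otimes> t \<or> t \<otimes> g = inv g \<otimes> t"
      using eq w(1,2) unfolding add_KG by (auto simp: delta_def split: if_splits)
    then show ?thesis
    proof
      \<comment> \<open>Then \<open>tg\<close> is an involution, and involutions are already known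
        to commute with each other.\<close>
      assume e: "t \<otimes> g = inv g \<otimes> t"
      have "(t \<otimes> g) \<otimes> (t \<otimes> g) = t \<otimes> (g \<otimes> (t \<otimes> g))" using t g by (simp add: m_assoc)
      also have "\<dots> = \<one>" unfolding e using t g by simp
      finally have "t \<otimes> (t \<otimes> g) = (t \<otimes> g) \<otimes> t" using t g by (intro invol) auto
      also have "\<dots> = t \<otimes> (g \<otimes> t)" using t g by (simp add: m_assoc)
      finally show ?thesis by (rule l_cancel) (use t g in auto)
    qed
  qed
  have sq: "a \<otimes> a \<noteq> \<one>" if "a \<in> carrier G" "b \<in> carrier G" "a \<otimes> b \<noteq> b \<otimes> a" for a b
    using cen that by blast
  \<comment> \<open>The coefficient of \<open>gh\<close> in one order contains
    \<open>\<gamma>\<close>. In the other order no term hits \<open>gh\<close>, unless one of the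
    first two alternatives holds or \<open>gh\<close> is an involution and so central. Thus
    \<open>\<gamma>\<close> must be cancelled by a second one, which can only come from
    \<open>g^-1 h^-1\<close>; this forces characteristic 2.\<close>
  have weak: "g \<otimes> h \<otimes> g = h \<or> h \<otimes> g \<otimes> h = g \<or> (\<one>\<^bsub>K\<^esub> \<oplus>\<^bsub>K\<^esub> \<one>\<^bsub>K\<^esub> = \<zero>\<^bsub>K\<^esub> \<and> (g \<otimes> g) \<otimes> (h \<otimes> h) = \<one>)"
    if g: "g \<in> carrier G" and h: "h \<in> carrier G" and ne: "g \<otimes> h \<noteq> h \<otimes> g" for g h
  proof (rule ccontr)
    assume no: "\<not> ?thesis"
    have ng: "inv g \<noteq> g" "inv h \<noteq> h" using sq[OF g h ne] sq[OF h g ne[symmetric]] inv_eq_self_iff g h by blast+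
    obtain \<alpha> w where w: "\<alpha> \<in> carrier K" "\<alpha> \<noteq> \<zero>\<^bsub>K\<^esub>" "w \<in> symmetric_units K G"
      "\<And>f. f \<in> carrier KG \<Longrightarrow> w \<otimes>\<^bsub>KG\<^esub> f = f \<otimes>\<^bsub>KG\<^esub> w \<Longrightarrow> sym_pair \<alpha> g \<otimes>\<^bsub>KG\<^esub> f = f \<otimes>\<^bsub>KG\<^esub> sym_pair \<alpha> g"
      using pairE[OF g] by blast
    obtain \<beta> v where v: "\<beta> \<in> carrier K" "\<beta> \<noteq> \<zero>\<^bsub>K\<^esub>" "v \<in> symmetric_units K G"
      "\<And>f. f \<in> carrier KG \<Longrightarrow> v \<otimes>\<^bsub>KG\<^esub> f = f \<otimes>\<^bsub>KG\<^esub> v \<Longrightarrow> sym_pair \<beta> h \<otimes>\<^bsub>KG\<^esub> f = f \<otimes>\<^bsub>KG\<^esub> sym_pair \<beta> h"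
      using pairE[OF h] by blast
    have "sym_pair \<alpha> g \<otimes>\<^bsub>KG\<^esub> v = v \<otimes>\<^bsub>KG\<^esub> sym_pair \<alpha> g" by (rule w(4)[OF SU[OF v(3)] com[OF w(3) v(3)]])
    then have c: "sym_pair \<beta> h \<otimes>\<^bsub>KG\<^esub> sym_pair \<alpha> g = sym_pair \<alpha> g \<otimes>\<^bsub>KG\<^esub> sym_pair \<beta> h"
      using v(4)[of "sym_pair \<alpha> g"] w(1) g by simp
    define \<gamma> where "\<gamma> = \<alpha> \<otimes>\<^bsub>K\<^esub> \<beta>"
    have \<gamma>: "\<gamma> \<in> carrier K" "\<gamma> \<noteq> \<zero>\<^bsub>K\<^esub>" "\<alpha> \<otimes>\<^bsub>K\<^esub> \<beta> = \<gamma>" "\<beta> \<otimes>\<^bsub>K\<^esub> \<alpha> = \<gamma>"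
      using w(1,2) v(1,2) K.integral_iff by (simp_all add: \<gamma>_def K.m_comm)
    have n1: "g \<otimes> h \<noteq> g \<otimes> inv h"
    proof
      assume "g \<otimes> h = g \<otimes> inv h"
      then have "h = inv h" by (rule l_cancel) (use g h in auto)
      then show False using ng by simp
    qed
    have n2: "g \<otimes> h \<noteq> inv g \<otimes> h"
    proof
      assume "g \<otimes> h = inv g \<otimes> h"
      then have "g = inv g" by (rule r_cancel) (use g h in auto)
      then show False using ng by simp
    qed
    have n3: "g \<otimes> h \<noteq> h \<otimes> inv g"
    proof
      assume "g \<otimes> h = h \<otimes> inv g"
      then have "g \<otimes> h \<otimes> g = h" using g h by (simp add: m_assoc)
      then show False using no by simp
    qed
    have n4: "g \<otimes> h \<noteq> inv h \<otimes> g"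
    proof
      assume "g \<otimes> h = inv h \<otimes> g"
      then have "h \<otimes> (g \<otimes> h) = g" using g h by simp
      then show False using no g h by (simp add: m_assoc)
    qed
    have n5: "g \<otimes> h \<noteq> inv h \<otimes> inv g"
    proof
      assume "g \<otimes> h = inv h \<otimes> inv g"
      then have "inv (g \<otimes> h) = g \<otimes> h" using g h by (simp add: inv_mult_group)
      then have "(g \<otimes> h) \<otimes> (g \<otimes> h) = \<one>" using inv_eq_self_iff g h by blast
      then have "(g \<otimes> h) \<otimes> g = g \<otimes> (g \<otimes> h)" using g h by (intro cen) auto
      then have "g \<otimes> (h \<otimes> g) = g \<otimes> (g \<otimes> h)" using g h by (simp add: m_assoc)
      then have "h \<otimes> g = g \<otimes> h" by (rule l_cancel) (use g h in auto)
      then show False using ne by simp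
    qed
    have "(sym_pair \<beta> h \<otimes>\<^bsub>KG\<^esub> sym_pair \<alpha> g) (g \<otimes> h) = \<zero>\<^bsub>K\<^esub>"
      unfolding sym_pair_mult[OF v(1) w(1) h g] \<gamma>(4) add_KG using n3 n4 n5 ne by (simp add: delta_def)
    moreover have "(sym_pair \<alpha> g \<otimes>\<^bsub>KG\<^esub> sym_pair \<beta> h) (g \<otimes> h) = \<gamma> \<oplus>\<^bsub>K\<^esub> \<delta> \<gamma> (inv g \<otimes> inv h) (g \<otimes> h)"
      unfolding sym_pair_mult[OF w(1) v(1) g h] \<gamma>(3) add_KG using n1 n2 \<gamma>(1) by (simp add: delta_def)
    ultimately have z: "\<gamma> \<oplus>\<^bsub>K\<^esub> \<delta> \<gamma> (inv g \<otimes> inv h) (g \<otimes> h) = \<zero>\<^bsub>K\<^esub>" using c by simp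
    then have e: "g \<otimes> h = inv g \<otimes> inv h" and "\<gamma> \<oplus>\<^bsub>K\<^esub> \<gamma> = \<zero>\<^bsub>K\<^esub>"
      using \<gamma>(1,2) by (auto simp: delta_def split: if_splits)
    then have "\<gamma> \<otimes>\<^bsub>K\<^esub> (\<one>\<^bsub>K\<^esub> \<oplus>\<^bsub>K\<^esub> \<one>\<^bsub>K\<^esub>) = \<zero>\<^bsub>K\<^esub>" using \<gamma>(1) by (simp add: K.r_distr)
    then have "\<one>\<^bsub>K\<^esub> \<oplus>\<^bsub>K\<^esub> \<one>\<^bsub>K\<^esub> = \<zero>\<^bsub>K\<^esub>" using \<gamma>(1,2) K.integral_iff by simp
    moreover have "g \<otimes> (g \<otimes> h) \<otimes> h = \<one>" unfolding e using g h by (simp add: m_assoc)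
    ultimately show False using no g h by (simp add: m_assoc)
  qed
  show "g \<otimes> h = h \<otimes> g \<or> g \<otimes> h \<otimes> g = h \<or> h \<otimes> g \<otimes> h = g \<or>
      (\<one>\<^bsub>K\<^esub> \<oplus>\<^bsub>K\<^esub> \<one>\<^bsub>K\<^esub> = \<zero>\<^bsub>K\<^esub> \<and> g \<otimes> g = h \<otimes> h \<and> (g \<otimes> g) \<otimes> (g \<otimes> g) = \<one>)"
    if g: "g \<in> carrier G" and h: "h \<in> carrier G" for g h
  proof (rule ccontr)
    assume no: "\<not> ?thesis"
    then have ne: "g \<otimes> h \<noteq> h \<otimes> g" by blast
    have 1: "\<one>\<^bsub>K\<^esub> \<oplus>\<^bsub>K\<^esub> \<one>\<^bsub>K\<^esub> = \<zero>\<^bsub>K\<^esub>" "(g \<otimes> g) \<otimes> (h \<otimes> h) = \<one>" using weak[OF g h ne] no by blast+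
    have ne': "g \<otimes> inv h \<noteq> inv h \<otimes> g"
    proof
      assume "g \<otimes> inv h = inv h \<otimes> g"
      then have "h \<otimes> (g \<otimes> inv h) \<otimes> h = h \<otimes> (inv h \<otimes> g) \<otimes> h" by simp
      then show False using ne g h by (simp add: m_assoc)
    qed
    \<comment> \<open>\<open>weak\<close> alone gives \<open>g^2 h^2 = 1\<close>. Applied to
      \<open>g\<close> and \<open>h^-1\<close> as well, it gives \<open>g^2 = h^2\<close>, and
      together these give \<open>g^4 = 1\<close>.\<close>
    have "(g \<otimes> g) \<otimes> (inv h \<otimes> inv h) = \<one>"
      using weak[OF g inv_closed[OF h] ne']
    proof (elim disjE conjE)
      assume "g \<otimes> inv h \<otimes> g = inv h"
      then have "inv (g \<otimes> inv h \<otimes> g) = h" using h by simp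
      then have "inv g \<otimes> h \<otimes> inv g = h" using g h by (simp add: inv_mult_group m_assoc)
      then have "g \<otimes> (inv g \<otimes> h \<otimes> inv g) \<otimes> g = g \<otimes> h \<otimes> g" by simp
      then show ?thesis using no g h by (simp add: m_assoc)
    next
      assume "inv h \<otimes> g \<otimes> inv h = g"
      then have "h \<otimes> (inv h \<otimes> g \<otimes> inv h) \<otimes> h = h \<otimes> g \<otimes> h" by simp
      then show ?thesis using no g h by (simp add: m_assoc)
    qed
    then have 2: "(g \<otimes> g) \<otimes> (inv h \<otimes> inv h) \<otimes> (h \<otimes> h) = h \<otimes> h" using h by simp
    then have 3: "g \<otimes> g = h \<otimes> h" using g h by (simp add: m_assoc)
    show False using no 1 3 by simp
  qed
qed

end

section \<open>From the group ring to the classification\<close>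

lemma (in domain) ring_characteristic_eq_2_iff: "ring_characteristic R = 2 \<longleftrightarrow> \<one> \<oplus> \<one> = \<zero>"
proof -
  have "\<one> [^]\<^bsub>add_monoid R\<^esub> (2::nat) = \<one> \<oplus> \<one>"
    by (simp add: numeral_2_eq_2 nat_pow_def)
  then have "\<one> \<oplus> \<one> = \<zero> \<longleftrightarrow> ring_characteristic R dvd 2"
    using group.pow_eq_id[OF a_group, of \<one> 2] by (simp add: ring_characteristic_def)
  moreover have "ring_characteristic R \<noteq> 1"
    using group.ord_eq_1[OF a_group, of \<one>] by (simp add: ring_characteristic_def)
  ultimately show ?thesis using prime_nat_iff[of 2] two_is_prime_nat by auto
qed

lemma (in group_algebra) symmetric_units_subgroup_iff:
  assumes tor: "torsion_group G" and fav: "favourable G K"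
  shows "subgroup (symmetric_units K G) (units_of KG) \<longleftrightarrow>
    (if ring_characteristic K = 2 then char2_condition G else odd_condition G)" (is "?S \<longleftrightarrow> ?C")
proof
  assume ?S
  then have com: "\<And>f h. f \<in> symmetric_units K G \<Longrightarrow> h \<in> symmetric_units K G \<Longrightarrow> f \<otimes>\<^bsub>KG\<^esub> h = h \<otimes>\<^bsub>KG\<^esub> f"
    using symmetric_units_subgroup_iff_commute by blast
  have fav': "\<exists>n::nat. g [^] n = \<one> \<and> (\<exists>\<alpha>\<in>carrier K. \<alpha> \<noteq> \<zero>\<^bsub>K\<^esub> \<and> \<one>\<^bsub>K\<^esub> \<ominus>\<^bsub>K\<^esub> \<alpha> [^]\<^bsub>K\<^esub> n \<in> Units K)"
    if g: "g \<in> carrier G" for g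
  proof -
    have "ord g \<noteq> 0" using tor g pow_eq_id[OF g] unfolding torsion_group_def by force
    then show ?thesis using fav g pow_ord_eq_1[OF g] unfolding favourable_def by blast
  qed
  note 1 = involutions_central[OF com fav'] and 2 = commuting_trichotomy[OF com fav']
  show ?C
    using 1 2 unfolding char2_condition_def odd_condition_def K.ring_characteristic_eq_2_iff
    by (auto split: if_splits)
next
  assume C: ?C
  have cen: "t \<otimes> h = h \<otimes> t" if "t \<in> carrier G" "h \<in> carrier G" "t \<otimes> t = \<one>" for t h
    using C that unfolding char2_condition_def odd_condition_def by (auto split: if_splits)
  have c: "g \<otimes> h = h \<otimes> g \<or> g \<otimes> h \<otimes> g = h \<or> h \<otimes> g \<otimes> h = g \<or>
      (\<one>\<^bsub>K\<^esub> \<oplus>\<^bsub>K\<^esub> \<one>\<^bsub>K\<^esub> = \<zero>\<^bsub>K\<^esub> \<and> g \<otimes> g = h \<otimes> h \<and> (g \<otimes> g) \<otimes> (g \<otimes> g) = \<one>)"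
    if "g \<in> carrier G" "h \<in> carrier G" for g h
    using C that unfolding char2_condition_def odd_condition_def K.ring_characteristic_eq_2_iff
    by (auto split: if_splits)
  show ?S unfolding symmetric_units_subgroup_iff_commute
  proof (intro ballI)
    fix f h assume "f \<in> symmetric_units K G" "h \<in> symmetric_units K G"
    then show "f \<otimes>\<^bsub>KG\<^esub> h = h \<otimes>\<^bsub>KG\<^esub> f"
      by (intro symmetric_commute[OF cen c]) (auto simp: symmetric_units_def)
  qed
qed

lemma (in group) odd_condition_iff:
  "odd_condition G \<longleftrightarrow> comm_group G \<or> hamiltonian_group G \<and> two_group G"
proof
  assume "odd_condition G"
  then show "comm_group G \<or> hamiltonian_group G \<and> two_group G"
    using odd_condition_quaternionic quaternionic_hamiltonian by blast
next
  assume "comm_group G \<or> hamiltonian_group G \<and> two_group G"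
  then show "odd_condition G"
  proof
    assume "comm_group G"
    then have "\<And>g h. g \<in> carrier G \<Longrightarrow> h \<in> carrier G \<Longrightarrow> g \<otimes> h = h \<otimes> g"
      using comm_monoid.m_comm comm_group.axioms(1) by metis
    then show ?thesis unfolding odd_condition_def by blast
  next
    assume "hamiltonian_group G \<and> two_group G"
    then show ?thesis using hamiltonian_odd_condition unfolding hamiltonian_group_def by blast
  qed
qed

lemma (in group) char2_condition_iff:
  "char2_condition G \<longleftrightarrow> comm_group G \<or>
    (\<exists>E H. internal_direct_product G E H \<and> elementary_abelian_two_group (G\<lparr>carrier := E\<rparr>) \<and>
      exceptional_group (G\<lparr>carrier := H\<rparr>))"
proof
  assume c: "char2_condition G"
  interpret char2_group G by unfold_locales (rule c)
  show "comm_group G \<or> (\<exists>E H. internal_direct_product G E H \<and>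
      elementary_abelian_two_group (G\<lparr>carrier := E\<rparr>) \<and> exceptional_group (G\<lparr>carrier := H\<rparr>))"
    using classification by blast
next
  assume "comm_group G \<or> (\<exists>E H. internal_direct_product G E H \<and>
      elementary_abelian_two_group (G\<lparr>carrier := E\<rparr>) \<and> exceptional_group (G\<lparr>carrier := H\<rparr>))"
  then show "char2_condition G"
  proof (elim disjE exE conjE)
    assume "comm_group G"
    then have "\<And>g h. g \<in> carrier G \<Longrightarrow> h \<in> carrier G \<Longrightarrow> g \<otimes> h = h \<otimes> g"
      using comm_monoid.m_comm comm_group.axioms(1) by metis
    then show ?thesis unfolding char2_condition_def by blast
  next
    fix E H
    assume 1: "internal_direct_product G E H" "elementary_abelian_two_group (G\<lparr>carrier := E\<rparr>)"
      and 2: "exceptional_group (G\<lparr>carrier := H\<rparr>)"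
    have "group (G\<lparr>carrier := H\<rparr>)"
      using 1(1) subgroup_imp_group unfolding internal_direct_product_def by blast
    then show ?thesis
      using direct_product_char2_condition[OF is_group 1] exceptional_group_char2_condition 2 by blast
  qed
qed

theorem theorem1:
  fixes G :: "('g, 'm) monoid_scheme" and K :: "('k, 'n) ring_scheme" and p :: nat
  assumes "group G" and "torsion_group G"
    and "domain K" and "favourable G K" and "ring_characteristic K = p"
  shows "subgroup (symmetric_units K G) (units_of (group_ring K G)) \<longleftrightarrow>
    comm_group G \<or>
    (p \<noteq> 2 \<and> hamiltonian_group G \<and> two_group G) \<or>
    (p = 2 \<and> (\<exists>E H. internal_direct_product G E H \<and>
       elementary_abelian_two_group (G\<lparr>carrier := E\<rparr>) \<and>
       exceptional_group (G\<lparr>carrier := H\<rparr>)))"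
proof -
  interpret group G by fact
  interpret K: domain K by fact
  interpret group_algebra G K by unfold_locales
  show ?thesis
    using symmetric_units_subgroup_iff[OF assms(2,4)] odd_condition_iff char2_condition_iff assms(5) by auto
qed

end
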